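(* Let $M$ be a compact, oriented 7-manifold (or, more generally, 7-orbifold) with (possibly empty) boundary, and let $\phi$ be a closed $\mathrm{G}_2$ 3-form on $M$. Then $$\inf_{\phi' \in [\phi]_+^\partial} \mathcal{H}_3^\partial(\phi') = 0.$$ In particular (taking $\partial M=\emptyset$) the same conclusion holds for the Hitchin functional on $\mathrm{G}_2$ 3-forms over closed manifolds and orbifolds.
   Context: Let $\theta^1,\dots,\theta^7$ be the standard basis of $(\mathbb{R}^7)^*$, $\theta^{ij\dots k}=\theta^i\wedge\theta^j\wedge\dots\wedge\theta^k$, $vol_0=\theta^{1234567}$, and $$\phi_{mod} = \theta^{123} + \theta^{145} + \theta^{167} + \theta^{246} - \theta^{257} - \theta^{347} - \theta^{356}.$$ Orbifolds: an $n$-orbifold with boundary is a connected, Hausdorff, second-countable space with a maximal atlas of compatible charts $U\cong\Gamma\backslash\tilde U$, where $\Gamma\subset \mathrm{GL}(n;\mathbb{R})$ is a finite group and $\tilde U$ is a connected $\Gamma$-invariant open neighbourhood of $0$ in $\mathbb{R}^n$ or in the half-space $\{x^n\ge 0\}$. Differential forms on an orbifold are given in each chart by $\Gamma$-invariant smooth forms on $\tilde U$ (compatibly between charts); pointwise conditions on forms are imposed on these local lifts. Manifolds are the case in which all the orbifold groups are trivial. Boundaries may be empty. A 3-form $\phi$ on an oriented 7-manifold (or 7-orbifold) $M$ is a $\mathrm{G}_2$ 3-form if at each point $x$ (of each local lift) there is an orientation-preserving linear isomorphism $\alpha:T_xM\to\mathbb{R}^7$ with $\alpha^*\phi_{mod}=\phi|_x$.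 The stabiliser of $\phi_{mod}$ in $\mathrm{GL}_+(7;\mathbb{R})$ is $\mathrm{G}_2\subset\mathrm{SO}(7)$, so $\phi$ induces a well-defined volume form $vol_\phi$, given at $x$ by $\alpha^*vol_0$. Let $\Omega^2(M;\partial M)=\{\alpha\in\Omega^2(M) : \alpha|_x=0 \text{ for all } x\in\partial M\}$. For a closed $\mathrm{G}_2$ 3-form $\phi$, let $[\phi]_+^\partial=\{\phi'\in\phi+d\Omega^2(M;\partial M) : \phi' \text{ is a } \mathrm{G}_2 \text{ 3-form}\}$, and define the Donaldson--Hitchin functional $\mathcal{H}_3^\partial:[\phi]_+^\partial\to(0,\infty)$ by $\mathcal{H}_3^\partial(\phi')=\int_M vol_{\phi'}$. When $\partial M=\emptyset$ this is the Hitchin functional. *)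

theory Defs
  imports "HOL-Analysis.Analysis"
begin

section \<open>Smooth maps on subsets of Euclidean space\<close>

primrec Ck_on :: "nat \<Rightarrow> ('a::euclidean_space \<Rightarrow> 'b::real_normed_vector) \<Rightarrow> 'a set \<Rightarrow> bool" where
  "Ck_on 0 f U \<longleftrightarrow> continuous_on U f"
| "Ck_on (Suc k) f U \<longleftrightarrow> (\<forall>x\<in>U. f differentiable (at x)) \<and>
     (\<forall>v. Ck_on k (\<lambda>x. frechet_derivative f (at x) v) U)"

text \<open>On a set that is not open (such as a relatively open subset of a half-space), smooth means
  locally the restriction of a smooth map defined on an open set.\<close>

definition smooth_on :: "'a::euclidean_space set \<Rightarrow> ('a \<Rightarrow> 'b::real_normed_vector) \<Rightarrow> bool" where
  "smooth_on S f \<longleftrightarrow> (\<forall>x\<in>S. \<exists>U g. open U \<and> x \<in> U \<and> (\<forall>k. Ck_on k g U) \<and> (\<forall>y\<in>S \<inter> U. g y = f y))"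


section \<open>Linear algebra of forms on $R^7$\<close>

text \<open>The index type \<open>7\<close> consists of the residues modulo 7, so the seven coordinates of a vector
  \<open>v\<close> are \<open>v $ 1, \<dots>, v $ 6, v $ 7\<close>, the last of which is also \<open>v $ 0\<close>.\<close>

type_synonym R7 = "real^7"

text \<open>A \<open>k\<close>-form at a point is a function of a sequence of vectors of which only the first \<open>k\<close>
  (numbered from 0) matter.\<close>

type_synonym pform = "(nat \<Rightarrow> R7) \<Rightarrow> real"

definition alternating_form :: "nat \<Rightarrow> pform \<Rightarrow> bool" where
  "alternating_form k w \<longleftrightarrow>
     (\<forall>v v'. (\<forall>i<k. v i = v' i) \<longrightarrow> w v = w v') \<and>
     (\<forall>v. \<forall>i<k. linear (\<lambda>x. w (v(i := x)))) \<and>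
     (\<forall>v. \<forall>i<k. \<forall>j<k. i \<noteq> j \<and> v i = v j \<longrightarrow> w v = 0)"

text \<open>\<open>theta [i, j, \<dots>, k]\<close> is the wedge product of the standard dual basis covectors with these
  indices, in the convention without factorials.\<close>

definition theta :: "7 list \<Rightarrow> pform" where
  "theta is v = (\<Sum>\<sigma> | \<sigma> permutes {..<length is}.
     of_int (sign \<sigma>) * (\<Prod>a<length is. v (\<sigma> a) $ (is ! a)))"

definition phi_mod :: pform where
  "phi_mod v = theta [1,2,3] v + theta [1,4,5] v + theta [1,6,7] v + theta [2,4,6] v
     - theta [2,5,7] v - theta [3,4,7] v - theta [3,5,6] v"

definition vol0 :: pform where
  "vol0 = theta [1,2,3,4,5,6,7]"

definition pullback :: "(R7 \<Rightarrow> R7) \<Rightarrow> pform \<Rightarrow> pform" where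
  "pullback L w = (\<lambda>v. w (\<lambda>i. L (v i)))"

text \<open>The sign \<open>s\<close> of value \<open>1\<close> or \<open>-1\<close> gives the orientation of the source relative to the
  standard one.\<close>

definition G2_frames :: "real \<Rightarrow> pform \<Rightarrow> (R7 \<Rightarrow> R7) set" where
  "G2_frames s w = {L. linear L \<and> bij L \<and> s * det (matrix L) > 0 \<and> pullback L phi_mod = w}"

text \<open>This does not depend on the frame chosen, since the stabiliser of \<open>phi_mod\<close> in
  $GL_+(7,R)$ lies in $SO(7)$.\<close>

definition vol_at :: "real \<Rightarrow> pform \<Rightarrow> pform" where
  "vol_at s w = pullback (SOME L. L \<in> G2_frames s w) vol0"


section \<open>Seven-dimensional orbifolds with boundary\<close>

definition half_space :: "R7 set" where
  "half_space = {x. x $ 7 \<ge> 0}"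

record 'a chart =
  grp :: "(real^7^7) set"
  lift :: "R7 set"
  proj :: "R7 \<Rightarrow> 'a"

abbreviation image_of :: "'a chart \<Rightarrow> 'a set" where
  "image_of c \<equiv> proj c ` lift c"

definition finite_linear_group :: "(real^7^7) set \<Rightarrow> bool" where
  "finite_linear_group \<Gamma> \<longleftrightarrow> finite \<Gamma> \<and> mat 1 \<in> \<Gamma> \<and> (\<forall>g\<in>\<Gamma>. \<forall>h\<in>\<Gamma>. g ** h \<in> \<Gamma>) \<and>
     (\<forall>g\<in>\<Gamma>. invertible g \<and> matrix_inv g \<in> \<Gamma>)"

text \<open>The last two clauses say that \<open>proj c\<close> induces a homeomorphism of the orbit space of
  \<open>lift c\<close> under \<open>grp c\<close> with \<open>image_of c\<close>.\<close>

definition is_chart :: "'a topology \<Rightarrow> 'a chart \<Rightarrow> bool" where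
  "is_chart X c \<longleftrightarrow>
     finite_linear_group (grp c) \<and>
     0 \<in> lift c \<and> connected (lift c) \<and>
     (open (lift c) \<or> openin (top_of_set half_space) (lift c)) \<and>
     (\<forall>g\<in>grp c. \<forall>x\<in>lift c. g *v x \<in> lift c) \<and>
     openin X (image_of c) \<and>
     quotient_map (top_of_set (lift c)) (subtopology X (image_of c)) (proj c) \<and>
     (\<forall>x\<in>lift c. \<forall>y\<in>lift c. proj c x = proj c y \<longleftrightarrow> (\<exists>g\<in>grp c. y = g *v x))"

text \<open>As \<open>0 \<in> lift c\<close>, a chart with \<open>lift c\<close> open in $R^7$ is never contained in the half-space
  and has no boundary points.\<close>

definition lift_boundary :: "'a chart \<Rightarrow> R7 set" where
  "lift_boundary c = {x \<in> lift c. lift c \<subseteq> half_space \<and> x $ 7 = 0}"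

text \<open>A lifted transition is a diffeomorphism \<open>f\<close> from a relatively open subset \<open>V\<close> of
  \<open>lift c1\<close> onto one of \<open>lift c2\<close>, covering the identity of the orbifold.\<close>

definition transition :: "'a chart \<Rightarrow> 'a chart \<Rightarrow> R7 set \<Rightarrow> (R7 \<Rightarrow> R7) \<Rightarrow> bool" where
  "transition c1 c2 V f \<longleftrightarrow>
     openin (top_of_set (lift c1)) V \<and> openin (top_of_set (lift c2)) (f ` V) \<and>
     inj_on f V \<and> smooth_on V f \<and> smooth_on (f ` V) (inv_into V f) \<and>
     (\<forall>x\<in>V. proj c2 (f x) = proj c1 x)"

definition compatible :: "'a chart \<Rightarrow> 'a chart \<Rightarrow> bool" where
  "compatible c1 c2 \<longleftrightarrow> (\<forall>x\<in>lift c1. \<forall>y\<in>lift c2. proj c1 x = proj c2 y \<longrightarrow>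
     (\<exists>V f. transition c1 c2 V f \<and> x \<in> V \<and> f x = y))"

record 'a orbifold =
  space_of :: "'a topology"
  atlas :: "'a chart set"

definition orbifold7 :: "('a, 'z) orbifold_scheme \<Rightarrow> bool" where
  "orbifold7 M \<longleftrightarrow>
     topspace (space_of M) \<noteq> {} \<and> connected_space (space_of M) \<and>
     Hausdorff_space (space_of M) \<and> second_countable (space_of M) \<and>
     (\<forall>c\<in>atlas M. is_chart (space_of M) c) \<and>
     (\<Union>c\<in>atlas M. image_of c) = topspace (space_of M) \<and>
     (\<forall>c1\<in>atlas M. \<forall>c2\<in>atlas M. compatible c1 c2) \<and>
     (\<forall>c. is_chart (space_of M) c \<and> (\<forall>c'\<in>atlas M. compatible c c') \<longrightarrow> c \<in> atlas M)"

definition orb_boundary :: "('a, 'z) orbifold_scheme \<Rightarrow> 'a set" where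
  "orb_boundary M = (\<Union>c\<in>atlas M. proj c ` lift_boundary c)"

definition tangent_map :: "R7 set \<Rightarrow> (R7 \<Rightarrow> R7) \<Rightarrow> R7 \<Rightarrow> R7 \<Rightarrow> R7" where
  "tangent_map V f x = frechet_derivative f (at x within V)"

text \<open>The atlas is the full one, with charts of both orientations; an orientation is given by the sign
  of each (connected) \<open>lift c\<close> relative to the standard orientation of $R^7$.\<close>

record 'a oriented_orbifold = "'a orbifold" +
  orient :: "'a chart \<Rightarrow> real"

definition oriented_orbifold7 :: "('a, 'z) oriented_orbifold_scheme \<Rightarrow> bool" where
  "oriented_orbifold7 M \<longleftrightarrow> orbifold7 M \<and>
     (\<forall>c\<in>atlas M. (orient M c = 1 \<or> orient M c = -1) \<and> (\<forall>g\<in>grp c. det g > 0)) \<and>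
     (\<forall>c1\<in>atlas M. \<forall>c2\<in>atlas M. \<forall>V f. transition c1 c2 V f \<longrightarrow>
        (\<forall>x\<in>V. orient M c1 * orient M c2 * det (matrix (tangent_map V f x)) > 0))"


section \<open>Differential forms\<close>

text \<open>A form assigns to every chart \<open>c\<close> and every point of \<open>lift c\<close> a form on $R^7$; its
  values for other charts and points are irrelevant.\<close>

type_synonym 'a dform = "'a chart \<Rightarrow> R7 \<Rightarrow> pform"

definition smooth_form_on :: "nat \<Rightarrow> R7 set \<Rightarrow> (R7 \<Rightarrow> pform) \<Rightarrow> bool" where
  "smooth_form_on k S w \<longleftrightarrow>
     (\<forall>x\<in>S. alternating_form k (w x)) \<and> (\<forall>v. smooth_on S (\<lambda>x. w x v))"

definition is_form :: "('a, 'z) orbifold_scheme \<Rightarrow> nat \<Rightarrow> 'a dform \<Rightarrow> bool" where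
  "is_form M k w \<longleftrightarrow>
     (\<forall>c\<in>atlas M. smooth_form_on k (lift c) (w c)) \<and>
     (\<forall>c\<in>atlas M. \<forall>g\<in>grp c. \<forall>x\<in>lift c. pullback (\<lambda>u. g *v u) (w c (g *v x)) = w c x) \<and>
     (\<forall>c1\<in>atlas M. \<forall>c2\<in>atlas M. \<forall>V f. transition c1 c2 V f \<longrightarrow>
        (\<forall>x\<in>V. pullback (tangent_map V f x) (w c2 (f x)) = w c1 x))"

text \<open>The exterior derivative of a \<open>k\<close>-form, evaluated on \<open>v 0, \<dots>, v k\<close>: the alternating sum of
  the derivatives in direction \<open>v i\<close> of the form evaluated on the remaining vectors.\<close>

definition ext_deriv :: "nat \<Rightarrow> R7 set \<Rightarrow> (R7 \<Rightarrow> pform) \<Rightarrow> R7 \<Rightarrow> pform" where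
  "ext_deriv k S w x v = (\<Sum>i\<le>k. (-1) ^ i *
     frechet_derivative (\<lambda>y. w y (\<lambda>j. v (if j < i then j else Suc j))) (at x within S) (v i))"

definition ext_d :: "nat \<Rightarrow> 'a dform \<Rightarrow> 'a dform" where
  "ext_d k w = (\<lambda>c. ext_deriv k (lift c) (w c))"

definition form_eq :: "('a, 'z) orbifold_scheme \<Rightarrow> 'a dform \<Rightarrow> 'a dform \<Rightarrow> bool" where
  "form_eq M w w' \<longleftrightarrow> (\<forall>c\<in>atlas M. \<forall>x\<in>lift c. w c x = w' c x)"

definition closed_form :: "('a, 'z) orbifold_scheme \<Rightarrow> nat \<Rightarrow> 'a dform \<Rightarrow> bool" where
  "closed_form M k w \<longleftrightarrow> is_form M k w \<and> form_eq M (ext_d k w) (\<lambda>c x v. 0)"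

text \<open>The forms of degree \<open>k\<close> that vanish at the points of the boundary (on all tangent vectors of
  \<open>M\<close>, not only those tangent to the boundary).\<close>

definition forms_rel_boundary :: "('a, 'z) orbifold_scheme \<Rightarrow> nat \<Rightarrow> 'a dform set" where
  "forms_rel_boundary M k = {w. is_form M k w \<and>
     (\<forall>c\<in>atlas M. \<forall>x\<in>lift c. proj c x \<in> orb_boundary M \<longrightarrow> w c x = (\<lambda>v. 0))}"


section \<open>Integration\<close>

definition partition_of_unity ::
    "('a, 'z) orbifold_scheme \<Rightarrow> 'a chart set \<Rightarrow> ('a chart \<Rightarrow> 'a \<Rightarrow> real) \<Rightarrow> bool" where
  "partition_of_unity M C \<rho> \<longleftrightarrow>
     finite C \<and> C \<subseteq> atlas M \<and>
     (\<forall>c\<in>C. \<forall>p\<in>topspace (space_of M). 0 \<le> \<rho> c p) \<and>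
     (\<forall>p\<in>topspace (space_of M). (\<Sum>c\<in>C. \<rho> c p) = 1) \<and>
     (\<forall>c\<in>C. (space_of M) closure_of {p \<in> topspace (space_of M). \<rho> c p \<noteq> 0} \<subseteq> image_of c) \<and>
     (\<forall>c\<in>C. \<forall>c'\<in>atlas M. smooth_on (lift c') (\<lambda>x. \<rho> c (proj c' x)))"

definition std_basis :: "nat \<Rightarrow> R7" where
  "std_basis i = axis (of_nat (Suc i)) 1"

text \<open>The integral of a 7-form over a compact oriented orbifold. On such an orbifold finite
  partitions of unity exist and the value is the same for all of them.\<close>

definition orbifold_integral :: "('a, 'z) oriented_orbifold_scheme \<Rightarrow> 'a dform \<Rightarrow> real" where
  "orbifold_integral M w = (SOME I. \<exists>C \<rho>. partition_of_unity M C \<rho> \<and>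
     I = (\<Sum>c\<in>C. orient M c / real (card (grp c)) *
            (LINT x:lift c|lborel. \<rho> c (proj c x) * w c x std_basis)))"


section \<open>$G_2$ 3-forms and the Donaldson--Hitchin functional\<close>

definition G2_form :: "('a, 'z) oriented_orbifold_scheme \<Rightarrow> 'a dform \<Rightarrow> bool" where
  "G2_form M \<phi> \<longleftrightarrow> is_form M 3 \<phi> \<and>
     (\<forall>c\<in>atlas M. \<forall>x\<in>lift c. G2_frames (orient M c) (\<phi> c x) \<noteq> {})"

definition vol_form :: "('a, 'z) oriented_orbifold_scheme \<Rightarrow> 'a dform \<Rightarrow> 'a dform" where
  "vol_form M \<phi> = (\<lambda>c x. vol_at (orient M c) (\<phi> c x))"

definition hitchin_functional :: "('a, 'z) oriented_orbifold_scheme \<Rightarrow> 'a dform \<Rightarrow> real" where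
  "hitchin_functional M \<phi> = orbifold_integral M (vol_form M \<phi>)"

definition G2_class_rel_boundary ::
    "('a, 'z) oriented_orbifold_scheme \<Rightarrow> 'a dform \<Rightarrow> 'a dform set" where
  "G2_class_rel_boundary M \<phi> = {\<phi>'. G2_form M \<phi>' \<and>
     (\<exists>\<alpha>\<in>forms_rel_boundary M 2. form_eq M \<phi>' (\<lambda>c x v. \<phi> c x v + ext_d 2 \<alpha> c x v))}"

text \<open>The \<open>G2\<close> 3-forms in the full de Rham class, the domain of the Hitchin functional of a closed
  orbifold.\<close>

definition G2_class :: "('a, 'z) oriented_orbifold_scheme \<Rightarrow> 'a dform \<Rightarrow> 'a dform set" where
  "G2_class M \<phi> = {\<phi>'. G2_form M \<phi>' \<and>
     (\<exists>\<alpha>. is_form M 2 \<alpha> \<and> form_eq M \<phi>' (\<lambda>c x v. \<phi> c x v + ext_d 2 \<alpha> c x v))}"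

end

theory Submission
  imports Defs
begin

text \<open>In a frame at a point of a patch, add \<open>d(U \<theta>\<^sup>2\<^sup>3) = \<eta> \<and> \<theta>\<^sup>2\<^sup>3\<close> to the form,
  where \<open>U\<close> is a bump function supported in a small ball and \<open>\<eta> = dU\<close> is of a fixed size,
  independent of the radius. The model form becomes \<open>\<phi>\<^sub>m\<^sub>o\<^sub>d + \<eta> \<and> \<theta>\<^sup>2\<^sup>3\<close>, which for small \<open>\<eta>\<close> is a
  \<open>G2\<close> form whose volume density, the cube root of
  \<open>1 + \<eta>\<^sub>1 - (\<eta>\<^sub>4\<^sup>2 + \<eta>\<^sub>5\<^sup>2 + \<eta>\<^sub>6\<^sup>2 + \<eta>\<^sub>7\<^sup>2) / 4\<close>, is strictly concave. The linear term
  integrates to zero over the ball, so the volume of the ball decreases by a factor that depends neither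
  on the ball nor on the form. A Vitali covering by such balls decreases the volume of a whole patch;
  as some member of a fixed finite partition of unity carries a fixed share of the total volume, every form
  in the class can be replaced by one of volume at most \<open>1 - \<kappa>\<close> times the old, with \<open>\<kappa>\<close> depending only
  on \<open>M\<close>.\<close>

section \<open>Calculus of smooth maps\<close>

text \<open>To first order an exact perturbation changes the total volume by a term of no sign, so
  the gain must come from the second order, and it survives on small balls only if the differential
  of the perturbation keeps its size there. Hence the potential has amplitude proportional to the
  radius: it tends to zero, its differential does not. Meanwhile the form on the ball approaches its
  value at the centre, so one explicit computation in a frozen frame decides. The direction
  \<theta>^23 is taken because the perturbed model is then visibly a pullback of the model by a
  shear and a scaling, hence G2 with known volume. Frames may be stretched without bound as the form
  is changed again and again. If the rate depended on the form, the volumes could stall at a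
  positive limit; therefore all nearness is measured in frames adapted to the form. Singular points
  and the boundary are avoided: perturbations live in open fundamental domains on which the
  projection is injective, and are extended by zero. Pointwise volume and integral are defined by
  arbitrary choices (of a frame, of a partition of unity), so independence of both has to precede
  any estimate.\<close>

lemma frechet_derivative_germ:
  assumes "open U" "x \<in> U" "x \<in> S" "\<And>y. y \<in> U \<inter> S \<Longrightarrow> f y = g y"
  shows has_derivative_germ: "(f has_derivative D) (at x within S) \<longleftrightarrow> (g has_derivative D) (at x within S)"
    and "frechet_derivative f (at x within S) = frechet_derivative g (at x within S)"
    and differentiable_germ: "f differentiable (at x within S) \<longleftrightarrow> g differentiable (at x within S)"
proof -
  have ev: "\<forall>\<^sub>F y in at x within S. f y = g y"
    using assms unfolding eventually_at_topological by blast
  have *: "(f has_derivative D) (at x within S) \<longleftrightarrow> (g has_derivative D) (at x within S)" for D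
    using has_derivative_transform_eventually[of f D x S g]
      has_derivative_transform_eventually[of g D x S f] ev assms
    by (metis (mono_tags, lifting) IntI eventually_mono)
  \<comment> \<open>\<open>frechet_derivative\<close> is a \<open>SOME\<close> over all derivatives
    at the point. The two functions have the same derivatives, so the choices agree, also where a
    derivative is not unique or does not exist.\<close>
  then show "(f has_derivative D) (at x within S) \<longleftrightarrow> (g has_derivative D) (at x within S)"
    "frechet_derivative f (at x within S) = frechet_derivative g (at x within S)"
    "f differentiable (at x within S) \<longleftrightarrow> g differentiable (at x within S)"
    unfolding frechet_derivative_def differentiable_def by auto
qed

lemma Ck_on_cong:
  assumes "open U" "\<And>x. x \<in> U \<Longrightarrow> f x = g x"
  shows "Ck_on k f U \<longleftrightarrow> Ck_on k g U"
  using assms(2)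
proof (induction k arbitrary: f g)
  case 0
  then show ?case by (auto cong: continuous_on_cong)
next
  case (Suc k)
  have "f differentiable (at x) \<longleftrightarrow> g differentiable (at x)"
    and "frechet_derivative f (at x) = frechet_derivative g (at x)" if "x \<in> U" for x
    using frechet_derivative_germ[of U x UNIV f g] assms(1) that Suc.prems by auto
  then show ?case using Suc.IH[of "\<lambda>x. frechet_derivative f (at x) v" "\<lambda>x. frechet_derivative g (at x) v" for v]
    by auto
qed

lemma Ck_on_subset: "Ck_on k f U \<Longrightarrow> W \<subseteq> U \<Longrightarrow> Ck_on k f W"
  by (induction k arbitrary: f) (auto intro: continuous_on_subset)

lemma Ck_on_imp_continuous: "Ck_on k f U \<Longrightarrow> continuous_on U f"
  by (cases k) (auto intro!: continuous_at_imp_continuous_on differentiable_imp_continuous_within)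

lemma Ck_on_SucD: "Ck_on (Suc k) f U \<Longrightarrow> Ck_on k f U"
proof (induction k arbitrary: f)
  case 0
  then show ?case using Ck_on_imp_continuous by fastforce
qed auto

text \<open>\<open>Ck_on\<close> recurses through the chosen derivative. On an open set an explicit
  derivative may stand in for it, since \<open>Ck_on_cong\<close> only looks at values on the
  set.\<close>

lemma Ck_on_SucI:
  assumes "open U" "\<And>x. x \<in> U \<Longrightarrow> (f has_derivative D x) (at x)"
    and "\<And>v. Ck_on k (\<lambda>x. D x v) U"
  shows "Ck_on (Suc k) f U"
proof -
  have "frechet_derivative f (at x) = D x" if "x \<in> U" for x
    using assms(2)[OF that] frechet_derivative_at by metis
  then have "Ck_on k (\<lambda>x. frechet_derivative f (at x) v) U" for v
    using Ck_on_cong[OF assms(1), of "\<lambda>x. frechet_derivative f (at x) v" "\<lambda>x. D x v"] assms(3) by auto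
  then show ?thesis using assms(2) by (auto simp: differentiable_def)
qed

lemma Ck_on_has_derivative:
  "Ck_on (Suc k) f U \<Longrightarrow> x \<in> U \<Longrightarrow> (f has_derivative frechet_derivative f (at x)) (at x)"
  by (simp add: frechet_derivative_works[symmetric])

lemma Ck_on_local:
  assumes "\<And>x. x \<in> S \<Longrightarrow> \<exists>U. open U \<and> x \<in> U \<and> Ck_on k f U"
  shows "Ck_on k f S"
  using assms
proof (induction k arbitrary: f)
  case 0
  have "isCont f x" if "x \<in> S" for x
    using 0[OF that] by (auto simp: continuous_on_eq_continuous_at)
  then show ?case by (auto intro: continuous_at_imp_continuous_on)
next
  case (Suc k)
  show ?case
    using Suc.prems by (fastforce intro!: Suc.IH)
qed

lemma Ck_on_const [simp]: "Ck_on k (\<lambda>x. c) U"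
  by (induction k arbitrary: c) auto

lemma Ck_on_bounded_linear:
  assumes "bounded_linear L"
  shows "Ck_on k L U"
proof (cases k)
  case 0
  then show ?thesis using assms by (auto intro: linear_continuous_on)
next
  case (Suc j)
  have "frechet_derivative L (at x) = L" for x
    using assms bounded_linear_imp_has_derivative frechet_derivative_at by metis
  then show ?thesis using Suc assms by (auto intro: bounded_linear_imp_differentiable)
qed

lemma Ck_on_bounded_linear_compose:
  assumes "open U" "bounded_linear L" "Ck_on k f U"
  shows "Ck_on k (\<lambda>x. L (f x)) U"
  using assms(3)
proof (induction k arbitrary: f)
  case 0
  then show ?case using assms(2) by (auto intro: linear_continuous_on_compose continuous_on_compose2 linear_continuous_on)
next
  case (Suc k)
  show ?case
  proof (rule Ck_on_SucI[OF assms(1)])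
    show "((\<lambda>x. L (f x)) has_derivative (\<lambda>v. L (frechet_derivative f (at x) v))) (at x)" if "x \<in> U" for x
      using bounded_linear.has_derivative[OF assms(2)] Ck_on_has_derivative[OF Suc.prems that] by blast
  qed (use Suc in auto)
qed

lemma Ck_on_bilinear:
  assumes "open U" "bounded_bilinear P" "Ck_on k f U" "Ck_on k g U"
  shows "Ck_on k (\<lambda>x. P (f x) (g x)) U" 
  using assms(3,4)
proof (induction k arbitrary: f g)
  case 0
  then show ?case using assms(2) by (auto intro: bounded_bilinear.continuous_on)
next
  case (Suc k)
  note add = Ck_on.simps
  have sum: "Ck_on k (\<lambda>x. p x + q x) U" if "Ck_on k p U" "Ck_on k q U" for p q and k
    using that
  proof (induction k arbitrary: p q)
    case 0
    then show ?case by (auto intro: continuous_intros)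
  next
    case (Suc k)
    show ?case
      by (rule Ck_on_SucI[OF assms(1) has_derivative_add[OF Ck_on_has_derivative[OF Suc.prems(1)] Ck_on_has_derivative[OF Suc.prems(2)]]])
         (use Suc in auto)
  qed
  show ?case
    by (rule Ck_on_SucI[OF assms(1) bounded_bilinear.FDERIV[OF assms(2) Ck_on_has_derivative[OF Suc.prems(1)] Ck_on_has_derivative[OF Suc.prems(2)]]])
       (use Suc Ck_on_SucD[OF Suc.prems(1)] Ck_on_SucD[OF Suc.prems(2)] in \<open>auto intro!: sum\<close>)
qed

lemma Ck_on_add:
  assumes "open U" "Ck_on k f U" "Ck_on k g U"
  shows "Ck_on k (\<lambda>x. f x + g x) U"
  using assms(2,3)
proof (induction k arbitrary: f g)
  case 0
  then show ?case by (auto intro: continuous_intros)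
next
  case (Suc k)
  show ?case
    by (rule Ck_on_SucI[OF assms(1) has_derivative_add[OF Ck_on_has_derivative[OF Suc.prems(1)] Ck_on_has_derivative[OF Suc.prems(2)]]])
       (use Suc in auto)
qed

lemma Ck_on_sum:
  assumes "open U" "\<And>i. i \<in> I \<Longrightarrow> Ck_on k (f i) U"
  shows "Ck_on k (\<lambda>x. \<Sum>i\<in>I. f i x) U"
  using assms(2)
  by (induction I rule: infinite_finite_induct) (simp_all add: Ck_on_add[OF assms(1)])

text \<open>The chain rule applies a derivative at a moving point to a moving vector, which is not
  of the form \<open>g (f x)\<close>. Expanding the vector in the basis leaves products of
  coefficients with maps of that form, and the induction covers these with \<open>g\<close> replaced
  by its directional derivatives.\<close>

lemma Ck_on_compose:
  fixes f :: "'a::euclidean_space \<Rightarrow> 'b::euclidean_space" and g :: "'b \<Rightarrow> 'c::real_normed_vector"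
  assumes "open U" "open W" "f ` U \<subseteq> W" "Ck_on k f U" "Ck_on k g W"
  shows "Ck_on k (\<lambda>x. g (f x)) U"
  using assms(4,5)
proof (induction k arbitrary: g)
  case 0
  then show ?case using assms(3) by (auto intro: continuous_on_compose2)
next
  case (Suc k)
  have lin: "linear (frechet_derivative g (at (f x)))" if "x \<in> U" for x
    using Suc.prems(2) assms(3) that has_derivative_linear Ck_on_has_derivative by (metis image_subset_iff)
  show ?case
  proof (rule Ck_on_SucI[OF assms(1)])
    fix x assume x: "x \<in> U"
    have "((\<lambda>x. g (f x)) has_derivative (\<lambda>v. frechet_derivative g (at (f x)) (frechet_derivative f (at x) v))) (at x)"
      using diff_chain_at[OF Ck_on_has_derivative[OF Suc.prems(1) x], of g "frechet_derivative g (at (f x))"]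
        Ck_on_has_derivative[OF Suc.prems(2), of "f x"] assms(3) x by (auto simp: o_def)
    also have "(\<lambda>v. frechet_derivative g (at (f x)) (frechet_derivative f (at x) v)) =
       (\<lambda>v. \<Sum>b\<in>Basis. (frechet_derivative f (at x) v \<bullet> b) *\<^sub>R frechet_derivative g (at (f x)) b)"
    proof
      fix v
      have "frechet_derivative g (at (f x)) (frechet_derivative f (at x) v) =
        frechet_derivative g (at (f x)) (\<Sum>b\<in>Basis. (frechet_derivative f (at x) v \<bullet> b) *\<^sub>R b)"
        by (simp add: euclidean_representation)
      then show "frechet_derivative g (at (f x)) (frechet_derivative f (at x) v) =
        (\<Sum>b\<in>Basis. (frechet_derivative f (at x) v \<bullet> b) *\<^sub>R frechet_derivative g (at (f x)) b)"
        by (simp add: linear_sum[OF lin[OF x]] linear_scale[OF lin[OF x]])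
    qed
    finally show "((\<lambda>x. g (f x)) has_derivative (\<lambda>v. \<Sum>b\<in>Basis. (frechet_derivative f (at x) v \<bullet> b) *\<^sub>R frechet_derivative g (at (f x)) b)) (at x)" .
  next
    fix v
    have 1: "Ck_on k (\<lambda>x. frechet_derivative g (at (f x)) b) U" for b
      using Suc.IH[of "\<lambda>y. frechet_derivative g (at y) b"] Suc.prems Ck_on_SucD[OF Suc.prems(1)] by auto
    have 2: "Ck_on k (\<lambda>x. frechet_derivative f (at x) v \<bullet> b) U" for b
      by (rule Ck_on_bounded_linear_compose[OF assms(1) bounded_linear_inner_left]) (use Suc.prems in auto)
    show "Ck_on k (\<lambda>x. \<Sum>b\<in>Basis. (frechet_derivative f (at x) v \<bullet> b) *\<^sub>R frechet_derivative g (at (f x)) b) U"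
      by (intro Ck_on_sum[OF assms(1)] Ck_on_bilinear[OF assms(1) bounded_bilinear_scaleR 2 1])
  qed
qed

lemma Ck_on_inverse:
  fixes f :: "'a::euclidean_space \<Rightarrow> real"
  assumes "open U" "Ck_on k f U" "\<And>x. x \<in> U \<Longrightarrow> f x \<noteq> 0"
  shows "Ck_on k (\<lambda>x. inverse (f x)) U"
  using assms(2)
proof (induction k)
  case 0
  then show ?case using assms(3) by (auto intro!: continuous_intros)
next
  case (Suc k)
  note C = Ck_on_SucD[OF Suc.prems]
  show ?case
  proof (rule Ck_on_SucI[OF assms(1)])
    show "((\<lambda>x. inverse (f x)) has_derivative (\<lambda>v. (-1) *\<^sub>R ((inverse (f x) * frechet_derivative f (at x) v) * inverse (f x)))) (at x)"
      if "x \<in> U" for x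
      using Deriv.has_derivative_inverse[OF assms(3)[OF that] Ck_on_has_derivative[OF Suc.prems that]] by (simp add: mult.assoc)
    show "Ck_on k (\<lambda>x. (-1) *\<^sub>R ((inverse (f x) * frechet_derivative f (at x) v) * inverse (f x))) U" for v
      using Suc.IH[OF C] Suc.prems
      by (intro Ck_on_bounded_linear_compose[OF assms(1) bounded_linear_scaleR_right] Ck_on_bilinear[OF assms(1) bounded_bilinear_mult]) auto
  qed
qed

section \<open>Smooth maps on arbitrary subsets\<close>

lemma smooth_onE:
  assumes "smooth_on S f" "x \<in> S"
  obtains U g where "open U" "x \<in> U" "\<forall>k. Ck_on k g U" "\<forall>y. y \<in> S \<longrightarrow> y \<in> U \<longrightarrow> g y = f y"
proof -
  have "\<exists>U g. open U \<and> x \<in> U \<and> (\<forall>k. Ck_on k g U) \<and> (\<forall>y\<in>S \<inter> U. g y = f y)"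
    using assms(1) unfolding smooth_on_def by (rule bspec) (rule assms(2))
  then show thesis by (elim exE conjE, intro that) auto
qed

lemma smooth_onI:
  assumes "\<And>x. x \<in> S \<Longrightarrow> \<exists>U g. open U \<and> x \<in> U \<and> (\<forall>k. Ck_on k g U) \<and> (\<forall>y. y \<in> S \<longrightarrow> y \<in> U \<longrightarrow> g y = f y)"
  shows "smooth_on S f"
  unfolding smooth_on_def
proof
  fix x assume "x \<in> S"
  then obtain U g where "open U" "x \<in> U" "\<forall>k. Ck_on k g U" "\<forall>y. y \<in> S \<longrightarrow> y \<in> U \<longrightarrow> g y = f y"
    using assms by metis
  then show "\<exists>U g. open U \<and> x \<in> U \<and> (\<forall>k. Ck_on k g U) \<and> (\<forall>y\<in>S \<inter> U. g y = f y)"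
    by (intro exI[of _ U] exI[of _ g]) simp
qed

lemma smooth_onI_open:
  assumes "open S" "\<And>k. Ck_on k f S"
  shows "smooth_on S f"
  by (rule smooth_onI, intro exI[of _ S] exI[of _ f]) (simp add: assms)

lemma smooth_on_open:
  assumes "open S" "smooth_on S f"
  shows "Ck_on k f S"
proof (rule Ck_on_local)
  fix x assume x: "x \<in> S"
  obtain U g where U: "open U" "x \<in> U" "\<forall>k. Ck_on k g U" "\<forall>y. y \<in> S \<longrightarrow> y \<in> U \<longrightarrow> g y = f y"
    using smooth_onE[OF assms(2) x] .
  have "Ck_on k g (S \<inter> U)" by (rule Ck_on_subset[OF U(3)[rule_format]]) simp
  moreover have "Ck_on k g (S \<inter> U) \<longleftrightarrow> Ck_on k f (S \<inter> U)"
    by (rule Ck_on_cong) (use assms(1) U in auto)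
  ultimately show "\<exists>U. open U \<and> x \<in> U \<and> Ck_on k f U"
    using U(1,2) assms(1) x by (intro exI[of _ "S \<inter> U"]) (simp add: open_Int)
qed

lemma smooth_on_local:
  assumes "\<And>x. x \<in> S \<Longrightarrow> \<exists>U g. open U \<and> x \<in> U \<and> smooth_on (S \<inter> U) g \<and> (\<forall>y\<in>S \<inter> U. g y = f y)"
  shows "smooth_on S f"
proof (rule smooth_onI)
  fix x assume x: "x \<in> S"
  from assms[OF x] obtain U g where U: "open U" "x \<in> U" "smooth_on (S \<inter> U) g" "\<forall>y\<in>S \<inter> U. g y = f y"
    by (elim exE conjE)
  have xu: "x \<in> S \<inter> U" using x U by simp
  obtain W h where W: "open W" "x \<in> W" "\<forall>k. Ck_on k h W" "\<forall>y. y \<in> S \<inter> U \<longrightarrow> y \<in> W \<longrightarrow> h y = g y"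
    using smooth_onE[OF U(3) xu] .
  show "\<exists>U g. open U \<and> x \<in> U \<and> (\<forall>k. Ck_on k g U) \<and> (\<forall>y. y \<in> S \<longrightarrow> y \<in> U \<longrightarrow> g y = f y)"
  proof (intro exI conjI allI impI)
    show "open (U \<inter> W)" "x \<in> U \<inter> W" using U W by (simp_all add: open_Int)
    show "Ck_on k h (U \<inter> W)" for k by (rule Ck_on_subset[OF W(3)[rule_format]]) simp
    show "h y = f y" if "y \<in> S" "y \<in> U \<inter> W" for y using U(4) W(4)[rule_format, of y] that by simp
  qed
qed

lemma smooth_on_subset:
  assumes "smooth_on S f" "T \<subseteq> S"
  shows "smooth_on T f"
proof (rule smooth_onI)
  fix x assume "x \<in> T"
  then have x: "x \<in> S" using assms(2) by auto
  obtain U g where U: "open U" "x \<in> U" "\<forall>k. Ck_on k g U" "\<forall>y. y \<in> S \<longrightarrow> y \<in> U \<longrightarrow> g y = f y"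
    using smooth_onE[OF assms(1) x] .
  show "\<exists>U g. open U \<and> x \<in> U \<and> (\<forall>k. Ck_on k g U) \<and> (\<forall>y. y \<in> T \<longrightarrow> y \<in> U \<longrightarrow> g y = f y)"
    using U assms(2) by (intro exI[of _ U] exI[of _ g]) auto
qed

lemma smooth_on_cong_imp:
  assumes "smooth_on S f" "\<And>x. x \<in> S \<Longrightarrow> f x = g x"
  shows "smooth_on S g"
proof (rule smooth_onI)
  fix x assume x: "x \<in> S"
  obtain U h where U: "open U" "x \<in> U" "\<forall>k. Ck_on k h U" "\<forall>y. y \<in> S \<longrightarrow> y \<in> U \<longrightarrow> h y = f y"
    using smooth_onE[OF assms(1) x] .
  show "\<exists>U h. open U \<and> x \<in> U \<and> (\<forall>k. Ck_on k h U) \<and> (\<forall>y. y \<in> S \<longrightarrow> y \<in> U \<longrightarrow> h y = g y)"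
    using U assms(2) by (intro exI[of _ U] exI[of _ h]) simp
qed

lemma smooth_on_const [simp]: "smooth_on S (\<lambda>x. c)"
  by (rule smooth_on_subset[OF smooth_onI_open[OF open_UNIV]]) simp_all

lemma smooth_on_bounded_linear: "bounded_linear L \<Longrightarrow> smooth_on S L"
  by (rule smooth_on_subset[OF smooth_onI_open[OF open_UNIV]]) (simp_all add: Ck_on_bounded_linear)

lemma smooth_on_imp_continuous_on:
  assumes "smooth_on S f" shows "continuous_on S f"
  unfolding continuous_on_eq_continuous_within
proof
  fix x assume x: "x \<in> S"
  obtain U g where U: "open U" "x \<in> U" "\<forall>k. Ck_on k g U" "\<forall>y. y \<in> S \<longrightarrow> y \<in> U \<longrightarrow> g y = f y"
    using smooth_onE[OF assms x] .
  have "continuous_on U g" using U(3)[rule_format] Ck_on_imp_continuous by blast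
  then have "isCont g x" using U(1,2) continuous_on_eq_continuous_at by blast
  then have "(g \<longlongrightarrow> f x) (at x within S)"
    using U(4)[rule_format, OF x U(2)] by (simp add: isCont_def tendsto_within_subset[of g _ x UNIV])
  moreover have "\<forall>\<^sub>F y in at x within S. g y = f y"
    using U(1,2,4) unfolding eventually_at_topological by blast
  ultimately show "continuous (at x within S) f"
    unfolding continuous_within by (rule Lim_transform_eventually)
qed

lemma smooth_on_op2:
  fixes f :: "'a::euclidean_space \<Rightarrow> 'b::real_normed_vector" and g :: "'a \<Rightarrow> 'c::real_normed_vector"
  assumes "smooth_on S f" "smooth_on S g"
    and P: "\<And>(U::'a set) k f g. open U \<Longrightarrow> Ck_on k f U \<Longrightarrow> Ck_on k g U \<Longrightarrow> Ck_on k (\<lambda>x. P (f x) (g x)) U"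
  shows "smooth_on S (\<lambda>x. P (f x) (g x))"
proof (rule smooth_onI)
  fix x assume x: "x \<in> S"
  obtain U F where U: "open U" "x \<in> U" "\<forall>k. Ck_on k F U" "\<forall>y. y \<in> S \<longrightarrow> y \<in> U \<longrightarrow> F y = f y"
    using smooth_onE[OF assms(1) x] .
  obtain W G where W: "open W" "x \<in> W" "\<forall>k. Ck_on k G W" "\<forall>y. y \<in> S \<longrightarrow> y \<in> W \<longrightarrow> G y = g y"
    using smooth_onE[OF assms(2) x] .
  have "Ck_on k (\<lambda>x. P (F x) (G x)) (U \<inter> W)" for k
    by (rule P) (use U W in \<open>auto intro: Ck_on_subset[OF U(3)[rule_format]] Ck_on_subset[OF W(3)[rule_format]]\<close>)
  then show "\<exists>U h. open U \<and> x \<in> U \<and> (\<forall>k. Ck_on k h U) \<and> (\<forall>y. y \<in> S \<longrightarrow> y \<in> U \<longrightarrow> h y = P (f y) (g y))"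
    using U(1,2,4) W(1,2,4) by (intro exI[of _ "U \<inter> W"] exI[of _ "\<lambda>x. P (F x) (G x)"]) (simp add: open_Int)
qed

lemma smooth_on_add: "smooth_on S f \<Longrightarrow> smooth_on S g \<Longrightarrow> smooth_on S (\<lambda>x. f x + g x)"
  by (rule smooth_on_op2[where P = "(+)"]) (simp_all add: Ck_on_add)

lemma smooth_on_mult:
  fixes f g :: "'a::euclidean_space \<Rightarrow> real"
  shows "smooth_on S f \<Longrightarrow> smooth_on S g \<Longrightarrow> smooth_on S (\<lambda>x. f x * g x)"
  by (rule smooth_on_op2[where P = "(*)"]) (simp_all add: Ck_on_bilinear[OF _ bounded_bilinear_mult])

lemma smooth_on_sum:
  "(\<And>i. i \<in> I \<Longrightarrow> smooth_on S (f i)) \<Longrightarrow> smooth_on S (\<lambda>x. \<Sum>i\<in>I. f i x)"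
  by (induction I rule: infinite_finite_induct) (simp_all add: smooth_on_add)

lemma smooth_on_compose:
  fixes f :: "'a::euclidean_space \<Rightarrow> 'b::euclidean_space" and g :: "'b \<Rightarrow> 'c::real_normed_vector"
  assumes "smooth_on S f" "smooth_on T g" "f ` S \<subseteq> T"
  shows "smooth_on S (\<lambda>x. g (f x))"
proof (rule smooth_onI)
  fix x assume x: "x \<in> S"
  then have fx: "f x \<in> T" using assms(3) by auto
  obtain U F where U: "open U" "x \<in> U" "\<forall>k. Ck_on k F U" "\<forall>y. y \<in> S \<longrightarrow> y \<in> U \<longrightarrow> F y = f y"
    using smooth_onE[OF assms(1) x] .
  obtain W G where W: "open W" "f x \<in> W" "\<forall>k. Ck_on k G W" "\<forall>y. y \<in> T \<longrightarrow> y \<in> W \<longrightarrow> G y = g y"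
    using smooth_onE[OF assms(2) fx] .
  define O' where "O' = U \<inter> F -` W"
  have "continuous_on U F" using U(3)[rule_format] Ck_on_imp_continuous by blast
  then have O: "open O'" unfolding O'_def using U(1) W(1) by (simp add: continuous_open_preimage)
  have sub: "O' \<subseteq> U" "F ` O' \<subseteq> W" by (auto simp: O'_def)
  show "\<exists>U h. open U \<and> x \<in> U \<and> (\<forall>k. Ck_on k h U) \<and> (\<forall>y. y \<in> S \<longrightarrow> y \<in> U \<longrightarrow> h y = g (f y))"
  proof (intro exI conjI allI impI)
    show "open O'" by (rule O)
    show "x \<in> O'" using U(2) U(4)[rule_format, OF x U(2)] W(2) by (simp add: O'_def)
    show "Ck_on k (\<lambda>x. G (F x)) O'" for k
      by (rule Ck_on_compose[OF O W(1) sub(2) Ck_on_subset[OF U(3)[rule_format] sub(1)] W(3)[rule_format]])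
    show "G (F y) = g (f y)" if "y \<in> S" "y \<in> O'" for y
      using that U(4)[rule_format, of y] W(4)[rule_format, of "f y"] assms(3) by (auto simp: O'_def)
  qed
qed

lemma smooth_on_inverse:
  fixes f :: "'a::euclidean_space \<Rightarrow> real"
  assumes "smooth_on S f" "\<And>x. x \<in> S \<Longrightarrow> f x \<noteq> 0"
  shows "smooth_on S (\<lambda>x. inverse (f x))"
proof (rule smooth_on_compose[OF assms(1), of "-{0}" inverse])
  show "smooth_on (-{0::real}) inverse"
    by (intro smooth_onI_open Ck_on_inverse[of "-{0}" _ "\<lambda>x. x"] Ck_on_bounded_linear bounded_linear_ident) auto
qed (use assms(2) in auto)

lemma smooth_on_frechet_derivative:
  assumes "open S" "smooth_on S f"
  shows "smooth_on S (\<lambda>x. frechet_derivative f (at x) v)"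
proof (rule smooth_onI_open[OF assms(1)])
  show "Ck_on k (\<lambda>x. frechet_derivative f (at x) v) S" for k
    using smooth_on_open[OF assms, of "Suc k"] by simp
qed

lemma smooth_on_has_derivative:
  "open S \<Longrightarrow> smooth_on S f \<Longrightarrow> x \<in> S \<Longrightarrow> (f has_derivative frechet_derivative f (at x)) (at x)"
  by (rule Ck_on_has_derivative[OF smooth_on_open])

lemma smooth_on_differentiable:
  assumes "smooth_on S f" "x \<in> S" shows "f differentiable (at x within S)"
proof -
  obtain U g where U: "open U" "x \<in> U" "\<forall>k. Ck_on k g U" "\<forall>y. y \<in> S \<longrightarrow> y \<in> U \<longrightarrow> g y = f y"
    using smooth_onE[OF assms] .
  have "g differentiable (at x within S)"
    using U(3)[rule_format, of "Suc 0"] U(2) by (auto intro: differentiable_at_withinI)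
  then show ?thesis using differentiable_germ[of U x S g f] U(1,2,4) assms(2) by simp
qed

text \<open>The powers of \<open>1 / t\<close> make the family closed under differentiation.\<close>

definition flat_fun :: "nat \<Rightarrow> real \<Rightarrow> real" where
  "flat_fun n t = (if t \<le> 0 then 0 else exp (- inverse t) * inverse t ^ n)"

lemma flat_fun_tendsto: "(flat_fun n \<longlongrightarrow> 0) (at 0)"
proof -
  have "((\<lambda>t::real. exp (- inverse t) * inverse t ^ n) \<longlongrightarrow> 0) (at_right 0)"
  proof -
    have "((\<lambda>x::real. x ^ n / exp x) \<longlongrightarrow> 0) at_top" by (rule tendsto_power_div_exp_0)
    then have "((\<lambda>t::real. (inverse t) ^ n / exp (inverse t)) \<longlongrightarrow> 0) (at_right 0)"
      using filterlim_compose filterlim_inverse_at_top_right by blast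
    then show ?thesis by (simp add: exp_minus divide_inverse mult.commute)
  qed
  then have "(flat_fun n \<longlongrightarrow> 0) (at_right 0)"
    by (rule Lim_transform_eventually) (auto simp: flat_fun_def eventually_at_right_field intro!: exI[of _ 1])
  moreover have "(flat_fun n \<longlongrightarrow> 0) (at_left 0)"
    by (rule Lim_transform_eventually[of "\<lambda>x. 0"]) (auto simp: flat_fun_def eventually_at_left_field intro!: exI[of _ "-1"])
  ultimately show ?thesis by (rule filterlim_split_at[rotated])
qed

lemma flat_fun_deriv:
  "(flat_fun n has_real_derivative flat_fun (n + 2) t - real n * flat_fun (n + 1) t) (at t)"
proof -
  consider "t < 0" | "t = 0" | "t > 0" by linarith
  then show ?thesis
  proof cases
    case 1
    have "(flat_fun n has_real_derivative 0) (at t)"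
      by (rule has_field_derivative_transform_within_open[of "\<lambda>x. 0" 0 t "{..<0}"]) (use 1 in \<open>auto simp: flat_fun_def\<close>)
    then show ?thesis using 1 by (simp add: flat_fun_def)
  next
    case 2
    \<comment> \<open>The difference quotient at 0 is \<open>flat_fun (n + 1)\<close>, so the limit
      already known gives the derivative.\<close>
    have "((\<lambda>h. flat_fun n h / h) \<longlongrightarrow> 0) (at 0)"
      using flat_fun_tendsto[of "n+1"]
      by (rule Lim_transform_eventually) (auto simp: flat_fun_def eventually_at_filter divide_inverse)
    then show ?thesis using 2 by (simp add: DERIV_def flat_fun_def)
  next
    case 3
    have "((\<lambda>t. exp (- inverse t) * inverse t ^ n) has_real_derivative
       exp (- inverse t) * inverse t ^ 2 * inverse t ^ n - exp (- inverse t) * (real n * inverse t ^ (n - 1) * inverse t ^ 2)) (at t)"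
      using 3 by (auto intro!: derivative_eq_intros simp: power2_eq_square)
    also have "real n * inverse t ^ (n - 1) * inverse t ^ 2 = real n * inverse t ^ (n + 1)"
      by (cases n) (simp_all add: power2_eq_square)
    also have "exp (- inverse t) * inverse t ^ 2 * inverse t ^ n - exp (- inverse t) * (real n * inverse t ^ (n + 1))
       = flat_fun (n + 2) t - real n * flat_fun (n + 1) t"
      using 3 by (simp add: flat_fun_def power_add power2_eq_square mult_ac)
    finally show ?thesis
      by (rule has_field_derivative_transform_within_open[of _ _ t "{0<..}"]) (use 3 in \<open>auto simp: flat_fun_def\<close>)
  qed
qed

lemma Ck_on_flat_fun: "Ck_on k (flat_fun n) UNIV"
proof (induction k arbitrary: n)
  case 0
  have "isCont (flat_fun n) t" for t
    using flat_fun_deriv DERIV_isCont by blast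
  then show ?case by (auto intro: continuous_at_imp_continuous_on)
next
  case (Suc k)
  show ?case
  proof (rule Ck_on_SucI)
    show "(flat_fun n has_derivative (\<lambda>v. v * flat_fun (n + 2) x + (v * (- real n)) * flat_fun (n + 1) x)) (at x)" for x
      using flat_fun_deriv[of n x] unfolding has_field_derivative_def
      by (rule has_derivative_eq_rhs) (simp add: fun_eq_iff algebra_simps)
    show "Ck_on k (\<lambda>x. v * flat_fun (n + 2) x + v * - real n * flat_fun (n + 1) x) UNIV" for v
      by (intro Ck_on_add Ck_on_bounded_linear_compose[OF _ bounded_linear_mult_right] Suc) auto
  qed auto
qed

text \<open>The radial bump exp (-1 / (1 - |x|^2)) on the unit ball. Being even it has an odd
  differential, so that first order volume changes cancel on a ball.\<close>

definition bump :: "'a::euclidean_space \<Rightarrow> real" where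
  "bump x = flat_fun 0 (1 - x \<bullet> x)"

lemma bump_smooth: "smooth_on S (bump :: 'a::euclidean_space \<Rightarrow> real)"
proof -
  have "smooth_on UNIV (\<lambda>x::'a. flat_fun 0 (1 + (-1) * (x \<bullet> x)))"
  proof (rule smooth_on_compose[of _ _ UNIV "flat_fun 0"])
    have "smooth_on UNIV (\<lambda>x::'a. x \<bullet> x)"
      by (intro smooth_onI_open Ck_on_bilinear[OF _ bounded_bilinear_inner] Ck_on_bounded_linear bounded_linear_ident) auto
    then show "smooth_on UNIV (\<lambda>x::'a. 1 + (-1) * (x \<bullet> x))"
      by (intro smooth_on_add smooth_on_mult) auto
  qed (auto intro: smooth_onI_open Ck_on_flat_fun)
  then show ?thesis by (auto simp: bump_def[abs_def] intro: smooth_on_subset)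
qed

lemma bump_nonneg: "bump x \<ge> 0"
  by (auto simp: bump_def flat_fun_def)

lemma bump_pos_iff: "bump x > 0 \<longleftrightarrow> norm x < 1"
proof -
  have "x \<bullet> x < 1 \<longleftrightarrow> norm x < 1"
    by (simp add: dot_square_norm power_less_one_iff)
  then show ?thesis by (auto simp: bump_def flat_fun_def)
qed

lemma bump_eq_0_iff: "bump x = 0 \<longleftrightarrow> norm x \<ge> 1"
  using bump_pos_iff[of x] bump_nonneg[of x] by linarith

lemma bump_has_derivative:
  "(bump has_derivative (\<lambda>v. - 2 * flat_fun 2 (1 - x \<bullet> x) * (x \<bullet> v))) (at x)"
proof -
  have "((\<lambda>x. 1 - x \<bullet> x) has_derivative (\<lambda>v. - (x \<bullet> v + v \<bullet> x))) (at x)"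
    by (auto intro!: derivative_eq_intros simp: inner_commute)
  from has_derivative_compose[OF this flat_fun_deriv[of 0, unfolded has_field_derivative_def]]
  show ?thesis unfolding bump_def
    by (rule has_derivative_eq_rhs) (auto simp: inner_commute algebra_simps numeral_2_eq_2)
qed

section \<open>The model form and its orbit\<close>

lemma exhaust_7: "x = 1 \<or> x = 2 \<or> x = 3 \<or> x = 4 \<or> x = 5 \<or> x = 6 \<or> x = 7" for x :: 7
proof (induct x)
  case (of_int z)
  then have "0 \<le> z" and "z < 7" by simp_all
  then have "z = 0 \<or> z = 1 \<or> z = 2 \<or> z = 3 \<or> z = 4 \<or> z = 5 \<or> z = 6" by arith
  then show ?case by auto
qed

lemma UNIV_7: "(UNIV::7 set) = {1,2,3,4,5,6,7}"
  using exhaust_7 by auto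

lemma sum_7: "sum f (UNIV::7 set) = f 1 + f 2 + f 3 + f 4 + f 5 + f 6 + f 7"
  unfolding UNIV_7 by (simp add: ac_simps)

lemma forall_7: "(\<forall>i::7. P i) \<longleftrightarrow> P 1 \<and> P 2 \<and> P 3 \<and> P 4 \<and> P 5 \<and> P 6 \<and> P 7"
  by (metis exhaust_7)

text \<open>The octonionic cross product on the imaginary octonions: \<open>w \<bullet> cross7 u v = phi_mod (u, v, w)\<close>.\<close>

definition cross7 :: "R7 \<Rightarrow> R7 \<Rightarrow> R7" where
  "cross7 v w = (\<chi> i.
     if i = 1 then v$2 * w$3 - v$3 * w$2 + (v$4 * w$5 - v$5 * w$4) + (v$6 * w$7 - v$7 * w$6)
     else if i = 2 then v$3 * w$1 - v$1 * w$3 + (v$4 * w$6 - v$6 * w$4) - (v$5 * w$7 - v$7 * w$5)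
     else if i = 3 then v$1 * w$2 - v$2 * w$1 - (v$4 * w$7 - v$7 * w$4) - (v$5 * w$6 - v$6 * w$5)
     else if i = 4 then v$5 * w$1 - v$1 * w$5 + (v$6 * w$2 - v$2 * w$6) - (v$7 * w$3 - v$3 * w$7)
     else if i = 5 then v$1 * w$4 - v$4 * w$1 - (v$7 * w$2 - v$2 * w$7) - (v$6 * w$3 - v$3 * w$6)
     else if i = 6 then v$7 * w$1 - v$1 * w$7 + (v$2 * w$4 - v$4 * w$2) - (v$3 * w$5 - v$5 * w$3)
     else v$1 * w$6 - v$6 * w$1 - (v$2 * w$5 - v$5 * w$2) - (v$3 * w$4 - v$4 * w$3))"

lemma cross7_nth:
  "cross7 v w $ 1 = v$2 * w$3 - v$3 * w$2 + (v$4 * w$5 - v$5 * w$4) + (v$6 * w$7 - v$7 * w$6)"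
  "cross7 v w $ 2 = v$3 * w$1 - v$1 * w$3 + (v$4 * w$6 - v$6 * w$4) - (v$5 * w$7 - v$7 * w$5)"
  "cross7 v w $ 3 = v$1 * w$2 - v$2 * w$1 - (v$4 * w$7 - v$7 * w$4) - (v$5 * w$6 - v$6 * w$5)"
  "cross7 v w $ 4 = v$5 * w$1 - v$1 * w$5 + (v$6 * w$2 - v$2 * w$6) - (v$7 * w$3 - v$3 * w$7)"
  "cross7 v w $ 5 = v$1 * w$4 - v$4 * w$1 - (v$7 * w$2 - v$2 * w$7) - (v$6 * w$3 - v$3 * w$6)"
  "cross7 v w $ 6 = v$7 * w$1 - v$1 * w$7 + (v$2 * w$4 - v$4 * w$2) - (v$3 * w$5 - v$5 * w$3)"
  "cross7 v w $ 7 = v$1 * w$6 - v$6 * w$1 - (v$2 * w$5 - v$5 * w$2) - (v$3 * w$4 - v$4 * w$3)"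
  by (simp_all add: cross7_def)

definition phi3 :: "R7 \<Rightarrow> R7 \<Rightarrow> R7 \<Rightarrow> real" where
  "phi3 u v w = u \<bullet> cross7 v w"

lemma inner_7: "(u::R7) \<bullet> v = u$1 * v$1 + u$2 * v$2 + u$3 * v$3 + u$4 * v$4 + u$5 * v$5 + u$6 * v$6 + u$7 * v$7"
  by (simp add: inner_vec_def sum_7)

lemma theta_3:
  "theta [a, b, c] v = v 0 $ a * (v 1 $ b * v 2 $ c - v 2 $ b * v 1 $ c)
     - v 1 $ a * (v 0 $ b * v 2 $ c - v 2 $ b * v 0 $ c)
     + v 2 $ a * (v 0 $ b * v 1 $ c - v 1 $ b * v 0 $ c)"
proof -
  have f012: "finite {1::nat, 2}" "0 \<notin> {1::nat, 2}" by auto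
  have f12: "finite {2::nat}" "1 \<notin> {2::nat}" by auto
  have *: "{..<length [a, b, c]} = {0, 1, 2}" by auto
  show ?thesis
    unfolding theta_def *
    unfolding sum_over_permutations_insert[OF f012]
    unfolding sum_over_permutations_insert[OF f12]
    unfolding permutes_sing
    by (simp add: sign_swap_id permutation_swap_id sign_compose transpose_def algebra_simps)
qed

lemma phi_mod_eq: "phi_mod v = phi3 (v 0) (v 1) (v 2)"
  unfolding phi_mod_def theta_3 phi3_def inner_7 cross7_nth by (simp add: algebra_simps)

lemma cross7_bilinear: "bounded_bilinear cross7"
proof -
  have "bilinear cross7"
    unfolding bilinear_def
    by (auto intro!: linearI simp: vec_eq_iff forall_7 cross7_nth algebra_simps)
  then show ?thesis by (simp add: bilinear_conv_bounded_bilinear)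
qed

interpretation cross7: bounded_bilinear cross7 by (rule cross7_bilinear)

lemma cross7_self [simp]: "cross7 u u = 0"
  by (simp add: vec_eq_iff forall_7 cross7_nth)

lemma cross7_skew: "w \<bullet> cross7 u v = - (v \<bullet> cross7 u w)"
  unfolding inner_7 cross7_nth by (simp add: algebra_simps)

text \<open>A form of the alternative law of the octonions: on the orthogonal complement of
  \<open>u\<close> the map \<open>cross7 u\<close> squares to -|u|^2. The computation of the
  stabiliser rests on this identity.\<close>

lemma cross7_cross7: "cross7 u (cross7 u v) = (u \<bullet> v) *\<^sub>R u - (u \<bullet> u) *\<^sub>R v"
  unfolding vec_eq_iff forall_7
  by (intro conjI; simp add: cross7_nth inner_7 algebra_simps)

lemma phi3_cyclic: "phi3 u v w = phi3 w u v"
  unfolding phi3_def inner_7 cross7_nth by (simp add: algebra_simps)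

section \<open>Determinants and the volume form\<close>

text \<open>Both sides are Leibniz sums, over permutations of \<open>{..<7}\<close> and of the type
  \<open>7\<close>. The bijection \<open>b n = n + 1\<close>, which sends 6 to \<open>7 = 0\<close>,
  transports one to the other and preserves signs.\<close>

lemma theta_7_eq_det: "theta [1,2,3,4,5,6,7] (\<lambda>i. A *v std_basis i) = det A"
proof -
  define b :: "nat \<Rightarrow> 7" where "b = (\<lambda>n. of_nat (Suc n))"
  have less7: "{..<7::nat} = {0,1,2,3,4,5,6}" by auto
  have b: "bij_betw b {..<7} UNIV"
    unfolding bij_betw_def
  proof
    show "inj_on b {..<7}" unfolding less7 b_def by (simp add: inj_on_def)
    show "b ` {..<7} = UNIV" unfolding less7 b_def UNIV_7 by auto
  qed
  have "[0..<7::nat] = [0,1,2,3,4,5,6]" by (simp add: upt_rec)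
  then have "[1,2,3,4,5,6,7] = map b [0..<7]" by (simp add: b_def)
  then have ls: "[1,2,3,4,5,6,7::7] ! a = b a" if "a < 7" for a
    using that by simp
  define m where "m = (\<lambda>\<pi> x. if x \<in> (UNIV :: 7 set) then b (\<pi> (inv_into {..<7} b x)) else x)"
  have m: "bij_betw m {\<pi>. \<pi> permutes {..<7}} {\<pi>. \<pi> permutes UNIV}"
    unfolding m_def by (rule bij_betw_permutations[OF b])
  have mm: "m \<sigma> = map_permutation {..<7} b \<sigma>" for \<sigma>
    unfolding m_def map_permutation_def restrict_id_def using b by (auto simp: bij_betw_def)
  have ib: "inv_into {..<7} b (b a) = a" if "a < 7" for a
    using b that by (simp add: bij_betw_def inv_into_f_f)
  have "det A = (\<Sum>p\<in>{\<pi>. \<pi> permutes UNIV}. of_int (sign p) * (\<Prod>i\<in>UNIV. A $ i $ p i))"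
    by (simp add: det_def)
  also have "\<dots> = (\<Sum>\<sigma>\<in>{\<pi>. \<pi> permutes {..<7}}. of_int (sign (m \<sigma>)) * (\<Prod>i\<in>UNIV. A $ i $ m \<sigma> i))"
    by (rule sum.reindex_bij_betw[OF m, symmetric])
  also have "\<dots> = (\<Sum>\<sigma>\<in>{\<pi>. \<pi> permutes {..<7}}. of_int (sign \<sigma>) * (\<Prod>a<7. A $ b a $ b (\<sigma> a)))"
  proof (rule sum.cong[OF refl])
    fix \<sigma> :: "nat \<Rightarrow> nat" assume "\<sigma> \<in> {\<pi>. \<pi> permutes {..<7}}"
    then have s: "\<sigma> permutes {..<7}" by simp
    have "sign (m \<sigma>) = sign \<sigma>"
      unfolding mm by (rule sign_map_permutation) (use b s in \<open>auto simp: bij_betw_def\<close>)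
    moreover have "(\<Prod>i\<in>UNIV. A $ i $ m \<sigma> i) = (\<Prod>a\<in>{..<7}. A $ b a $ m \<sigma> (b a))"
      by (rule prod.reindex_bij_betw[OF b, symmetric])
    moreover have "m \<sigma> (b a) = b (\<sigma> a)" if "a < 7" for a
      using ib[OF that] by (simp add: m_def)
    ultimately show "of_int (sign (m \<sigma>)) * (\<Prod>i\<in>UNIV. A $ i $ m \<sigma> i) = of_int (sign \<sigma>) * (\<Prod>a<7. A $ b a $ b (\<sigma> a))"
      by simp
  qed
  also have "\<dots> = theta [1,2,3,4,5,6,7] (\<lambda>i. A *v std_basis i)"
  proof -
    have "(A *v std_basis j) $ i = A $ i $ b j" for i j
      by (simp add: std_basis_def b_def matrix_vector_mult_basis column_def)
    then have A: "(A *v std_basis (\<sigma> a)) $ ([1,2,3,4,5,6,7] ! a) = A $ b a $ b (\<sigma> a)" if "a \<in> {..<7}" for \<sigma> a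
      using that by (simp only: ls lessThan_iff)
    have "length [1,2,3,4,5,6,7::7] = 7" by simp
    then show ?thesis unfolding theta_def by (simp only: A cong: prod.cong)
  qed
  finally show ?thesis ..
qed

lemma vol0_linear:
  assumes "linear L"
  shows "vol0 (\<lambda>i. L (std_basis i)) = det (matrix L)"
  using theta_7_eq_det[of "matrix L"] by (simp add: vol0_def fun_cong[OF matrix_vector_mul(2)[OF assms]])

text \<open>An orthogonal change of basis turns \<open>a\<close> into a multiple of a basis vector.
  The transposed matrix then differs from the identity in a single column, and
  \<open>cramer_lemma\<close> evaluates it.\<close>

lemma det_rank1_update: "det (\<chi> i j. (if i = j then 1 else 0) + a $ i * b $ j) = 1 + a \<bullet> (b :: real^'n)"
proof (cases "a = 0")
  case True
  then show ?thesis using det_I[where 'a=real and 'n='n] by (simp add: mat_def)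
next
  case False
  fix k :: 'n
  obtain Q where Q: "orthogonal_matrix Q" "Q *v axis k 1 = a /\<^sub>R norm a"
    using orthogonal_matrix_exists_basis[of "a /\<^sub>R norm a" k] False by auto
  have QQ: "transpose Q ** Q = mat 1" "Q ** transpose Q = mat 1"
    using Q(1) by (auto simp: orthogonal_matrix_def)
  define c where "c = transpose Q *v b"
  have qa: "transpose Q *v a = norm a *\<^sub>R axis k 1"
  proof -
    have "transpose Q *v a = norm a *\<^sub>R (transpose Q *v (a /\<^sub>R norm a))"
      using False by (simp add: matrix_vector_mult_scaleR)
    also have "\<dots> = norm a *\<^sub>R axis k 1"
      unfolding Q(2)[symmetric] matrix_vector_mul_assoc QQ by simp
    finally show ?thesis .
  qed
  define R where "R v w = (\<chi> i j. v $ i * w $ j)" for v w :: "real^'n"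
  have R1: "B ** R v w = R (B *v v) w" for B v w
    by (simp add: R_def matrix_matrix_mult_def matrix_vector_mult_def vec_eq_iff sum_distrib_right mult.assoc)
  have R2: "R v w ** B = R v (transpose B *v w)" for B v w
    by (simp add: R_def matrix_matrix_mult_def matrix_vector_mult_def vec_eq_iff sum_distrib_left transpose_def mult_ac)
  have "det (mat 1 + R a b) = det (transpose Q) * det (mat 1 + R a b) * det Q"
  proof -
    have "det (transpose Q) * det Q = 1" unfolding det_mul[symmetric] QQ by simp
    then show ?thesis by (simp add: mult.commute mult.left_commute)
  qed
  also have "\<dots> = det (transpose Q ** (mat 1 + R a b) ** Q)"
    by (simp add: det_mul)
  also have "transpose Q ** (mat 1 + R a b) ** Q = mat 1 + R (transpose Q *v a) c"
  proof -
    have "(A + B) ** C = A ** C + B ** C" for A B C :: "real^'n^'n"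
      by (simp add: matrix_matrix_mult_def vec_eq_iff sum.distrib distrib_right)
    then show ?thesis by (simp add: matrix_add_ldistrib QQ R1 R2 c_def)
  qed
  also have "\<dots> = transpose (\<chi> i j. if j = k then (mat 1 *v (axis k 1 + norm a *\<^sub>R c)) $ i else mat 1 $ i $ j)"
    unfolding qa R_def matrix_vector_mul_lid by (auto simp: vec_eq_iff transpose_def mat_def axis_def)
  also have "det \<dots> = (axis k 1 + norm a *\<^sub>R c) $ k * det (mat 1 :: real^'n^'n)"
    unfolding det_transpose by (rule cramer_lemma)
  also have "\<dots> = 1 + norm a * c $ k" by simp
  also have "norm a * c $ k = a \<bullet> b"
  proof -
    have "norm a * c $ k = c \<bullet> (transpose Q *v a)" unfolding qa by (simp add: inner_axis)
    also have "\<dots> = (Q *v c) \<bullet> a"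
      by (metis dot_lmul_matrix transpose_matrix_vector transpose_transpose inner_commute)
    also have "Q *v c = b" unfolding c_def matrix_vector_mul_assoc QQ by simp
    finally have "norm a * c $ k = b \<bullet> a" .
    then have "norm a * c $ k = a \<bullet> b" by (simp add: inner_commute)
    then show ?thesis .
  qed
  finally show ?thesis by (simp add: R_def mat_def plus_vec_def)
qed

section \<open>The infinitesimal action on the model form\<close>

text \<open>For \<open>C\<close> skew in its last two indices this is the contraction of those
  indices with \<open>phi_mod\<close>: the sum over a, b of phi_mod (j, a, b) * C (i, a, b). Applied
  to the variation of \<open>phi_mod\<close> under a matrix it returns that matrix times 18 on
  multiples of the identity, times 4 on traceless symmetric matrices, and times 12 or 0 on the two
  types of skew matrices, the 0 belonging to the Lie algebra of G2. The weights in
  \<open>inf_frame\<close> invert 4, 12 and 18: 1/12 + 1/6 = 1/4, 1/6 - 1/12 = 1/12, and 18/4 -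
  126/36 = 1.\<close>

definition contr :: "real^7^7^7 \<Rightarrow> 7 \<Rightarrow> 7 \<Rightarrow> real" where
  "contr C i j = 2 * (if j = 1 then C$i$2$3 + C$i$4$5 + C$i$6$7
     else if j = 2 then C$i$3$1 + C$i$4$6 - C$i$5$7
     else if j = 3 then C$i$1$2 - C$i$4$7 - C$i$5$6
     else if j = 4 then C$i$5$1 + C$i$6$2 - C$i$7$3
     else if j = 5 then C$i$1$4 - C$i$7$2 - C$i$6$3
     else if j = 6 then C$i$7$1 + C$i$2$4 - C$i$3$5
     else C$i$1$6 - C$i$2$5 - C$i$3$4)"

definition alt3 :: "real^7^7^7 \<Rightarrow> real^7^7^7" where
  "alt3 B = (\<chi> i j k. (B$i$j$k - B$j$i$k + B$j$k$i - B$k$j$i + B$k$i$j - B$i$k$j) / 6)"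

text \<open>A right inverse of the action of \<open>gl(7)\<close> on the model form; by the inverse function theorem
  the orbit of the model form is therefore open.\<close>

definition inf_frame :: "real^7^7^7 \<Rightarrow> real^7^7" where
  "inf_frame C = (\<chi> i l. contr C l i / 12 + contr C i l / 6 -
     (if i = l then (\<Sum>m\<in>UNIV. contr C m m) / 36 else 0))"

lemma contr_nth:
  "contr C i 1 = 2 * (C$i$2$3 + C$i$4$5 + C$i$6$7)"
  "contr C i 2 = 2 * (C$i$3$1 + C$i$4$6 - C$i$5$7)"
  "contr C i 3 = 2 * (C$i$1$2 - C$i$4$7 - C$i$5$6)"
  "contr C i 4 = 2 * (C$i$5$1 + C$i$6$2 - C$i$7$3)"
  "contr C i 5 = 2 * (C$i$1$4 - C$i$7$2 - C$i$6$3)"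
  "contr C i 6 = 2 * (C$i$7$1 + C$i$2$4 - C$i$3$5)"
  "contr C i 7 = 2 * (C$i$1$6 - C$i$2$5 - C$i$3$4)"
  by (simp_all add: contr_def)

lemma cross7_axis:
  "cross7 (axis 1 1) (axis 2 1) = axis 3 1" "cross7 (axis 2 1) (axis 1 1) = - axis 3 1"
  "cross7 (axis 1 1) (axis 3 1) = - axis 2 1" "cross7 (axis 3 1) (axis 1 1) = axis 2 1"
  "cross7 (axis 1 1) (axis 4 1) = axis 5 1" "cross7 (axis 4 1) (axis 1 1) = - axis 5 1"
  "cross7 (axis 1 1) (axis 5 1) = - axis 4 1" "cross7 (axis 5 1) (axis 1 1) = axis 4 1"
  "cross7 (axis 1 1) (axis 6 1) = axis 7 1" "cross7 (axis 6 1) (axis 1 1) = - axis 7 1"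
  "cross7 (axis 1 1) (axis 7 1) = - axis 6 1" "cross7 (axis 7 1) (axis 1 1) = axis 6 1"
  "cross7 (axis 2 1) (axis 3 1) = axis 1 1" "cross7 (axis 3 1) (axis 2 1) = - axis 1 1"
  "cross7 (axis 2 1) (axis 4 1) = axis 6 1" "cross7 (axis 4 1) (axis 2 1) = - axis 6 1"
  "cross7 (axis 2 1) (axis 5 1) = - axis 7 1" "cross7 (axis 5 1) (axis 2 1) = axis 7 1"
  "cross7 (axis 2 1) (axis 6 1) = - axis 4 1" "cross7 (axis 6 1) (axis 2 1) = axis 4 1"
  "cross7 (axis 2 1) (axis 7 1) = axis 5 1" "cross7 (axis 7 1) (axis 2 1) = - axis 5 1"
  "cross7 (axis 3 1) (axis 4 1) = - axis 7 1" "cross7 (axis 4 1) (axis 3 1) = axis 7 1"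
  "cross7 (axis 3 1) (axis 5 1) = - axis 6 1" "cross7 (axis 5 1) (axis 3 1) = axis 6 1"
  "cross7 (axis 3 1) (axis 6 1) = axis 5 1" "cross7 (axis 6 1) (axis 3 1) = - axis 5 1"
  "cross7 (axis 3 1) (axis 7 1) = axis 4 1" "cross7 (axis 7 1) (axis 3 1) = - axis 4 1"
  "cross7 (axis 4 1) (axis 5 1) = axis 1 1" "cross7 (axis 5 1) (axis 4 1) = - axis 1 1"
  "cross7 (axis 4 1) (axis 6 1) = axis 2 1" "cross7 (axis 6 1) (axis 4 1) = - axis 2 1"
  "cross7 (axis 4 1) (axis 7 1) = - axis 3 1" "cross7 (axis 7 1) (axis 4 1) = axis 3 1"
  "cross7 (axis 5 1) (axis 6 1) = - axis 3 1" "cross7 (axis 6 1) (axis 5 1) = axis 3 1"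
  "cross7 (axis 5 1) (axis 7 1) = - axis 2 1" "cross7 (axis 7 1) (axis 5 1) = axis 2 1"
  "cross7 (axis 6 1) (axis 7 1) = axis 1 1" "cross7 (axis 7 1) (axis 6 1) = - axis 1 1"
  by (simp_all add: vec_eq_iff forall_7 cross7_nth axis_def)


text \<open>The swap of the first two indices and the rotation generate all permutations of three
  indices. A tensor identity is thereby reduced to the 35 strictly increasing triples, which can be
  enumerated as numerals.\<close>

lemma alternating_eq_0:
  fixes h :: "7 \<Rightarrow> 7 \<Rightarrow> 7 \<Rightarrow> real"
  assumes sw: "\<And>i j k. h j i k = - h i j k" and cy: "\<And>i j k. h j k i = h i j k"
    and sorted: "\<And>a b c. 1 \<le> a \<Longrightarrow> a < b \<Longrightarrow> b < c \<Longrightarrow> c \<le> 7 \<Longrightarrow> h (of_nat a) (of_nat b) (of_nat c) = 0"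
  shows "h i j k = 0"
proof -
  have surj: "\<exists>a. 1 \<le> a \<and> a \<le> 7 \<and> i = of_nat a" for i :: 7
  proof -
    have "\<exists>a\<in>{1,2,3,4,5,6,7::nat}. i = of_nat a" using exhaust_7[of i] by simp
    then obtain a where "a \<in> {1,2,3,4,5,6,7::nat}" "i = of_nat a" by blast
    then show ?thesis by (intro exI[of _ a]) auto
  qed
  obtain a b c where abc: "i = of_nat a" "j = of_nat b" "k = of_nat c"
    "1 \<le> a" "a \<le> 7" "1 \<le> b" "b \<le> 7" "1 \<le> c" "c \<le> 7"
    using surj by metis
  define g where "g a b c = h (of_nat a) (of_nat b) (of_nat c)" for a b c
  have g: "g y x z = - g x y z" "g y z x = g x y z" for x y z
    unfolding g_def by (rule sw, rule cy)
  have diag: "g x x z = 0" "g x z x = 0" "g z x x = 0" for x z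
    using g(1)[of x x z] g(2)[of x x z] g(2)[of x z x] by auto
  have s: "g x y z = 0" if "1 \<le> x" "x < y" "y < z" "z \<le> 7" for x y z
    using sorted that by (simp add: g_def)
  consider "a = b \<or> b = c \<or> a = c" | "a < b" "b < c" | "a < c" "c < b" | "b < a" "a < c"
    | "b < c" "c < a" | "c < a" "a < b" | "c < b" "b < a" by linarith
  then have "g a b c = 0"
  proof cases
    case 1 then show ?thesis using diag by auto
  next
    case 2 then show ?thesis using s abc by auto
  next
    case 3 then have "g a c b = 0" using s abc by auto
    then show ?thesis using g(1)[of a c b] g(2)[of a b c] by simp
  next
    case 4 then have "g b a c = 0" using s abc by auto
    then show ?thesis using g(1)[of b a c] by simp
  next
    case 5 then have "g b c a = 0" using s abc by auto
    then show ?thesis using g(2)[of b c a] by simp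
  next
    case 6 then have "g c a b = 0" using s abc by auto
    then show ?thesis using g(2)[of a b c] by simp
  next
    case 7 then have "g c b a = 0" using s abc by auto
    then show ?thesis using g(1)[of c b a] g(2)[of b c a] by simp
  qed
  then show ?thesis by (simp add: g_def abc)
qed

lemma alt3_swap: "alt3 B $ j $ i $ k = - alt3 B $ i $ j $ k" "alt3 B $ j $ k $ i = alt3 B $ i $ j $ k"
  by (simp_all add: alt3_def field_simps)

lemma alt3_sort:
  "alt3 B $ i $ k $ j = - alt3 B $ i $ j $ k" "alt3 B $ j $ i $ k = - alt3 B $ i $ j $ k"
  "alt3 B $ j $ k $ i = alt3 B $ i $ j $ k" "alt3 B $ k $ i $ j = alt3 B $ i $ j $ k"
  "alt3 B $ k $ j $ i = - alt3 B $ i $ j $ k"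
  by (simp_all add: alt3_def field_simps)

lemma alt3_diag: "alt3 B $ i $ i $ k = 0" "alt3 B $ i $ k $ i = 0" "alt3 B $ k $ i $ i = 0"
  by (simp_all add: alt3_def)

lemma inf_frame_entry: "inf_frame C $ i $ l = contr C l i / 12 + contr C i l / 6 -
     (if i = l then (contr C 1 1 + contr C 2 2 + contr C 3 3 + contr C 4 4 + contr C 5 5 + contr C 6 6 + contr C 7 7) / 36 else 0)"
  by (simp add: inf_frame_def sum_7)

text \<open>The linearised orbit equation at the identity, entry by entry. The defect
  \<open>h\<close> is alternating, so 35 entries decide; it is written cyclically so that only cross
  products of two basis vectors have to be evaluated.\<close>

lemma inf_frame_action:
  "phi3 (inf_frame (alt3 B) $ i) (axis j 1) (axis k 1) + phi3 (axis i 1) (inf_frame (alt3 B) $ j) (axis k 1)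
     + phi3 (axis i 1) (axis j 1) (inf_frame (alt3 B) $ k) = alt3 B $ i $ j $ k"
proof -
  define a where "a = inf_frame (alt3 B)"
  define h where "h i j k = a $ i \<bullet> cross7 (axis j 1) (axis k 1) + a $ j \<bullet> cross7 (axis k 1) (axis i 1)
    + a $ k \<bullet> cross7 (axis i 1) (axis j 1) - alt3 B $ i $ j $ k" for i j k
  have skew: "cross7 v u = - cross7 u v" for u v
    by (simp add: vec_eq_iff forall_7 cross7_nth)
  have "h i j k = 0"
  proof (rule alternating_eq_0)
    show "h j i k = - h i j k" for i j k
      unfolding h_def alt3_swap(1)[of B i j k]
      by (simp add: skew[of "axis k 1" "axis i 1"] skew[of "axis k 1" "axis j 1"] skew[of "axis j 1" "axis i 1"])
    show "h j k i = h i j k" for i j k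
      unfolding h_def alt3_swap(2)[where i = i and j = j and k = k] by simp
  next
    have h_axis: "x \<bullet> - axis m 1 = - x $ m" for x :: R7 and m by (simp add: inner_axis)
    have hz: "h 1 2 3 = 0" "h 1 2 4 = 0" "h 1 2 5 = 0" "h 1 2 6 = 0" "h 1 2 7 = 0" "h 1 3 4 = 0" "h 1 3 5 = 0"
      "h 1 3 6 = 0" "h 1 3 7 = 0" "h 1 4 5 = 0" "h 1 4 6 = 0" "h 1 4 7 = 0" "h 1 5 6 = 0" "h 1 5 7 = 0"
      "h 1 6 7 = 0" "h 2 3 4 = 0" "h 2 3 5 = 0" "h 2 3 6 = 0" "h 2 3 7 = 0" "h 2 4 5 = 0" "h 2 4 6 = 0"
      "h 2 4 7 = 0" "h 2 5 6 = 0" "h 2 5 7 = 0" "h 2 6 7 = 0" "h 3 4 5 = 0" "h 3 4 6 = 0" "h 3 4 7 = 0"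
      "h 3 5 6 = 0" "h 3 5 7 = 0" "h 3 6 7 = 0" "h 4 5 6 = 0" "h 4 5 7 = 0" "h 4 6 7 = 0" "h 5 6 7 = 0"
      unfolding h_def cross7_axis inner_axis h_axis a_def inf_frame_entry contr_nth alt3_diag
        alt3_sort[where i=1 and j=2 and k=3] alt3_sort[where i=1 and j=2 and k=4]
        alt3_sort[where i=1 and j=2 and k=5] alt3_sort[where i=1 and j=2 and k=6]
        alt3_sort[where i=1 and j=2 and k=7] alt3_sort[where i=1 and j=3 and k=4]
        alt3_sort[where i=1 and j=3 and k=5] alt3_sort[where i=1 and j=3 and k=6]
        alt3_sort[where i=1 and j=3 and k=7] alt3_sort[where i=1 and j=4 and k=5]
        alt3_sort[where i=1 and j=4 and k=6] alt3_sort[where i=1 and j=4 and k=7]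
        alt3_sort[where i=1 and j=5 and k=6] alt3_sort[where i=1 and j=5 and k=7]
        alt3_sort[where i=1 and j=6 and k=7] alt3_sort[where i=2 and j=3 and k=4]
        alt3_sort[where i=2 and j=3 and k=5] alt3_sort[where i=2 and j=3 and k=6]
        alt3_sort[where i=2 and j=3 and k=7] alt3_sort[where i=2 and j=4 and k=5]
        alt3_sort[where i=2 and j=4 and k=6] alt3_sort[where i=2 and j=4 and k=7]
        alt3_sort[where i=2 and j=5 and k=6] alt3_sort[where i=2 and j=5 and k=7]
        alt3_sort[where i=2 and j=6 and k=7] alt3_sort[where i=3 and j=4 and k=5]
        alt3_sort[where i=3 and j=4 and k=6] alt3_sort[where i=3 and j=4 and k=7]
        alt3_sort[where i=3 and j=5 and k=6] alt3_sort[where i=3 and j=5 and k=7]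
        alt3_sort[where i=3 and j=6 and k=7] alt3_sort[where i=4 and j=5 and k=6]
        alt3_sort[where i=4 and j=5 and k=7] alt3_sort[where i=4 and j=6 and k=7]
        alt3_sort[where i=5 and j=6 and k=7]
      by (simp_all add: field_simps)
    have "\<forall>a\<in>{1..5}. \<forall>b\<in>{Suc a..6}. \<forall>c\<in>{Suc b..7}. h (of_nat a) (of_nat b) (of_nat c) = 0"
      by (simp add: atLeastAtMost_upt upt_rec hz)
    then show "h (of_nat a) (of_nat b) (of_nat c) = 0" if "1 \<le> a" "a < b" "b < c" "c \<le> 7" for a b c
      using that by simp
  qed
  moreover have "phi3 (axis i 1) (a $ j) (axis k 1) = a $ j \<bullet> cross7 (axis k 1) (axis i 1)"
    by (metis phi3_cyclic phi3_def)
  moreover have "phi3 (axis i 1) (axis j 1) (a $ k) = a $ k \<bullet> cross7 (axis i 1) (axis j 1)"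
    by (metis phi3_cyclic phi3_def)
  ultimately show ?thesis unfolding a_def[symmetric] by (simp add: h_def phi3_def)
qed

section \<open>Alternating 3-forms and their components\<close>

text \<open>An argument for a 3-form; the tail of the sequence has the value \<open>c\<close>, which
  a 3-form does not see.\<close>

definition vec3 :: "'a \<Rightarrow> 'a \<Rightarrow> 'a \<Rightarrow> nat \<Rightarrow> 'a" where
  "vec3 a b c = (\<lambda>n. if n = 0 then a else if n = 1 then b else c)"

lemma vec3_simps [simp]: "vec3 a b c 0 = a" "vec3 a b c 1 = b" "vec3 a b c (Suc 0) = b" "vec3 a b c 2 = c"
  by (auto simp: vec3_def)

lemma less_3: "(\<forall>i<3::nat. P i) \<longleftrightarrow> P 0 \<and> P 1 \<and> P 2"
  by (auto simp: less_Suc_eq numeral_3_eq_3 numeral_2_eq_2)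

lemma alternating_form_3:
  "alternating_form 3 w \<longleftrightarrow> (\<forall>v. w v = w (vec3 (v 0) (v 1) (v 2))) \<and>
    (\<forall>b c. linear (\<lambda>x. w (vec3 x b c))) \<and> (\<forall>a c. linear (\<lambda>x. w (vec3 a x c))) \<and> (\<forall>a b. linear (\<lambda>x. w (vec3 a b x))) \<and>
    (\<forall>a c. w (vec3 a a c) = 0) \<and> (\<forall>a b. w (vec3 a b a) = 0) \<and> (\<forall>a b. w (vec3 a b b) = 0)"
  (is "?l \<longleftrightarrow> ?r")
proof
  assume l: ?l
  have eq: "w v = w v'" if "v 0 = v' 0" "v 1 = v' 1" "v 2 = v' 2" for v v'
    using l that unfolding alternating_form_def less_3 by blast
  have lin: "linear (\<lambda>x. w (v(0 := x)))" "linear (\<lambda>x. w (v(1 := x)))" "linear (\<lambda>x. w (v(2 := x)))" for v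
    using l unfolding alternating_form_def less_3 by blast+
  have z: "v 0 = v 1 \<Longrightarrow> w v = 0" "v 0 = v 2 \<Longrightarrow> w v = 0" "v 1 = v 2 \<Longrightarrow> w v = 0" for v
    using l unfolding alternating_form_def less_3 by (metis zero_neq_one zero_neq_numeral one_eq_numeral_iff num.distinct(1))+
  have "linear (\<lambda>x. w (vec3 x b c))" "linear (\<lambda>x. w (vec3 b x c))" "linear (\<lambda>x. w (vec3 b c x))" for b c
  proof -
    have e: "w (vec3 x b c) = w ((vec3 0 b c)(0 := x))" "w (vec3 b x c) = w ((vec3 b 0 c)(1 := x))"
      "w (vec3 b c x) = w ((vec3 b c 0)(2 := x))" for x
      by (rule eq; simp)+
    show "linear (\<lambda>x. w (vec3 x b c))" "linear (\<lambda>x. w (vec3 b x c))" "linear (\<lambda>x. w (vec3 b c x))"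
      unfolding e by (rule lin)+
  qed
  moreover have "w v = w (vec3 (v 0) (v 1) (v 2))" for v by (rule eq) simp_all
  ultimately show ?r using z by simp
next
  assume r: ?r
  have eq: "w v = w (vec3 (v 0) (v 1) (v 2))" for v using r by blast
  show ?l
    unfolding alternating_form_def less_3
  proof (intro conjI allI impI)
    fix v v' :: "nat \<Rightarrow> R7"
    assume "v 0 = v' 0 \<and> v 1 = v' 1 \<and> v 2 = v' 2"
    then show "w v = w v'" using eq[of v] eq[of v'] by simp
  next
    fix v :: "nat \<Rightarrow> R7"
    have "w (v(0 := x)) = w (vec3 x (v 1) (v 2))" "w (v(1 := x)) = w (vec3 (v 0) x (v 2))" "w (v(2 := x)) = w (vec3 (v 0) (v 1) x)" for x
      by (subst eq, simp)+
    then show "linear (\<lambda>x. w (v(0 := x)))" "linear (\<lambda>x. w (v(1 := x)))" "linear (\<lambda>x. w (v(2 := x)))"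
      using r by simp_all
  next
    fix v :: "nat \<Rightarrow> R7"
    have z: "w (vec3 a a c) = 0" "w (vec3 a b a) = 0" "w (vec3 a b b) = 0" for a b c
      using r by blast+
    show "w v = 0" if "0 \<noteq> (1::nat) \<and> v 0 = v 1" using eq[of v] z(1)[of "v 1" "v 2"] that by simp
    show "w v = 0" if "0 \<noteq> (2::nat) \<and> v 0 = v 2" using eq[of v] z(2)[of "v 2" "v 1"] that by simp
    show "w v = 0" if "1 \<noteq> (2::nat) \<and> v 1 = v 2" using eq[of v] z(3)[of "v 0" "v 2"] that by simp
    show "w v = 0" if "1 \<noteq> (0::nat) \<and> v 1 = v 0" using eq[of v] z(1)[of "v 0" "v 2"] that by simp
    show "w v = 0" if "2 \<noteq> (0::nat) \<and> v 2 = v 0" using eq[of v] z(2)[of "v 0" "v 1"] that by simp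
    show "w v = 0" if "2 \<noteq> (1::nat) \<and> v 2 = v 1" using eq[of v] z(3)[of "v 0" "v 1"] that by simp
  qed auto
qed

lemma alternating_form_3D:
  assumes "alternating_form 3 w"
  shows "w v = w (vec3 (v 0) (v 1) (v 2))"
    "linear (\<lambda>x. w (vec3 x b c))" "linear (\<lambda>x. w (vec3 a x c))" "linear (\<lambda>x. w (vec3 a b x))"
    "w (vec3 a a c) = 0" "w (vec3 a b a) = 0" "w (vec3 a b b) = 0"
  using assms unfolding alternating_form_3 by blast+

lemma alternating_form_3_swap:
  assumes "alternating_form 3 w"
  shows "w (vec3 b a c) = - w (vec3 a b c)" "w (vec3 b c a) = w (vec3 a b c)"
proof -
  note D = alternating_form_3D[OF assms]
  have A: "w (vec3 b a c) = - w (vec3 a b c)" for a b c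
    using linear_add[OF D(2)[of "a + b" c], of a b] linear_add[OF D(3)[of a c], of a b] linear_add[OF D(3)[of b c], of a b]
      D(5)[of "a + b" c] D(5)[of a c] D(5)[of b c] by linarith
  have B: "w (vec3 a c b) = - w (vec3 a b c)" for a b c
    using linear_add[OF D(3)[of a "b + c"], of b c] linear_add[OF D(4)[of a b], of b c] linear_add[OF D(4)[of a c], of b c]
      D(7)[of a "b + c"] D(7)[of a b] D(7)[of a c] by linarith
  show "w (vec3 b a c) = - w (vec3 a b c)" by (rule A)
  show "w (vec3 b c a) = w (vec3 a b c)" using A[of b a c] B[of b a c] by simp
qed

lemma alternating_form_3_expand:
  assumes "alternating_form 3 w"
  shows "w (vec3 a b c) = (\<Sum>i\<in>UNIV. \<Sum>j\<in>UNIV. \<Sum>k\<in>UNIV. a $ i * b $ j * c $ k * w (vec3 (axis i 1) (axis j 1) (axis k 1)))"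
proof -
  note D = alternating_form_3D[OF assms]
  have e: "x = (\<Sum>i\<in>UNIV. x $ i *\<^sub>R axis i 1)" for x :: R7
    by (simp add: vec_eq_iff axis_def if_distrib sum.delta cong: if_cong)
  have 1: "w (vec3 a b c) = (\<Sum>i\<in>UNIV. a $ i * w (vec3 (axis i 1) b c))" for a b c
    by (subst e[of a]) (simp add: linear_sum[OF D(2)] linear_scale[OF D(2)])
  have 2: "w (vec3 a b c) = (\<Sum>i\<in>UNIV. b $ i * w (vec3 a (axis i 1) c))" for a b c
    by (subst e[of b]) (simp add: linear_sum[OF D(3)] linear_scale[OF D(3)])
  have 3: "w (vec3 a b c) = (\<Sum>i\<in>UNIV. c $ i * w (vec3 a b (axis i 1)))" for a b c
    by (subst e[of c]) (simp add: linear_sum[OF D(4)] linear_scale[OF D(4)])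
  have "w (vec3 a b c) = (\<Sum>i\<in>UNIV. a $ i * (\<Sum>j\<in>UNIV. b $ j * (\<Sum>k\<in>UNIV. c $ k * w (vec3 (axis i 1) (axis j 1) (axis k 1)))))"
    by (subst 1, subst 2, subst 3) (rule refl)
  then show ?thesis by (simp add: sum_distrib_left mult.assoc)
qed

lemma alternating_form_3_bound:
  assumes "alternating_form 3 w" "\<And>i j k. \<bar>w (vec3 (axis i 1) (axis j 1) (axis k 1))\<bar> \<le> d"
    and "\<And>i. \<bar>a $ i\<bar> \<le> m" "\<And>i. \<bar>b $ i\<bar> \<le> m" "\<And>i. \<bar>c $ i\<bar> \<le> m"
  shows "\<bar>w (vec3 a b c)\<bar> \<le> 343 * m ^ 3 * d"
proof -
  have m: "0 \<le> m" "0 \<le> d" using assms(2)[of 1 1 1] assms(3)[of 1] by linarith+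
  have "\<bar>a $ i * b $ j * c $ k * w (vec3 (axis i 1) (axis j 1) (axis k 1))\<bar> \<le> m * m * m * d" for i j k
    unfolding abs_mult by (intro mult_mono assms mult_nonneg_nonneg m) auto
  then have "\<bar>w (vec3 a b c)\<bar> \<le> (\<Sum>i\<in>(UNIV::7 set). \<Sum>j\<in>(UNIV::7 set). \<Sum>k\<in>(UNIV::7 set). m * m * m * d)"
    unfolding alternating_form_3_expand[OF assms(1), of a b c]
    by (intro order.trans[OF sum_abs] sum_mono) 
  also have "\<dots> = 343 * m ^ 3 * d" by (simp add: power3_eq_cube)
  finally show ?thesis .
qed

lemma alternating_form_3_eqI:
  assumes "alternating_form 3 w" "alternating_form 3 w'"
    and "\<And>i j k. w (vec3 (axis i 1) (axis j 1) (axis k 1)) = w' (vec3 (axis i 1) (axis j 1) (axis k 1))"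
  shows "w = w'"
proof
  fix v
  show "w v = w' v"
    unfolding alternating_form_3D(1)[OF assms(1), of v] alternating_form_3D(1)[OF assms(2), of v]
      alternating_form_3_expand[OF assms(1), of "v 0" "v 1" "v 2"] alternating_form_3_expand[OF assms(2), of "v 0" "v 1" "v 2"]
    by (simp add: assms(3))
qed

lemma alternating_form_3_pullback:
  assumes "alternating_form 3 w" "linear L"
  shows "alternating_form 3 (pullback L w)"
proof -
  note D = alternating_form_3D[OF assms(1)]
  have e: "pullback L w (vec3 a b c) = w (vec3 (L a) (L b) (L c))" for a b c
    unfolding pullback_def by (subst D(1)) simp
  show ?thesis
    unfolding alternating_form_3 e
    using D(5-7) linear_compose[OF assms(2) D(2)] linear_compose[OF assms(2) D(3)] linear_compose[OF assms(2) D(4)]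
    by (auto simp: o_def pullback_def intro: D(1)[THEN trans])
qed

lemma alternating_form_3_diff:
  assumes "alternating_form 3 w" "alternating_form 3 w'"
  shows "alternating_form 3 (\<lambda>v. w v - w' v)"
  unfolding alternating_form_3
proof (intro conjI allI)
  show "w v - w' v = w (vec3 (v 0) (v 1) (v 2)) - w' (vec3 (v 0) (v 1) (v 2))" for v
    using alternating_form_3D(1)[OF assms(1), of v] alternating_form_3D(1)[OF assms(2), of v] by simp
qed (use alternating_form_3D(2-7)[OF assms(1)] alternating_form_3D(2-7)[OF assms(2)] in \<open>simp_all add: linear_compose_sub\<close>)

lemma alternating_form_3_phi_mod: "alternating_form 3 phi_mod"
proof -
  have lin: "linear (\<lambda>x. phi3 x b c)" "linear (\<lambda>x. phi3 b x c)" "linear (\<lambda>x. phi3 b c x)" for b c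
    by (rule linearI; simp add: phi3_def cross7.add_left cross7.add_right cross7.scaleR_left cross7.scaleR_right
      inner_add_left inner_add_right)+
  have z: "phi3 b b c = 0" "phi3 b c b = 0" "phi3 c b b = 0" for b c
    unfolding phi3_def inner_7 cross7_nth by (simp_all add: algebra_simps)
  show ?thesis
    unfolding alternating_form_3 phi_mod_eq by (simp add: lin z)
qed

lemma alternating_average:
  fixes f :: "7 \<Rightarrow> 7 \<Rightarrow> 7 \<Rightarrow> real"
  assumes sw: "\<And>i j k. f j i k = - f i j k" and cy: "\<And>i j k. f j k i = f i j k"
  shows "(f i j k - f j i k + f j k i - f k j i + f k i j - f i k j) / 6 = f i j k"
  using sw[where i = i and j = j and k = k] cy[where i = i and j = j and k = k]
    sw[where i = j and j = k and k = i] cy[where i = j and j = k and k = i] sw[where i = k and j = i and k = j]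
  by simp

lemma bounded_linear_alt3: "bounded_linear alt3"
  unfolding linear_conv_bounded_linear[symmetric]
  by (rule linearI) (simp_all add: alt3_def vec_eq_iff field_simps)

lemma alt3_alt3: "alt3 (alt3 B) = alt3 B"
  by (simp add: alt3_def vec_eq_iff field_simps)

lemma contr_linear: "contr (x + y) i j = contr x i j + contr y i j" "contr (c *\<^sub>R x) i j = c * contr x i j"
  by (simp_all add: contr_def algebra_simps)

lemma linear_inf_frame: "linear inf_frame"
  by (rule linearI) (simp_all add: vec_eq_iff inf_frame_entry contr_linear field_simps)

text \<open>The orbit lies in the proper subspace of alternating tensors, while the open mapping
  theorem wants a derivative onto the whole target. So \<open>F\<close> carries an auxiliary tensor
  and adds its non-alternating part; \<open>inf_frame\<close> then yields a right inverse of the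
  derivative at the identity. Nothing is lost, since \<open>alt3\<close> removes the added part
  again.\<close>

lemma near_phi_mod:
  assumes "0 < \<tau>"
  shows "\<exists>\<delta>>0. \<forall>w. alternating_form 3 w \<longrightarrow>
     (\<forall>i j k. \<bar>w (vec3 (axis i 1) (axis j 1) (axis k 1)) - phi3 (axis i 1) (axis j 1) (axis k 1)\<bar> < \<delta>) \<longrightarrow>
     (\<exists>L. linear L \<and> \<bar>det (matrix L) - 1\<bar> < \<tau> \<and> pullback L phi_mod = w)"
proof -
  define P :: "real^7^7 \<Rightarrow> real^7^7^7 \<Rightarrow> real^7^7^7" where "P X W = (\<chi> i j k. X $ i \<bullet> W $ j $ k)" for X W
  define Cr :: "real^7^7 \<Rightarrow> real^7^7 \<Rightarrow> real^7^7^7" where "Cr Y Z = (\<chi> j k. cross7 (Y $ j) (Z $ k))" for Y Z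
  have P: "bounded_bilinear P"
    unfolding bilinear_conv_bounded_bilinear[symmetric] bilinear_def
    by (auto intro!: linearI simp: P_def vec_eq_iff inner_add_left inner_add_right)
  have Cr: "bounded_bilinear Cr"
    unfolding bilinear_conv_bounded_bilinear[symmetric] bilinear_def
    by (auto intro!: linearI simp: Cr_def vec_eq_iff cross7.add_left cross7.add_right cross7.scaleR_left cross7.scaleR_right)
  have PC: "P X (Cr Y Z) $ i $ j $ k = phi3 (X $ i) (Y $ j) (Z $ k)" for X Y Z i j k
    by (simp add: P_def Cr_def phi3_def)
  define F where "F p = P (fst p) (Cr (fst p) (fst p)) + (snd p - alt3 (snd p))" for p :: "(real^7^7) \<times> (real^7^7^7)"
  define F' where "F' p h = P (fst p) (Cr (fst p) (fst h) + Cr (fst h) (fst p)) + P (fst h) (Cr (fst p) (fst p)) + (snd h - alt3 (snd h))"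
    for p h :: "(real^7^7) \<times> (real^7^7^7)"
  have dF: "(F has_derivative F' p) (at p)" for p
    unfolding F_def F'_def
    by (intro has_derivative_add has_derivative_diff bounded_bilinear.FDERIV[OF P] bounded_bilinear.FDERIV[OF Cr]
        bounded_linear.has_derivative[OF bounded_linear_alt3] has_derivative_fst has_derivative_snd has_derivative_ident)
  define I :: "(real^7^7) \<times> (real^7^7^7)" where "I = (mat 1, 0)"
  define G where "G B = (inf_frame (alt3 B), B)" for B
  have G: "bounded_linear G"
    unfolding G_def linear_conv_bounded_linear[symmetric]
    using linear_inf_frame bounded_linear_alt3[THEN bounded_linear.linear]
    by (intro linearI) (simp_all add: linear_add linear_scale)
  have row: "(mat 1 :: real^7^7) $ i = axis i 1" for i
    by (simp add: vec_eq_iff mat_def axis_def)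
  have FG: "F' I \<circ> G = id"
  proof
    fix B
    have "P (mat 1) (Cr (mat 1) (inf_frame (alt3 B)) + Cr (inf_frame (alt3 B)) (mat 1)) + P (inf_frame (alt3 B)) (Cr (mat 1) (mat 1)) = alt3 B"
      by (simp add: vec_eq_iff bounded_bilinear.add_right[OF P] PC row inf_frame_action[symmetric])
    then show "(F' I \<circ> G) B = id B" by (simp add: F'_def I_def G_def)
  qed
  \<comment> \<open>Restricting the source to determinants near 1 still leaves a neighbourhood of
    the base point, so nearby forms are reached by frames of controlled volume.\<close>
  define T where "T = {p :: (real^7^7) \<times> (real^7^7^7). \<bar>det (fst p) - 1\<bar> < \<tau>}"
  have "continuous_on UNIV (\<lambda>p :: (real^7^7) \<times> (real^7^7^7). det (fst p))"
    unfolding det_def by (intro continuous_intros)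
  then have "open T" unfolding T_def by (intro open_Collect_less continuous_intros) 
  moreover have "I \<in> T" using assms by (simp add: T_def I_def)
  ultimately have "I \<in> interior T" by (simp add: interior_open)
  moreover have "continuous_on UNIV F"
    using has_derivative_continuous[OF dF] by (intro continuous_at_imp_continuous_on) simp
  ultimately have "F I \<in> interior (F ` T)"
    using sussmann_open_mapping[OF open_UNIV _ UNIV_I dF G FG] by auto
  then obtain e where e: "e > 0" "ball (F I) e \<subseteq> F ` T"
    unfolding mem_interior by blast
  show ?thesis
  proof (intro exI[of _ "e / 343"] conjI allI impI)
    show "e / 343 > 0" using e by simp
    fix w assume w: "alternating_form 3 w"
      "\<forall>i j k. \<bar>w (vec3 (axis i 1) (axis j 1) (axis k 1)) - phi3 (axis i 1) (axis j 1) (axis k 1)\<bar> < e / 343"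
    define W :: "real^7^7^7" where "W = (\<chi> i j k. w (vec3 (axis i 1) (axis j 1) (axis k 1)))"
    have aW: "alt3 W = W"
    proof -
      have "W $ j $ i $ k = - W $ i $ j $ k" "W $ j $ k $ i = W $ i $ j $ k" for i j k
        using alternating_form_3_swap(1)[OF w(1), of "axis j 1" "axis i 1" "axis k 1"]
          alternating_form_3_swap(2)[OF w(1), of "axis j 1" "axis k 1" "axis i 1"] by (simp_all add: W_def)
      from alternating_average[of "\<lambda>i j k. W $ i $ j $ k", OF this]
      show ?thesis by (simp add: alt3_def vec_eq_iff)
    qed
    have FI: "F I $ i $ j $ k = phi3 (axis i 1) (axis j 1) (axis k 1)" for i j k
      using bounded_linear_alt3 by (simp add: F_def I_def PC row linear_simps(3))
    have nle: "norm x \<le> (\<Sum>i\<in>UNIV. norm (x $ i))" for x :: "('x::real_normed_vector)^7"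
      unfolding norm_vec_def by (rule L2_set_le_sum) simp
    have "norm (W - F I) \<le> (\<Sum>i\<in>UNIV. norm ((W - F I) $ i))" by (rule nle)
    also have "\<dots> \<le> (\<Sum>i\<in>(UNIV::7 set). \<Sum>j\<in>(UNIV::7 set). \<Sum>k\<in>(UNIV::7 set). norm ((W - F I) $ i $ j $ k))"
      by (intro sum_mono order.trans[OF nle] order.refl)
    also have "\<dots> < (\<Sum>i\<in>(UNIV::7 set). \<Sum>j\<in>(UNIV::7 set). \<Sum>k\<in>(UNIV::7 set). e / 343)"
      by (intro sum_strict_mono) (use w(2) in \<open>auto simp: W_def FI\<close>)
    finally have "W \<in> ball (F I) e" by (simp add: dist_norm norm_minus_commute)
    then obtain p where p: "p \<in> T" "F p = W" using e(2) by auto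
    define A where "A = fst p"
    have altP: "alt3 (P A (Cr A A)) = P A (Cr A A)"
    proof -
      have "phi3 b a c = - phi3 a b c" "phi3 b c a = phi3 a b c" for a b c
        unfolding phi3_def inner_7 cross7_nth by (simp_all add: algebra_simps)
      from alternating_average[of "\<lambda>i j k. phi3 (A $ i) (A $ j) (A $ k)", OF this]
      show ?thesis by (simp add: alt3_def vec_eq_iff PC)
    qed
    \<comment> \<open>\<open>alt3\<close> is idempotent, so it kills the auxiliary summand of
      \<open>F p\<close> and fixes both \<open>W\<close> and the orbit part.\<close>
    have "W = alt3 (F p)" using aW p by simp
    also have "\<dots> = P A (Cr A A)"
      using altP by (simp add: F_def A_def linear_simps[OF bounded_linear_alt3] alt3_alt3)
    finally have WA: "W $ i $ j $ k = phi3 (A $ i) (A $ j) (A $ k)" for i j k by (simp add: PC)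
    \<comment> \<open>The tensor formed from \<open>A\<close> is \<open>phi3\<close> evaluated on
      the rows of \<open>A\<close>; the map that sends basis vectors to these rows has the
      transposed matrix.\<close>
    define L where "L v = transpose A *v v" for v
    have L: "linear L" unfolding L_def by (rule matrix_vector_mul_linear)
    have "matrix L = transpose A" unfolding L_def by (rule matrix_of_matrix_vector_mul)
    then have "\<bar>det (matrix L) - 1\<bar> < \<tau>" using p(1) by (simp add: T_def A_def)
    moreover have "pullback L phi_mod = w"
    proof (rule alternating_form_3_eqI[OF alternating_form_3_pullback[OF alternating_form_3_phi_mod L] w(1)])
      have LA: "L (axis i 1) = A $ i" for i
        by (simp add: L_def matrix_vector_mult_basis column_def transpose_def vec_eq_iff)
      show "pullback L phi_mod (vec3 (axis i 1) (axis j 1) (axis k 1)) = w (vec3 (axis i 1) (axis j 1) (axis k 1))" for i j k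
        using WA[of i j k] by (simp add: pullback_def phi_mod_eq LA W_def)
    qed
    ultimately show "\<exists>L. linear L \<and> \<bar>det (matrix L) - 1\<bar> < \<tau> \<and> pullback L phi_mod = w"
      using L by blast
  qed
qed

section \<open>The stabiliser of the model form\<close>

definition outer :: "real^'n \<Rightarrow> real^'n \<Rightarrow> real^'n^'n" where
  "outer v w = (\<chi> i j. v $ i * w $ j)"

lemma outer_mult: "outer v w *v x = (w \<bullet> x) *\<^sub>R v"
  by (simp add: outer_def matrix_vector_mult_def vec_eq_iff inner_vec_def sum_distrib_left sum_distrib_right mult_ac)

lemma det_rank1: "det (mat 1 + outer a b) = 1 + a \<bullet> b"
proof -
  have "mat 1 + outer a b = (\<chi> i j. (if i = j then 1 else 0) + a $ i * b $ j)"
    by (simp add: vec_eq_iff outer_def mat_def)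
  then show ?thesis using det_rank1_update by simp
qed

lemma inner_transpose: "x \<bullet> (transpose A *v y) = (A *v x) \<bullet> (y :: real^'n)"
  by (metis dot_lmul_matrix inner_commute transpose_matrix_vector)

lemma det_scaleR_mat: "det (c *\<^sub>R A) = c ^ CARD('n) * det (A :: real^'n^'n)"
proof -
  have "(c *\<^sub>R A) = matrix ((*\<^sub>R) c) ** A"
    by (simp add: matrix_eq matrix_vector_mul_assoc[symmetric] fun_cong[OF matrix_vector_mul(2)[OF linear_scaleR]] scaleR_matrix_vector_assoc)
  then show ?thesis by (simp add: det_mul det_matrix_scaleR)
qed

text \<open>\<open>matrix (cross7 u)\<close> is singular because it kills \<open>u\<close>; the rank
  one term can fill in the kernel. The matrix represents the bilinear form phi3 (y, u, x) + (k .
  y)(k . x), so its determinant picks up the square of the determinant of a change of basis.\<close>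

definition cross_form :: "R7 \<Rightarrow> R7 \<Rightarrow> real^7^7" where
  "cross_form u k = matrix (cross7 u) + outer k k"

lemma cross_form_mult: "cross_form u k *v x = cross7 u x + (k \<bullet> x) *\<^sub>R k"
  using fun_cong[OF matrix_vector_mul(2)[OF bounded_linear.linear[OF cross7.bounded_linear_right]], of u x]
  by (simp add: cross_form_def matrix_vector_mult_add_rdistrib outer_mult)

lemma cross7_orth: "u \<bullet> cross7 u v = 0"
  using cross7_skew[of u u v] by simp

text \<open>By \<open>cross7_cross7\<close> the square of the matrix is -|u|^2 times a rank one
  change of the identity, whose determinant is known. The exponent 16 is twice 8: six factors |u|
  from the complement of \<open>u\<close> and two from the rank one term.\<close>

lemma det_cross_form_self: "(det (cross_form u u))\<^sup>2 = norm u ^ 16"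
proof (cases "u = 0")
  case True
  then have "cross_form u u = 0"
    unfolding matrix_eq cross_form_mult by (simp add: cross7.zero_left)
  then show ?thesis using True det_scaleR_mat[of 0 "cross_form u u"] by simp
next
  case False
  define n where "n = u \<bullet> u"
  have n: "n > 0" using False by (simp add: n_def)
  have "cross_form u u ** cross_form u u = (- n) *\<^sub>R (mat 1 + outer (- ((1 + n) / n) *\<^sub>R u) u)"
    unfolding matrix_eq matrix_vector_mul_assoc[symmetric]
  proof
    fix x
    have "cross_form u u *v (cross_form u u *v x) = (u \<bullet> x) *\<^sub>R u - n *\<^sub>R x + ((u \<bullet> x) * n) *\<^sub>R u"
      unfolding cross_form_mult
      by (simp add: cross7.add_right cross7.scaleR_right cross7_cross7 cross7_orth inner_add_right n_def)
    also have "\<dots> = (- n) *\<^sub>R x + ((u \<bullet> x) * (1 + n)) *\<^sub>R u"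
      by (simp add: distrib_left scaleR_left.add)
    also have "(u \<bullet> x) * (1 + n) = (- n) * ((u \<bullet> x) * (- ((1 + n) / n)))"
      using n by (simp add: field_simps)
    also have "(- n) *\<^sub>R x + ((- n) * ((u \<bullet> x) * (- ((1 + n) / n)))) *\<^sub>R u = (- n) *\<^sub>R (x + (u \<bullet> x) *\<^sub>R (- ((1 + n) / n) *\<^sub>R u))"
      by (simp only: scaleR_add_right scaleR_scaleR)
    also have "\<dots> = ((- n) *\<^sub>R (mat 1 + outer (- ((1 + n) / n) *\<^sub>R u) u)) *v x"
      by (simp only: scaleR_matrix_vector_assoc[symmetric] matrix_vector_mult_add_rdistrib outer_mult matrix_vector_mul_lid)
    finally show "cross_form u u *v (cross_form u u *v x) = ((- n) *\<^sub>R (mat 1 + outer (- ((1 + n) / n) *\<^sub>R u) u)) *v x" .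
  qed
  then have "(det (cross_form u u))\<^sup>2 = det ((- n) *\<^sub>R (mat 1 + outer (- ((1 + n) / n) *\<^sub>R u) u))"
    by (simp only: power2_eq_square det_mul[symmetric])
  also have "\<dots> = (- n) ^ 7 * (1 - ((1 + n) / n) * n)"
    unfolding det_scaleR_mat det_rank1 by (simp add: n_def[symmetric])
  also have "\<dots> = n ^ 7 * n" using n by (simp add: field_simps)
  also have "\<dots> = ((norm u)\<^sup>2) ^ 8" by (simp add: n_def dot_square_norm flip: power_Suc2)
  also have "\<dots> = norm u ^ 16" by (simp flip: power_mult)
  finally show ?thesis .
qed

text \<open>Congruence by \<open>Q = mat 1 + outer h u\<close> moves the rank one term from
  \<open>u\<close> to \<open>k\<close>. It leaves the cross product part alone, because
  \<open>cross7 u\<close> kills \<open>u\<close> and has image orthogonal to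
  \<open>u\<close>.\<close>

lemma det_cross_form:
  assumes "u \<noteq> 0"
  shows "det (cross_form u k) = ((k \<bullet> u) / (u \<bullet> u))\<^sup>2 * det (cross_form u u)"
proof -
  define n where "n = u \<bullet> u"
  have n: "n > 0" using assms by (simp add: n_def)
  define h where "h = (1 / n) *\<^sub>R (k - u)"
  have kh: "k = u + n *\<^sub>R h" using n by (simp add: h_def)
  define Q where "Q = mat 1 + outer h u"
  have Qx: "Q *v x = x + (u \<bullet> x) *\<^sub>R h" for x
    by (simp add: Q_def matrix_vector_mult_add_rdistrib outer_mult)
  have QTx: "transpose Q *v x = x + (h \<bullet> x) *\<^sub>R u" for x
  proof -
    have "transpose Q = mat 1 + outer u h"
      by (auto simp: Q_def transpose_def outer_def vec_eq_iff mat_def)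
    then show ?thesis by (simp add: matrix_vector_mult_add_rdistrib outer_mult)
  qed
  have "Q ** cross_form u u ** transpose Q = cross_form u k"
    unfolding matrix_eq matrix_vector_mul_assoc[symmetric] cross_form_mult Qx QTx
    by (simp add: kh cross7.add_right cross7.scaleR_right cross7_orth inner_add_right inner_add_left n_def[symmetric] algebra_simps)
  then have "det (cross_form u k) = (det Q)\<^sup>2 * det (cross_form u u)"
    by (simp add: det_mul det_transpose power2_eq_square flip: \<open>Q ** cross_form u u ** transpose Q = cross_form u k\<close>)
  moreover have "det Q = (k \<bullet> u) / n"
    unfolding Q_def det_rank1 using n by (simp add: h_def inner_diff_left n_def field_simps)
  ultimately show ?thesis by (simp add: n_def)
qed

text \<open>The stabiliser of \<open>phi_mod\<close> in \<open>GL(7)\<close> scales the norm by a constant, which is read off from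
  \<open>det (cross_form u k)\<close>; a similarity of determinant \<open>d\<close> with ratio \<open>\<bar>d\<bar> powr (-1/2)\<close> has \<open>\<bar>d\<bar> = 1\<close>.\<close>

lemma phi3_stabiliser_det:
  assumes "linear g" "inj g" "\<And>u v w. phi3 (g u) (g v) (g w) = phi3 u v w"
  shows "\<bar>det (matrix g)\<bar> = 1"
proof -
  define d where "d = \<bar>det (matrix g)\<bar>"
  have mg: "matrix g *v x = g x" for x using fun_cong[OF matrix_vector_mul(2)[OF assms(1)]] .
  have d0: "d > 0" using det_nz_iff_inj[OF assms(1)] assms(2) by (simp add: d_def)
  have gu: "sqrt d * norm (g u) = norm u" for u
  proof (cases "u = 0")
    case True
    then show ?thesis using assms(1) by (simp add: linear_0)
  next
    case False
    then have g0: "g u \<noteq> 0" using assms(1,2) by (metis injD linear_0)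
    \<comment> \<open>Pulling back the rank one term of \<open>g u\<close> along \<open>g\<close>
      gives the rank one term of this vector, whose inner product with \<open>u\<close> is |g u|^2.
      That is where the norm enters.\<close>
    define k where "k = transpose (matrix g) *v g u"
    have "transpose (matrix g) ** cross_form (g u) (g u) ** matrix g = cross_form u k"
      unfolding matrix_eq matrix_vector_mul_assoc[symmetric] cross_form_mult mg
    proof
      fix x
      show "transpose (matrix g) *v (cross7 (g u) (g x) + (g u \<bullet> g x) *\<^sub>R g u) = cross7 u x + (k \<bullet> x) *\<^sub>R k"
      proof (rule vector_eq_ldot[THEN iffD1], rule allI)
        fix y
        have "g y \<bullet> cross7 (g u) (g x) = y \<bullet> cross7 u x"
          using assms(3)[of y u x] by (simp add: phi3_def)
        moreover have "k \<bullet> z = g u \<bullet> g z" for z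
          unfolding k_def inner_commute[of _ z] inner_transpose mg by (rule inner_commute)
        ultimately show "y \<bullet> (transpose (matrix g) *v (cross7 (g u) (g x) + (g u \<bullet> g x) *\<^sub>R g u)) = y \<bullet> (cross7 u x + (k \<bullet> x) *\<^sub>R k)"
          unfolding inner_transpose mg by (simp add: inner_add_right inner_commute[of y k] inner_commute[of "g y"])
      qed
    qed
    then have "d\<^sup>2 * det (cross_form (g u) (g u)) = det (cross_form u k)"
      by (simp add: d_def det_mul det_transpose power2_eq_square flip: \<open>transpose (matrix g) ** cross_form (g u) (g u) ** matrix g = cross_form u k\<close>)
    also have "\<dots> = ((g u \<bullet> g u) / (u \<bullet> u))\<^sup>2 * det (cross_form u u)"
    proof -
      have "k \<bullet> u = g u \<bullet> g u"
        unfolding k_def by (subst inner_commute) (simp only: inner_transpose mg)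
      then show ?thesis unfolding det_cross_form[OF False, of k] by simp
    qed
    finally have e: "d\<^sup>2 * det (cross_form (g u) (g u)) = ((g u \<bullet> g u) / (u \<bullet> u))\<^sup>2 * det (cross_form u u)" .
    have "(d\<^sup>2)\<^sup>2 * norm (g u) ^ 16 = (d\<^sup>2 * det (cross_form (g u) (g u)))\<^sup>2"
      by (simp only: power_mult_distrib det_cross_form_self)
    also have "\<dots> = (((g u \<bullet> g u) / (u \<bullet> u))\<^sup>2)\<^sup>2 * norm u ^ 16"
      by (simp only: e power_mult_distrib det_cross_form_self)
    also have "(((g u \<bullet> g u) / (u \<bullet> u))\<^sup>2)\<^sup>2 = norm (g u) ^ 8 / norm u ^ 8"
      by (simp add: dot_square_norm power_divide flip: power_mult)
    finally have "d ^ 4 * norm (g u) ^ 16 = norm (g u) ^ 8 / norm u ^ 8 * norm u ^ 16"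
      by (simp flip: power_mult)
    then have "d ^ 4 * norm (g u) ^ 8 = norm u ^ 8"
    proof -
      have 16: "norm x ^ 16 = norm x ^ 8 * norm x ^ 8" for x :: R7 by (simp add: power_add[symmetric])
      have u8: "norm u ^ 8 \<noteq> 0" using False by simp
      have "(d ^ 4 * norm (g u) ^ 8) * norm (g u) ^ 8 = norm (g u) ^ 8 / norm u ^ 8 * (norm u ^ 8 * norm u ^ 8)"
        using \<open>d ^ 4 * norm (g u) ^ 16 = _\<close> unfolding 16 mult.assoc .
      also have "\<dots> = norm u ^ 8 * norm (g u) ^ 8"
      proof -
        have "A / B * (B * B) = B * A" if "B \<noteq> 0" for A B :: real using that by simp
        then show ?thesis using u8 by blast
      qed
      finally have "(d ^ 4 * norm (g u) ^ 8) * norm (g u) ^ 8 = norm u ^ 8 * norm (g u) ^ 8" .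
      then show ?thesis using g0 by simp
    qed
    then have "(sqrt d * norm (g u)) ^ 8 = norm u ^ 8"
    proof -
      have "sqrt d ^ (2 * 4) = d ^ 4" unfolding power_mult using d0 by simp
      then show ?thesis using \<open>d ^ 4 * norm (g u) ^ 8 = _\<close> by (simp add: power_mult_distrib)
    qed
    then show ?thesis
      by (rule power_eq_imp_eq_base) (use d0 in auto)
  qed
  define f where "f u = sqrt d *\<^sub>R g u" for u
  have lf: "linear f" unfolding f_def using linear_compose_scale_right[OF assms(1)] .
  have "orthogonal_transformation f"
    unfolding orthogonal_transformation using lf gu d0 by (simp add: f_def)
  then have "\<bar>det (matrix f)\<bar> = 1"
    using det_orthogonal_matrix orthogonal_transformation_matrix by fastforce
  moreover have "matrix f = sqrt d *\<^sub>R matrix g"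
    by (simp add: matrix_def f_def vec_eq_iff)
  \<comment> \<open>The rescaled map is orthogonal, and scaling by sqrt d multiplies the determinant
    by its seventh power; with d = (sqrt d)^2 this says that the ninth power of sqrt d is 1.\<close>
  ultimately have "sqrt d ^ 7 * d = 1"
    using d0 by (simp add: det_scaleR_mat abs_mult d_def)
  moreover have "sqrt d ^ 9 = sqrt d ^ 7 * (sqrt d)\<^sup>2" by (simp only: power_add[symmetric]) simp
  ultimately have "sqrt d ^ 9 = 1" using d0 by simp
  then have "sqrt d = 1" using power_eq_imp_eq_base[of "sqrt d" 9 1] d0 by simp
  then show ?thesis by (simp add: d_def)
qed

text \<open>Two frames of one form differ by a stabiliser element, of determinant 1 or -1, and the
  orientation condition excludes -1. Hence the \<open>SOME\<close> in \<open>vol_at\<close> has a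
  definite volume.\<close>

lemma G2_frames_det_unique:
  assumes "L \<in> G2_frames s w" "L' \<in> G2_frames s w"
  shows "det (matrix L) = det (matrix L')"
proof -
  have L: "linear L" "bij L" "s * det (matrix L) > 0" "pullback L phi_mod = w"
    and L': "linear L'" "bij L'" "s * det (matrix L') > 0" "pullback L' phi_mod = w"
    using assms by (auto simp: G2_frames_def)
  have li: "linear (inv L)" using L(1,2) by (simp add: linear_inj_imp_surj bij_is_inj inj_linear_imp_inv_linear)
  define g where "g = L' \<circ> inv L"
  have g: "linear g" unfolding g_def using li L'(1) by (rule linear_compose)
  have ginj: "inj g" unfolding g_def using L(2) L'(2) by (simp add: bij_imp_bij_inv bij_is_inj inj_compose)
  have "phi3 (g u) (g v) (g w) = phi3 u v w" for u v w
  proof -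
    have "pullback L' phi_mod (vec3 (inv L u) (inv L v) (inv L w)) = pullback L phi_mod (vec3 (inv L u) (inv L v) (inv L w))"
      using L(4) L'(4) by simp
    then show ?thesis
      using L(2) by (simp add: pullback_def phi_mod_eq g_def bij_is_surj surj_f_inv_f)
  qed
  then have "\<bar>det (matrix g)\<bar> = 1" using phi3_stabiliser_det[OF g ginj] by blast
  moreover have "L' = g \<circ> L" using L(2) by (auto simp: g_def bij_is_inj)
  then have "det (matrix L') = det (matrix g) * det (matrix L)"
    using matrix_compose[OF L(1) g] by (simp add: det_mul)
  ultimately have "\<bar>det (matrix L')\<bar> = \<bar>det (matrix L)\<bar>" by (simp add: abs_mult)
  then show ?thesis using L(3) L'(3) by (auto simp: abs_if zero_less_mult_iff split: if_splits)
qed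

lemma vol_at_eq:
  assumes "L \<in> G2_frames s w"
  shows "vol_at s w std_basis = det (matrix L)"
proof -
  define L' where "L' = (SOME L. L \<in> G2_frames s w)"
  have L': "L' \<in> G2_frames s w" unfolding L'_def by (rule someI[of "\<lambda>L. L \<in> G2_frames s w", OF assms])
  have "vol_at s w std_basis = det (matrix L')"
  proof -
    have "vol_at s w std_basis = vol0 (\<lambda>i. L' (std_basis i))"
      by (simp only: vol_at_def pullback_def L'_def)
    moreover have "linear L'" using L' by (simp add: G2_frames_def)
    ultimately show ?thesis using vol0_linear by simp
  qed
  then show ?thesis using G2_frames_det_unique[OF assms L'] by simp
qed

section \<open>The model form plus a multiple of \<theta>^23\<close>

definition wedge23 :: "R7 \<Rightarrow> R7 \<Rightarrow> R7 \<Rightarrow> R7 \<Rightarrow> real" where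
  "wedge23 \<eta> u v w = (\<eta> \<bullet> u) * (v$2 * w$3 - w$2 * v$3) - (\<eta> \<bullet> v) * (u$2 * w$3 - w$2 * u$3)
     + (\<eta> \<bullet> w) * (u$2 * v$3 - v$2 * u$3)"

text \<open>The components \<open>\<eta>\<^sub>2\<close> and \<open>\<eta>\<^sub>3\<close> do not contribute. A shear removes
  \<open>\<eta>\<^sub>4, \<dots>, \<eta>\<^sub>7\<close> from \<open>phi_mod + wedge23 \<eta>\<close>, at the expense of a quadratic change of
  \<open>\<eta>\<^sub>1\<close>, and a diagonal map of determinant \<open>model_vol \<eta>\<close> removes what is left.\<close>

definition model_vol :: "R7 \<Rightarrow> real" where
  "model_vol \<eta> = root 3 (1 + \<eta>$1 - ((\<eta>$4)\<^sup>2 + (\<eta>$5)\<^sup>2 + (\<eta>$6)\<^sup>2 + (\<eta>$7)\<^sup>2) / 4)"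

text \<open>Let x have components only in the directions 4 to 7, the only ones that matter. With
  basis vectors e the map is p + p1 x + p2 (e3 x x) - p3 (e2 x x), the products being cross
  products. These images of e1, e2, e3 are such that the first variation of \<open>phi_mod\<close>
  is exactly 2 x wedge \<theta>^23.\<close>

definition shear :: "R7 \<Rightarrow> R7 \<Rightarrow> R7" where
  "shear x p = (\<chi> i.
     if i = 4 then p$4 + (x$4 * p$1 + x$7 * p$2 + x$6 * p$3)
     else if i = 5 then p$5 + (x$5 * p$1 + x$6 * p$2 - x$7 * p$3)
     else if i = 6 then p$6 + (x$6 * p$1 - x$5 * p$2 - x$4 * p$3)
     else if i = 7 then p$7 + (x$7 * p$1 - x$4 * p$2 + x$5 * p$3)
     else p $ i)"

lemma shear_nth:
  "shear x p $ 1 = p$1" "shear x p $ 2 = p$2" "shear x p $ 3 = p$3"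
  "shear x p $ 4 = p$4 + (x$4 * p$1 + x$7 * p$2 + x$6 * p$3)"
  "shear x p $ 5 = p$5 + (x$5 * p$1 + x$6 * p$2 - x$7 * p$3)"
  "shear x p $ 6 = p$6 + (x$6 * p$1 - x$5 * p$2 - x$4 * p$3)"
  "shear x p $ 7 = p$7 + (x$7 * p$1 - x$4 * p$2 + x$5 * p$3)"
  by (simp_all add: shear_def)

definition diag_scale :: "real \<Rightarrow> real \<Rightarrow> R7 \<Rightarrow> R7" where
  "diag_scale a b p = (\<chi> i. (if i = 1 \<or> i = 2 \<or> i = 3 then a else b) * p $ i)"

lemma diag_scale_nth:
  "diag_scale a b p $ 1 = a * p$1" "diag_scale a b p $ 2 = a * p$2" "diag_scale a b p $ 3 = a * p$3"
  "diag_scale a b p $ 4 = b * p$4" "diag_scale a b p $ 5 = b * p$5" "diag_scale a b p $ 6 = b * p$6" "diag_scale a b p $ 7 = b * p$7"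
  by (simp_all add: diag_scale_def)

lemma linear_shear: "linear (shear x)"
  by (rule linearI) (simp_all add: vec_eq_iff forall_7 shear_nth algebra_simps)

lemma linear_diag_scale: "linear (diag_scale a b)"
  by (rule linearI) (simp_all add: vec_eq_iff diag_scale_def algebra_simps)

lemma det_diag_scale: "det (matrix (diag_scale a b)) = a ^ 3 * b ^ 4"
proof -
  have "matrix (diag_scale a b) $ i $ j = (if i = j then (if i = 1 \<or> i = 2 \<or> i = 3 then a else b) else 0)" for i j
    by (simp add: matrix_def diag_scale_def axis_def)
  then have "det (matrix (diag_scale a b)) = (\<Prod>i\<in>(UNIV::7 set). if i = 1 \<or> i = 2 \<or> i = 3 then a else b)"
    by (subst det_diagonal) simp_all
  also have "\<dots> = a ^ 3 * b ^ 4" unfolding UNIV_7 by (simp add: eval_nat_numeral)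
  finally show ?thesis .
qed

lemma shear_shear: "shear x (shear y p) = shear (x + y) p"
  unfolding vec_eq_iff forall_7 shear_nth by (simp add: algebra_simps)

lemma shear_0: "shear 0 p = p"
  unfolding vec_eq_iff forall_7 shear_nth by simp

text \<open>Conjugation by a diagonal matrix turns a shear into its square.\<close>

lemma det_shear: "det (matrix (shear x)) = 1"
proof -
  let ?d = "\<lambda>L :: R7 \<Rightarrow> R7. det (matrix L)"
  have comp: "?d (f \<circ> g) = ?d f * ?d g" if "linear f" "linear g" for f g :: "R7 \<Rightarrow> R7"
    using matrix_compose[OF that(2,1)] by (simp add: det_mul)
  note lin = linear_shear linear_diag_scale
  have "diag_scale 1 2 \<circ> shear x = shear (x + x) \<circ> diag_scale 1 2"
    unfolding fun_eq_iff vec_eq_iff forall_7 by (simp add: shear_nth diag_scale_nth algebra_simps)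
  then have "?d (diag_scale 1 2) * ?d (shear x) = ?d (shear (x + x)) * ?d (diag_scale 1 2)"
    using comp[OF lin(2,1)] comp[OF lin(1,2)] by metis
  then have "?d (shear x) = ?d (shear (x + x))" by (simp add: det_diag_scale)
  also have "shear (x + x) = shear x \<circ> shear x" by (simp add: fun_eq_iff shear_shear)
  finally have 1: "?d (shear x) = ?d (shear x) * ?d (shear x)" unfolding comp[OF lin(1,1)] .
  have "shear x \<circ> shear (- x) = id" by (simp add: fun_eq_iff shear_shear shear_0)
  then have "?d (shear x) * ?d (shear (- x)) = 1" using comp[OF lin(1,1), of x "- x"] by (simp add: matrix_id_mat_1)
  then have "?d (shear x) \<noteq> 0" by auto
  then show ?thesis using 1 by simp
qed

lemma alternating_form_3_eq_0I:
  assumes d: "alternating_form 3 d"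
    and z: "\<forall>a\<in>{1..5}. \<forall>b\<in>{Suc a..6}. \<forall>c\<in>{Suc b..7}.
      d (vec3 (axis (of_nat a) 1) (axis (of_nat b) 1) (axis (of_nat c) 1)) = 0"
  shows "d v = 0"
proof -
  have b: "d (vec3 (axis i 1) (axis j 1) (axis k 1)) = 0" for i j k
  proof (rule alternating_eq_0[of "\<lambda>i j k. d (vec3 (axis i 1) (axis j 1) (axis k 1))"])
    show "d (vec3 (axis j 1) (axis i 1) (axis k 1)) = - d (vec3 (axis i 1) (axis j 1) (axis k 1))" for i j k
      by (rule alternating_form_3_swap(1)[OF d])
    show "d (vec3 (axis j 1) (axis k 1) (axis i 1)) = d (vec3 (axis i 1) (axis j 1) (axis k 1))" for i j k
      by (rule alternating_form_3_swap(2)[OF d])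
    show "d (vec3 (axis (of_nat a) 1) (axis (of_nat b) 1) (axis (of_nat c) 1)) = 0"
      if "1 \<le> a" "a < b" "b < c" "c \<le> 7" for a b c
      using z that by simp
  qed
  show ?thesis
    unfolding alternating_form_3D(1)[OF d, of v] alternating_form_3_expand[OF d, of "v 0" "v 1" "v 2"] by (simp add: b)
qed

lemma alternating_form_3_wedge23: "alternating_form 3 (\<lambda>v. c * wedge23 \<eta> (v 0) (v 1) (v 2))"
proof -
  have lin: "linear (\<lambda>x. c * wedge23 \<eta> x b d)" "linear (\<lambda>x. c * wedge23 \<eta> b x d)" "linear (\<lambda>x. c * wedge23 \<eta> b d x)" for b d
    by (rule linearI; simp add: wedge23_def inner_add_right algebra_simps)+
  have z: "wedge23 \<eta> b b d = 0" "wedge23 \<eta> b d b = 0" "wedge23 \<eta> d b b = 0" for b d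
    unfolding wedge23_def by (simp_all add: algebra_simps)
  show ?thesis
    unfolding alternating_form_3 by (simp add: lin z)
qed

lemma alternating_form_3_add:
  assumes "alternating_form 3 w" "alternating_form 3 w'"
  shows "alternating_form 3 (\<lambda>v. w v + w' v)"
  unfolding alternating_form_3
proof (intro conjI allI)
  show "w v + w' v = w (vec3 (v 0) (v 1) (v 2)) + w' (vec3 (v 0) (v 1) (v 2))" for v
    using alternating_form_3D(1)[OF assms(1), of v] alternating_form_3D(1)[OF assms(2), of v] by simp
qed (use alternating_form_3D(2-7)[OF assms(1)] alternating_form_3D(2-7)[OF assms(2)] in \<open>simp_all add: linear_compose_add\<close>)

lemma alternating_form_3_scale:
  assumes "alternating_form 3 w"
  shows "alternating_form 3 (\<lambda>v. c * w v)"
proof -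
  note D = alternating_form_3D[OF assms]
  have l: "linear (\<lambda>x. c * f x)" if "linear f" for f :: "R7 \<Rightarrow> real"
    using linear_compose_scale_right[OF that, of c] by simp
  have e: "c * w v = c * w (vec3 (v 0) (v 1) (v 2))" for v
    using D(1)[of v] by simp
  show ?thesis
    unfolding alternating_form_3
    by (intro conjI allI e l[OF D(2)] l[OF D(3)] l[OF D(4)]) (simp_all add: D(5-7))
qed

text \<open>Only components 4 to 7 are displaced, by combinations of the first three coordinates.
  Terms with two displacements are therefore multiples of \<theta>^123, and no cubic term arises
  because \<open>phi_mod\<close> has no term with three indices from 4 to 7. The identity itself is
  a check on increasing basis triples.\<close>

lemma phi3_shear:
  "phi3 (shear x u) (shear x v) (shear x w) = phi3 u v w + 2 * wedge23 (\<chi> i. if i = 1 \<or> i = 2 \<or> i = 3 then 0 else x $ i) u v w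
     + ((x$4)\<^sup>2 + (x$5)\<^sup>2 + (x$6)\<^sup>2 + (x$7)\<^sup>2) * wedge23 (axis 1 1) u v w"
proof -
  define d where "d v = pullback (shear x) phi_mod v - (phi_mod v + 2 * wedge23 (\<chi> i. if i = 1 \<or> i = 2 \<or> i = 3 then 0 else x $ i) (v 0) (v 1) (v 2)
     + ((x$4)\<^sup>2 + (x$5)\<^sup>2 + (x$6)\<^sup>2 + (x$7)\<^sup>2) * wedge23 (axis 1 1) (v 0) (v 1) (v 2))" for v
  have d: "alternating_form 3 d"
    unfolding d_def by (intro alternating_form_3_diff alternating_form_3_add alternating_form_3_wedge23
        alternating_form_3_pullback alternating_form_3_phi_mod linear_shear)
  have "d (vec3 u v w) = 0"
    by (rule alternating_form_3_eq_0I[OF d])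
      (simp add: atLeastAtMost_upt upt_rec d_def pullback_def phi_mod_eq phi3_def inner_7 cross7_nth shear_nth
        wedge23_def axis_def power2_eq_square)
  then show ?thesis by (simp add: d_def pullback_def phi_mod_eq)
qed

text \<open>Apart from \<theta>^123, which scales by a^3, every term of \<open>phi_mod\<close> has
  one index from 1 to 3 and two from 4 to 7, so it scales by a b^2.\<close>

lemma phi3_diag_scale:
  "phi3 (diag_scale a b u) (diag_scale a b v) (diag_scale a b w) =
     a * b\<^sup>2 * phi3 u v w + (a ^ 3 - a * b\<^sup>2) * wedge23 (axis 1 1) u v w"
proof -
  define d where "d v = pullback (diag_scale a b) phi_mod v - (a * b\<^sup>2 * phi_mod v + (a ^ 3 - a * b\<^sup>2) * wedge23 (axis 1 1) (v 0) (v 1) (v 2))" for v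
  have d: "alternating_form 3 d"
    unfolding d_def by (intro alternating_form_3_diff alternating_form_3_add alternating_form_3_wedge23
        alternating_form_3_scale alternating_form_3_pullback alternating_form_3_phi_mod linear_diag_scale)
  have "d (vec3 u v w) = 0"
    by (rule alternating_form_3_eq_0I[OF d])
      (simp add: atLeastAtMost_upt upt_rec d_def pullback_def phi_mod_eq phi3_def inner_7 cross7_nth diag_scale_nth
        wedge23_def axis_def power2_eq_square power3_eq_cube)
  then show ?thesis by (simp add: d_def pullback_def phi_mod_eq)
qed

lemma cube_le_cancel: "a ^ 3 \<le> b ^ 3 \<Longrightarrow> a \<le> (b :: real)"
proof -
  assume "a ^ 3 \<le> b ^ 3"
  then have "root 3 (a ^ 3) \<le> root 3 (b ^ 3)" by simp
  then show ?thesis by (simp add: odd_real_root_power_cancel)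
qed

lemma model_vol_cube:
  assumes "\<And>j. j \<in> {1,4,5,6,7} \<Longrightarrow> \<bar>\<eta> $ j\<bar> \<le> 1/4"
  shows "model_vol \<eta> ^ 3 = 1 + \<eta>$1 - ((\<eta>$4)\<^sup>2 + (\<eta>$5)\<^sup>2 + (\<eta>$6)\<^sup>2 + (\<eta>$7)\<^sup>2) / 4"
    "1/2 \<le> model_vol \<eta>" "model_vol \<eta> \<le> 2"
proof -
  have sq: "(\<eta> $ j)\<^sup>2 \<le> 1/16" if "j \<in> {1,4,5,6,7}" for j
    using power_mono[OF assms[OF that], of 2] by (simp add: power2_eq_square)
  let ?s = "1 + \<eta>$1 - ((\<eta>$4)\<^sup>2 + (\<eta>$5)\<^sup>2 + (\<eta>$6)\<^sup>2 + (\<eta>$7)\<^sup>2) / 4"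
  define q where "q = (\<eta>$4)\<^sup>2 + (\<eta>$5)\<^sup>2 + (\<eta>$6)\<^sup>2 + (\<eta>$7)\<^sup>2"
  have q: "0 \<le> q" "q \<le> 1/4"
    using sq[of 4] sq[of 5] sq[of 6] sq[of 7] by (simp_all add: q_def)
  have aux: "1/2 \<le> 1 + e - r / 4 \<and> 1 + e - r / 4 \<le> 2" if "\<bar>e\<bar> \<le> 1/4" "0 \<le> r" "r \<le> 1/4" for e r :: real
    using that by (intro conjI; linarith)
  have s: "1/2 \<le> ?s" "?s \<le> 2"
    using aux[OF assms[of 1] q] unfolding q_def by simp_all
  show c: "model_vol \<eta> ^ 3 = ?s" unfolding model_vol_def by (rule odd_real_root_pow) simp
  show "1/2 \<le> model_vol \<eta>"
  proof -
    have "(1/2) ^ 3 \<le> model_vol \<eta> ^ 3" unfolding c by (rule order.trans[OF _ s(1)]) (simp add: power3_eq_cube)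
    then show ?thesis by (rule cube_le_cancel)
  qed
  show "model_vol \<eta> \<le> 2"
  proof -
    have "model_vol \<eta> ^ 3 \<le> 2 ^ 3" unfolding c using s by simp
    then show ?thesis by (rule cube_le_cancel)
  qed
qed

text \<open>Writing the volume as the cube root of 1 + 3p, strict concavity gives 1 + p - p^2/2. The
  true second coefficient is -1; the slack up to -1/2 pays for the higher orders. The term in q is
  already negative at first order in p, and p^2 supplies the square of the first component.\<close>

lemma model_vol_le:
  assumes "\<And>j. j \<in> {1,4,5,6,7} \<Longrightarrow> \<bar>\<eta> $ j\<bar> \<le> 1/4"
  shows "model_vol \<eta> \<le> 1 + \<eta>$1 / 3 - ((\<eta>$1)\<^sup>2 + (\<eta>$4)\<^sup>2 + (\<eta>$5)\<^sup>2 + (\<eta>$6)\<^sup>2 + (\<eta>$7)\<^sup>2) / 36"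
proof -
  define q where "q = (\<eta>$4)\<^sup>2 + (\<eta>$5)\<^sup>2 + (\<eta>$6)\<^sup>2 + (\<eta>$7)\<^sup>2"
  have sq: "(\<eta> $ j)\<^sup>2 \<le> 1/16" if "j \<in> {1,4,5,6,7}" for j
    using power_mono[OF assms[OF that], of 2] by (simp add: power2_eq_square)
  have q: "0 \<le> q" "q \<le> 1/4"
    using sq[of 4] sq[of 5] sq[of 6] sq[of 7] by (simp_all add: q_def)
  define z where "z = \<eta>$1 - q / 4"
  define p where "p = z / 3"
  have e1: "\<bar>\<eta>$1\<bar> \<le> 1/4" using assms by simp
  \<comment> \<open>Here |z| is at most 1/4 + 1/16 = 5/16, so |p| is at most 5/48.\<close>
  have p: "\<bar>p\<bar> \<le> 11/100" 
  proof -
    have aux: "\<bar>(e - r / 4) / 3\<bar> \<le> 11/100" if "\<bar>e\<bar> \<le> 1/4" "0 \<le> r" "r \<le> 1/4" for e r :: real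
      using that unfolding abs_le_iff by (intro conjI; argo)
    show ?thesis unfolding p_def z_def by (rule aux[OF e1 q])
  qed
  \<comment> \<open>Cubing avoids roots: the difference of the two sides is p^2 times a factor close
    to 3/2.\<close>
  have "1 + 3 * p \<le> (1 + p - p\<^sup>2 / 2) ^ 3"
  proof -
    have "(1 + p - p\<^sup>2 / 2) ^ 3 - (1 + 3 * p) = p\<^sup>2 * (3/2 - 2 * p + p * p * (- 3/4) + p * p * p * (3/4) - p * p * p * p / 8)"
      by (simp add: power2_eq_square power3_eq_cube field_simps)
    moreover have "0 \<le> 3/2 - 2 * p + p * p * (- 3/4) + p * p * p * (3/4) - p * p * p * p / 8"
    proof -
      have "\<bar>p * p\<bar> \<le> 1 * (11/100)" "\<bar>p * p * p\<bar> \<le> 1 * 1 * (11/100)" "\<bar>p * p * p * p\<bar> \<le> 1 * 1 * 1 * (11/100)"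
        unfolding abs_mult using p by (intro mult_mono; simp)+
      then show ?thesis using p by linarith
    qed
    ultimately show ?thesis by (smt (verit) mult_nonneg_nonneg zero_le_power2)
  qed
  moreover have "model_vol \<eta> ^ 3 = 1 + 3 * p"
    unfolding p_def z_def q_def using model_vol_cube(1)[OF assms] by simp
  ultimately have "model_vol \<eta> ^ 3 \<le> (1 + p - p\<^sup>2 / 2) ^ 3" by simp
  then have "model_vol \<eta> \<le> 1 + p - p\<^sup>2 / 2" by (rule cube_le_cancel)
  also have "\<dots> = 1 + \<eta>$1 / 3 - q / 12 - z\<^sup>2 / 18" by (simp add: p_def z_def power2_eq_square field_simps)
  finally have le: "model_vol \<eta> \<le> 1 + \<eta>$1 / 3 - q / 12 - z\<^sup>2 / 18" .
  \<comment> \<open>Half of this square is what has to be nonnegative below: the mixed term of z^2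
    is absorbed by half of the square of the first component, at the cost of q^2/16.\<close>
  have "0 \<le> (\<eta>$1 - q / 2)\<^sup>2" by simp
  then have z: "(\<eta>$1)\<^sup>2 / 2 - q * q / 16 \<le> z\<^sup>2"
    by (simp add: z_def power2_eq_square field_simps)
  have qq: "q * q \<le> q * (1/4)" using q by (intro mult_left_mono) auto
  have "model_vol \<eta> \<le> 1 + \<eta>$1 / 3 - ((\<eta>$1)\<^sup>2 + q) / 36"
    using le z qq q by argo
  then show ?thesis by (simp add: q_def add.assoc)
qed

text \<open>The shear creates the components 4 to 7 of \<eta>, the scaling then adjusts the
  coefficient of \<theta>^123. The entry bound on the inverse is what makes later nearness constants
  independent of \<eta>.\<close>

lemma model_frame:
  assumes \<eta>: "\<And>j. j \<in> {1,4,5,6,7} \<Longrightarrow> \<bar>\<eta> $ j\<bar> \<le> 1/4"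
  obtains L L' where "linear L" "linear L'" "L \<circ> L' = id" "L' \<circ> L = id" "det (matrix L) = model_vol \<eta>"
    "\<And>u v w. phi3 (L u) (L v) (L w) = phi3 u v w + wedge23 \<eta> u v w"
    "\<And>i j. \<bar>L' (axis i 1) $ j\<bar> \<le> 8"
proof
  define a where "a = model_vol \<eta>"
  note a = model_vol_cube[OF \<eta>, folded a_def]
  \<comment> \<open>With a b^2 = 1 the six mixed terms of \<open>phi_mod\<close> are unchanged, and
    the determinant a^3 b^4 collapses to a.\<close>
  define b where "b = 1 / sqrt a"
  have b: "b\<^sup>2 = 1 / a" "b > 0" using a by (simp_all add: b_def power_divide)
  \<comment> \<open>Half of \<eta>, because the first variation in \<open>phi3_shear\<close> carries
    the factor 2.\<close>
  define x :: R7 where "x = (1/2) *\<^sub>R \<eta>"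
  define L where "L = diag_scale a b \<circ> shear x"
  define L' where "L' = shear (- x) \<circ> diag_scale (1 / a) (1 / b)"
  show "linear L" "linear L'" unfolding L_def L'_def by (intro linear_compose linear_shear linear_diag_scale)+
  have dd: "diag_scale a b (diag_scale (1 / a) (1 / b) p) = p" "diag_scale (1 / a) (1 / b) (diag_scale a b p) = p" for p
    using a b unfolding vec_eq_iff diag_scale_def by auto
  show "L \<circ> L' = id" "L' \<circ> L = id"
    unfolding L_def L'_def fun_eq_iff by (simp_all add: dd shear_shear shear_0)
  have "det (matrix L) = a ^ 3 * b ^ 4"
    unfolding L_def using matrix_compose[OF linear_shear[of x] linear_diag_scale[of a b]] by (simp add: det_mul det_diag_scale det_shear)
  also have "b ^ 4 = (1 / a)\<^sup>2" unfolding b(1)[symmetric] by (simp add: power_mult[symmetric])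
  also have "a ^ 3 * (1 / a)\<^sup>2 = a" using a(2) by (simp add: power2_eq_square power3_eq_cube)
  finally show "det (matrix L) = model_vol \<eta>" by (simp add: a_def)
  show "phi3 (L u) (L v) (L w) = phi3 u v w + wedge23 \<eta> u v w" for u v w
  proof -
    have ab: "a * b\<^sup>2 = 1" using a b by simp
    have t: "wedge23 (axis 1 1) (shear x u) (shear x v) (shear x w) = wedge23 (axis 1 1) u v w"
      unfolding wedge23_def inner_7 shear_nth by (simp add: axis_def)
    have "phi3 (L u) (L v) (L w) = phi3 u v w + 2 * wedge23 (\<chi> i. if i = 1 \<or> i = 2 \<or> i = 3 then 0 else x $ i) u v w
     + ((x$4)\<^sup>2 + (x$5)\<^sup>2 + (x$6)\<^sup>2 + (x$7)\<^sup>2 + (a ^ 3 - 1)) * wedge23 (axis 1 1) u v w"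
      unfolding L_def o_def phi3_diag_scale ab t phi3_shear by (simp add: algebra_simps)
    also have "(x$4)\<^sup>2 + (x$5)\<^sup>2 + (x$6)\<^sup>2 + (x$7)\<^sup>2 + (a ^ 3 - 1) = \<eta> $ 1"
    proof -
      have "(x $ j)\<^sup>2 = (\<eta> $ j)\<^sup>2 / 4" for j by (simp add: x_def power2_eq_square)
      moreover have "a ^ 3 - 1 = \<eta> $ 1 - ((\<eta> $ 4)\<^sup>2 + (\<eta> $ 5)\<^sup>2 + (\<eta> $ 6)\<^sup>2 + (\<eta> $ 7)\<^sup>2) / 4"
        using a(1) by simp
      ultimately show ?thesis by (simp only:) (simp add: add_divide_distrib)
    qed
    moreover have "2 * wedge23 (\<chi> i. if i = 1 \<or> i = 2 \<or> i = 3 then 0 else x $ i) u v w + \<eta> $ 1 * wedge23 (axis 1 1) u v w = wedge23 \<eta> u v w"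
      unfolding wedge23_def inner_7 x_def by (simp add: axis_def algebra_simps)
    ultimately show ?thesis by simp
  qed
  \<comment> \<open>The inverse scaling has entries at most 2, and an entry of the shear is a sum of
    at most four terms, each bounded by 2.\<close>
  show "\<bar>L' (axis i 1) $ j\<bar> \<le> 8" for i j
  proof -
    define p where "p = diag_scale (1 / a) (1 / b) (axis i 1)"
    have "1 / b = sqrt a" by (simp add: b_def)
    also have "sqrt a \<le> sqrt 4" using a by (intro real_sqrt_le_mono) simp
    finally have "1 / b \<le> 2" by simp
    moreover have "1 / a \<le> 2" using a by (simp add: field_simps)
    ultimately have p: "\<bar>p $ k\<bar> \<le> 2" for k
      using a b by (auto simp: p_def diag_scale_def axis_def)
    have x: "\<bar>x $ k\<bar> \<le> 1" if "k \<in> {4,5,6,7}" for k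
      using \<eta>[of k] that by (auto simp: x_def)
    have xp: "\<bar>(- x) $ k * p $ l\<bar> \<le> 2" if "k \<in> {4,5,6,7}" for k l
      using mult_mono[OF x[OF that] p[of l]] by (simp add: abs_mult)
    have aux: "\<bar>c + (d + e + f)\<bar> \<le> 8" "\<bar>c + (d + e - f)\<bar> \<le> 8" "\<bar>c + (d - e - f)\<bar> \<le> 8" "\<bar>c + (d - e + f)\<bar> \<le> 8"
      if "\<bar>c\<bar> \<le> 2" "\<bar>d\<bar> \<le> 2" "\<bar>e\<bar> \<le> 2" "\<bar>f\<bar> \<le> 2" for c d e f :: real
      using that by linarith+
    have "\<bar>p $ k\<bar> \<le> 8" for k using p[of k] by linarith
    then have "\<forall>j. \<bar>shear (- x) p $ j\<bar> \<le> 8"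
      unfolding forall_7 shear_nth by (intro conjI aux p xp) simp_all
    then show ?thesis by (simp add: L'_def p_def)
  qed
qed

text \<open>Pulling back by the inverse of the model frame moves the question to a neighbourhood of
  \<open>phi_mod\<close>. One \<delta> serves all admissible \<eta> because those inverses are
  uniformly bounded.\<close>

lemma near_model_frame:
  assumes "0 < \<tau>"
  shows "\<exists>\<delta>>0. \<forall>\<eta> w. (\<forall>j\<in>{1,4,5,6,7}. \<bar>\<eta> $ j\<bar> \<le> 1/4) \<longrightarrow> alternating_form 3 w \<longrightarrow>
     (\<forall>i j k. \<bar>w (vec3 (axis i 1) (axis j 1) (axis k 1)) - (phi3 (axis i 1) (axis j 1) (axis k 1) + wedge23 \<eta> (axis i 1) (axis j 1) (axis k 1))\<bar> < \<delta>) \<longrightarrow>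
     (\<exists>L. linear L \<and> \<bar>det (matrix L) - model_vol \<eta>\<bar> \<le> \<tau> * model_vol \<eta> \<and> pullback L phi_mod = w)"
proof -
  obtain d where d: "d > 0" and near: "\<And>w. alternating_form 3 w \<Longrightarrow>
     (\<forall>i j k. \<bar>w (vec3 (axis i 1) (axis j 1) (axis k 1)) - phi3 (axis i 1) (axis j 1) (axis k 1)\<bar> < d) \<Longrightarrow>
     (\<exists>L. linear L \<and> \<bar>det (matrix L) - 1\<bar> < \<tau> \<and> pullback L phi_mod = w)"
    using near_phi_mod[OF assms] by metis
  \<comment> \<open>The pullback costs at most 343 * 8^3: there are 7^3 component terms, each with
    three entries bounded by 8. The factor 2 makes the final inequality strict.\<close>
  define e where "e = d / (343 * 8 ^ 3 * 2)"
  have e: "e > 0" using d by (simp add: e_def)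
  show ?thesis
  proof (intro exI[of _ e] conjI allI impI e)
    fix \<eta> :: R7 and w
    assume \<eta>: "\<forall>j\<in>{1,4,5,6,7}. \<bar>\<eta> $ j\<bar> \<le> 1/4" and w: "alternating_form 3 w"
      and close: "\<forall>i j k. \<bar>w (vec3 (axis i 1) (axis j 1) (axis k 1)) - (phi3 (axis i 1) (axis j 1) (axis k 1) + wedge23 \<eta> (axis i 1) (axis j 1) (axis k 1))\<bar> < e"
    obtain N N' where N: "linear N" "linear N'" "N \<circ> N' = id" "N' \<circ> N = id" "det (matrix N) = model_vol \<eta>"
      "\<And>u v w. phi3 (N u) (N v) (N w) = phi3 u v w + wedge23 \<eta> u v w" "\<And>i j. \<bar>N' (axis i 1) $ j\<bar> \<le> 8"
      using model_frame[of \<eta>] \<eta> by metis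
    define s where "s = (\<lambda>v. w v - pullback N phi_mod v)"
    have s: "alternating_form 3 s"
      unfolding s_def by (intro alternating_form_3_diff w alternating_form_3_pullback alternating_form_3_phi_mod N)
    have se: "\<bar>s (vec3 (axis i 1) (axis j 1) (axis k 1))\<bar> \<le> e" for i j k
      using close[rule_format, of i j k] by (simp add: s_def pullback_def phi_mod_eq N(6))
    have pw: "pullback N' w (vec3 a b c) = w (vec3 (N' a) (N' b) (N' c))" for a b c
      unfolding pullback_def by (subst alternating_form_3D(1)[OF w]) simp
    have "\<bar>pullback N' w (vec3 (axis i 1) (axis j 1) (axis k 1)) - phi3 (axis i 1) (axis j 1) (axis k 1)\<bar> < d" for i j k
    proof -
      have NN: "N (N' v) = v" for v using fun_cong[OF N(3), of v] by simp
      have "pullback N' w (vec3 (axis i 1) (axis j 1) (axis k 1)) - phi3 (axis i 1) (axis j 1) (axis k 1) =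
        s (vec3 (N' (axis i 1)) (N' (axis j 1)) (N' (axis k 1)))"
        by (simp add: pw s_def pullback_def[of N] phi_mod_eq NN)
      moreover have "\<bar>s (vec3 (N' (axis i 1)) (N' (axis j 1)) (N' (axis k 1)))\<bar> \<le> 343 * 8 ^ 3 * e"
        by (rule alternating_form_3_bound[OF s se N(7) N(7) N(7)])
      ultimately show ?thesis using d by (simp add: e_def)
    qed
    then obtain A where A: "linear A" "\<bar>det (matrix A) - 1\<bar> < \<tau>" "pullback A phi_mod = pullback N' w"
      using near[OF alternating_form_3_pullback[OF w N(2)]] by blast
    have "pullback (A \<circ> N) phi_mod = pullback N (pullback A phi_mod)"
      by (simp add: pullback_def o_def)
    also have "\<dots> = w"
    proof -
      have "N' (N v) = v" for v using fun_cong[OF N(4), of v] by simp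
      then show ?thesis by (simp add: A(3) pullback_def[of N] pullback_def[of N'])
    qed
    finally have "pullback (A \<circ> N) phi_mod = w" .
    moreover have "\<bar>det (matrix (A \<circ> N)) - model_vol \<eta>\<bar> \<le> \<tau> * model_vol \<eta>"
    proof -
      have "0 \<le> model_vol \<eta>" 
      proof -
        have "1/2 \<le> model_vol \<eta>" by (rule model_vol_cube(2)) (use \<eta> in blast)
        then show ?thesis by simp
      qed
      moreover have "det (matrix (A \<circ> N)) - model_vol \<eta> = (det (matrix A) - 1) * model_vol \<eta>"
        using matrix_compose[OF N(1) A(1)] by (simp add: det_mul N(5) algebra_simps)
      ultimately show ?thesis using A(2) by (simp add: abs_mult mult_right_mono)
    qed
    moreover have "linear (A \<circ> N)" using A(1) N(1) by (rule linear_compose[rotated])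
    ultimately show "\<exists>L. linear L \<and> \<bar>det (matrix L) - model_vol \<eta>\<bar> \<le> \<tau> * model_vol \<eta> \<and> pullback L phi_mod = w"
      by blast
  qed
qed

section \<open>Exterior derivatives of pulled back 2-forms\<close>

lemma frechet_derivative_eq: "(f has_derivative D) (at x) \<Longrightarrow> frechet_derivative f (at x) = D"
  by (rule frechet_derivative_at[symmetric])

section \<open>Symmetry of second derivatives\<close>

lemma has_derivative_along_line:
  assumes "(f has_derivative f') (at (x + t *\<^sub>R v))"
  shows "((\<lambda>t. f (x + t *\<^sub>R v)) has_real_derivative f' v) (at t)"
proof -
  have "((\<lambda>t. x + t *\<^sub>R v) has_derivative (\<lambda>h. h *\<^sub>R v)) (at t)"
    by (auto intro!: derivative_eq_intros)
  from has_derivative_compose[OF this assms]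
  have "((\<lambda>t. f (x + t *\<^sub>R v)) has_derivative (\<lambda>h. f' (h *\<^sub>R v))) (at t)" .
  moreover have "f' (h *\<^sub>R v) = f' v * h" for h
    using linear_scale[OF has_derivative_linear[OF assms], of h v] by simp
  ultimately show ?thesis by (simp add: has_field_derivative_def)
qed

lemma second_difference:
  fixes f :: "'a::euclidean_space \<Rightarrow> real"
  assumes C2: "Ck_on (Suc (Suc 0)) f (ball x e)" and t: "0 < t" "t * (norm v + norm w) < e"
  shows "\<exists>\<tau> \<sigma>. 0 < \<tau> \<and> \<tau> < t \<and> 0 < \<sigma> \<and> \<sigma> < t \<and>
    f (x + t *\<^sub>R v + t *\<^sub>R w) - f (x + t *\<^sub>R v) - f (x + t *\<^sub>R w) + f x =
    t * t * frechet_derivative (\<lambda>y. frechet_derivative f (at y) v) (at (x + \<tau> *\<^sub>R v + \<sigma> *\<^sub>R w)) w"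
proof -
  have inb: "x + \<tau> *\<^sub>R v + \<sigma> *\<^sub>R w \<in> ball x e" if "0 \<le> \<tau>" "\<tau> \<le> t" "0 \<le> \<sigma>" "\<sigma> \<le> t" for \<tau> \<sigma>
  proof -
    have "norm (\<tau> *\<^sub>R v + \<sigma> *\<^sub>R w) \<le> norm (\<tau> *\<^sub>R v) + norm (\<sigma> *\<^sub>R w)" by (rule norm_triangle_ineq)
    also have "\<dots> = \<tau> * norm v + \<sigma> * norm w" using that by simp
    also have "\<dots> \<le> t * norm v + t * norm w" using that by (intro add_mono mult_right_mono) auto
    finally have "norm (\<tau> *\<^sub>R v + \<sigma> *\<^sub>R w) < e" using t by (simp add: distrib_left)
    moreover have "dist x (x + \<tau> *\<^sub>R v + \<sigma> *\<^sub>R w) = norm (\<tau> *\<^sub>R v + \<sigma> *\<^sub>R w)"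
    proof -
      have "dist x (x + z) = norm z" for z by (simp add: dist_norm)
      then show ?thesis by (simp only: add.assoc)
    qed
    ultimately show ?thesis by simp
  qed
  define p where "p \<tau> = f (x + t *\<^sub>R w + \<tau> *\<^sub>R v) - f (x + \<tau> *\<^sub>R v)" for \<tau>
  have dp: "(p has_real_derivative frechet_derivative f (at (x + t *\<^sub>R w + \<tau> *\<^sub>R v)) v - frechet_derivative f (at (x + \<tau> *\<^sub>R v)) v) (at \<tau>)"
    if "0 \<le> \<tau>" "\<tau> \<le> t" for \<tau>
    unfolding p_def
    by (intro DERIV_diff has_derivative_along_line Ck_on_has_derivative[OF C2])
      (use inb[of \<tau> t] inb[of \<tau> 0] that t in \<open>simp_all add: add_ac\<close>)
  have "\<exists>\<tau>>0. \<tau> < t \<and> p t - p 0 = (t - 0) * (frechet_derivative f (at (x + t *\<^sub>R w + \<tau> *\<^sub>R v)) v - frechet_derivative f (at (x + \<tau> *\<^sub>R v)) v)"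
    by (rule MVT2[OF t(1)]) (rule dp)
  then obtain \<tau> where \<tau>: "0 < \<tau>" "\<tau> < t"
    "p t - p 0 = (t - 0) * (frechet_derivative f (at (x + t *\<^sub>R w + \<tau> *\<^sub>R v)) v - frechet_derivative f (at (x + \<tau> *\<^sub>R v)) v)"
    by (elim exE conjE)
  have C1: "Ck_on (Suc 0) (\<lambda>y. frechet_derivative f (at y) v) (ball x e)"
    using C2 by simp
  have dq: "((\<lambda>\<sigma>. frechet_derivative f (at (x + \<tau> *\<^sub>R v + \<sigma> *\<^sub>R w)) v) has_real_derivative
     frechet_derivative (\<lambda>y. frechet_derivative f (at y) v) (at (x + \<tau> *\<^sub>R v + \<sigma> *\<^sub>R w)) w) (at \<sigma>)"
    if "0 \<le> \<sigma>" "\<sigma> \<le> t" for \<sigma>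
    using has_derivative_along_line[OF Ck_on_has_derivative[OF C1 inb[of \<tau> \<sigma>]]] that \<tau> by simp
  have "\<exists>\<sigma>>0. \<sigma> < t \<and> frechet_derivative f (at (x + \<tau> *\<^sub>R v + t *\<^sub>R w)) v - frechet_derivative f (at (x + \<tau> *\<^sub>R v + 0 *\<^sub>R w)) v =
     (t - 0) * frechet_derivative (\<lambda>y. frechet_derivative f (at y) v) (at (x + \<tau> *\<^sub>R v + \<sigma> *\<^sub>R w)) w"
    by (rule MVT2[OF t(1)]) (rule dq)
  then obtain \<sigma> where \<sigma>: "0 < \<sigma>" "\<sigma> < t"
    "frechet_derivative f (at (x + \<tau> *\<^sub>R v + t *\<^sub>R w)) v - frechet_derivative f (at (x + \<tau> *\<^sub>R v + 0 *\<^sub>R w)) v =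
     (t - 0) * frechet_derivative (\<lambda>y. frechet_derivative f (at y) v) (at (x + \<tau> *\<^sub>R v + \<sigma> *\<^sub>R w)) w"
    by (elim exE conjE)
  have "f (x + t *\<^sub>R v + t *\<^sub>R w) - f (x + t *\<^sub>R v) - f (x + t *\<^sub>R w) + f x = p t - p 0"
    by (simp add: p_def add_ac)
  also have "\<dots> = t * t * frechet_derivative (\<lambda>y. frechet_derivative f (at y) v) (at (x + \<tau> *\<^sub>R v + \<sigma> *\<^sub>R w)) w"
    using \<tau>(3) \<sigma>(3) by (simp add: add_ac)
  finally show ?thesis using \<tau> \<sigma> by blast
qed

text \<open>The second difference along \<open>v\<close> and \<open>w\<close> does not depend on
  their order, and \<open>second_difference\<close> writes it as t^2 times either mixed derivative
  at some nearby point. Continuity of both then forces equality at \<open>x\<close>.\<close>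

lemma second_derivative_symmetric:
  fixes f :: "'a::euclidean_space \<Rightarrow> real"
  assumes U: "open U" "x \<in> U" and C2: "Ck_on (Suc (Suc 0)) f U"
  shows "frechet_derivative (\<lambda>y. frechet_derivative f (at y) v) (at x) w = frechet_derivative (\<lambda>y. frechet_derivative f (at y) w) (at x) v"
proof (rule ccontr)
  define A where "A y = frechet_derivative (\<lambda>y. frechet_derivative f (at y) v) (at y) w" for y
  define B where "B y = frechet_derivative (\<lambda>y. frechet_derivative f (at y) w) (at y) v" for y
  assume "\<not> ?thesis"
  then have ne: "A x \<noteq> B x" by (simp add: A_def B_def)
  define \<epsilon> where "\<epsilon> = \<bar>A x - B x\<bar> / 2"
  have e: "\<epsilon> > 0" using ne by (simp add: \<epsilon>_def)
  have "continuous_on U A" "continuous_on U B"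
    using C2 unfolding A_def B_def by simp_all
  then have "isCont A x" "isCont B x" using U by (simp_all add: continuous_on_eq_continuous_at)
  then have "\<exists>d>0. \<forall>y. dist y x < d \<longrightarrow> dist (A y) (A x) < \<epsilon>" "\<exists>d>0. \<forall>y. dist y x < d \<longrightarrow> dist (B y) (B x) < \<epsilon>"
    using e unfolding continuous_at_eps_delta by blast+
  then obtain d1 d2 where d1: "d1 > 0" "\<forall>y. dist y x < d1 \<longrightarrow> dist (A y) (A x) < \<epsilon>"
    and d2: "d2 > 0" "\<forall>y. dist y x < d2 \<longrightarrow> dist (B y) (B x) < \<epsilon>" by blast
  obtain r where r: "r > 0" "ball x r \<subseteq> U" using U openE by blast
  define \<rho> where "\<rho> = min r (min d1 d2)"
  have \<rho>: "\<rho> > 0" "\<rho> \<le> r" "\<rho> \<le> d1" "\<rho> \<le> d2" using r(1) d1(1) d2(1) by (simp_all add: \<rho>_def)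
  define n where "n = norm v + norm w + 1"
  define t where "t = \<rho> / (2 * n)"
  have np: "n > 0" using norm_ge_zero[of v] norm_ge_zero[of w] unfolding n_def by linarith
  have t: "t > 0" using \<rho> np by (simp add: t_def)
  have "t * (norm v + norm w) \<le> t * n" using t by (intro mult_left_mono) (auto simp: n_def)
  also have "\<dots> = \<rho> / 2" using np by (simp add: t_def)
  also have "\<dots> < \<rho>" using \<rho> by simp
  finally have tb: "t * (norm v + norm w) < \<rho>" .
  then have tb': "t * (norm w + norm v) < \<rho>" by (simp add: add.commute)
  have C2': "Ck_on (Suc (Suc 0)) f (ball x \<rho>)"
    by (rule Ck_on_subset[OF C2]) (use r \<rho> in auto)
  have near: "dist (x + a *\<^sub>R p + b *\<^sub>R q) x < \<rho>" if "0 < a" "a < t" "0 < b" "b < t" "t * (norm p + norm q) < \<rho>" for a b and p q :: 'a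
  proof -
    have "norm (a *\<^sub>R p + b *\<^sub>R q) \<le> a * norm p + b * norm q"
      using norm_triangle_ineq[of "a *\<^sub>R p" "b *\<^sub>R q"] that by simp
    also have "\<dots> \<le> t * norm p + t * norm q" using that by (intro add_mono mult_right_mono) auto
    finally show ?thesis using that by (simp add: dist_norm add.assoc distrib_left)
  qed
  obtain a b where ab: "0 < a" "a < t" "0 < b" "b < t"
    "f (x + t *\<^sub>R v + t *\<^sub>R w) - f (x + t *\<^sub>R v) - f (x + t *\<^sub>R w) + f x = t * t * A (x + a *\<^sub>R v + b *\<^sub>R w)"
    using second_difference[OF C2' t tb] unfolding A_def by blast
  obtain a' b' where ab': "0 < a'" "a' < t" "0 < b'" "b' < t"
    "f (x + t *\<^sub>R w + t *\<^sub>R v) - f (x + t *\<^sub>R w) - f (x + t *\<^sub>R v) + f x = t * t * B (x + a' *\<^sub>R w + b' *\<^sub>R v)"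
    using second_difference[OF C2' t tb'] unfolding B_def by blast
  have comm: "x + t *\<^sub>R w + t *\<^sub>R v = x + t *\<^sub>R v + t *\<^sub>R w" by (simp add: add_ac)
  have "t * t * A (x + a *\<^sub>R v + b *\<^sub>R w) = t * t * B (x + a' *\<^sub>R w + b' *\<^sub>R v)"
    using ab(5) ab'(5) unfolding comm by linarith
  then have "A (x + a *\<^sub>R v + b *\<^sub>R w) = B (x + a' *\<^sub>R w + b' *\<^sub>R v)" using t by simp
  moreover have "dist (A (x + a *\<^sub>R v + b *\<^sub>R w)) (A x) < \<epsilon>"
    using near[OF ab(1-4) tb] \<rho> by (intro d1(2)[rule_format]) linarith
  moreover have "dist (B (x + a' *\<^sub>R w + b' *\<^sub>R v)) (B x) < \<epsilon>"
    using near[OF ab'(1-4) tb'] \<rho> by (intro d2(2)[rule_format]) linarith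
  ultimately have "\<bar>A x - B x\<bar> < 2 * \<epsilon>" unfolding dist_real_def by linarith
  then show False by (simp add: \<epsilon>_def)
qed

section \<open>Two-forms on R^7\<close>

text \<open>Given on all of R^7: the perturbations have compact support inside a patch, so their
  extension by zero is smooth and no domain has to be carried along.\<close>

definition smooth_2form :: "(R7 \<Rightarrow> R7 \<Rightarrow> R7 \<Rightarrow> real) \<Rightarrow> bool" where
  "smooth_2form B \<longleftrightarrow> (\<forall>x. bilinear (B x)) \<and> (\<forall>x a. B x a a = 0) \<and> (\<forall>a b. smooth_on UNIV (\<lambda>x. B x a b))"

definition deriv_2form :: "(R7 \<Rightarrow> R7 \<Rightarrow> R7 \<Rightarrow> real) \<Rightarrow> R7 \<Rightarrow> R7 \<Rightarrow> R7 \<Rightarrow> R7 \<Rightarrow> real" where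
  "deriv_2form B x h a b = frechet_derivative (\<lambda>x. B x a b) (at x) h"

lemma R7_expand: "(\<Sum>i\<in>UNIV. x $ i *\<^sub>R axis i 1) = (x :: R7)"
  by (simp add: vec_eq_iff axis_def if_distrib sum.delta cong: if_cong)

lemma bilinear_expand:
  fixes B :: "R7 \<Rightarrow> R7 \<Rightarrow> real"
  assumes "bilinear B"
  shows "B a b = (\<Sum>i\<in>UNIV. \<Sum>j\<in>UNIV. a $ i * b $ j * B (axis i 1) (axis j 1))"
proof -
  have l: "linear (\<lambda>x. B x c)" "linear (B c)" for c using assms by (auto simp: bilinear_def)
  have "B a b = B (\<Sum>i\<in>UNIV. a $ i *\<^sub>R axis i 1) (\<Sum>j\<in>UNIV. b $ j *\<^sub>R axis j 1)"
    by (simp add: R7_expand)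
  also have "\<dots> = (\<Sum>i\<in>UNIV. a $ i * B (axis i 1) (\<Sum>j\<in>UNIV. b $ j *\<^sub>R axis j 1))"
    by (simp only: linear_sum[OF l(1)] linear_scale[OF l(1)] real_scaleR_def)
  also have "\<dots> = (\<Sum>i\<in>UNIV. a $ i * (\<Sum>j\<in>UNIV. b $ j * B (axis i 1) (axis j 1)))"
    by (simp only: linear_sum[OF l(2)] linear_scale[OF l(2)] real_scaleR_def)
  finally show ?thesis by (simp add: sum_distrib_left mult.assoc)
qed

lemma smooth_2form_has_derivative:
  assumes B: "smooth_2form B" and f: "(f has_derivative f') (at y)" and p: "(p has_derivative p') (at y)" and q: "(q has_derivative q') (at y)"
  shows "((\<lambda>y. B (f y) (p y) (q y)) has_derivative
     (\<lambda>v. deriv_2form B (f y) (f' v) (p y) (q y) + B (f y) (p' v) (q y) + B (f y) (p y) (q' v))) (at y)"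
proof -
  define C where "C i j x = B x (axis i 1) (axis j 1)" for i j :: 7 and x
  define dC where "dC i j x h = frechet_derivative (C i j) (at x) h" for i j x h
  have bil: "bilinear (B x)" for x using B by (simp add: smooth_2form_def)
  have ex: "B x a b = (\<Sum>i\<in>UNIV. \<Sum>j\<in>UNIV. a $ i * b $ j * C i j x)" for x a b
    unfolding C_def by (rule bilinear_expand[OF bil])
  have smC: "smooth_on UNIV (C i j)" for i j
    using B unfolding C_def smooth_2form_def by blast
  have dC: "(C i j has_derivative dC i j x) (at x)" for i j x
    unfolding dC_def by (rule smooth_on_has_derivative[OF open_UNIV smC]) simp
  have D: "((\<lambda>y. B (g y) (r y) (s y)) has_derivative
     (\<lambda>v. \<Sum>i\<in>UNIV. \<Sum>j\<in>UNIV. r y $ i * s y $ j * dC i j (g y) (g' v) + (r y $ i * s' v $ j + r' v $ i * s y $ j) * C i j (g y))) (at y)"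
    if "(g has_derivative g') (at y)" "(r has_derivative r') (at y)" "(s has_derivative s') (at y)" for g r s g' r' s'
    unfolding ex
    by (intro has_derivative_sum has_derivative_mult bounded_linear.has_derivative[OF bounded_linear_vec_nth] that
        has_derivative_compose[OF that(1) dC])
  have dB: "deriv_2form B (f y) h a b = (\<Sum>i\<in>UNIV. \<Sum>j\<in>UNIV. a $ i * b $ j * dC i j (f y) h)" for h a b
  proof -
    have "((\<lambda>x. B x a b) has_derivative (\<lambda>h. \<Sum>i\<in>UNIV. \<Sum>j\<in>UNIV. a $ i * b $ j * dC i j (f y) h)) (at (f y))"
      unfolding ex
      by (intro has_derivative_sum has_derivative_mult_right dC)
    then show ?thesis
      unfolding deriv_2form_def by (simp add: frechet_derivative_eq)
  qed
  show ?thesis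
    by (rule has_derivative_eq_rhs[OF D[OF f p q]])
      (simp add: dB ex fun_eq_iff sum.distrib[symmetric] distrib_right add_ac)
qed

text \<open>Exterior differentiation commutes with pullback: by symmetry the second derivatives of \<open>f\<close> cancel.\<close>

lemma pullback_deriv_2form:
  fixes f :: "R7 \<Rightarrow> R7"
  assumes B: "smooth_2form B" and V: "open V" "y \<in> V" "Ck_on (Suc (Suc 0)) f V"
  defines "F \<equiv> \<lambda>y. frechet_derivative f (at y)"
  defines "d \<equiv> \<lambda>a b c. frechet_derivative (\<lambda>y. B (f y) (F y a) (F y b)) (at y) c"
  shows "d b c a - d a c b + d a b c =
    deriv_2form B (f y) (F y a) (F y b) (F y c) - deriv_2form B (f y) (F y b) (F y a) (F y c)
    + deriv_2form B (f y) (F y c) (F y a) (F y b)"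
    and "(\<lambda>y. B (f y) (F y a) (F y b)) differentiable (at y)"
proof -
  define S where "S a c = frechet_derivative (\<lambda>y. F y a) (at y) c" for a c
  have f: "(f has_derivative F y) (at y)"
    unfolding F_def by (rule Ck_on_has_derivative[OF V(3,2)])
  have C1: "Ck_on (Suc 0) (\<lambda>y. F y a) V" for a using V(3) unfolding F_def by simp
  have p: "((\<lambda>y. F y a) has_derivative S a) (at y)" for a
    unfolding S_def by (rule Ck_on_has_derivative[OF C1 V(2)])
  note D = smooth_2form_has_derivative[OF B f p p]
  show "(\<lambda>y. B (f y) (F y a) (F y b)) differentiable (at y)" using D by (rule differentiableI)
  have dd: "d a b c = deriv_2form B (f y) (F y c) (F y a) (F y b) + B (f y) (S a c) (F y b) + B (f y) (F y a) (S b c)" for a b c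
    unfolding d_def by (simp only: frechet_derivative_eq[OF D])
  \<comment> \<open>Second derivatives are known to be symmetric for real functions, so the argument
    passes through the components of \<open>f\<close>.\<close>
  have sym: "S a c = S c a" for a c
  proof -
    have comp: "frechet_derivative (\<lambda>y. g y $ i) (at z) h = frechet_derivative g (at z) h $ i"
      if "(g has_derivative frechet_derivative g (at z)) (at z)" for g :: "R7 \<Rightarrow> R7" and z h i
      by (simp only: frechet_derivative_eq[OF bounded_linear.has_derivative[OF bounded_linear_vec_nth that]])
    have Sc: "S a c $ i = frechet_derivative (\<lambda>y. frechet_derivative (\<lambda>y. f y $ i) (at y) a) (at y) c" for i a c
    proof -
      have "S a c $ i = frechet_derivative (\<lambda>y. F y a $ i) (at y) c"
        unfolding S_def by (rule comp[symmetric], rule Ck_on_has_derivative[OF C1 V(2)])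
      also have "\<dots> = frechet_derivative (\<lambda>y. frechet_derivative (\<lambda>y. f y $ i) (at y) a) (at y) c"
      proof (rule arg_cong[where f = "\<lambda>D. D c"], rule frechet_derivative_germ(2)[OF V(1,2)])
        fix z assume "z \<in> V \<inter> UNIV"
        then show "F z a $ i = frechet_derivative (\<lambda>y. f y $ i) (at z) a"
          unfolding F_def using comp[OF Ck_on_has_derivative[OF V(3)], of z i a] by simp
      qed simp
      finally show ?thesis .
    qed
    have "Ck_on (Suc (Suc 0)) (\<lambda>y. f y $ i) V" for i
      by (rule Ck_on_bounded_linear_compose[OF V(1) bounded_linear_vec_nth V(3)])
    then show ?thesis
      unfolding vec_eq_iff Sc using second_derivative_symmetric[OF V(1,2)] by blast
  qed
  have skew: "B (f y) a b = - B (f y) b a" for a b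
  proof -
    have bil: "bilinear (B (f y))" and z: "\<And>a. B (f y) a a = 0" using B by (auto simp: smooth_2form_def)
    have "B (f y) (a + b) (a + b) = B (f y) a a + B (f y) a b + (B (f y) b a + B (f y) b b)"
      by (simp only: bilinear_ladd[OF bil] bilinear_radd[OF bil])
    then show ?thesis using z by simp
  qed
  show "d b c a - d a c b + d a b c =
    deriv_2form B (f y) (F y a) (F y b) (F y c) - deriv_2form B (f y) (F y b) (F y a) (F y c)
    + deriv_2form B (f y) (F y c) (F y a) (F y b)"
    unfolding dd sym[of b a] sym[of c a] sym[of c b] using skew[of "S a c" "F y b"] skew[of "F y a" "S b c"] skew[of "S a b" "F y c"]
    by simp
qed

section \<open>Patches of an oriented orbifold\<close>

locale oriented_orb =
  fixes M :: "'a oriented_orbifold"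
  assumes oriented: "oriented_orbifold7 M"
begin

lemma orb: "orbifold7 M"
  using oriented unfolding oriented_orbifold7_def by (elim conjE)

lemma orbD:
  "topspace (space_of M) \<noteq> {}" "Hausdorff_space (space_of M)" "\<forall>c\<in>atlas M. is_chart (space_of M) c"
  "(\<Union>c\<in>atlas M. image_of c) = topspace (space_of M)"
  "\<forall>c1\<in>atlas M. \<forall>c2\<in>atlas M. compatible c1 c2"
  using orb unfolding orbifold7_def by - (elim conjE, assumption)+

lemma chart: "c \<in> atlas M \<Longrightarrow> is_chart (space_of M) c"
  using orbD(3) by (rule bspec)

lemma chartD:
  assumes "c \<in> atlas M"
  shows "finite_linear_group (grp c)" "0 \<in> lift c" "connected (lift c)"
    "open (lift c) \<or> openin (top_of_set half_space) (lift c)"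
    "\<forall>g\<in>grp c. \<forall>x\<in>lift c. g *v x \<in> lift c" "openin (space_of M) (image_of c)"
    "quotient_map (top_of_set (lift c)) (subtopology (space_of M) (image_of c)) (proj c)"
    "\<forall>x\<in>lift c. \<forall>y\<in>lift c. proj c x = proj c y \<longleftrightarrow> (\<exists>g\<in>grp c. y = g *v x)"
  using chart[OF assms] unfolding is_chart_def by - (elim conjE, assumption)+

lemmas hausdorff = orbD(2)

lemma covered: "p \<in> topspace (space_of M) \<Longrightarrow> \<exists>c\<in>atlas M. p \<in> image_of c"
proof -
  assume p: "p \<in> topspace (space_of M)"
  have "p \<in> (\<Union>c\<in>atlas M. image_of c)" unfolding orbD(4) by (rule p)
  then show ?thesis by blast
qed

lemma compat:
  assumes "c1 \<in> atlas M" "c2 \<in> atlas M" "x \<in> lift c1" "y \<in> lift c2" "proj c1 x = proj c2 y"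
  obtains V f where "transition c1 c2 V f" "x \<in> V" "f x = y"
proof -
  have "compatible c1 c2" using orbD(5) assms(1,2) by blast
  then have "\<exists>V f. transition c1 c2 V f \<and> x \<in> V \<and> f x = y"
    using assms(3-5) unfolding compatible_def by blast
  then show thesis using that by blast
qed

lemma image_openin: "c \<in> atlas M \<Longrightarrow> openin (space_of M) (image_of c)"
  by (rule chartD)

lemma proj_in_topspace: "c \<in> atlas M \<Longrightarrow> x \<in> lift c \<Longrightarrow> proj c x \<in> topspace (space_of M)"
  using openin_subset[OF image_openin] by blast

lemma proj_continuous: "c \<in> atlas M \<Longrightarrow> continuous_map (top_of_set (lift c)) (space_of M) (proj c)"
proof -
  assume c: "c \<in> atlas M"
  show ?thesis
    by (rule continuous_map_into_fulltopology[OF quotient_imp_continuous_map[OF chartD(7)[OF c]]])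
qed

lemma orient_cases: "c \<in> atlas M \<Longrightarrow> orient M c = 1 \<or> orient M c = -1"
proof -
  assume c: "c \<in> atlas M"
  have "\<forall>c\<in>atlas M. (orient M c = 1 \<or> orient M c = -1) \<and> (\<forall>g\<in>grp c. det g > 0)"
    using oriented unfolding oriented_orbifold7_def by (elim conjE)
  then show ?thesis using c by blast
qed

lemma orient_transition:
  assumes "c1 \<in> atlas M" "c2 \<in> atlas M" "transition c1 c2 V f" "x \<in> V"
  shows "orient M c1 * orient M c2 * det (matrix (tangent_map V f x)) > 0"
proof -
  have "\<forall>c1\<in>atlas M. \<forall>c2\<in>atlas M. \<forall>V f. transition c1 c2 V f \<longrightarrow>
        (\<forall>x\<in>V. orient M c1 * orient M c2 * det (matrix (tangent_map V f x)) > 0)"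
    using oriented unfolding oriented_orbifold7_def by (elim conjE)
  then show ?thesis using assms by blast
qed

lemma lift_cases:
  assumes "c \<in> atlas M"
  obtains T H where "open T" "lift c = H \<inter> T" "H = UNIV \<or> H = half_space"
proof -
  from chartD(4)[OF assms] show thesis
  proof
    assume "open (lift c)" then show thesis using that[of "lift c" UNIV] by simp
  next
    assume "openin (top_of_set half_space) (lift c)"
    then obtain T where "open T" "lift c = half_space \<inter> T" unfolding openin_open by blast
    then show thesis using that by blast
  qed
qed

lemma half_space_interior: "open {x :: R7. x $ 7 > 0}"
  by (intro open_Collect_less continuous_intros)

lemma negligible_lift_frontier:
  assumes "c \<in> atlas M"
  shows "negligible (lift c - interior (lift c))"
proof -
  obtain T H where T: "open T" "lift c = H \<inter> T" "H = UNIV \<or> H = half_space"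
    using lift_cases[OF assms] .
  have "lift c - interior (lift c) \<subseteq> {x. x \<bullet> axis 7 1 = 0}"
  proof
    fix x assume x: "x \<in> lift c - interior (lift c)"
    show "x \<in> {x. x \<bullet> axis 7 1 = 0}"
    proof (rule ccontr)
      assume "x \<notin> {x. x \<bullet> axis 7 1 = 0}"
      then have ne: "x $ 7 \<noteq> 0" by (simp add: inner_axis)
      have "\<exists>W. open W \<and> x \<in> W \<and> W \<subseteq> lift c"
      proof (cases "H = UNIV")
        case True then show ?thesis using T x by (intro exI[of _ T]) simp
      next
        case False
        then have H: "H = half_space" using T by simp
        then have "x $ 7 > 0" using x ne T by (auto simp: half_space_def)
        moreover have "{x. x $ 7 > 0} \<inter> T \<subseteq> lift c"
          unfolding T(2) H half_space_def by auto
        moreover have "x \<in> T" using x T(2) by blast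
        ultimately show ?thesis
          by (intro exI[of _ "{x. x $ 7 > 0} \<inter> T"] conjI open_Int half_space_interior T(1)) simp_all
      qed
      then obtain W where "open W" "x \<in> W" "W \<subseteq> lift c" by blast
      then have "x \<in> interior (lift c)" by (rule interiorI)
      then show False using x by blast
    qed
  qed
  moreover have "negligible {x :: R7. x \<bullet> axis 7 1 = 0}"
    by (rule negligible_standard_hyperplane) (simp add: axis_in_Basis_iff)
  ultimately show ?thesis by (rule negligible_subset[rotated])
qed

lemma transition_interior:
  assumes "c1 \<in> atlas M" "c2 \<in> atlas M" "transition c1 c2 V f" "x \<in> V" "x \<in> interior (lift c1)"
  obtains W where "open W" "x \<in> W" "W \<subseteq> V" "W \<subseteq> interior (lift c1)" "smooth_on W f"
    "tangent_map V f x = frechet_derivative f (at x)"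
proof -
  have "openin (top_of_set (lift c1)) V" using assms(3) by (simp add: transition_def)
  then obtain T where T: "open T" "V = lift c1 \<inter> T" unfolding openin_open by blast
  let ?W = "interior (lift c1) \<inter> T"
  have W: "open ?W" "x \<in> ?W" "?W \<subseteq> V" using T assms interior_subset by auto
  have "smooth_on V f" using assms(3) by (simp add: transition_def)
  then have "smooth_on ?W f" using W(3) by (rule smooth_on_subset)
  moreover have "x \<in> interior V" using W by (rule interiorI)
  then have "tangent_map V f x = frechet_derivative f (at x)"
    unfolding tangent_map_def by (simp only: at_within_interior)
  ultimately show thesis using W by (intro that[of ?W]) simp_all
qed

text \<open>Invariance of the boundary. The orientation condition makes the derivative of the
  transition invertible, so the image of a neighbourhood of \<open>x\<close> contains a
  neighbourhood of \<open>f x\<close>, and that image lies in \<open>lift c2\<close>.\<close>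

lemma transition_image_interior:
  assumes "c1 \<in> atlas M" "c2 \<in> atlas M" "transition c1 c2 V f" "x \<in> V" "x \<in> interior (lift c1)"
  shows "f x \<in> interior (lift c2)"
proof -
  obtain W where W: "open W" "x \<in> W" "W \<subseteq> V" "smooth_on W f"
    "tangent_map V f x = frechet_derivative f (at x)"
    using transition_interior[OF assms] .
  define f' where "f' = frechet_derivative f (at x)"
  have f': "(f has_derivative f') (at x)"
    unfolding f'_def by (rule smooth_on_has_derivative[OF W(1,4,2)])
  have lin: "linear f'" using f' by (rule has_derivative_linear)
  have "det (matrix f') \<noteq> 0"
    using orient_transition[OF assms(1-4)] unfolding W(5) f'_def[symmetric] by auto
  then have "inj f'" using det_nz_iff_inj[OF lin] by simp
  then have "surj f'" using linear_injective_imp_surjective[OF lin] by simp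
  then obtain g where g: "linear g" "f' \<circ> g = id"
    using linear_surjective_right_inverse[OF lin] by blast
  have "f x \<in> interior (f ` W)"
  proof (rule sussmann_open_mapping[OF W(1) _ W(2) f' _ g(2) order_refl])
    show "continuous_on W f" using W(4) by (rule smooth_on_imp_continuous_on)
    show "bounded_linear g" using g(1) by (simp add: linear_conv_bounded_linear)
    show "x \<in> interior W" using W by (simp add: interior_open)
  qed
  moreover have "f ` W \<subseteq> lift c2"
  proof -
    have "openin (top_of_set (lift c2)) (f ` V)" using assms(3) by (simp add: transition_def)
    then have "f ` V \<subseteq> lift c2" using openin_imp_subset by blast
    then show ?thesis using W(3) by blast
  qed
  ultimately show ?thesis using interior_mono by blast
qed

section \<open>The map from a chart into a patch\<close>

text \<open>An open piece of a lift that embeds into the orbifold. A form with compact support in it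
  can be carried to all charts without averaging over their groups.\<close>

definition patch :: "'a chart \<Rightarrow> R7 set \<Rightarrow> bool" where
  "patch c D \<longleftrightarrow> c \<in> atlas M \<and> open D \<and> D \<subseteq> lift c \<and> inj_on (proj c) D"

definition preimg :: "'a chart \<Rightarrow> R7 set \<Rightarrow> 'a chart \<Rightarrow> R7 set" where
  "preimg c D c' = {y \<in> lift c'. proj c' y \<in> proj c ` D}"

text \<open>The change of coordinates into the patch, defined in one stroke over everything that
  lies above the patch. It depends on \<open>y\<close> only through the point
  \<open>proj c' y\<close>, so compatibility with transitions and group actions comes for
  free.\<close>

definition to_patch :: "'a chart \<Rightarrow> R7 set \<Rightarrow> 'a chart \<Rightarrow> R7 \<Rightarrow> R7" where
  "to_patch c D c' y = inv_into D (proj c) (proj c' y)"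

definition to_patch' :: "'a chart \<Rightarrow> R7 set \<Rightarrow> 'a chart \<Rightarrow> R7 \<Rightarrow> R7 \<Rightarrow> R7" where
  "to_patch' c D c' y = frechet_derivative (to_patch c D c') (at y)"

lemma to_patch_in:
  assumes "y \<in> preimg c D c'"
  shows "to_patch c D c' y \<in> D" "proj c (to_patch c D c' y) = proj c' y"
proof -
  have "proj c' y \<in> proj c ` D" using assms by (simp add: preimg_def)
  then show "to_patch c D c' y \<in> D" "proj c (to_patch c D c' y) = proj c' y"
    unfolding to_patch_def by (rule inv_into_into, rule f_inv_into_f)
qed

lemma to_patch_eq:
  assumes "patch c D" "x \<in> D" "proj c' y = proj c x"
  shows "to_patch c D c' y = x"
  using assms by (simp add: to_patch_def patch_def inv_into_f_f)

text \<open>Near \<open>y\<close> a transition covering the identity must coincide with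
  \<open>to_patch\<close>, because a point of \<open>D\<close> is determined by its projection.
  Smoothness and orientation of \<open>to_patch\<close> are inherited from such transitions.\<close>

lemma patch_local:
  assumes P: "patch c D" and c': "c' \<in> atlas M" and y: "y \<in> preimg c D c'"
  obtains V h W where "transition c' c V h" "y \<in> V" "tangent_map V h y = to_patch' c D c' y"
    "open W" "y \<in> W" "W \<subseteq> preimg c D c'" "W \<subseteq> V" "W \<subseteq> interior (lift c')" "\<forall>z\<in>W. h z = to_patch c D c' z" "smooth_on W h"
proof -
  have c: "c \<in> atlas M" "open D" "D \<subseteq> lift c" using P by (auto simp: patch_def)
  define x where "x = to_patch c D c' y"
  have x: "x \<in> D" "proj c x = proj c' y" using to_patch_in[OF y] by (auto simp: x_def)
  have xl: "x \<in> lift c" "x \<in> interior (lift c)" using x c interior_maximal by blast+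
  have yl: "y \<in> lift c'" using y by (simp add: preimg_def)
  \<comment> \<open>A transition out of the patch shows that \<open>y\<close> is an interior point.
    Only then can the transition into the patch be differentiated in the ordinary sense at
    \<open>y\<close>.\<close>
  have yint: "y \<in> interior (lift c')"
  proof -
    obtain V k where "transition c c' V k" "x \<in> V" "k x = y"
      using compat[OF c(1) c' xl(1) yl x(2)] .
    then show ?thesis using transition_image_interior[OF c(1) c' _ _ xl(2)] by blast
  qed
  obtain V h where h: "transition c' c V h" "y \<in> V" "h y = x"
    using compat[OF c' c(1) yl xl(1) x(2)[symmetric]] .
  obtain W where W: "open W" "y \<in> W" "W \<subseteq> V" "W \<subseteq> interior (lift c')" "smooth_on W h"
    "tangent_map V h y = frechet_derivative h (at y)"
    using transition_interior[OF c' c(1) h(1,2) yint] .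
  let ?W = "W \<inter> h -` D"
  have oW: "open ?W"
    using smooth_on_imp_continuous_on[OF W(5)] W(1) c(2) by (simp add: continuous_open_preimage)
  have yW: "y \<in> ?W" using W h x by simp
  have Wp: "z \<in> preimg c D c' \<and> h z = to_patch c D c' z" if "z \<in> ?W" for z
  proof -
    have pz: "proj c (h z) = proj c' z" using h(1) that W(3) by (auto simp: transition_def)
    have "z \<in> lift c'" using that W(4) interior_subset by blast
    then have "z \<in> preimg c D c'" unfolding preimg_def using pz[symmetric] that by auto
    moreover have "to_patch c D c' z = h z" using to_patch_eq[OF P _ pz[symmetric]] that by simp
    ultimately show ?thesis by simp
  qed
  have "frechet_derivative h (at y) = to_patch' c D c' y"
    unfolding to_patch'_def by (rule frechet_derivative_germ(2)[OF oW yW]) (use Wp in auto)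
  then show thesis
    using that[OF h(1,2) _ oW yW] W Wp smooth_on_subset[OF W(5), of ?W] by auto
qed

lemma preimg_open:
  assumes "patch c D" "c' \<in> atlas M"
  shows "open (preimg c D c')"
proof (subst open_subopen, intro ballI)
  fix y assume "y \<in> preimg c D c'"
  from patch_local[OF assms this] obtain W where "open W" "y \<in> W" "W \<subseteq> preimg c D c'" .
  then show "\<exists>T. open T \<and> y \<in> T \<and> T \<subseteq> preimg c D c'" by blast
qed

lemma preimg_subset: "preimg c D c' \<subseteq> lift c'"
  by (auto simp: preimg_def)

lemma to_patch_smooth:
  assumes "patch c D" "c' \<in> atlas M"
  shows "smooth_on (preimg c D c') (to_patch c D c')"
proof (rule smooth_on_local)
  fix y assume y: "y \<in> preimg c D c'"
  obtain V h W where W: "transition c' c V h" "y \<in> V" "tangent_map V h y = to_patch' c D c' y"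
    "open W" "y \<in> W" "W \<subseteq> preimg c D c'" "W \<subseteq> V" "W \<subseteq> interior (lift c')" "\<forall>z\<in>W. h z = to_patch c D c' z" "smooth_on W h"
    using patch_local[OF assms y] .
  show "\<exists>U g. open U \<and> y \<in> U \<and> smooth_on (preimg c D c' \<inter> U) g \<and> (\<forall>z\<in>preimg c D c' \<inter> U. g z = to_patch c D c' z)"
    using W(9) by (intro exI[of _ W] exI[of _ h] conjI W(4,5) smooth_on_subset[OF W(10)]) simp_all
qed

lemma to_patch_has_derivative:
  assumes "patch c D" "c' \<in> atlas M" "y \<in> preimg c D c'"
  shows "(to_patch c D c' has_derivative to_patch' c D c' y) (at y)"
  unfolding to_patch'_def
  by (rule smooth_on_has_derivative[OF preimg_open to_patch_smooth]) (use assms in auto)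

lemma to_patch_orient:
  assumes "patch c D" "c' \<in> atlas M" "y \<in> preimg c D c'"
  shows "orient M c' * orient M c * det (matrix (to_patch' c D c' y)) > 0"
proof -
  obtain V h W where W: "transition c' c V h" "y \<in> V" "tangent_map V h y = to_patch' c D c' y"
    using patch_local[OF assms] .
  have "c \<in> atlas M" using assms(1) by (simp add: patch_def)
  then show ?thesis using orient_transition[OF assms(2) _ W(1,2)] W(3) by simp
qed

lemma form_preimg:
  assumes "patch c D" "c' \<in> atlas M" "y \<in> preimg c D c'" "is_form M k w"
  shows "w c' y = pullback (to_patch' c D c' y) (w c (to_patch c D c' y))"
proof -
  obtain V h W where W: "transition c' c V h" "y \<in> V" "tangent_map V h y = to_patch' c D c' y"
    "open W" "y \<in> W" "W \<subseteq> preimg c D c'" "W \<subseteq> V" "W \<subseteq> interior (lift c')" "\<forall>z\<in>W. h z = to_patch c D c' z"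
    using patch_local[OF assms(1-3)] .
  have "c \<in> atlas M" using assms(1) by (simp add: patch_def)
  then have "pullback (tangent_map V h y) (w c (h y)) = w c' y"
  proof -
    have "\<forall>c1\<in>atlas M. \<forall>c2\<in>atlas M. \<forall>V f. transition c1 c2 V f \<longrightarrow>
        (\<forall>x\<in>V. pullback (tangent_map V f x) (w c2 (f x)) = w c1 x)"
      using assms(4) unfolding is_form_def by (elim conjE)
    then show ?thesis using assms(2) W(1,2) \<open>c \<in> atlas M\<close> by blast
  qed
  then show ?thesis using W(3) W(9)[rule_format, OF W(5)] by simp
qed

lemma transition_preimg:
  assumes "transition c1 c2 V F" "x \<in> V"
  shows "x \<in> lift c1" "F x \<in> lift c2" "proj c2 (F x) = proj c1 x"
    "F x \<in> preimg c D c2 \<longleftrightarrow> x \<in> preimg c D c1" "to_patch c D c2 (F x) = to_patch c D c1 x"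
proof -
  have V: "openin (top_of_set (lift c1)) V" "openin (top_of_set (lift c2)) (F ` V)" and p: "\<forall>x\<in>V. proj c2 (F x) = proj c1 x"
    using assms(1) by (auto simp: transition_def)
  have Vs: "V \<subseteq> lift c1" "F ` V \<subseteq> lift c2" using V openin_imp_subset by blast+
  show l: "x \<in> lift c1" "F x \<in> lift c2" "proj c2 (F x) = proj c1 x" using assms(2) p Vs by auto
  show "F x \<in> preimg c D c2 \<longleftrightarrow> x \<in> preimg c D c1" "to_patch c D c2 (F x) = to_patch c D c1 x"
    using l by (simp_all add: preimg_def to_patch_def)
qed

text \<open>The chain rule for \<open>to_patch\<close> composed with any map over the identity of
  the orbifold; it serves transitions and group elements alike.\<close>

lemma to_patch_chain:
  assumes P: "patch c D" and c: "c1 \<in> atlas M" "c2 \<in> atlas M" and W: "open W" "x \<in> W" "W \<subseteq> lift c1"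
    and F: "(F has_derivative F') (at x)" and eq: "\<And>z. z \<in> W \<Longrightarrow> F z \<in> lift c2 \<and> proj c2 (F z) = proj c1 z"
    and x: "x \<in> preimg c D c1"
  shows "to_patch' c D c1 x = to_patch' c D c2 (F x) \<circ> F'"
proof -
  have Fx: "F x \<in> preimg c D c2" using x eq[OF W(2)] by (simp add: preimg_def)
  have "((\<lambda>z. to_patch c D c2 (F z)) has_derivative (\<lambda>v. to_patch' c D c2 (F x) (F' v))) (at x)"
    by (rule has_derivative_compose[OF F to_patch_has_derivative[OF P c(2) Fx]])
  moreover have "to_patch c D c2 (F z) = to_patch c D c1 z" if "z \<in> W" for z
    using eq[OF that] by (simp add: to_patch_def)
  ultimately have "(to_patch c D c1 has_derivative (\<lambda>v. to_patch' c D c2 (F x) (F' v))) (at x)"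
    using has_derivative_germ[OF W(1,2), of UNIV "\<lambda>z. to_patch c D c2 (F z)" "to_patch c D c1"] by simp
  then show ?thesis unfolding to_patch'_def[of c D c1] by (simp add: frechet_derivative_eq fun_eq_iff)
qed

lemma preimg_interior:
  assumes "patch c D" "c' \<in> atlas M" "y \<in> preimg c D c'"
  shows "y \<in> interior (lift c')"
  using interior_maximal[OF preimg_subset preimg_open[OF assms(1,2)]] assms(3) by blast

lemma to_patch_transition:
  assumes P: "patch c D" and c: "c1 \<in> atlas M" "c2 \<in> atlas M" and F: "transition c1 c2 V F" and x: "x \<in> V" "x \<in> preimg c D c1"
  shows "to_patch' c D c1 x = to_patch' c D c2 (F x) \<circ> tangent_map V F x"
proof -
  obtain W where W: "open W" "x \<in> W" "W \<subseteq> V" "W \<subseteq> interior (lift c1)" "smooth_on W F"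
    "tangent_map V F x = frechet_derivative F (at x)"
    using transition_interior[OF c F x(1) preimg_interior[OF P c(1) x(2)]] .
  show ?thesis
  proof (rule to_patch_chain[OF P c W(1,2) _ _ _ x(2)])
    show "W \<subseteq> lift c1" using W(4) interior_subset by blast
    show "(F has_derivative tangent_map V F x) (at x)"
      unfolding W(6) by (rule smooth_on_has_derivative[OF W(1,5,2)])
    show "F z \<in> lift c2 \<and> proj c2 (F z) = proj c1 z" if "z \<in> W" for z
      using transition_preimg(2,3)[OF F] that W(3) by blast
  qed
qed

lemma group_lift:
  assumes "c \<in> atlas M" "g \<in> grp c" "x \<in> lift c"
  shows "g *v x \<in> lift c" "proj c (g *v x) = proj c x"
proof -
  note l = chartD(5)[OF assms(1)] and p = chartD(8)[OF assms(1)]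
  show gl: "g *v x \<in> lift c" using l assms by blast
  have "proj c x = proj c (g *v x)" using p gl assms by blast
  then show "proj c (g *v x) = proj c x" by simp
qed

lemma to_patch_group:
  assumes P: "patch c D" and c: "c' \<in> atlas M" and g: "g \<in> grp c'" and x: "x \<in> preimg c D c'"
  shows "g *v x \<in> preimg c D c'" "to_patch c D c' (g *v x) = to_patch c D c' x"
    "to_patch' c D c' x = to_patch' c D c' (g *v x) \<circ> (*v) g"
proof -
  note gl = group_lift[OF c g]
  have xl: "x \<in> lift c'" using x preimg_subset by blast
  show "g *v x \<in> preimg c D c'" using x gl[OF xl] by (simp add: preimg_def)
  show "to_patch c D c' (g *v x) = to_patch c D c' x" using gl[OF xl] by (simp add: to_patch_def)
  show "to_patch' c D c' x = to_patch' c D c' (g *v x) \<circ> (*v) g"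
  proof (rule to_patch_chain[OF P c c preimg_open[OF P c] x preimg_subset _ _ x])
    show "((*v) g has_derivative (*v) g) (at x)"
      by (intro bounded_linear_imp_has_derivative linear_conv_bounded_linear[THEN iffD1] matrix_vector_mul_linear)
    show "g *v z \<in> lift c' \<and> proj c' (g *v z) = proj c' z" if "z \<in> preimg c D c'" for z
      using gl[of z] that preimg_subset by blast
  qed
qed

text \<open>A boundary point seen in a half-space chart would be interior to the lift, yet a small
  step downwards leaves the half-space. Forms extended by zero from a patch thus vanish at the
  boundary.\<close>

lemma preimg_boundary:
  assumes "patch c D" "c' \<in> atlas M" "y \<in> preimg c D c'"
  shows "proj c' y \<notin> orb_boundary M"
proof
  assume "proj c' y \<in> orb_boundary M"
  then obtain c'' z where z: "c'' \<in> atlas M" "z \<in> lift_boundary c''" "proj c' y = proj c'' z"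
    unfolding orb_boundary_def by blast
  have zl: "z \<in> lift c''" "lift c'' \<subseteq> half_space" "z $ 7 = 0" using z(2) by (auto simp: lift_boundary_def)
  have "z \<in> preimg c D c''" using assms(3) z(3) zl by (simp add: preimg_def)
  then have "z \<in> interior (lift c'')" by (rule preimg_interior[OF assms(1) z(1)])
  then obtain e where e: "e > 0" "ball z e \<subseteq> lift c''" unfolding mem_interior by blast
  let ?y = "z - (e/2) *\<^sub>R axis 7 1"
  have "dist z ?y = e / 2" using e by (simp add: dist_norm)
  then have "?y \<in> lift c''" using e by auto
  then have "?y $ 7 \<ge> 0" using zl by (auto simp: half_space_def)
  then show False using e zl by simp
qed

end

section \<open>Extending forms from a patch\<close>

lemma alternating_formD:
  assumes "alternating_form k w"
  shows "(\<forall>i<k. v i = v' i) \<Longrightarrow> w v = w v'" "i < k \<Longrightarrow> linear (\<lambda>x. w (v(i := x)))"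
    "i < k \<Longrightarrow> j < k \<Longrightarrow> i \<noteq> j \<Longrightarrow> v i = v j \<Longrightarrow> w v = 0"
proof -
  have "\<forall>v v'. (\<forall>i<k. v i = v' i) \<longrightarrow> w v = w v'" "\<forall>v. \<forall>i<k. linear (\<lambda>x. w (v(i := x)))"
    "\<forall>v. \<forall>i<k. \<forall>j<k. i \<noteq> j \<and> v i = v j \<longrightarrow> w v = 0"
    using assms unfolding alternating_form_def by - (elim conjE, assumption)+
  then show "(\<forall>i<k. v i = v' i) \<Longrightarrow> w v = w v'" "i < k \<Longrightarrow> linear (\<lambda>x. w (v(i := x)))"
    "i < k \<Longrightarrow> j < k \<Longrightarrow> i \<noteq> j \<Longrightarrow> v i = v j \<Longrightarrow> w v = 0"
    by simp_all
qed

lemma alternating_form_pullback: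
  assumes "alternating_form k w" "linear L"
  shows "alternating_form k (pullback L w)"
proof -
  note a = alternating_formD[OF assms(1)]
  have "linear (\<lambda>x. pullback L w (v(i := x)))" if "i < k" for v i
  proof -
    have "pullback L w (v(i := x)) = w ((\<lambda>j. L (v j))(i := L x))" for x
      unfolding pullback_def by (rule arg_cong[of _ _ w]) auto
    then show ?thesis using linear_compose[OF assms(2) a(2)[OF that]] by (simp add: o_def)
  qed
  moreover have "pullback L w v = pullback L w v'" if "\<forall>i<k. v i = v' i" for v v'
    unfolding pullback_def by (rule a(1)) (use that in simp)
  moreover have "pullback L w v = 0" if "i < k" "j < k" "i \<noteq> j" "v i = v j" for v i j
    unfolding pullback_def by (rule a(3)[of i j]) (use that in simp_all)
  ultimately show ?thesis unfolding alternating_form_def by (intro conjI allI impI) (assumption | elim conjE)+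
qed

lemma alternating_form_add:
  assumes "alternating_form k w" "alternating_form k w'"
  shows "alternating_form k (\<lambda>v. w v + w' v)"
proof -
  note a = alternating_formD[OF assms(1)] and b = alternating_formD[OF assms(2)]
  show ?thesis
    unfolding alternating_form_def
  proof (intro conjI allI impI)
    show "w v + w' v = w v' + w' v'" if "\<forall>i<k. v i = v' i" for v v' using a(1)[of v v'] b(1)[of v v'] that by simp
    show "linear (\<lambda>x. w (v(i := x)) + w' (v(i := x)))" if "i < k" for v i
      by (rule linear_compose_add[OF a(2)[OF that] b(2)[OF that]])
    show "w v + w' v = 0" if "i < k" "j < k" "i \<noteq> j \<and> v i = v j" for v i j
      using a(3)[of i j v] b(3)[of i j v] that by simp
  qed
qed

lemma alternating_form_zero: "alternating_form k (\<lambda>v. 0)"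
  by (simp add: alternating_form_def module_hom_zero)

lemma smooth_on_nth: "smooth_on S f \<Longrightarrow> smooth_on S (\<lambda>x. (f x :: R7) $ i)"
  by (rule smooth_on_compose[of S f UNIV "\<lambda>x. x $ i"]) (auto intro: smooth_on_bounded_linear bounded_linear_vec_nth)

lemma deriv_2form_expand:
  assumes B: "smooth_2form B"
  shows "deriv_2form B x h a b = (\<Sum>i\<in>UNIV. \<Sum>j\<in>UNIV. a $ i * b $ j * deriv_2form B x h (axis i 1) (axis j 1))"
proof -
  have bil: "bilinear (B x)" for x using B by (simp add: smooth_2form_def)
  have d: "((\<lambda>x. B x (axis i 1) (axis j 1)) has_derivative (\<lambda>h. deriv_2form B x h (axis i 1) (axis j 1))) (at x)" for i j
    unfolding deriv_2form_def by (rule smooth_on_has_derivative[OF open_UNIV]) (use B in \<open>simp_all add: smooth_2form_def\<close>)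
  have "((\<lambda>x. \<Sum>i\<in>UNIV. \<Sum>j\<in>UNIV. a $ i * b $ j * B x (axis i 1) (axis j 1)) has_derivative
     (\<lambda>h. \<Sum>i\<in>UNIV. \<Sum>j\<in>UNIV. a $ i * b $ j * deriv_2form B x h (axis i 1) (axis j 1))) (at x)"
    by (intro has_derivative_sum has_derivative_mult_right d)
  moreover have "B x a b = (\<Sum>i\<in>UNIV. \<Sum>j\<in>UNIV. a $ i * b $ j * B x (axis i 1) (axis j 1))" for x
    by (rule bilinear_expand[OF bil])
  ultimately have "((\<lambda>x. B x a b) has_derivative
     (\<lambda>h. \<Sum>i\<in>UNIV. \<Sum>j\<in>UNIV. a $ i * b $ j * deriv_2form B x h (axis i 1) (axis j 1))) (at x)"
    by simp
  then show ?thesis unfolding deriv_2form_def[of B x h a b] by (simp add: frechet_derivative_eq)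
qed

lemma deriv_2form_linear:
  assumes B: "smooth_2form B"
  shows "linear (\<lambda>h. deriv_2form B x h a b)" "linear (\<lambda>a. deriv_2form B x h a b)" "linear (\<lambda>b. deriv_2form B x h a b)"
    "deriv_2form B x h a a = 0" "deriv_2form B x h b a = - deriv_2form B x h a b"
proof -
  have "((\<lambda>x. B x a b) has_derivative (\<lambda>h. deriv_2form B x h a b)) (at x)"
    unfolding deriv_2form_def by (rule smooth_on_has_derivative[OF open_UNIV]) (use B in \<open>simp_all add: smooth_2form_def\<close>)
  then show "linear (\<lambda>h. deriv_2form B x h a b)" by (rule has_derivative_linear)
  have la: "linear (\<lambda>a. deriv_2form B x h a b)" for b
  proof -
    have "linear (\<lambda>a. \<Sum>i\<in>UNIV. \<Sum>j\<in>UNIV. a $ i * b $ j * deriv_2form B x h (axis i 1) (axis j 1))"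
      by (rule linearI) (simp_all add: algebra_simps sum.distrib sum_distrib_left)
    moreover have "(\<lambda>a. deriv_2form B x h a b) = (\<lambda>a. \<Sum>i\<in>UNIV. \<Sum>j\<in>UNIV. a $ i * b $ j * deriv_2form B x h (axis i 1) (axis j 1))"
      by (rule ext) (rule deriv_2form_expand[OF B])
    ultimately show ?thesis by (simp only:)
  qed
  have lb: "linear (\<lambda>b. deriv_2form B x h a b)" for a
  proof -
    have "linear (\<lambda>b. \<Sum>i\<in>UNIV. \<Sum>j\<in>UNIV. a $ i * b $ j * deriv_2form B x h (axis i 1) (axis j 1))"
      by (rule linearI) (simp_all add: algebra_simps sum.distrib sum_distrib_left)
    moreover have "(\<lambda>b. deriv_2form B x h a b) = (\<lambda>b. \<Sum>i\<in>UNIV. \<Sum>j\<in>UNIV. a $ i * b $ j * deriv_2form B x h (axis i 1) (axis j 1))"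
      by (rule ext) (rule deriv_2form_expand[OF B])
    ultimately show ?thesis by (simp only:)
  qed
  show "linear (\<lambda>a. deriv_2form B x h a b)" "linear (\<lambda>b. deriv_2form B x h a b)" by (rule la, rule lb)
  have z: "deriv_2form B x h a a = 0" for a
    using B unfolding deriv_2form_def smooth_2form_def by simp
  then show "deriv_2form B x h a a = 0" .
  have "deriv_2form B x h (a + b) (a + b) = deriv_2form B x h a a + deriv_2form B x h a b + (deriv_2form B x h b a + deriv_2form B x h b b)"
    by (simp only: linear_add[OF la] linear_add[OF lb])
  then show "deriv_2form B x h b a = - deriv_2form B x h a b" using z by simp
qed

definition form2 :: "(R7 \<Rightarrow> R7 \<Rightarrow> R7 \<Rightarrow> real) \<Rightarrow> R7 \<Rightarrow> pform" where
  "form2 B x v = B x (v 0) (v 1)"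

definition dform2 :: "(R7 \<Rightarrow> R7 \<Rightarrow> R7 \<Rightarrow> real) \<Rightarrow> R7 \<Rightarrow> pform" where
  "dform2 B x v = deriv_2form B x (v 0) (v 1) (v 2) - deriv_2form B x (v 1) (v 0) (v 2) + deriv_2form B x (v 2) (v 0) (v 1)"

lemma alternating_form2:
  assumes B: "smooth_2form B"
  shows "alternating_form 2 (form2 B x)"
proof -
  have bil: "linear (\<lambda>a. B x a b)" "linear (B x a)" "B x a a = 0" for a b using B by (auto simp: smooth_2form_def bilinear_def)
  have l2: "(\<forall>i<2::nat. P i) \<longleftrightarrow> P 0 \<and> P 1" for P by (auto simp: less_2_cases_iff)
  show ?thesis
    unfolding alternating_form_def form2_def l2 using bil by simp
qed

lemma alternating_dform2:
  assumes B: "smooth_2form B"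
  shows "alternating_form 3 (dform2 B x)"
proof -
  note L = deriv_2form_linear[OF B]
  have l: "linear (\<lambda>y. f y - g y + h y)" if "linear f" "linear g" "linear h" for f g h :: "R7 \<Rightarrow> real"
    by (intro linear_compose_add linear_compose_sub that)
  show ?thesis
    unfolding alternating_form_3 dform2_def vec3_simps
  proof (intro conjI allI l L(1-3))
    show "deriv_2form B x a b a - deriv_2form B x b a a + deriv_2form B x a a b = 0" for a b
      using L(5)[of x a b a] L(4)[of x b a] by simp
  qed (simp_all add: L(4))
qed

context oriented_orb
begin

text \<open>Extension by zero of a form on a patch: in each chart the pullback along
  \<open>to_patch\<close> over the patch, and zero elsewhere.\<close>

definition globform :: "'a chart \<Rightarrow> R7 set \<Rightarrow> (R7 \<Rightarrow> pform) \<Rightarrow> 'a dform" where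
  "globform c D w c' y v = (if y \<in> preimg c D c'
     then pullback (to_patch' c D c' y) (w (to_patch c D c' y)) v else 0)"

text \<open>Here the Hausdorff property enters: the support of an extended form is closed in the
  orbifold, so the extension vanishes near every point off the patch.\<close>

lemma proj_compact_closed:
  assumes "c \<in> atlas M" "compact K" "K \<subseteq> lift c"
  shows "closedin (space_of M) (proj c ` K)"
proof -
  have "compactin (top_of_set (lift c)) K"
    using assms by (simp add: compactin_subtopology)
  then have "compactin (space_of M) (proj c ` K)"
    using proj_continuous[OF assms(1)] by (rule image_compactin)
  then show ?thesis using hausdorff by (simp add: compactin_imp_closedin)
qed

lemma off_closed_open:
  assumes "c' \<in> atlas M" "closedin (space_of M) S"
  obtains T where "open T" "\<And>y. y \<in> lift c' \<Longrightarrow> y \<in> T \<longleftrightarrow> proj c' y \<notin> S"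
proof -
  have "openin (space_of M) (topspace (space_of M) - S)" using assms(2) by (simp add: openin_diff)
  then have "openin (top_of_set (lift c')) {y \<in> topspace (top_of_set (lift c')). proj c' y \<in> topspace (space_of M) - S}"
    by (rule openin_continuous_map_preimage[OF proj_continuous[OF assms(1)]])
  then obtain T where T: "open T" "{y \<in> topspace (top_of_set (lift c')). proj c' y \<in> topspace (space_of M) - S} = lift c' \<inter> T"
    unfolding openin_open by blast
  have "y \<in> T \<longleftrightarrow> proj c' y \<notin> S" if "y \<in> lift c'" for y
    using T(2) that proj_in_topspace[OF assms(1) that] by auto
  then show thesis using that T(1) by blast
qed

text \<open>At a boundary point the derivative within a lift is still unique, because a small
  positive step along any coordinate axis stays in the half-space.\<close>

lemma lift_frechet_derivative:
  assumes "c \<in> atlas M" "y \<in> lift c" "(f has_derivative D) (at y within lift c)"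
  shows "frechet_derivative f (at y within lift c) = D"
proof (rule frechet_derivative_unique_within[OF _ assms(3)])
  show "(f has_derivative frechet_derivative f (at y within lift c)) (at y within lift c)"
    using assms(3) by (metis differentiableI frechet_derivative_works)
next
  fix i :: R7 and e :: real assume i: "i \<in> Basis" and e: "e > 0"
  obtain T H where T: "open T" "lift c = H \<inter> T" "H = UNIV \<or> H = half_space"
    using lift_cases[OF assms(1)] .
  have "y \<in> T" using T(2) assms(2) by blast
  then obtain r where r: "r > 0" "ball y r \<subseteq> T" using T(1) openE by blast
  define d where "d = min r e / 2"
  have d: "d > 0" "d < e" "d < r" using r e by (auto simp: d_def)
  have "y + d *\<^sub>R i \<in> T" using d i r(2) by (auto simp: dist_norm)
  moreover have "y + d *\<^sub>R i \<in> H"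
  proof (cases "H = UNIV")
    case False
    then have H: "H = half_space" using T(3) by simp
    obtain k where "i = axis k 1" using i by (auto simp: Basis_vec_def)
    moreover have "y $ 7 \<ge> 0" using assms(2) T(2) H by (auto simp: half_space_def)
    ultimately show ?thesis using H d by (simp add: half_space_def axis_def)
  qed simp
  ultimately have "y + d *\<^sub>R i \<in> lift c" using T(2) by blast
  then show "\<exists>d. 0 < \<bar>d\<bar> \<and> \<bar>d\<bar> < e \<and> y + d *\<^sub>R i \<in> lift c" using d by (intro exI[of _ d]) simp
qed

lemma globform_off_support:
  assumes "\<And>x v. x \<notin> K \<Longrightarrow> w x v = 0" "y \<in> lift c'" "proj c' y \<notin> proj c ` K"
  shows "globform c D w c' y v = 0"
proof -
  have "to_patch c D c' y \<notin> K" if "y \<in> preimg c D c'"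
    using to_patch_in(2)[OF that] assms(3) by (metis image_eqI)
  then show ?thesis using assms(1) by (auto simp: globform_def pullback_def)
qed

lemma is_form_globform:
  assumes P: "patch c D" and K: "compact K" "K \<subseteq> D" "\<And>x v. x \<notin> K \<Longrightarrow> w x v = 0"
    and alt: "\<And>x. alternating_form k (w x)"
    and sm: "\<And>c' v. c' \<in> atlas M \<Longrightarrow>
       smooth_on (preimg c D c') (\<lambda>y. pullback (to_patch' c D c' y) (w (to_patch c D c' y)) v)"
  shows "is_form M k (globform c D w)"
proof -
  have c: "c \<in> atlas M" "D \<subseteq> lift c" using P by (auto simp: patch_def)
  have cl: "closedin (space_of M) (proj c ` K)"
    using proj_compact_closed[OF c(1) K(1)] K(2) c(2) by blast
  have lin: "linear (to_patch' c D c' y)" if "c' \<in> atlas M" "y \<in> preimg c D c'" for c' y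
    using to_patch_has_derivative[OF P that] by (rule has_derivative_linear)
  show ?thesis
    unfolding is_form_def smooth_form_on_def
  proof (intro conjI ballI allI impI)
    fix c' y assume c': "c' \<in> atlas M" and y: "y \<in> lift c'"
    show "alternating_form k (globform c D w c' y)"
    proof (cases "y \<in> preimg c D c'")
      case True
      then have "globform c D w c' y = pullback (to_patch' c D c' y) (w (to_patch c D c' y))"
        by (simp add: globform_def fun_eq_iff)
      then show ?thesis using alternating_form_pullback[OF alt lin[OF c' True]] by simp
    next
      case False
      then have "globform c D w c' y = (\<lambda>v. 0)" by (simp add: globform_def fun_eq_iff)
      then show ?thesis by (simp add: alternating_form_zero)
    qed
  next
    fix c' v assume c': "c' \<in> atlas M"
    show "smooth_on (lift c') (\<lambda>x. globform c D w c' x v)"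
    proof (rule smooth_on_local)
      fix y assume y: "y \<in> lift c'"
      show "\<exists>U g. open U \<and> y \<in> U \<and> smooth_on (lift c' \<inter> U) g \<and> (\<forall>z\<in>lift c' \<inter> U. g z = globform c D w c' z v)"
      proof (cases "y \<in> preimg c D c'")
        case True
        have "lift c' \<inter> preimg c D c' = preimg c D c'" using preimg_subset by blast
        then show ?thesis using True sm[OF c'] preimg_open[OF P c']
          by (intro exI[of _ "preimg c D c'"] exI[of _ "\<lambda>y. pullback (to_patch' c D c' y) (w (to_patch c D c' y)) v"])
            (simp add: globform_def)
      next
        case False
        obtain T where T: "open T" "\<And>y. y \<in> lift c' \<Longrightarrow> y \<in> T \<longleftrightarrow> proj c' y \<notin> proj c ` K"
          using off_closed_open[OF c' cl] by blast
        have "y \<in> T" using T(2)[OF y] False y K(2) by (auto simp: preimg_def)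
        moreover have "0 = globform c D w c' z v" if "z \<in> lift c' \<inter> T" for z
          using globform_off_support[OF K(3), where y = z and c' = c' and c = c] T(2)[of z] that by simp
        ultimately show ?thesis using T(1)
          by (intro exI[of _ T] exI[of _ "\<lambda>z. 0"]) simp
      qed
    qed
  next
    fix c' g y assume c': "c' \<in> atlas M" and g: "g \<in> grp c'" and y: "y \<in> lift c'"
    note gl = group_lift[OF c' g y]
    show "pullback (\<lambda>u. g *v u) (globform c D w c' (g *v y)) = globform c D w c' y"
    proof (cases "y \<in> preimg c D c'")
      case True
      note G = to_patch_group[OF P c' g True]
      show ?thesis using True G by (simp add: globform_def pullback_def fun_eq_iff)
    next
      case False
      then have "g *v y \<notin> preimg c D c'" using gl y by (simp add: preimg_def)
      then show ?thesis using False by (simp add: globform_def pullback_def fun_eq_iff)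
    qed
  next
    fix c1 c2 V F y assume c12: "c1 \<in> atlas M" "c2 \<in> atlas M" and F: "transition c1 c2 V F" and y: "y \<in> V"
    note tp = transition_preimg(4,5)[OF F y, of c D]
    show "pullback (tangent_map V F y) (globform c D w c2 (F y)) = globform c D w c1 y"
    proof (cases "y \<in> preimg c D c1")
      case True
      show ?thesis using True tp to_patch_transition[OF P c12 F y True] by (simp add: globform_def pullback_def fun_eq_iff)
    next
      case False
      then show ?thesis using tp by (simp add: globform_def pullback_def fun_eq_iff)
    qed
  qed
qed

lemma to_patch'_smooth:
  assumes "patch c D" "c' \<in> atlas M"
  shows "smooth_on (preimg c D c') (\<lambda>y. to_patch' c D c' y v)"
  unfolding to_patch'_def by (rule smooth_on_frechet_derivative[OF preimg_open[OF assms] to_patch_smooth[OF assms]])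

lemma is_form_glob2:
  assumes P: "patch c D" and K: "compact K" "K \<subseteq> D" "\<And>x a b. x \<notin> K \<Longrightarrow> B x a b = 0" and B: "smooth_2form B"
  shows "is_form M 2 (globform c D (form2 B))"
proof (rule is_form_globform[OF P K(1,2) _ alternating_form2[OF B]])
  show "form2 B x v = 0" if "x \<notin> K" for x v using K(3)[OF that] by (simp add: form2_def)
  fix c' :: "'a chart" and v :: "nat \<Rightarrow> R7" assume c': "c' \<in> atlas M"
  have bil: "bilinear (B x)" for x using B by (simp add: smooth_2form_def)
  have "smooth_on (preimg c D c') (\<lambda>y. \<Sum>i\<in>UNIV. \<Sum>j\<in>UNIV. to_patch' c D c' y (v 0) $ i * to_patch' c D c' y (v 1) $ j
     * B (to_patch c D c' y) (axis i 1) (axis j 1))"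
    by (intro smooth_on_sum smooth_on_mult smooth_on_nth to_patch'_smooth[OF P c']
        smooth_on_compose[OF to_patch_smooth[OF P c'], of UNIV "\<lambda>x. B x (axis i 1) (axis j 1)" for i j])
      (use B in \<open>auto simp: smooth_2form_def\<close>)
  moreover have "pullback (to_patch' c D c' y) (form2 B (to_patch c D c' y)) v =
     (\<Sum>i\<in>UNIV. \<Sum>j\<in>UNIV. to_patch' c D c' y (v 0) $ i * to_patch' c D c' y (v 1) $ j
     * B (to_patch c D c' y) (axis i 1) (axis j 1))" for y
    unfolding pullback_def form2_def by (rule bilinear_expand[OF bil])
  ultimately show "smooth_on (preimg c D c') (\<lambda>y. pullback (to_patch' c D c' y) (form2 B (to_patch c D c' y)) v)"
    by (simp only:)
qed

lemma is_form_globd2: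
  assumes P: "patch c D" and K: "compact K" "K \<subseteq> D" "\<And>x a b. x \<notin> K \<Longrightarrow> B x a b = 0" and B: "smooth_2form B"
  shows "\<And>x v. x \<notin> K \<Longrightarrow> dform2 B x v = 0" "is_form M 3 (globform c D (dform2 B))"
proof -
  have d0: "deriv_2form B x h a b = 0" if "x \<notin> K" for x h a b
  proof -
    have "frechet_derivative (\<lambda>x. B x a b) (at x) = frechet_derivative (\<lambda>x. 0) (at x)"
      by (rule frechet_derivative_germ(2)[of "- K"]) (use that K in \<open>auto simp: compact_imp_closed\<close>)
    then show ?thesis unfolding deriv_2form_def by simp
  qed
  show z: "dform2 B x v = 0" if "x \<notin> K" for x v using d0[OF that] by (simp add: dform2_def)
  show "is_form M 3 (globform c D (dform2 B))"
  proof (rule is_form_globform[OF P K(1,2) z alternating_dform2[OF B]])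
    fix c' :: "'a chart" and v :: "nat \<Rightarrow> R7" assume c': "c' \<in> atlas M"
    note ex = alternating_form_3_expand[OF alternating_dform2[OF B]]
    have smb: "smooth_on UNIV (\<lambda>x. deriv_2form B x h a b)" for h a b
      unfolding deriv_2form_def by (rule smooth_on_frechet_derivative) (use B in \<open>auto simp: smooth_2form_def\<close>)
    have smd: "smooth_on UNIV (\<lambda>x. dform2 B x v)" for v
    proof -
      have "smooth_on UNIV (\<lambda>x. deriv_2form B x (v 0) (v 1) (v 2) + (-1) * deriv_2form B x (v 1) (v 0) (v 2) + deriv_2form B x (v 2) (v 0) (v 1))"
        by (intro smooth_on_add smooth_on_mult smb smooth_on_const)
      then show ?thesis by (simp add: dform2_def)
    qed
    have "smooth_on (preimg c D c') (\<lambda>y. \<Sum>i\<in>UNIV. \<Sum>j\<in>UNIV. \<Sum>k\<in>UNIV. to_patch' c D c' y (v 0) $ i * to_patch' c D c' y (v 1) $ j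
       * to_patch' c D c' y (v 2) $ k * dform2 B (to_patch c D c' y) (vec3 (axis i 1) (axis j 1) (axis k 1)))"
      by (intro smooth_on_sum smooth_on_mult smooth_on_nth to_patch'_smooth[OF P c']
          smooth_on_compose[OF to_patch_smooth[OF P c'] smd]) simp
    moreover have "pullback (to_patch' c D c' y) (dform2 B (to_patch c D c' y)) v =
       dform2 B (to_patch c D c' y) (vec3 (to_patch' c D c' y (v 0)) (to_patch' c D c' y (v 1)) (to_patch' c D c' y (v 2)))" for y
      by (simp add: pullback_def dform2_def)
    ultimately show "smooth_on (preimg c D c') (\<lambda>y. pullback (to_patch' c D c' y) (dform2 B (to_patch c D c' y)) v)"
      by (simp only: ex[of _ "to_patch' c D c' y (v 0)" "to_patch' c D c' y (v 1)" "to_patch' c D c' y (v 2)" for y])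
  qed
qed

lemma ext_deriv_2:
  "ext_deriv 2 S w x v = frechet_derivative (\<lambda>y. w y (\<lambda>j. v (Suc j))) (at x within S) (v 0)
     - frechet_derivative (\<lambda>y. w y (\<lambda>j. v (if j < 1 then j else Suc j))) (at x within S) (v 1)
     + frechet_derivative (\<lambda>y. w y (\<lambda>j. v (if j < 2 then j else Suc j))) (at x within S) (v 2)"
proof -
  have "{..2::nat} = {0, 1, 2}" by auto
  then show ?thesis unfolding ext_deriv_def by simp
qed

text \<open>Over the patch this is naturality of the exterior derivative. At any other point the
  form vanishes on a neighbourhood in the lift, where \<open>lift_frechet_derivative\<close> also
  fixes the derivative at boundary points.\<close>

lemma ext_d_globform:
  assumes P: "patch c D" and K: "compact K" "K \<subseteq> D" "\<And>x a b. x \<notin> K \<Longrightarrow> B x a b = 0" and B: "smooth_2form B"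
    and c': "c' \<in> atlas M" and y: "y \<in> lift c'"
  shows "ext_d 2 (globform c D (form2 B)) c' y v = globform c D (dform2 B) c' y v"
proof (cases "y \<in> preimg c D c'")
  case True
  let ?f = "to_patch c D c'"
  note O = preimg_open[OF P c']
  have at: "at y within lift c' = at y" by (rule at_within_interior[OF preimg_interior[OF P c' True]])
  have C: "Ck_on (Suc (Suc 0)) ?f (preimg c D c')" by (rule smooth_on_open[OF O to_patch_smooth[OF P c']])
  have g: "frechet_derivative (\<lambda>y. globform c D (form2 B) c' y u) (at y) =
     frechet_derivative (\<lambda>y. B (?f y) (frechet_derivative ?f (at y) (u 0)) (frechet_derivative ?f (at y) (u 1))) (at y)" for u
    by (rule frechet_derivative_germ(2)[OF O True]) (simp_all add: globform_def pullback_def form2_def to_patch'_def)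
  show ?thesis
    unfolding ext_d_def ext_deriv_2 at g
    using pullback_deriv_2form(1)[OF B O True C, of "v 1" "v 2" "v 0"] True
    by (simp add: globform_def pullback_def dform2_def to_patch'_def numeral_2_eq_2)
next
  case False
  have c: "c \<in> atlas M" "D \<subseteq> lift c" using P by (auto simp: patch_def)
  have cl: "closedin (space_of M) (proj c ` K)"
    using proj_compact_closed[OF c(1) K(1)] K(2) c(2) by blast
  obtain T where T: "open T" "\<And>y. y \<in> lift c' \<Longrightarrow> y \<in> T \<longleftrightarrow> proj c' y \<notin> proj c ` K"
    using off_closed_open[OF c' cl] by blast
  have yT: "y \<in> T" using T(2)[OF y] False y K(2) by (auto simp: preimg_def)
  have z: "frechet_derivative (\<lambda>y. globform c D (form2 B) c' y u) (at y within lift c') = (\<lambda>v. 0)" for u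
  proof -
    have "globform c D (form2 B) c' z u = 0" if "z \<in> T \<inter> lift c'" for z
      by (rule globform_off_support[of K]) (use that T(2) K(3) in \<open>auto simp: form2_def\<close>)
    then have "frechet_derivative (\<lambda>y. globform c D (form2 B) c' y u) (at y within lift c') = frechet_derivative (\<lambda>y. 0) (at y within lift c')"
      by (intro frechet_derivative_germ(2)[OF T(1) yT y]) simp
    also have "\<dots> = (\<lambda>v. 0)" by (rule lift_frechet_derivative[OF c' y]) simp
    finally show ?thesis .
  qed
  show ?thesis
    unfolding ext_d_def ext_deriv_2 z using False by (simp add: globform_def)
qed

lemma is_formD:
  assumes "is_form M k w"
  shows "c \<in> atlas M \<Longrightarrow> x \<in> lift c \<Longrightarrow> alternating_form k (w c x)"
    "c \<in> atlas M \<Longrightarrow> smooth_on (lift c) (\<lambda>x. w c x v)"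
    "c \<in> atlas M \<Longrightarrow> g \<in> grp c \<Longrightarrow> x \<in> lift c \<Longrightarrow> pullback (\<lambda>u. g *v u) (w c (g *v x)) = w c x"
    "c1 \<in> atlas M \<Longrightarrow> c2 \<in> atlas M \<Longrightarrow> transition c1 c2 V f \<Longrightarrow> x \<in> V \<Longrightarrow> pullback (tangent_map V f x) (w c2 (f x)) = w c1 x"
proof -
  have "\<forall>c\<in>atlas M. (\<forall>x\<in>lift c. alternating_form k (w c x)) \<and> (\<forall>v. smooth_on (lift c) (\<lambda>x. w c x v))"
    "\<forall>c\<in>atlas M. \<forall>g\<in>grp c. \<forall>x\<in>lift c. pullback (\<lambda>u. g *v u) (w c (g *v x)) = w c x"
    "\<forall>c1\<in>atlas M. \<forall>c2\<in>atlas M. \<forall>V f. transition c1 c2 V f \<longrightarrow>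
        (\<forall>x\<in>V. pullback (tangent_map V f x) (w c2 (f x)) = w c1 x)"
    using assms unfolding is_form_def smooth_form_on_def by - (elim conjE, assumption)+
  then show "c \<in> atlas M \<Longrightarrow> x \<in> lift c \<Longrightarrow> alternating_form k (w c x)"
    "c \<in> atlas M \<Longrightarrow> smooth_on (lift c) (\<lambda>x. w c x v)"
    "c \<in> atlas M \<Longrightarrow> g \<in> grp c \<Longrightarrow> x \<in> lift c \<Longrightarrow> pullback (\<lambda>u. g *v u) (w c (g *v x)) = w c x"
    "c1 \<in> atlas M \<Longrightarrow> c2 \<in> atlas M \<Longrightarrow> transition c1 c2 V f \<Longrightarrow> x \<in> V \<Longrightarrow> pullback (tangent_map V f x) (w c2 (f x)) = w c1 x"
    by simp_all
qed

lemma is_form_add: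
  assumes "is_form M k w" "is_form M k w'"
  shows "is_form M k (\<lambda>c x v. w c x v + w' c x v)"
  unfolding is_form_def smooth_form_on_def
proof (intro conjI ballI allI impI)
  note W = is_formD[OF assms(1)] and W' = is_formD[OF assms(2)]
  show "alternating_form k (\<lambda>v. w c x v + w' c x v)" if "c \<in> atlas M" "x \<in> lift c" for c x
    by (intro alternating_form_add W(1) W'(1) that)
  show "smooth_on (lift c) (\<lambda>x. w c x v + w' c x v)" if "c \<in> atlas M" for c v
    by (intro smooth_on_add W(2) W'(2) that)
  show "pullback (\<lambda>u. g *v u) (\<lambda>v. w c (g *v x) v + w' c (g *v x) v) = (\<lambda>v. w c x v + w' c x v)"
    if "c \<in> atlas M" "g \<in> grp c" "x \<in> lift c" for c g x
    using W(3)[OF that] W'(3)[OF that] by (simp add: pullback_def fun_eq_iff)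
  show "pullback (tangent_map V f x) (\<lambda>v. w c2 (f x) v + w' c2 (f x) v) = (\<lambda>v. w c1 x v + w' c1 x v)"
    if "c1 \<in> atlas M" "c2 \<in> atlas M" "transition c1 c2 V f" "x \<in> V" for c1 c2 V f x
    using W(4)[OF that] W'(4)[OF that] by (simp add: pullback_def fun_eq_iff)
qed

lemma is_form_cong:
  assumes "is_form M k w" "\<And>c x v. c \<in> atlas M \<Longrightarrow> x \<in> lift c \<Longrightarrow> w' c x v = w c x v"
  shows "is_form M k w'"
proof -
  note W = is_formD[OF assms(1)]
  have eq: "w' c x = w c x" if "c \<in> atlas M" "x \<in> lift c" for c x
    using assms(2)[OF that] by (simp add: fun_eq_iff)
  show ?thesis
    unfolding is_form_def smooth_form_on_def
  proof (intro conjI ballI allI impI)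
    show "alternating_form k (w' c x)" if "c \<in> atlas M" "x \<in> lift c" for c x
      unfolding eq[OF that] by (rule W(1)[OF that])
    show "smooth_on (lift c) (\<lambda>x. w' c x v)" if "c \<in> atlas M" for c v
      by (rule smooth_on_cong_imp[OF W(2)[OF that]]) (use assms(2) that in simp)
    show "pullback (\<lambda>u. g *v u) (w' c (g *v x)) = w' c x"
      if "c \<in> atlas M" "g \<in> grp c" "x \<in> lift c" for c g x
      using W(3)[OF that] eq[OF that(1,3)] eq[OF that(1) group_lift(1)[OF that]] by simp
    show "pullback (tangent_map V f x) (w' c2 (f x)) = w' c1 x"
      if "c1 \<in> atlas M" "c2 \<in> atlas M" "transition c1 c2 V f" "x \<in> V" for c1 c2 V f x
      using W(4)[OF that] eq[OF that(1) transition_preimg(1)[OF that(3,4)]] eq[OF that(2) transition_preimg(2)[OF that(3,4)]] by simp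
  qed
qed

lemma ext_d_add:
  assumes "is_form M 2 w" "is_form M 2 w'" "c \<in> atlas M" "x \<in> lift c"
  shows "ext_d 2 (\<lambda>c x v. w c x v + w' c x v) c x v = ext_d 2 w c x v + ext_d 2 w' c x v"
proof -
  have d: "frechet_derivative (\<lambda>y. w c y u + w' c y u) (at x within lift c) h =
    frechet_derivative (\<lambda>y. w c y u) (at x within lift c) h + frechet_derivative (\<lambda>y. w' c y u) (at x within lift c) h" for u h
  proof -
    have "((\<lambda>y. w c y u) has_derivative frechet_derivative (\<lambda>y. w c y u) (at x within lift c)) (at x within lift c)"
      "((\<lambda>y. w' c y u) has_derivative frechet_derivative (\<lambda>y. w' c y u) (at x within lift c)) (at x within lift c)"
      unfolding frechet_derivative_works[symmetric]
      by (rule smooth_on_differentiable[OF is_formD(2)[OF assms(1,3)] assms(4)],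
          rule smooth_on_differentiable[OF is_formD(2)[OF assms(2,3)] assms(4)])
    from has_derivative_add[OF this]
    show ?thesis by (simp add: lift_frechet_derivative[OF assms(3,4)])
  qed
  show ?thesis unfolding ext_d_def ext_deriv_2 d by simp
qed

end

section \<open>Fundamental domains and densities\<close>

text \<open>Real integrands enter the theorem for vector-valued ones through
  \<open>real^1\<close>.\<close>

lemma change_of_variables_real:
  fixes f :: "R7 \<Rightarrow> real"
  assumes "S \<in> sets lebesgue" "\<And>x. x \<in> S \<Longrightarrow> (g has_derivative g' x) (at x within S)" "inj_on g S"
  shows "f absolutely_integrable_on (g ` S) \<longleftrightarrow> (\<lambda>x. \<bar>det (matrix (g' x))\<bar> * f (g x)) absolutely_integrable_on S"
    and "f absolutely_integrable_on (g ` S) \<Longrightarrow> integral (g ` S) f = integral S (\<lambda>x. \<bar>det (matrix (g' x))\<bar> * f (g x))"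
proof -
  let ?v = "vec :: real \<Rightarrow> real^1"
  have bv: "bounded_linear ?v"
    unfolding linear_conv_bounded_linear[symmetric] by (rule linearI) (simp_all add: vec_eq_iff)
  have ab: "(\<lambda>x. ?v (h x)) absolutely_integrable_on T \<longleftrightarrow> h absolutely_integrable_on T" for h :: "R7 \<Rightarrow> real" and T
  proof
    assume "(\<lambda>x. ?v (h x)) absolutely_integrable_on T"
    from absolutely_integrable_linear[OF this bounded_linear_vec_nth[of 1]]
    show "h absolutely_integrable_on T" by (simp add: o_def)
  next
    assume "h absolutely_integrable_on T"
    from absolutely_integrable_linear[OF this bv]
    show "(\<lambda>x. ?v (h x)) absolutely_integrable_on T" by (simp add: o_def)
  qed
  have int: "integral T (\<lambda>x. ?v (h x)) = ?v (integral T h)" if "h absolutely_integrable_on T" for h :: "R7 \<Rightarrow> real" and T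
    using integral_linear[OF _ bv, of h T] that by (simp add: o_def set_lebesgue_integral_eq_integral(1))
  have e: "\<bar>det (matrix (g' x))\<bar> *\<^sub>R ?v (f (g x)) = ?v (\<bar>det (matrix (g' x))\<bar> * f (g x))" for x
    by (simp add: vec_eq_iff)
  note cv = has_absolute_integral_change_of_variables[OF assms, of "\<lambda>x. ?v (f x)", unfolded e ab]
  show 1: "f absolutely_integrable_on (g ` S) \<longleftrightarrow> (\<lambda>x. \<bar>det (matrix (g' x))\<bar> * f (g x)) absolutely_integrable_on S"
    using cv by blast
  assume f: "f absolutely_integrable_on (g ` S)"
  have "integral (g ` S) (\<lambda>x. ?v (f x)) = integral S (\<lambda>x. ?v (\<bar>det (matrix (g' x))\<bar> * f (g x)))"
    using cv[of "integral S (\<lambda>x. ?v (\<bar>det (matrix (g' x))\<bar> * f (g x)))"] f 1 by simp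
  then have "?v (integral (g ` S) f) = ?v (integral S (\<lambda>x. \<bar>det (matrix (g' x))\<bar> * f (g x)))"
    using int[OF f] int[OF f[unfolded 1]] by simp
  then show "integral (g ` S) f = integral S (\<lambda>x. \<bar>det (matrix (g' x))\<bar> * f (g x))"
    by (simp add: vec_eq_iff)
qed

context oriented_orb
begin

lemma grp_finite: "c \<in> atlas M \<Longrightarrow> finite (grp c)"
  and grp_one: "c \<in> atlas M \<Longrightarrow> mat 1 \<in> grp c"
  and grp_mult: "c \<in> atlas M \<Longrightarrow> g \<in> grp c \<Longrightarrow> h \<in> grp c \<Longrightarrow> g ** h \<in> grp c"
  and grp_inv: "c \<in> atlas M \<Longrightarrow> g \<in> grp c \<Longrightarrow> matrix_inv g \<in> grp c"
  and grp_inv_mult: "c \<in> atlas M \<Longrightarrow> g \<in> grp c \<Longrightarrow> g ** matrix_inv g = mat 1"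
    "c \<in> atlas M \<Longrightarrow> g \<in> grp c \<Longrightarrow> matrix_inv g ** g = mat 1"
proof -
  assume c: "c \<in> atlas M"
  have f: "finite (grp c)" "mat 1 \<in> grp c" "\<forall>g\<in>grp c. \<forall>h\<in>grp c. g ** h \<in> grp c"
    "\<forall>g\<in>grp c. invertible g \<and> matrix_inv g \<in> grp c"
    using chartD(1)[OF c] unfolding finite_linear_group_def by - (elim conjE, assumption)+
  show "finite (grp c)" "mat 1 \<in> grp c" by (rule f)+
  show "g \<in> grp c \<Longrightarrow> h \<in> grp c \<Longrightarrow> g ** h \<in> grp c" using f(3) by blast
  show "g \<in> grp c \<Longrightarrow> matrix_inv g \<in> grp c" using f(4) by blast
  assume "g \<in> grp c"
  then have "invertible g" using f(4) by blast
  then have "g ** matrix_inv g = mat 1 \<and> matrix_inv g ** g = mat 1"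
    unfolding invertible_def matrix_inv_def by (rule someI_ex)
  then show "g ** matrix_inv g = mat 1" "matrix_inv g ** g = mat 1" by (rule conjunct1, rule conjunct2)
qed

lemma grp_inv_act:
  assumes "c \<in> atlas M" "g \<in> grp c"
  shows "matrix_inv g *v (g *v x) = x" "g *v (matrix_inv g *v x) = x"
  by (simp_all add: matrix_vector_mul_assoc grp_inv_mult[OF assms])

text \<open>Group elements become transitions of a chart to itself, so all facts about transitions,
  such as preservation of interior points and the density law, apply to them.\<close>

lemma group_transition:
  assumes c: "c \<in> atlas M" and g: "g \<in> grp c"
  shows "transition c c (lift c) ((*v) g)"
proof -
  have im: "(*v) g ` lift c = lift c"
  proof
    show "(*v) g ` lift c \<subseteq> lift c" using group_lift(1)[OF c g] by blast
    show "lift c \<subseteq> (*v) g ` lift c"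
    proof
      fix x assume "x \<in> lift c"
      then have "matrix_inv g *v x \<in> lift c" using group_lift(1)[OF c grp_inv[OF c g]] by blast
      then show "x \<in> (*v) g ` lift c" using grp_inv_act(2)[OF c g, of x] by (metis image_eqI)
    qed
  qed
  have bl: "bounded_linear ((*v) h)" for h :: "real^7^7"
    by (intro linear_conv_bounded_linear[THEN iffD1] matrix_vector_mul_linear)
  have inj: "inj_on ((*v) g) (lift c)"
    by (rule inj_on_inverseI[of _ "(*v) (matrix_inv g)"]) (rule grp_inv_act(1)[OF c g])
  have "smooth_on (lift c) (inv_into (lift c) ((*v) g))"
  proof (rule smooth_on_cong_imp[OF smooth_on_bounded_linear[OF bl[of "matrix_inv g"]]])
    fix x assume "x \<in> lift c"
    then have "matrix_inv g *v x \<in> lift c" using group_lift(1)[OF c grp_inv[OF c g]] by blast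
    then have "inv_into (lift c) ((*v) g) (g *v (matrix_inv g *v x)) = matrix_inv g *v x"
      by (rule inv_into_f_f[OF inj])
    then show "matrix_inv g *v x = inv_into (lift c) ((*v) g) x" by (simp add: grp_inv_act(2)[OF c g])
  qed
  then show ?thesis
    unfolding transition_def im using group_lift(2)[OF c g] inj smooth_on_bounded_linear[OF bl]
    by simp
qed

lemma group_interior:
  assumes "c \<in> atlas M" "g \<in> grp c" "x \<in> interior (lift c)"
  shows "g *v x \<in> interior (lift c)"
  by (rule transition_image_interior[OF assms(1,1) group_transition[OF assms(1,2)] subsetD[OF interior_subset assms(3)] assms(3)])

text \<open>Open and a patch at once: it absorbs the factor \<open>1 / card (grp c)\<close> of the
  integral, and it is the place where perturbations are supported. Covering up to a null set is
  enough for integration.\<close>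

definition fund_dom :: "'a chart \<Rightarrow> R7 set \<Rightarrow> bool" where
  "fund_dom c D \<longleftrightarrow> patch c D \<and> (\<forall>g\<in>grp c. \<forall>h\<in>grp c. g \<noteq> h \<longrightarrow> (*v) g ` D \<inter> (*v) h ` D = {}) \<and>
     negligible (lift c - (\<Union>g\<in>grp c. (*v) g ` D))"

lemma fund_domD:
  assumes "fund_dom c D"
  shows "patch c D" "c \<in> atlas M" "open D" "D \<subseteq> lift c" "inj_on (proj c) D"
    "negligible (lift c - (\<Union>g\<in>grp c. (*v) g ` D))" "D \<subseteq> interior (lift c)"
proof -
  show P: "patch c D" and "negligible (lift c - (\<Union>g\<in>grp c. (*v) g ` D))"
    using assms unfolding fund_dom_def by - (elim conjE, assumption)+
  show 1: "c \<in> atlas M" "open D" "D \<subseteq> lift c" "inj_on (proj c) D"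
    using P unfolding patch_def by - (elim conjE, assumption)+
  show "D \<subseteq> interior (lift c)" by (rule interior_maximal) fact+
qed

text \<open>A generic linear functional \<open>l\<close> separates the points of almost every orbit; the fundamental domain
  consists of the points at which \<open>l\<close> is largest on their orbit.\<close>

lemma fund_dom_exists:
  assumes c: "c \<in> atlas M"
  shows "\<exists>D. fund_dom c D"
proof -
  note fin = grp_finite[OF c] and inv = grp_inv_act[OF c]
  \<comment> \<open>For a nontrivial element the fixed vectors of the transposed matrix form a
    proper subspace, and finitely many null sets do not fill R^7.\<close>
  have "\<exists>l :: R7. \<forall>g\<in>grp c - {mat 1}. transpose g *v l \<noteq> l"
  proof (rule ccontr)
    assume "\<not> ?thesis"
    then have "(UNIV :: R7 set) \<subseteq> (\<Union>g\<in>grp c - {mat 1}. {l. transpose g *v l = l})" by blast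
    moreover have "negligible {l :: R7. transpose g *v l = l}" if "g \<in> grp c - {mat 1}" for g
    proof -
      have "transpose g - mat 1 \<noteq> 0"
      proof
        assume "transpose g - mat 1 = 0"
        then have "transpose (transpose g) = transpose (mat 1)" by simp
        then show False using that by (simp add: transpose_mat)
      qed
      then obtain i where i: "(transpose g - mat 1) $ i \<noteq> 0" by (auto simp: vec_eq_iff)
      have "{l. transpose g *v l = l} \<subseteq> {l. (transpose g - mat 1) $ i \<bullet> l = 0}"
      proof
        fix l assume "l \<in> {l. transpose g *v l = l}"
        then have "(transpose g - mat 1) *v l = 0" by (simp add: matrix_vector_mult_diff_rdistrib)
        then have "((transpose g - mat 1) *v l) $ i = 0" by simp
        then show "l \<in> {l. (transpose g - mat 1) $ i \<bullet> l = 0}"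
          by (simp add: matrix_vector_mul_component)
      qed
      then show ?thesis using negligible_hyperplane[of "(transpose g - mat 1) $ i" 0] i negligible_subset by blast
    qed
    then have "negligible (\<Union>g\<in>grp c - {mat 1}. {l :: R7. transpose g *v l = l})"
      using fin by (intro negligible_Union) auto
    ultimately have "negligible (UNIV :: R7 set)" using negligible_subset by blast
    then show False by simp
  qed
  then obtain l :: R7 where l: "\<And>g. g \<in> grp c \<Longrightarrow> g \<noteq> mat 1 \<Longrightarrow> transpose g *v l \<noteq> l" by blast
  have lg: "l \<bullet> (g *v x) = (transpose g *v l) \<bullet> x" for g x
    using inner_transpose[of x g l] by (simp add: inner_commute)
  \<comment> \<open>Two elements with the same image of \<open>l\<close> would make
    \<open>g ** matrix_inv h\<close> a nontrivial element whose transpose fixes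
    \<open>l\<close>.\<close>
  have sep: "transpose g *v l \<noteq> transpose h *v l" if "g \<in> grp c" "h \<in> grp c" "g \<noteq> h" for g h
  proof
    assume e: "transpose g *v l = transpose h *v l"
    define k where "k = g ** matrix_inv h"
    have "k \<in> grp c" using grp_mult[OF c that(1) grp_inv[OF c that(2)]] by (simp add: k_def)
    moreover have "k \<noteq> mat 1"
    proof
      assume "k = mat 1"
      then have "k ** h = h" by simp
      then show False using that grp_inv_mult(2)[OF c that(2)] by (simp add: k_def matrix_mul_assoc[symmetric])
    qed
    moreover have "transpose k *v l = transpose (matrix_inv h) *v (transpose h *v l)"
      by (simp only: k_def matrix_transpose_mul matrix_vector_mul_assoc[symmetric] e)
    then have "transpose k *v l = transpose (h ** matrix_inv h) *v l"
      by (simp only: matrix_transpose_mul matrix_vector_mul_assoc)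
    then have "transpose k *v l = l" by (simp add: grp_inv_mult(1)[OF c that(2)] transpose_mat)
    ultimately show False using l by blast
  qed
  define D where "D = {x \<in> interior (lift c). \<forall>g\<in>grp c - {mat 1}. l \<bullet> (g *v x) < l \<bullet> x}"
  have Dlt: "l \<bullet> (g *v x) < l \<bullet> x" if "x \<in> D" "g \<in> grp c" "g \<noteq> mat 1" for x g
    using that by (simp add: D_def)
  have "D = interior (lift c) \<inter> (\<Inter>g\<in>grp c - {mat 1}. {x. l \<bullet> (g *v x) < l \<bullet> x})"
    by (auto simp: D_def)
  moreover have "open {x. l \<bullet> (g *v x) < l \<bullet> x}" for g
    unfolding lg by (intro open_Collect_less continuous_intros)
  ultimately have oD: "open D" using fin by (simp add: open_Int open_INT)
  have DL: "D \<subseteq> lift c" unfolding D_def using interior_subset by blast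
  have orbit: "\<exists>g\<in>grp c. y = g *v x" if "x \<in> lift c" "y \<in> lift c" "proj c x = proj c y" for x y
    using chartD(8)[OF c] that by blast
  have inj: "inj_on (proj c) D"
  proof (rule inj_onI)
    fix x y assume xy: "x \<in> D" "y \<in> D" "proj c x = proj c y"
    then obtain g where g: "g \<in> grp c" "y = g *v x" using orbit DL by blast
    show "x = y"
    proof (cases "g = mat 1")
      case True then show ?thesis using g by simp
    next
      case False
      then have 1: "l \<bullet> y < l \<bullet> x" using Dlt[OF xy(1) g(1)] g(2) by simp
      have "matrix_inv g \<noteq> mat 1" using False grp_inv_mult(1)[OF c g(1)] by auto
      then have "l \<bullet> (matrix_inv g *v y) < l \<bullet> y" using Dlt[OF xy(2) grp_inv[OF c g(1)]] by simp
      then show ?thesis using 1 inv(1)[OF g(1)] g(2) by simp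
    qed
  qed
  have disj: "(*v) g ` D \<inter> (*v) h ` D = {}" if gh: "g \<in> grp c" "h \<in> grp c" "g \<noteq> h" for g h
  proof (rule ccontr)
    assume "(*v) g ` D \<inter> (*v) h ` D \<noteq> {}"
    then obtain x y where xy: "x \<in> D" "y \<in> D" "g *v x = h *v y" by auto
    have "x \<in> lift c" "y \<in> lift c" using xy DL by blast+
    note pj = group_lift(2)[OF c gh(1) this(1)] group_lift(2)[OF c gh(2) this(2)]
    have "proj c x = proj c y" using pj(1) pj(2) unfolding xy(3) by (rule trans[OF sym])
    then have "x = y" using inj xy by (simp add: inj_onD)
    define k where "k = matrix_inv h ** g"
    have k: "k \<in> grp c" using grp_mult[OF c grp_inv[OF c gh(2)] gh(1)] by (simp add: k_def)
    have "k \<noteq> mat 1"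
    proof
      assume "k = mat 1"
      then have "h ** k = h" by simp
      then show False using gh grp_inv_mult(1)[OF c gh(2)] by (simp add: k_def matrix_mul_assoc)
    qed
    moreover have "k *v x = x"
      using xy(3) \<open>x = y\<close> inv(1)[OF gh(2), of x] by (simp add: k_def matrix_vector_mul_assoc[symmetric])
    ultimately show False using Dlt[OF xy(1) k] by simp
  qed
  \<comment> \<open>Off these finitely many hyperplanes \<open>l\<close> takes distinct values at
    the points g x for different g, so the maximum is attained by exactly one group element.\<close>
  define H where "H = (\<Union>p\<in>{p \<in> grp c \<times> grp c. fst p \<noteq> snd p}. {x :: R7. (transpose (fst p) *v l - transpose (snd p) *v l) \<bullet> x = 0})"
  have nH: "negligible H"
    unfolding H_def
  proof (rule negligible_Union)
    show "finite ((\<lambda>p. {x :: R7. (transpose (fst p) *v l - transpose (snd p) *v l) \<bullet> x = 0}) ` {p \<in> grp c \<times> grp c. fst p \<noteq> snd p})"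
      using fin by (intro finite_imageI finite_subset[OF _ finite_cartesian_product[OF fin fin]]) auto
    fix T assume "T \<in> (\<lambda>p. {x :: R7. (transpose (fst p) *v l - transpose (snd p) *v l) \<bullet> x = 0}) ` {p \<in> grp c \<times> grp c. fst p \<noteq> snd p}"
    then obtain g h where "g \<in> grp c" "h \<in> grp c" "g \<noteq> h" "T = {x :: R7. (transpose g *v l - transpose h *v l) \<bullet> x = 0}" by auto
    then show "negligible T" using negligible_hyperplane[of "transpose g *v l - transpose h *v l" 0] sep by simp
  qed
  have cover: "lift c - (\<Union>g\<in>grp c. (*v) g ` D) \<subseteq> (lift c - interior (lift c)) \<union> H"
  proof
    fix x assume x: "x \<in> lift c - (\<Union>g\<in>grp c. (*v) g ` D)"
    show "x \<in> (lift c - interior (lift c)) \<union> H"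
    proof (rule ccontr)
      assume "x \<notin> (lift c - interior (lift c)) \<union> H"
      then have xi: "x \<in> interior (lift c)" and xH: "x \<notin> H" using x by auto
      have ne: "l \<bullet> (g *v x) \<noteq> l \<bullet> (h *v x)" if "g \<in> grp c" "h \<in> grp c" "g \<noteq> h" for g h
        using xH that unfolding H_def lg by (force simp: inner_diff_left)
      let ?m = "Max ((\<lambda>g. l \<bullet> (g *v x)) ` grp c)"
      have "?m \<in> (\<lambda>g. l \<bullet> (g *v x)) ` grp c"
        using fin grp_one[OF c] by (intro Max_in) auto
      then obtain g where g: "g \<in> grp c" "?m = l \<bullet> (g *v x)" by blast
      have mx: "l \<bullet> (h *v x) < l \<bullet> (g *v x)" if "h \<in> grp c" "h \<noteq> g" for h
      proof -
        have "l \<bullet> (h *v x) \<le> ?m" using fin that by (intro Max_ge) auto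
        then show ?thesis using ne[OF that(1) g(1) that(2)] g(2) by simp
      qed
      have "g *v x \<in> D"
        unfolding D_def
      proof (intro CollectI conjI ballI)
        show "g *v x \<in> interior (lift c)" by (rule group_interior[OF c g(1) xi])
        fix k assume k: "k \<in> grp c - {mat 1}"
        have "k ** g \<noteq> g"
        proof
          assume "k ** g = g"
          then have "(k ** g) ** matrix_inv g = g ** matrix_inv g" by simp
          then show False using k grp_inv_mult(1)[OF c g(1)] by (simp add: matrix_mul_assoc[symmetric])
        qed
        then show "l \<bullet> (k *v (g *v x)) < l \<bullet> (g *v x)"
          using mx[of "k ** g"] grp_mult[OF c _ g(1)] k by (simp add: matrix_vector_mul_assoc)
      qed
      then have "x \<in> (*v) (matrix_inv g) ` D" using inv(1)[OF g(1), of x] by (metis image_eqI)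
      then show False using x grp_inv[OF c g(1)] by blast
    qed
  qed
  have "negligible (lift c - (\<Union>g\<in>grp c. (*v) g ` D))"
    by (rule negligible_subset[OF negligible_Un[OF negligible_lift_frontier[OF c] nH] cover])
  then show ?thesis unfolding fund_dom_def patch_def using c oD DL inj disj by blast
qed

section \<open>Densities and their integrals\<close>

text \<open>Coordinate expressions of a measure on the orbifold. The transformation law is asked for
  at interior points, whose complement in a lift is a null set.\<close>

definition density :: "('a chart \<Rightarrow> R7 \<Rightarrow> real) \<Rightarrow> bool" where
  "density G \<longleftrightarrow> (\<forall>c1\<in>atlas M. \<forall>c2\<in>atlas M. \<forall>V f. transition c1 c2 V f \<longrightarrow>
     (\<forall>x\<in>V. x \<in> interior (lift c1) \<longrightarrow> G c1 x = \<bar>det (matrix (tangent_map V f x))\<bar> * G c2 (f x)))"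

lemma densityD:
  "density G \<Longrightarrow> c1 \<in> atlas M \<Longrightarrow> c2 \<in> atlas M \<Longrightarrow> transition c1 c2 V f \<Longrightarrow> x \<in> V \<Longrightarrow> x \<in> interior (lift c1) \<Longrightarrow>
    G c1 x = \<bar>det (matrix (tangent_map V f x))\<bar> * G c2 (f x)"
  unfolding density_def by (drule bspec, assumption)+ (drule spec, drule spec, drule mp, assumption, drule bspec, assumption, erule mp)

lemma density_patch:
  assumes G: "density G" and P: "patch c D" and c': "c' \<in> atlas M" and y: "y \<in> preimg c D c'"
  shows "G c' y = \<bar>det (matrix (to_patch' c D c' y))\<bar> * G c (to_patch c D c' y)"
proof -
  obtain V h W where W: "transition c' c V h" "y \<in> V" "tangent_map V h y = to_patch' c D c' y"
    "open W" "y \<in> W" "W \<subseteq> preimg c D c'" "W \<subseteq> V" "W \<subseteq> interior (lift c')" "\<forall>z\<in>W. h z = to_patch c D c' z"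
    using patch_local[OF P c' y] .
  have c: "c \<in> atlas M" using P by (simp add: patch_def)
  show ?thesis
    using densityD[OF G c' c W(1,2) preimg_interior[OF P c' y]] W(3) W(9)[rule_format, OF W(5)] by simp
qed

lemma density_group:
  assumes G: "density G" and c: "c \<in> atlas M" and g: "g \<in> grp c" and x: "x \<in> interior (lift c)"
  shows "G c x = \<bar>det g\<bar> * G c (g *v x)"
proof -
  have "((*v) g has_derivative (*v) g) (at x)"
    by (intro bounded_linear_imp_has_derivative linear_conv_bounded_linear[THEN iffD1] matrix_vector_mul_linear)
  then have "tangent_map (lift c) ((*v) g) x = (*v) g"
    unfolding tangent_map_def at_within_interior[OF x] by (rule frechet_derivative_eq)
  then show ?thesis
    using densityD[OF G c c group_transition[OF c g] subsetD[OF interior_subset x] x]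
    by (simp add: matrix_of_matrix_vector_mul)
qed

text \<open>The translates of the domain are disjoint, fill the lift up to a null set, and by the
  density law contribute equal integrals.\<close>

lemma integral_fund_dom:
  assumes G: "density G" and F: "fund_dom c D" and int: "G c absolutely_integrable_on lift c"
  shows "integral (lift c) (G c) = real (card (grp c)) * integral D (G c)"
proof -
  have P: "patch c D" and disj: "\<And>g h. g \<in> grp c \<Longrightarrow> h \<in> grp c \<Longrightarrow> g \<noteq> h \<Longrightarrow> (*v) g ` D \<inter> (*v) h ` D = {}"
    and neg: "negligible (lift c - (\<Union>g\<in>grp c. (*v) g ` D))" using F unfolding fund_dom_def by blast+
  have c: "c \<in> atlas M" and D: "open D" "D \<subseteq> lift c" using P by (auto simp: patch_def)
  have Di: "D \<subseteq> interior (lift c)" using D by (simp add: interior_maximal)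
  have gD: "open ((*v) g ` D)" "(*v) g ` D \<subseteq> lift c" if "g \<in> grp c" for g
  proof -
    have "(*v) g ` D = (*v) (matrix_inv g) -` D"
    proof (intro equalityI subsetI)
      fix x assume "x \<in> (*v) g ` D" then show "x \<in> (*v) (matrix_inv g) -` D"
        by (auto simp: grp_inv_act[OF c that])
    next
      fix x assume "x \<in> (*v) (matrix_inv g) -` D"
      then have "g *v (matrix_inv g *v x) \<in> (*v) g ` D" by blast
      then show "x \<in> (*v) g ` D" by (simp add: grp_inv_act[OF c that])
    qed
    moreover have "open ((*v) (matrix_inv g) -` D)"
      by (intro open_vimage D matrix_vector_mult_linear_continuous_on)
    ultimately show "open ((*v) g ` D)" by simp
    show "(*v) g ` D \<subseteq> lift c" using group_lift(1)[OF c that] D by blast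
  qed
  have ai: "G c absolutely_integrable_on ((*v) g ` D)" if "g \<in> grp c" for g
    by (rule set_integrable_subset[OF int _ gD(2)[OF that]]) (use gD(1)[OF that] in simp)
  have ig: "integral ((*v) g ` D) (G c) = integral D (G c)" if g: "g \<in> grp c" for g
  proof -
    have "integral ((*v) g ` D) (G c) = integral D (\<lambda>x. \<bar>det (matrix ((*v) g))\<bar> * G c (g *v x))"
    proof (rule change_of_variables_real(2)[OF _ _ _ ai[OF g]])
      show "((*v) g has_derivative (*v) g) (at x within D)" for x
        by (intro bounded_linear_imp_has_derivative linear_conv_bounded_linear[THEN iffD1] matrix_vector_mul_linear)
      show "inj_on ((*v) g) D"
        by (rule inj_on_inverseI[of _ "(*v) (matrix_inv g)"]) (rule grp_inv_act(1)[OF c g])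
    qed (use D in simp)
    also have "\<dots> = integral D (G c)"
      by (rule integral_cong) (use density_group[OF G c g] Di in \<open>auto simp: matrix_of_matrix_vector_mul\<close>)
    finally show ?thesis .
  qed
  have "(G c has_integral (\<Sum>g\<in>grp c. integral D (G c))) (\<Union>g\<in>grp c. (*v) g ` D)"
  proof (rule has_integral_UN[OF grp_finite[OF c]])
    show "(G c has_integral integral D (G c)) ((*v) g ` D)" if "g \<in> grp c" for g
      using ai[OF that] ig[OF that] by (metis integrable_integral set_lebesgue_integral_eq_integral(1))
    show "pairwise (\<lambda>g h. negligible ((*v) g ` D \<inter> (*v) h ` D)) (grp c)"
      using disj by (simp add: pairwise_def)
  qed
  then have "integral (\<Union>g\<in>grp c. (*v) g ` D) (G c) = real (card (grp c)) * integral D (G c)"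
    by (simp add: integral_unique)
  moreover have "integral (\<Union>g\<in>grp c. (*v) g ` D) (G c) = integral (lift c) (G c)"
    by (rule integral_subset_negligible[OF _ neg]) (use gD(2) in blast)
  ultimately show ?thesis by simp
qed

text \<open>Near such a point a transition into \<open>c2\<close> is a diffeomorphism onto its
  image, and it takes the missed points into the null set left uncovered by the translates of
  \<open>D2\<close>. Differentiable maps preserve null sets, and null sets are recognised
  locally.\<close>

lemma negligible_missed:
  assumes F1: "fund_dom c1 D1" and F2: "fund_dom c2 D2"
  shows "negligible {x \<in> D1. proj c1 x \<in> image_of c2 \<and> proj c1 x \<notin> proj c2 ` D2}" (is "negligible ?S")
proof (rule locally_negligible_alt[THEN iffD2], rule ballI)
  fix x assume x: "x \<in> ?S"
  have c1: "c1 \<in> atlas M" "open D1" "D1 \<subseteq> lift c1" using fund_domD[OF F1] by simp_all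
  have c2: "c2 \<in> atlas M" "D2 \<subseteq> lift c2" and B: "negligible (lift c2 - (\<Union>g\<in>grp c2. (*v) g ` D2))"
    using fund_domD[OF F2] by simp_all
  obtain y where y: "y \<in> lift c2" "proj c1 x = proj c2 y" using x by auto
  have xl: "x \<in> lift c1" "x \<in> interior (lift c1)" using x fund_domD(4,7)[OF F1] by blast+
  obtain V h where h: "transition c1 c2 V h" "x \<in> V" "h x = y" using compat[OF c1(1) c2(1) xl(1) y] .
  obtain W where W: "open W" "x \<in> W" "W \<subseteq> V" using transition_interior[OF c1(1) c2(1) h(1,2) xl(2)] .
  define B where "B = (lift c2 - (\<Union>g\<in>grp c2. (*v) g ` D2)) \<inter> h ` V"
  have inj: "inj_on h V" and sm: "smooth_on (h ` V) (inv_into V h)" using h(1) by (auto simp: transition_def)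
  have "?S \<inter> W \<subseteq> inv_into V h ` B"
  proof
    fix z assume z: "z \<in> ?S \<inter> W"
    then have zV: "z \<in> V" using W by blast
    note tp = transition_preimg(2,3)[OF h(1) zV]
    have "h z \<notin> (*v) g ` D2" if g: "g \<in> grp c2" for g
    proof
      assume "h z \<in> (*v) g ` D2"
      then obtain d where d: "d \<in> D2" "h z = g *v d" by blast
      have "d \<in> lift c2" using d c2(2) by blast
      have "proj c1 z = proj c2 d" using tp(2) group_lift(2)[OF c2(1) g \<open>d \<in> lift c2\<close>] unfolding d(2) by (rule trans[OF sym])
      then have "proj c1 z \<in> proj c2 ` D2" using d(1) by (rule image_eqI)
      then show False using z by simp
    qed
    then have "h z \<in> B" using tp zV by (auto simp: B_def)
    moreover have "inv_into V h (h z) = z" by (rule inv_into_f_f[OF inj zV])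
    ultimately show "z \<in> inv_into V h ` B" by (metis image_eqI)
  qed
  moreover have "negligible (inv_into V h ` B)"
  proof (rule negligible_differentiable_image_negligible)
    show "negligible B" unfolding B_def by (rule negligible_subset[OF B]) blast
    show "inv_into V h differentiable_on B"
      unfolding differentiable_on_def
    proof
      fix z assume "z \<in> B"
      then have "inv_into V h differentiable (at z within h ` V)"
        by (intro smooth_on_differentiable[OF sm]) (simp add: B_def)
      then show "inv_into V h differentiable (at z within B)"
        by (rule differentiable_within_subset) (simp add: B_def)
    qed
  qed simp
  ultimately have "negligible (?S \<inter> W)" using negligible_subset by blast
  then show "\<exists>U. openin (top_of_set ?S) U \<and> x \<in> U \<and> negligible U"
    using x W by (intro exI[of _ "?S \<inter> W"]) auto
qed

text \<open>\<open>to_patch\<close> identifies the parts of the two domains that lie over each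
  other, and change of variables applies there. The remaining points either see \<open>G\<close>
  vanish, as it does off the overlap of the two charts, or form a null set by
  \<open>negligible_missed\<close>.\<close>

lemma density_transfer:
  assumes F1: "fund_dom c1 D1" and F2: "fund_dom c2 D2" and G: "density G"
    and z1: "\<And>x. x \<in> lift c1 \<Longrightarrow> proj c1 x \<notin> image_of c2 \<Longrightarrow> G c1 x = 0"
    and z2: "\<And>x. x \<in> lift c2 \<Longrightarrow> proj c2 x \<notin> image_of c1 \<Longrightarrow> G c2 x = 0"
    and int: "G c2 absolutely_integrable_on D2"
  shows "G c1 absolutely_integrable_on D1" "integral D1 (G c1) = integral D2 (G c2)"
proof -
  have P: "patch c1 D1" "patch c2 D2" using fund_domD(1) F1 F2 by blast+
  have c1: "c1 \<in> atlas M" "open D1" "D1 \<subseteq> lift c1" "inj_on (proj c1) D1" using P(1) by (auto simp: patch_def)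
  have c2: "c2 \<in> atlas M" "open D2" "D2 \<subseteq> lift c2" using P(2) by (auto simp: patch_def)
  define W1 where "W1 = D1 \<inter> preimg c2 D2 c1"
  define W2 where "W2 = D2 \<inter> preimg c1 D1 c2"
  let ?f = "to_patch c2 D2 c1"
  have oW: "open W1" "open W2"
    unfolding W1_def W2_def by (intro open_Int c1 c2 preimg_open P)+
  have im: "?f ` W1 = W2"
  proof (intro equalityI subsetI)
    fix y assume "y \<in> ?f ` W1"
    then obtain x where x: "x \<in> D1" "x \<in> preimg c2 D2 c1" "y = ?f x" by (auto simp: W1_def)
    note t = to_patch_in[OF x(2)]
    then show "y \<in> W2" using x c2 by (auto simp: W2_def preimg_def)
  next
    fix y assume y: "y \<in> W2"
    then have yp: "y \<in> preimg c1 D1 c2" "y \<in> D2" by (auto simp: W2_def)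
    define x where "x = to_patch c1 D1 c2 y"
    have x: "x \<in> D1" "proj c1 x = proj c2 y" using to_patch_in[OF yp(1)] by (auto simp: x_def)
    then have "x \<in> W1" using yp c1 by (auto simp: W1_def preimg_def)
    moreover have "?f x = y" by (rule to_patch_eq[OF P(2) yp(2) x(2)])
    ultimately show "y \<in> ?f ` W1" by blast
  qed
  have inj: "inj_on ?f W1"
  proof (rule inj_onI)
    fix x x' assume x: "x \<in> W1" "x' \<in> W1" "?f x = ?f x'"
    then have "proj c1 x = proj c1 x'" using to_patch_in(2)[of x c2 D2 c1] to_patch_in(2)[of x' c2 D2 c1] by (simp add: W1_def)
    then show "x = x'" using x c1(4) by (simp add: W1_def inj_on_def)
  qed
  have sp1: "negligible {x \<in> D1 - W1. G c1 x \<noteq> 0}"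
  proof (rule negligible_subset[OF negligible_missed[OF F1 F2]])
    show "{x \<in> D1 - W1. G c1 x \<noteq> 0} \<subseteq> {x \<in> D1. proj c1 x \<in> image_of c2 \<and> proj c1 x \<notin> proj c2 ` D2}"
      using z1 c1(3) by (auto simp: W1_def preimg_def)
  qed
  have sp2: "negligible {x \<in> D2 - W2. G c2 x \<noteq> 0}"
  proof (rule negligible_subset[OF negligible_missed[OF F2 F1]])
    show "{x \<in> D2 - W2. G c2 x \<noteq> 0} \<subseteq> {x \<in> D2. proj c2 x \<in> image_of c1 \<and> proj c2 x \<notin> proj c1 ` D1}"
      using z2 c2(3) by (auto simp: W2_def preimg_def)
  qed
  have e1: "{x \<in> W1 - D1. G c1 x \<noteq> 0} = {}" "{x \<in> W2 - D2. G c2 x \<noteq> 0} = {}" by (auto simp: W1_def W2_def)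
  have der: "(?f has_derivative to_patch' c2 D2 c1 x) (at x within W1)" if "x \<in> W1" for x
    using to_patch_has_derivative[OF P(2) c1(1)] that by (auto simp: W1_def intro: has_derivative_at_withinI)
  have S: "W1 \<in> sets lebesgue" using oW by simp
  note cv = change_of_variables_real[OF S der inj, of "G c2", unfolded im]
  have i2: "G c2 absolutely_integrable_on W2"
  proof (rule absolutely_integrable_spike_set[OF int sp2])
    show "negligible {x \<in> W2 - D2. G c2 x \<noteq> 0}" by (simp only: e1 negligible_empty)
  qed
  have eq: "\<bar>det (matrix (to_patch' c2 D2 c1 x))\<bar> * G c2 (?f x) = G c1 x" if "x \<in> W1" for x
    using density_patch[OF G P(2) c1(1)] that by (simp add: W1_def)
  have "(\<lambda>x. \<bar>det (matrix (to_patch' c2 D2 c1 x))\<bar> * G c2 (?f x)) absolutely_integrable_on W1"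
    using cv(1) i2 by blast
  then have i1: "G c1 absolutely_integrable_on W1"
    using set_integrable_cong[OF refl refl, of W1 "\<lambda>x. \<bar>det (matrix (to_patch' c2 D2 c1 x))\<bar> * G c2 (?f x)" "G c1" lebesgue] eq by simp
  show "G c1 absolutely_integrable_on D1"
  proof (rule absolutely_integrable_spike_set[OF i1 _ sp1])
    show "negligible {x \<in> W1 - D1. G c1 x \<noteq> 0}" by (simp only: e1 negligible_empty)
  qed
  have "integral D1 (G c1) = integral W1 (G c1)"
    by (rule integral_spike_set[OF sp1]) (simp only: e1 negligible_empty)
  also have "\<dots> = integral W1 (\<lambda>x. \<bar>det (matrix (to_patch' c2 D2 c1 x))\<bar> * G c2 (?f x))"
    by (rule integral_cong) (simp add: eq)
  also have "\<dots> = integral W2 (G c2)" using cv(2)[OF _ i2] by simp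
  also have "\<dots> = integral D2 (G c2)"
    by (rule integral_spike_set[OF _ sp2]) (simp only: e1 negligible_empty)
  finally show "integral D1 (G c1) = integral D2 (G c2)" .
qed

end

section \<open>The volume of a $G_2$ form\<close>

text \<open>With the sign \<open>s\<close> of the orientation the coefficient of the volume form
  becomes the positive number |det L|, a density in the sense of measures.\<close>

definition form_vol :: "real \<Rightarrow> pform \<Rightarrow> real" where
  "form_vol s w = s * vol_at s w std_basis"

lemma form_vol_frame:
  assumes "L \<in> G2_frames s w" "s = 1 \<or> s = -1"
  shows "form_vol s w = \<bar>det (matrix L)\<bar>" "form_vol s w > 0"
proof -
  have "s * det (matrix L) > 0" using assms(1) by (simp add: G2_frames_def)
  then show "form_vol s w = \<bar>det (matrix L)\<bar>" "form_vol s w > 0"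
    using assms(2) by (auto simp: form_vol_def vol_at_eq[OF assms(1)])
qed

lemma bij_det:
  assumes "linear (L :: R7 \<Rightarrow> R7)" "det (matrix L) \<noteq> 0"
  shows "bij L"
proof -
  have "bij ((*v) (matrix L))" using assms(2) by (simp only: invertible_eq_bij[symmetric] invertible_det_nz) simp
  moreover have "(*v) (matrix L) = L" using assms(1) by (intro ext) (simp add: matrix_works)
  ultimately show ?thesis by simp
qed

lemma G2_frames_compose:
  assumes "L \<in> G2_frames s w" "linear T" "s' * s * det (matrix T) > 0"
  shows "L \<circ> T \<in> G2_frames s' (pullback T w)"
proof -
  have L: "linear L" "bij L" "s * det (matrix L) > 0" "pullback L phi_mod = w"
    using assms(1) unfolding G2_frames_def by blast+
  have lin: "linear (L \<circ> T)" by (rule linear_compose[OF assms(2) L(1)])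
  have d: "det (matrix (L \<circ> T)) = det (matrix L) * det (matrix T)"
    by (simp add: matrix_compose[OF assms(2) L(1)] det_mul)
  have "(s * det (matrix L)) * (s' * s * det (matrix T)) > 0" using L(3) assms(3) by (rule mult_pos_pos)
  then have "s\<^sup>2 * (s' * det (matrix (L \<circ> T))) > 0" unfolding d by (simp add: power2_eq_square algebra_simps)
  then have pos: "s' * det (matrix (L \<circ> T)) > 0" by (simp add: zero_less_mult_iff)
  then have "det (matrix (L \<circ> T)) \<noteq> 0" by auto
  then have "bij (L \<circ> T)" by (rule bij_det[OF lin])
  moreover have "pullback (L \<circ> T) phi_mod = pullback T w"
    unfolding L(4)[symmetric] by (simp add: pullback_def)
  ultimately show ?thesis unfolding G2_frames_def using lin pos by blast
qed

lemma form_vol_compose: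
  assumes "G2_frames s w \<noteq> {}" "linear T" "s' * s * det (matrix T) > 0" "s = 1 \<or> s = -1" "s' = 1 \<or> s' = -1"
  shows "form_vol s' (pullback T w) = \<bar>det (matrix T)\<bar> * form_vol s w"
proof -
  obtain L where L: "L \<in> G2_frames s w" using assms(1) by blast
  have "linear L" using L by (simp add: G2_frames_def)
  then show ?thesis
    unfolding form_vol_frame(1)[OF L assms(4)] form_vol_frame(1)[OF G2_frames_compose[OF L assms(2,3)] assms(5)]
    by (simp add: matrix_compose[OF assms(2)] det_mul abs_mult)
qed

text \<open>The form is tested on the vectors \<open>M (axis i 1)\<close> of the frame
  \<open>L\<close> itself, and the volume error is relative. This is why one \<delta> serves every
  frame, however distorted, and both orientations.\<close>

lemma frame_near:
  assumes "0 < \<tau>" "\<tau> < 1"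
  shows "\<exists>\<delta>>0. \<forall>s L M w0 \<eta> w. L \<in> G2_frames s w0 \<longrightarrow> linear M \<longrightarrow> (\<forall>v. M (L v) = v) \<longrightarrow>
     (\<forall>j\<in>{1,4,5,6,7}. \<bar>\<eta> $ j\<bar> \<le> 1/4) \<longrightarrow> alternating_form 3 w \<longrightarrow>
     (\<forall>i j k. \<bar>w (vec3 (M (axis i 1)) (M (axis j 1)) (M (axis k 1))) - (phi3 (axis i 1) (axis j 1) (axis k 1) + wedge23 \<eta> (axis i 1) (axis j 1) (axis k 1))\<bar> < \<delta>) \<longrightarrow>
     (\<exists>L'\<in>G2_frames s w. \<bar>\<bar>det (matrix L')\<bar> - model_vol \<eta> * \<bar>det (matrix L)\<bar>\<bar> \<le> \<tau> * model_vol \<eta> * \<bar>det (matrix L)\<bar>)"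
proof -
  obtain \<delta> where \<delta>: "\<delta> > 0" and near: "\<And>\<eta> w. \<forall>j\<in>{1,4,5,6,7}. \<bar>\<eta> $ j\<bar> \<le> 1/4 \<Longrightarrow> alternating_form 3 w \<Longrightarrow>
     \<forall>i j k. \<bar>w (vec3 (axis i 1) (axis j 1) (axis k 1)) - (phi3 (axis i 1) (axis j 1) (axis k 1) + wedge23 \<eta> (axis i 1) (axis j 1) (axis k 1))\<bar> < \<delta> \<Longrightarrow>
     \<exists>L. linear L \<and> \<bar>det (matrix L) - model_vol \<eta>\<bar> \<le> \<tau> * model_vol \<eta> \<and> pullback L phi_mod = w"
    using near_model_frame[OF assms(1)] by blast
  have "\<exists>L'\<in>G2_frames s w. \<bar>\<bar>det (matrix L')\<bar> - model_vol \<eta> * \<bar>det (matrix L)\<bar>\<bar> \<le> \<tau> * model_vol \<eta> * \<bar>det (matrix L)\<bar>"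
    if L: "L \<in> G2_frames s w0" and M: "linear M" "\<forall>v. M (L v) = v" and \<eta>: "\<forall>j\<in>{1,4,5,6,7}. \<bar>\<eta> $ j\<bar> \<le> 1/4"
      and w: "alternating_form 3 w"
      and wn: "\<forall>i j k. \<bar>w (vec3 (M (axis i 1)) (M (axis j 1)) (M (axis k 1))) - (phi3 (axis i 1) (axis j 1) (axis k 1) + wedge23 \<eta> (axis i 1) (axis j 1) (axis k 1))\<bar> < \<delta>"
    for s L M w0 \<eta> w
  proof -
    have Lf: "linear L" "s * det (matrix L) > 0" using L by (auto simp: G2_frames_def)
    have pv: "pullback M w (vec3 a b c) = w (vec3 (M a) (M b) (M c))" for a b c
      unfolding pullback_def by (subst alternating_form_3D(1)[OF w]) simp
    obtain L1 where L1: "linear L1" "\<bar>det (matrix L1) - model_vol \<eta>\<bar> \<le> \<tau> * model_vol \<eta>" "pullback L1 phi_mod = pullback M w"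
      using near[OF \<eta> alternating_form_3_pullback[OF w M(1)]] wn unfolding pv by blast
    have mv: "model_vol \<eta> \<ge> 1/2" using model_vol_cube(2)[of \<eta>] \<eta> by blast
    \<comment> \<open>With \<tau> < 1 the correcting map has positive determinant, so composing it
      with \<open>L\<close> keeps the orientation sign.\<close>
    have "\<tau> * model_vol \<eta> < 1 * model_vol \<eta>" using assms mv by (intro mult_strict_right_mono) auto
    then have d1: "det (matrix L1) > 0" using L1(2) by (simp add: abs_le_iff)
    have "bij L1" using bij_det[OF L1(1)] d1 by simp
    then have "L1 \<in> G2_frames 1 (pullback M w)" using L1 d1 by (simp add: G2_frames_def)
    then have "L1 \<circ> L \<in> G2_frames s (pullback L (pullback M w))" 
      by (rule G2_frames_compose) (use Lf in simp_all)
    moreover have "pullback L (pullback M w) = w" using M(2) by (simp add: pullback_def)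
    ultimately have "L1 \<circ> L \<in> G2_frames s w" by simp
    moreover have "\<bar>det (matrix (L1 \<circ> L))\<bar> = det (matrix L1) * \<bar>det (matrix L)\<bar>"
      using d1 by (simp add: matrix_compose[OF Lf(1) L1(1)] det_mul abs_mult)
    then have "\<bar>\<bar>det (matrix (L1 \<circ> L))\<bar> - model_vol \<eta> * \<bar>det (matrix L)\<bar>\<bar> = \<bar>det (matrix L1) - model_vol \<eta>\<bar> * \<bar>det (matrix L)\<bar>"
      by (simp add: left_diff_distrib[symmetric] abs_mult)
    then have "\<bar>\<bar>det (matrix (L1 \<circ> L))\<bar> - model_vol \<eta> * \<bar>det (matrix L)\<bar>\<bar> \<le> \<tau> * model_vol \<eta> * \<bar>det (matrix L)\<bar>"
      using mult_right_mono[OF L1(2), of "\<bar>det (matrix L)\<bar>"] by simp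
    ultimately show ?thesis by blast
  qed
  then show ?thesis using \<delta> by blast
qed

lemma frame_inverse:
  assumes "L \<in> G2_frames s w"
  obtains M where "linear M" "\<forall>v. M (L v) = v" "\<forall>v. L (M v) = v"
proof -
  have L: "linear L" "bij L" using assms by (auto simp: G2_frames_def)
  have "linear (inv L)" using L by (simp add: bij_def inj_linear_imp_inv_linear)
  moreover have "\<forall>v. inv L (L v) = v" "\<forall>v. L (inv L v) = v" using L(2) by (simp_all add: bij_def surj_f_inv_f)
  ultimately show thesis by (rule that)
qed

lemma model_vol_0 [simp]: "model_vol 0 = 1"
  by (simp add: model_vol_def)

lemma wedge23_0 [simp]: "wedge23 0 u v w = 0"
  by (simp add: wedge23_def)

lemma frame_at_center:
  assumes "L \<in> G2_frames s w" "\<forall>v. L (M v) = v" "alternating_form 3 w"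
  shows "w (vec3 (M a) (M b) (M c)) = phi3 a b c"
proof -
  have "w = pullback L phi_mod" using assms(1) by (simp add: G2_frames_def)
  then have "w (vec3 (M a) (M b) (M c)) = phi_mod (\<lambda>i. L (vec3 (M a) (M b) (M c) i))" by (simp add: pullback_def)
  also have "\<dots> = phi_mod (vec3 a b c)"
    using assms(2) by (subst alternating_form_3D(1)[OF alternating_form_3_phi_mod]) simp
  finally show ?thesis by (simp add: phi_mod_eq)
qed

text \<open>Frames are chosen point by point without continuity. Applying \<open>frame_near\<close>
  with \<eta> = 0 compares the volume at nearby points with that of one frame at \<open>x\<close>,
  in relative terms; continuity of the volume follows.\<close>

lemma form_vol_near:
  assumes "0 < \<tau>" "\<tau> < 1" and s: "s = 1 \<or> s = -1" and x: "x \<in> S"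
    and fr: "\<And>y. y \<in> S \<Longrightarrow> G2_frames s (\<psi> y) \<noteq> {}" and alt: "\<And>y. y \<in> S \<Longrightarrow> alternating_form 3 (\<psi> y)"
    and cont: "\<And>v. continuous_on S (\<lambda>y. \<psi> y v)"
  shows "\<forall>\<^sub>F y in at x within S. \<bar>form_vol s (\<psi> y) - form_vol s (\<psi> x)\<bar> \<le> \<tau> * form_vol s (\<psi> x)"
proof -
  obtain L where L: "L \<in> G2_frames s (\<psi> x)" using fr[OF x] by blast
  obtain M where M: "linear M" "\<forall>v. M (L v) = v" "\<forall>v. L (M v) = v" using frame_inverse[OF L] .
  obtain \<delta> where \<delta>: "\<delta> > 0" and near: "\<forall>s L M w0 \<eta> w. L \<in> G2_frames s w0 \<longrightarrow> linear M \<longrightarrow> (\<forall>v. M (L v) = v) \<longrightarrow>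
     (\<forall>j\<in>{1,4,5,6,7}. \<bar>\<eta> $ j\<bar> \<le> 1/4) \<longrightarrow> alternating_form 3 w \<longrightarrow>
     (\<forall>i j k. \<bar>w (vec3 (M (axis i 1)) (M (axis j 1)) (M (axis k 1))) - (phi3 (axis i 1) (axis j 1) (axis k 1) + wedge23 \<eta> (axis i 1) (axis j 1) (axis k 1))\<bar> < \<delta>) \<longrightarrow>
     (\<exists>L'\<in>G2_frames s w. \<bar>\<bar>det (matrix L')\<bar> - model_vol \<eta> * \<bar>det (matrix L)\<bar>\<bar> \<le> \<tau> * model_vol \<eta> * \<bar>det (matrix L)\<bar>)"
    using frame_near[OF assms(1,2)] by (elim exE conjE)
  let ?e = "\<lambda>i j k. vec3 (M (axis i 1)) (M (axis j 1)) (M (axis k 1))"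
  have "\<forall>\<^sub>F y in at x within S. \<bar>\<psi> y (?e i j k) - phi3 (axis i 1) (axis j 1) (axis k 1)\<bar> < \<delta>" for i j k
  proof -
    have "((\<lambda>y. \<psi> y (?e i j k)) \<longlongrightarrow> \<psi> x (?e i j k)) (at x within S)"
      using cont x by (simp add: continuous_on_def)
    then have "\<forall>\<^sub>F y in at x within S. dist (\<psi> y (?e i j k)) (\<psi> x (?e i j k)) < \<delta>"
      using \<delta> by (rule tendstoD)
    then show ?thesis by (simp only: frame_at_center[OF L M(3) alt[OF x]] dist_real_def)
  qed
  then have "\<forall>\<^sub>F y in at x within S. \<forall>i j k. \<bar>\<psi> y (?e i j k) - phi3 (axis i 1) (axis j 1) (axis k 1)\<bar> < \<delta>"
    by (simp only: eventually_all_finite)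
  moreover have "\<forall>\<^sub>F y in at x within S. y \<in> S" by (simp add: eventually_at_filter)
  ultimately show ?thesis
  proof eventually_elim
    case (elim y)
    then have "\<exists>L'\<in>G2_frames s (\<psi> y). \<bar>\<bar>det (matrix L')\<bar> - model_vol 0 * \<bar>det (matrix L)\<bar>\<bar> \<le> \<tau> * model_vol 0 * \<bar>det (matrix L)\<bar>"
      by (intro near[rule_format, OF L M(1)] alt) (simp_all add: M(2)[rule_format])
    then obtain L' where "L' \<in> G2_frames s (\<psi> y)" "\<bar>\<bar>det (matrix L')\<bar> - \<bar>det (matrix L)\<bar>\<bar> \<le> \<tau> * \<bar>det (matrix L)\<bar>" by auto
    then show ?case by (simp add: form_vol_frame(1)[OF _ s] form_vol_frame(1)[OF L s])
  qed
qed

lemma form_vol_continuous: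
  assumes s: "s = 1 \<or> s = -1"
    and fr: "\<And>y. y \<in> S \<Longrightarrow> G2_frames s (\<psi> y) \<noteq> {}" and alt: "\<And>y. y \<in> S \<Longrightarrow> alternating_form 3 (\<psi> y)"
    and cont: "\<And>v. continuous_on S (\<lambda>y. \<psi> y v)"
  shows "continuous_on S (\<lambda>y. form_vol s (\<psi> y))"
  unfolding continuous_on_def
proof
  fix x assume x: "x \<in> S"
  have pos: "form_vol s (\<psi> x) > 0" using fr[OF x] form_vol_frame(2)[OF _ s] by blast
  show "((\<lambda>y. form_vol s (\<psi> y)) \<longlongrightarrow> form_vol s (\<psi> x)) (at x within S)"
  proof (rule tendstoI)
    fix e :: real assume e: "e > 0"
    define \<tau> where "\<tau> = min (1/2) (e / (2 * form_vol s (\<psi> x)))"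
    have \<tau>: "0 < \<tau>" "\<tau> < 1" using e pos by (auto simp: \<tau>_def)
    have "\<tau> * form_vol s (\<psi> x) \<le> e / (2 * form_vol s (\<psi> x)) * form_vol s (\<psi> x)"
      using pos by (intro mult_right_mono) (auto simp: \<tau>_def)
    also have "\<dots> < e" using pos e by simp
    finally have le: "\<tau> * form_vol s (\<psi> x) < e" .
    have "\<forall>\<^sub>F y in at x within S. \<bar>form_vol s (\<psi> y) - form_vol s (\<psi> x)\<bar> \<le> \<tau> * form_vol s (\<psi> x)"
      by (rule form_vol_near[OF \<tau> s x fr alt cont])
    then show "\<forall>\<^sub>F y in at x within S. dist (form_vol s (\<psi> y)) (form_vol s (\<psi> x)) < e"
      by eventually_elim (use le in \<open>simp add: dist_real_def\<close>)
  qed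
qed

lemma compact_support_integrable:
  fixes f :: "R7 \<Rightarrow> real"
  assumes "continuous_on S f" "compact K" "K \<subseteq> S" "\<And>x. x \<in> S \<Longrightarrow> x \<notin> K \<Longrightarrow> f x = 0"
  shows "f absolutely_integrable_on S" "(LINT x:S|lborel. f x) = integral S f"
proof -
  have e: "(\<lambda>x. indicator K x *\<^sub>R f x) = (\<lambda>x. indicator S x *\<^sub>R f x)"
    using assms(3,4) by (force simp: indicator_def)
  have i: "integrable lborel (\<lambda>x. indicator S x *\<^sub>R f x)"
    using borel_integrable_compact[OF assms(2) continuous_on_subset[OF assms(1,3)]] unfolding e .
  then show "(LINT x:S|lborel. f x) = integral S f"
    by (intro set_borel_integral_eq_integral(2)) (simp add: set_integrable_def)
  have "integrable (completion lborel) (\<lambda>x. indicator S x *\<^sub>R f x)"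
    using i borel_measurable_integrable[OF i] by (subst integrable_completion) auto
  then show "f absolutely_integrable_on S" by (simp add: set_integrable_def)
qed

context oriented_orb
begin

definition vol_dens :: "'a dform \<Rightarrow> 'a chart \<Rightarrow> R7 \<Rightarrow> real" where
  "vol_dens \<phi> c x = form_vol (orient M c) (\<phi> c x)"

lemma G2_formD:
  assumes "G2_form M \<phi>"
  shows "is_form M 3 \<phi>" "c \<in> atlas M \<Longrightarrow> x \<in> lift c \<Longrightarrow> G2_frames (orient M c) (\<phi> c x) \<noteq> {}"
proof -
  show "is_form M 3 \<phi>" using assms unfolding G2_form_def by (rule conjunct1)
  show "c \<in> atlas M \<Longrightarrow> x \<in> lift c \<Longrightarrow> G2_frames (orient M c) (\<phi> c x) \<noteq> {}"
    using assms unfolding G2_form_def by (drule_tac conjunct2) (drule bspec, assumption, erule bspec, assumption)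
qed

lemma vol_dens_pos:
  assumes "G2_form M \<phi>" "c \<in> atlas M" "x \<in> lift c"
  shows "vol_dens \<phi> c x > 0"
proof -
  obtain L where "L \<in> G2_frames (orient M c) (\<phi> c x)" using G2_formD(2)[OF assms] by (auto simp: ex_in_conv[symmetric])
  then show ?thesis unfolding vol_dens_def by (rule form_vol_frame(2)[OF _ orient_cases[OF assms(2)]])
qed

lemma vol_dens_continuous:
  assumes "G2_form M \<phi>" "c \<in> atlas M"
  shows "continuous_on (lift c) (vol_dens \<phi> c)"
  unfolding vol_dens_def
proof (rule form_vol_continuous[OF orient_cases[OF assms(2)] G2_formD(2)[OF assms]])
  show "alternating_form 3 (\<phi> c y)" if "y \<in> lift c" for y
    by (rule is_formD(1)[OF G2_formD(1)[OF assms(1)] assms(2) that])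
  show "continuous_on (lift c) (\<lambda>y. \<phi> c y v)" for v
    by (rule smooth_on_imp_continuous_on[OF is_formD(2)[OF G2_formD(1)[OF assms(1)] assms(2)]])
qed

lemma vol_dens_density:
  assumes "G2_form M \<phi>"
  shows "density (vol_dens \<phi>)"
  unfolding density_def
proof (intro ballI allI impI)
  fix c1 c2 V f x
  assume c: "c1 \<in> atlas M" "c2 \<in> atlas M" and f: "transition c1 c2 V f" and x: "x \<in> V"
  have "f differentiable (at x within V)"
    using f x by (intro smooth_on_differentiable) (auto simp: transition_def)
  then have lin: "linear (tangent_map V f x)"
    unfolding tangent_map_def by (rule linear_frechet_derivative)
  have e: "pullback (tangent_map V f x) (\<phi> c2 (f x)) = \<phi> c1 x"
    by (rule is_formD(4)[OF G2_formD(1)[OF assms] c f x])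
  have "f x \<in> lift c2" by (rule transition_preimg(2)[OF f x])
  then show "vol_dens \<phi> c1 x = \<bar>det (matrix (tangent_map V f x))\<bar> * vol_dens \<phi> c2 (f x)"
    unfolding vol_dens_def e[symmetric]
    by (intro form_vol_compose G2_formD(2)[OF assms] c lin orient_transition[OF c f x] orient_cases)
qed

lemma density_mult:
  assumes "density G" shows "density (\<lambda>c x. r (proj c x) * G c x)"
  unfolding density_def
proof (intro ballI allI impI)
  fix c1 c2 V f x
  assume *: "c1 \<in> atlas M" "c2 \<in> atlas M" "transition c1 c2 V f" "x \<in> V" "x \<in> interior (lift c1)"
  show "r (proj c1 x) * G c1 x = \<bar>det (matrix (tangent_map V f x))\<bar> * (r (proj c2 (f x)) * G c2 (f x))"
    using densityD[OF assms *] transition_preimg(3)[OF *(3,4)] by (simp only: mult.left_commute)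
qed

lemma density_diff:
  assumes "density G" "density H" shows "density (\<lambda>c x. G c x - H c x)"
  unfolding density_def
proof (intro ballI allI impI)
  fix c1 c2 V f x
  assume *: "c1 \<in> atlas M" "c2 \<in> atlas M" "transition c1 c2 V f" "x \<in> V" "x \<in> interior (lift c1)"
  show "G c1 x - H c1 x = \<bar>det (matrix (tangent_map V f x))\<bar> * (G c2 (f x) - H c2 (f x))"
    using densityD[OF assms(1) *] densityD[OF assms(2) *] by (simp only: right_diff_distrib)
qed

text \<open>The saturation of an open set is a finite union of its translates, hence open in the
  lift, and \<open>proj c\<close> is a quotient map onto an open set.\<close>

lemma proj_open:
  assumes c: "c \<in> atlas M" and U: "openin (top_of_set (lift c)) U"
  shows "openin (space_of M) (proj c ` U)"
proof -
  have UL: "U \<subseteq> lift c" using U by (rule openin_imp_subset)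
  have e: "{x \<in> lift c. proj c x \<in> proj c ` U} = (\<Union>g\<in>grp c. lift c \<inter> (*v) g -` U)"
  proof (intro equalityI subsetI)
    fix x assume "x \<in> {x \<in> lift c. proj c x \<in> proj c ` U}"
    then obtain u where u: "x \<in> lift c" "u \<in> U" "proj c x = proj c u" by auto
    then obtain g where "g \<in> grp c" "u = g *v x" using chartD(8)[OF c] UL by blast
    then show "x \<in> (\<Union>g\<in>grp c. lift c \<inter> (*v) g -` U)" using u by blast
  next
    fix x assume "x \<in> (\<Union>g\<in>grp c. lift c \<inter> (*v) g -` U)"
    then obtain g where g: "g \<in> grp c" "x \<in> lift c" "g *v x \<in> U" by auto
    then show "x \<in> {x \<in> lift c. proj c x \<in> proj c ` U}" 
      using image_eqI[where f = "proj c", OF group_lift(2)[OF c g(1,2), symmetric] g(3)] g(2) by simp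
  qed
  have "openin (top_of_set (lift c)) (lift c \<inter> (*v) g -` U)" if "g \<in> grp c" for g
    by (rule continuous_openin_preimage[OF matrix_vector_mult_linear_continuous_on _ U])
      (use group_lift(1)[OF c that] in blast)
  then have "openin (top_of_set (lift c)) {x \<in> lift c. proj c x \<in> proj c ` U}"
    unfolding e by blast
  then have "openin (subtopology (space_of M) (image_of c)) (proj c ` U)"
    using chartD(7)[OF c] UL image_openin[OF c, THEN openin_subset]
    unfolding quotient_map_def by (simp add: image_mono Int_absorb1)
  then show ?thesis using image_openin[OF c] openin_trans_full by blast
qed

lemma lift_cball:
  assumes "c \<in> atlas M" "x \<in> lift c"
  obtains r where "r > 0" "compact (lift c \<inter> cball x r)"
proof -
  obtain T H where T: "open T" "lift c = H \<inter> T" "H = UNIV \<or> H = half_space" using lift_cases[OF assms(1)] .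
  have "closed H" using T(3) by (auto simp: half_space_def intro!: closed_Collect_le continuous_intros)
  obtain r where r: "r > 0" "cball x r \<subseteq> T" using T assms(2) open_contains_cball by blast
  have "lift c \<inter> cball x r = H \<inter> cball x r" using T r by auto
  then show thesis using that r \<open>closed H\<close> by (simp add: closed_Int_compact)
qed

lemma group_compact:
  assumes "c \<in> atlas M" "compact K" "K \<subseteq> lift c"
  shows "compact (\<Union>g\<in>grp c. (*v) g ` K)" "(\<Union>g\<in>grp c. (*v) g ` K) \<subseteq> lift c"
    "x \<in> lift c \<Longrightarrow> proj c x \<in> proj c ` K \<Longrightarrow> x \<in> (\<Union>g\<in>grp c. (*v) g ` K)"
proof -
  show "compact (\<Union>g\<in>grp c. (*v) g ` K)"
    by (intro compact_UN grp_finite assms ballI compact_continuous_image matrix_vector_mult_linear_continuous_on)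
  show "(\<Union>g\<in>grp c. (*v) g ` K) \<subseteq> lift c" using group_lift(1)[OF assms(1)] assms(3) by blast
  assume x: "x \<in> lift c" "proj c x \<in> proj c ` K"
  then obtain k where k: "k \<in> K" "proj c k = proj c x" by auto
  then obtain g where "g \<in> grp c" "x = g *v k" using chartD(8)[OF assms(1)] x(1) assms(3) by blast
  then show "x \<in> (\<Union>g\<in>grp c. (*v) g ` K)" using k by blast
qed

text \<open>Properness of the projection. Finitely many images of small compact pieces of the lift
  cover \<open>S\<close>, and the full preimage is a relatively closed part of the union of the
  finitely many translates of these pieces.\<close>

lemma compact_lift_preimage:
  assumes c: "c \<in> atlas M" and comp: "compact_space (space_of M)"
    and S: "closedin (space_of M) S" "S \<subseteq> image_of c"
  shows "compact {x \<in> lift c. proj c x \<in> S}"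
proof -
  have "\<forall>x\<in>lift c. \<exists>r>0. compact (lift c \<inter> cball x r)" using lift_cball[OF c] by metis
  then obtain r where r: "\<And>x. x \<in> lift c \<Longrightarrow> r x > 0" "\<And>x. x \<in> lift c \<Longrightarrow> compact (lift c \<inter> cball x (r x))" by metis
  define U where "U x = proj c ` (lift c \<inter> ball x (r x))" for x
  have U: "openin (space_of M) (U x)" for x
    unfolding U_def by (rule proj_open[OF c]) (simp add: openin_open_Int)
  have xU: "proj c x \<in> U x" if "x \<in> lift c" for x using that r by (auto simp: U_def)
  have "compactin (space_of M) S" using comp S(1) by (rule closedin_compact_space)
  moreover have "S \<subseteq> \<Union>(U ` lift c)" using S(2) xU by blast
  ultimately obtain F where F: "finite F" "F \<subseteq> U ` lift c" "S \<subseteq> \<Union>F"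
    unfolding compactin_def using U by (smt (verit, best) image_iff)
  obtain P where P: "finite P" "P \<subseteq> lift c" "F = U ` P" using finite_subset_image[OF F(1,2)] by blast
  define K where "K = (\<Union>x\<in>P. lift c \<inter> cball x (r x))"
  have K: "compact K" "K \<subseteq> lift c"
    unfolding K_def by (rule compact_UN) (use P r(2) in auto)
  have SK: "S \<subseteq> proj c ` K"
  proof
    fix p assume "p \<in> S"
    then obtain x where x: "x \<in> P" "p \<in> U x" using F(3) P(3) by blast
    then obtain y where "y \<in> lift c" "y \<in> ball x (r x)" "p = proj c y" by (auto simp: U_def)
    then show "p \<in> proj c ` K" using x by (force simp: K_def)
  qed
  define KK where "KK = (\<Union>g\<in>grp c. (*v) g ` K)"
  have KK: "compact KK" "KK \<subseteq> lift c" using group_compact(1,2)[OF c K] by (simp_all add: KK_def)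
  obtain T where T: "open T" "\<And>y. y \<in> lift c \<Longrightarrow> y \<in> T \<longleftrightarrow> proj c y \<notin> S"
    using off_closed_open[OF c S(1)] by blast
  have "{x \<in> lift c. proj c x \<in> S} = KK - T"
  proof (intro equalityI subsetI)
    fix x assume "x \<in> {x \<in> lift c. proj c x \<in> S}"
    then have x: "x \<in> lift c" "proj c x \<in> S" by auto
    then have "x \<in> KK" unfolding KK_def by (intro group_compact(3)[OF c K x(1)] subsetD[OF SK])
    then show "x \<in> KK - T" using T(2)[OF x(1)] x(2) by simp
  next
    fix x assume x: "x \<in> KK - T"
    then have xl: "x \<in> lift c" using KK(2) by auto
    then show "x \<in> {x \<in> lift c. proj c x \<in> S}" using T(2)[OF xl] x by simp
  qed
  then show ?thesis using KK(1) T(1) by (simp add: compact_diff)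
qed

end

section \<open>Partitions of unity\<close>

context oriented_orb
begin

text \<open>A Euclidean bump summed over the group is invariant and descends to the image of the
  chart. Its support there is closed in the orbifold, so extension by zero remains smooth in every
  chart.\<close>

lemma point_bump:
  assumes p: "p \<in> topspace (space_of M)"
  shows "\<exists>c u S W. c \<in> atlas M \<and> closedin (space_of M) S \<and> S \<subseteq> image_of c \<and> (\<forall>z. 0 \<le> u z) \<and>
    (\<forall>z. z \<notin> S \<longrightarrow> u z = (0::real)) \<and> openin (space_of M) W \<and> p \<in> W \<and> (\<forall>z\<in>W. u z > 0) \<and>
    (\<forall>c'\<in>atlas M. smooth_on (lift c') (\<lambda>x. u (proj c' x)))"
proof -
  obtain c where c: "c \<in> atlas M" "p \<in> image_of c" using covered[OF p] by blast
  then obtain x0 where x0: "x0 \<in> lift c" "p = proj c x0" by blast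
  obtain r where r: "r > 0" "compact (lift c \<inter> cball x0 r)" using lift_cball[OF c(1) x0(1)] .
  define K where "K = lift c \<inter> cball x0 r"
  define \<beta> :: "R7 \<Rightarrow> real" where "\<beta> x = (\<Sum>g\<in>grp c. bump ((1/r) *\<^sub>R (g *v x - x0)))" for x
  define u where "u z = (if z \<in> image_of c then \<beta> (inv_into (lift c) (proj c) z) else 0)" for z
  define S where "S = proj c ` K"
  define W where "W = proj c ` (lift c \<inter> ball x0 r)"
  note fin = grp_finite[OF c(1)]
  have \<beta>0: "\<beta> x \<ge> 0" for x unfolding \<beta>_def by (intro sum_nonneg bump_nonneg)
  have inv: "\<beta> (h *v x) = \<beta> x" if h: "h \<in> grp c" for h x
    unfolding \<beta>_def
  proof (rule sum.reindex_bij_witness[of _ "\<lambda>g. g ** matrix_inv h" "\<lambda>g. g ** h"])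
    note gi = grp_inv_mult[OF c(1) h]
    show "g ** h ** matrix_inv h = g" "g ** matrix_inv h ** h = g" for g
      by (simp_all only: matrix_mul_assoc[symmetric] gi matrix_mul_rid)
    show "g \<in> grp c \<Longrightarrow> g ** h \<in> grp c" "g \<in> grp c \<Longrightarrow> g ** matrix_inv h \<in> grp c" for g
      using grp_mult[OF c(1)] grp_inv[OF c(1) h] h by blast+
    show "bump ((1/r) *\<^sub>R ((g ** h) *v x - x0)) = bump ((1/r) *\<^sub>R (g *v (h *v x) - x0))" for g
      by (simp only: matrix_vector_mul_assoc)
  qed
  have u\<beta>: "u (proj c x) = \<beta> x" if x: "x \<in> lift c" for x
  proof -
    let ?y = "inv_into (lift c) (proj c) (proj c x)"
    have im: "proj c x \<in> image_of c" using x by blast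
    have y: "?y \<in> lift c" "proj c x = proj c ?y" using inv_into_into[OF im] f_inv_into_f[OF im] by simp_all
    then obtain g where "g \<in> grp c" "?y = g *v x" using chartD(8)[OF c(1)] x by blast
    then show ?thesis using im inv by (simp add: u_def)
  qed
  have K: "compact K" "K \<subseteq> lift c" using r(2) by (auto simp: K_def)
  have S: "closedin (space_of M) S" "S \<subseteq> image_of c"
    using proj_compact_closed[OF c(1) K] K(2) by (auto simp: S_def)
  have off: "u z = 0" if z: "z \<notin> S" for z
  proof (rule ccontr)
    assume nz: "u z \<noteq> 0"
    then have "z \<in> image_of c" by (simp add: u_def split: if_split_asm)
    then obtain x where x: "x \<in> lift c" "z = proj c x" by blast
    then have "\<beta> x \<noteq> 0" using nz u\<beta> by simp
    then obtain g where g: "g \<in> grp c" "bump ((1/r) *\<^sub>R (g *v x - x0)) \<noteq> 0"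
      unfolding \<beta>_def by (meson sum.neutral)
    then have "norm ((1/r) *\<^sub>R (g *v x - x0)) < 1" by (simp add: bump_eq_0_iff)
    then have "norm (g *v x - x0) < r" using r(1) by (simp add: divide_simps)
    then have "g *v x \<in> K" using group_lift(1)[OF c(1) g(1) x(1)] by (simp add: K_def dist_norm norm_minus_commute)
    moreover have "z = proj c (g *v x)" using group_lift(2)[OF c(1) g(1) x(1)] x(2) by simp
    ultimately show False using z unfolding S_def by blast
  qed
  have W: "openin (space_of M) W" "p \<in> W"
    unfolding W_def using r(1) x0 by (auto intro!: proj_open[OF c(1)] simp: openin_open_Int)
  have pos: "u z > 0" if "z \<in> W" for z
  proof -
    obtain x where x: "x \<in> lift c" "x \<in> ball x0 r" "z = proj c x" using \<open>z \<in> W\<close> by (auto simp: W_def)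
    have "norm ((1/r) *\<^sub>R (mat 1 *v x - x0)) < 1"
      using x(2) r(1) by (simp add: dist_norm norm_minus_commute divide_simps)
    then have "0 < bump ((1/r) *\<^sub>R (mat 1 *v x - x0))" by (simp only: bump_pos_iff)
    also have "\<dots> \<le> \<beta> x"
      unfolding \<beta>_def by (rule member_le_sum[OF grp_one[OF c(1)] _ fin]) (rule bump_nonneg)
    finally show ?thesis using u\<beta>[OF x(1)] x(3) by simp
  qed
  have sm\<beta>: "smooth_on UNIV \<beta>"
    unfolding \<beta>_def
  proof (rule smooth_on_sum)
    fix g
    have "smooth_on UNIV (\<lambda>x. (1/r) *\<^sub>R (g *v x) + (1/r) *\<^sub>R (- x0))"
      by (intro smooth_on_add smooth_on_bounded_linear smooth_on_const bounded_linear_scaleR_const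
        bounded_linear_const_scaleR linear_conv_bounded_linear[THEN iffD1] matrix_vector_mul_linear)
    then have "smooth_on UNIV (\<lambda>x. (1/r) *\<^sub>R (g *v x - x0))" by (simp add: algebra_simps)
    then show "smooth_on UNIV (\<lambda>x. bump ((1/r) *\<^sub>R (g *v x - x0)) :: real)"
      by (rule smooth_on_compose[OF _ bump_smooth[of UNIV]]) simp
  qed
  have "smooth_on (lift c') (\<lambda>x. u (proj c' x))" if c': "c' \<in> atlas M" for c'
  proof (rule smooth_on_local)
    fix y assume y: "y \<in> lift c'"
    show "\<exists>U g. open U \<and> y \<in> U \<and> smooth_on (lift c' \<inter> U) g \<and> (\<forall>z\<in>lift c' \<inter> U. g z = u (proj c' z))"
    proof (cases "proj c' y \<in> image_of c")
      case True
      then obtain x where x: "x \<in> lift c" "proj c' y = proj c x" by blast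
      obtain V f where f: "transition c' c V f" "y \<in> V" "f y = x" using compat[OF c' c(1) y x] .
      have V: "openin (top_of_set (lift c')) V" "smooth_on V f" using f(1) by (auto simp: transition_def)
      obtain U where U: "open U" "V = lift c' \<inter> U" using V(1) by (auto simp: openin_open)
      have "smooth_on V (\<lambda>z. \<beta> (f z))" by (rule smooth_on_compose[OF V(2) sm\<beta>]) simp
      moreover have "\<beta> (f z) = u (proj c' z)" if "z \<in> V" for z
        using u\<beta>[OF transition_preimg(2)[OF f(1) that]] transition_preimg(3)[OF f(1) that] by simp
      ultimately show ?thesis using U f(2) by (intro exI[of _ U] exI[of _ "\<lambda>z. \<beta> (f z)"]) auto
    next
      case False
      obtain T where T: "open T" "\<And>z. z \<in> lift c' \<Longrightarrow> z \<in> T \<longleftrightarrow> proj c' z \<notin> S"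
        using off_closed_open[OF c' S(1)] by blast
      have "y \<in> T" using T(2)[OF y] False S(2) by blast
      then show ?thesis using T off by (intro exI[of _ T] exI[of _ "\<lambda>z. 0"]) auto
    qed
  qed
  moreover have "\<forall>z. 0 \<le> u z" using \<beta>0 by (simp add: u_def)
  ultimately show ?thesis using c(1) S off W pos
    by (intro exI[of _ c] exI[of _ u] exI[of _ S] exI[of _ W]) simp
qed

lemma partition_of_unity_exists:
  assumes comp: "compact_space (space_of M)"
  shows "\<exists>C \<rho>. partition_of_unity M C \<rho>"
proof -
  let ?X = "topspace (space_of M)"
  obtain ch u S W where b: "\<forall>p\<in>?X. ch p \<in> atlas M \<and> closedin (space_of M) (S p) \<and> S p \<subseteq> image_of (ch p) \<and> (\<forall>z. 0 \<le> u p z) \<and>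
    (\<forall>z. z \<notin> S p \<longrightarrow> u p z = (0::real)) \<and> openin (space_of M) (W p) \<and> p \<in> W p \<and> (\<forall>z\<in>W p. u p z > 0) \<and>
    (\<forall>c'\<in>atlas M. smooth_on (lift c') (\<lambda>x. u p (proj c' x)))"
    using point_bump by (elim bchoice[THEN exE, rotated] | metis)
  have "\<forall>U\<in>W ` ?X. openin (space_of M) U" "?X \<subseteq> \<Union>(W ` ?X)" using b by blast+
  then obtain F where F: "finite F" "F \<subseteq> W ` ?X" "?X \<subseteq> \<Union>F"
    using comp unfolding compact_space_def compactin_def by meson
  obtain P where P: "finite P" "P \<subseteq> ?X" "F = W ` P" using finite_subset_image[OF F(1,2)] by blast
  have bP: "ch p \<in> atlas M" "closedin (space_of M) (S p)" "S p \<subseteq> image_of (ch p)" "0 \<le> u p z"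
    "z \<notin> S p \<Longrightarrow> u p z = 0" "z \<in> W p \<Longrightarrow> u p z > 0" "c' \<in> atlas M \<Longrightarrow> smooth_on (lift c') (\<lambda>x. u p (proj c' x))"
    if "p \<in> P" for p z c'
    using b[rule_format, of p] that P(2) by blast+
  define tot where "tot z = (\<Sum>p\<in>P. u p z)" for z
  have tot: "tot z > 0" if z: "z \<in> ?X" for z
  proof -
    obtain p where p: "p \<in> P" "z \<in> W p" using F(3) P(3) z by blast
    have "0 < u p z" by (rule bP(6)[OF p])
    also have "\<dots> \<le> tot z" unfolding tot_def using bP(4) by (intro member_le_sum p P) auto
    finally show ?thesis .
  qed
  \<comment> \<open>Several points may have been given the same chart. A partition of unity is
    indexed by charts, so the bumps that share one are added up.\<close>
  define Q where "Q c = {p \<in> P. ch p = c}" for c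
  define \<rho> where "\<rho> c z = (\<Sum>p\<in>Q c. u p z) * inverse (tot z)" for c z
  have QP: "Q c \<subseteq> P" for c by (auto simp: Q_def)
  have "partition_of_unity M (ch ` P) \<rho>"
    unfolding partition_of_unity_def
  proof (intro conjI ballI)
    show "finite (ch ` P)" "ch ` P \<subseteq> atlas M" using P(1) bP(1) by auto
    show "0 \<le> \<rho> c z" if "z \<in> ?X" for c z
      using tot[OF that] bP(4) QP unfolding \<rho>_def by (intro mult_nonneg_nonneg sum_nonneg) auto
    show "(\<Sum>c\<in>ch ` P. \<rho> c z) = 1" if "z \<in> ?X" for z
    proof -
      have "(\<Sum>c\<in>ch ` P. \<Sum>p\<in>Q c. u p z) = tot z"
        unfolding tot_def Q_def by (rule sum.image_gen[symmetric, OF P(1)])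
      then have "(\<Sum>c\<in>ch ` P. \<rho> c z) = tot z * inverse (tot z)"
        unfolding \<rho>_def sum_distrib_right[symmetric] by simp
      then show ?thesis using tot[OF that] by simp
    qed
    show "space_of M closure_of {z \<in> ?X. \<rho> c z \<noteq> 0} \<subseteq> image_of c" if "c \<in> ch ` P" for c
    proof -
      have "{z \<in> ?X. \<rho> c z \<noteq> 0} \<subseteq> (\<Union>p\<in>Q c. S p)"
      proof
        fix z assume "z \<in> {z \<in> ?X. \<rho> c z \<noteq> 0}"
        then have "(\<Sum>p\<in>Q c. u p z) \<noteq> 0" by (auto simp: \<rho>_def)
        then obtain p where "p \<in> Q c" "u p z \<noteq> 0" by (meson sum.neutral)
        then show "z \<in> (\<Union>p\<in>Q c. S p)" using bP(5) QP by blast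
      qed
      moreover have "closedin (space_of M) (\<Union>p\<in>Q c. S p)"
        using bP(2) QP finite_subset[OF QP P(1)] by (intro closedin_Union) auto
      ultimately have "space_of M closure_of {z \<in> ?X. \<rho> c z \<noteq> 0} \<subseteq> (\<Union>p\<in>Q c. S p)"
        by (rule closure_of_minimal)
      moreover have "(\<Union>p\<in>Q c. S p) \<subseteq> image_of c" using bP(3) unfolding Q_def by blast
      ultimately show ?thesis by (rule subset_trans)
    qed
    show "smooth_on (lift c') (\<lambda>x. \<rho> c (proj c' x))" if c': "c' \<in> atlas M" for c c'
      unfolding \<rho>_def
    proof (intro smooth_on_mult smooth_on_inverse)
      show "smooth_on (lift c') (\<lambda>x. \<Sum>p\<in>Q c. u p (proj c' x))"
        using bP(7)[OF _ c'] QP by (intro smooth_on_sum) blast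
      show "smooth_on (lift c') (\<lambda>x. tot (proj c' x))"
        unfolding tot_def using bP(7)[OF _ c'] by (intro smooth_on_sum) blast
      show "tot (proj c' x) \<noteq> 0" if "x \<in> lift c'" for x
        using tot[OF proj_in_topspace[OF c' that]] by simp
    qed
  qed
  then show ?thesis by blast
qed

end

section \<open>The Hitchin functional as an integral over fundamental domains\<close>

locale compact_oriented_orb = oriented_orb +
  assumes compact: "compact_space (space_of M)"
begin

definition fd :: "'a chart \<Rightarrow> R7 set" where
  "fd c = (SOME D. fund_dom c D)"

lemma fd: "c \<in> atlas M \<Longrightarrow> fund_dom c (fd c)"
  unfolding fd_def by (rule someI_ex) (rule fund_dom_exists)

definition cont_density :: "('a chart \<Rightarrow> R7 \<Rightarrow> real) \<Rightarrow> bool" where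
  "cont_density G \<longleftrightarrow> density G \<and> (\<forall>c\<in>atlas M. continuous_on (lift c) (G c))"

lemma cont_densityD:
  assumes "cont_density G"
  shows "density G" "c \<in> atlas M \<Longrightarrow> continuous_on (lift c) (G c)"
  using assms by (simp_all add: cont_density_def)

lemma cont_density_vol_dens: "G2_form M \<phi> \<Longrightarrow> cont_density (vol_dens \<phi>)"
  by (simp add: cont_density_def vol_dens_density vol_dens_continuous)

lemma cont_density_diff: "cont_density G \<Longrightarrow> cont_density H \<Longrightarrow> cont_density (\<lambda>c x. G c x - H c x)"
  by (simp add: cont_density_def density_diff continuous_on_diff)

lemma pouD:
  assumes "partition_of_unity M C \<rho>"
  shows "finite C" "C \<subseteq> atlas M"
    "c \<in> C \<Longrightarrow> c' \<in> atlas M \<Longrightarrow> x \<in> lift c' \<Longrightarrow> 0 \<le> \<rho> c (proj c' x)"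
    "c' \<in> atlas M \<Longrightarrow> x \<in> lift c' \<Longrightarrow> (\<Sum>c\<in>C. \<rho> c (proj c' x)) = 1"
    "c \<in> C \<Longrightarrow> c' \<in> atlas M \<Longrightarrow> continuous_on (lift c') (\<lambda>x. \<rho> c (proj c' x))"
    "c \<in> C \<Longrightarrow> c' \<in> atlas M \<Longrightarrow> x \<in> lift c' \<Longrightarrow> proj c' x \<notin> image_of c \<Longrightarrow> \<rho> c (proj c' x) = 0"
    "c \<in> C \<Longrightarrow> compact {x \<in> lift c. proj c x \<in> (space_of M) closure_of {p \<in> topspace (space_of M). \<rho> c p \<noteq> 0}}"
    "c \<in> C \<Longrightarrow> x \<in> lift c \<Longrightarrow> proj c x \<notin> (space_of M) closure_of {p \<in> topspace (space_of M). \<rho> c p \<noteq> 0} \<Longrightarrow> \<rho> c (proj c x) = 0"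
proof -
  have P: "finite C" "C \<subseteq> atlas M" "\<forall>c\<in>C. \<forall>p\<in>topspace (space_of M). 0 \<le> \<rho> c p"
    "\<forall>p\<in>topspace (space_of M). (\<Sum>c\<in>C. \<rho> c p) = 1"
    "\<forall>c\<in>C. (space_of M) closure_of {p \<in> topspace (space_of M). \<rho> c p \<noteq> 0} \<subseteq> image_of c"
    "\<forall>c\<in>C. \<forall>c'\<in>atlas M. smooth_on (lift c') (\<lambda>x. \<rho> c (proj c' x))"
    using assms unfolding partition_of_unity_def by - (elim conjE, assumption)+
  show "finite C" "C \<subseteq> atlas M" by (rule P)+
  show "c \<in> C \<Longrightarrow> c' \<in> atlas M \<Longrightarrow> x \<in> lift c' \<Longrightarrow> 0 \<le> \<rho> c (proj c' x)"
    using P(3) proj_in_topspace by blast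
  show "c' \<in> atlas M \<Longrightarrow> x \<in> lift c' \<Longrightarrow> (\<Sum>c\<in>C. \<rho> c (proj c' x)) = 1"
    using P(4) proj_in_topspace by blast
  show "c \<in> C \<Longrightarrow> c' \<in> atlas M \<Longrightarrow> continuous_on (lift c') (\<lambda>x. \<rho> c (proj c' x))"
    using P(6) smooth_on_imp_continuous_on by blast
  have cl: "p \<in> (space_of M) closure_of {p \<in> topspace (space_of M). \<rho> c p \<noteq> 0}"
    if "p \<in> topspace (space_of M)" "\<rho> c p \<noteq> 0" for p
    by (rule subsetD[OF closure_of_subset]) (use that in auto)
  show "c \<in> C \<Longrightarrow> c' \<in> atlas M \<Longrightarrow> x \<in> lift c' \<Longrightarrow> proj c' x \<notin> image_of c \<Longrightarrow> \<rho> c (proj c' x) = 0"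
    using cl[of "proj c' x"] P(5) proj_in_topspace by blast
  show "c \<in> C \<Longrightarrow> x \<in> lift c \<Longrightarrow> proj c x \<notin> (space_of M) closure_of {p \<in> topspace (space_of M). \<rho> c p \<noteq> 0} \<Longrightarrow> \<rho> c (proj c x) = 0"
    using cl[of "proj c x"] P(2) proj_in_topspace by blast
  show "c \<in> C \<Longrightarrow> compact {x \<in> lift c. proj c x \<in> (space_of M) closure_of {p \<in> topspace (space_of M). \<rho> c p \<noteq> 0}}"
    using P(2,5) by (intro compact_lift_preimage compact closedin_closure_of) auto
qed

lemma pou_integrable:
  assumes P: "partition_of_unity M C \<rho>" and c: "c \<in> C" and f: "continuous_on (lift c) f"
  shows "(\<lambda>x. \<rho> c (proj c x) * f x) absolutely_integrable_on lift c"
    "(LINT x:lift c|lborel. \<rho> c (proj c x) * f x) = integral (lift c) (\<lambda>x. \<rho> c (proj c x) * f x)"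
    "(\<lambda>x. \<rho> c (proj c x) * f x) absolutely_integrable_on fd c"
proof -
  have ca: "c \<in> atlas M" using pouD(2)[OF P] c by blast
  note F = fund_domD[OF fd[OF ca]]
  have cont: "continuous_on (lift c) (\<lambda>x. \<rho> c (proj c x) * f x)"
    by (intro continuous_on_mult pouD(5)[OF P c ca] f)
  have z: "\<rho> c (proj c x) * f x = 0" if "x \<in> lift c"
    "x \<notin> {x \<in> lift c. proj c x \<in> (space_of M) closure_of {p \<in> topspace (space_of M). \<rho> c p \<noteq> 0}}" for x
    using pouD(8)[OF P c] that by simp
  show 1: "(\<lambda>x. \<rho> c (proj c x) * f x) absolutely_integrable_on lift c"
    "(LINT x:lift c|lborel. \<rho> c (proj c x) * f x) = integral (lift c) (\<lambda>x. \<rho> c (proj c x) * f x)"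
    using compact_support_integrable[OF cont pouD(7)[OF P c] _ z] by auto
  show "(\<lambda>x. \<rho> c (proj c x) * f x) absolutely_integrable_on fd c"
    by (rule set_integrable_subset[OF 1(1) _ F(4)]) (use F(3) in simp)
qed

text \<open>The integral with each lift replaced by a fundamental domain, so that neither group
  orders nor signs occur.\<close>

definition total :: "'a chart set \<Rightarrow> ('a chart \<Rightarrow> 'a \<Rightarrow> real) \<Rightarrow> ('a chart \<Rightarrow> R7 \<Rightarrow> real) \<Rightarrow> real" where
  "total C \<rho> G = (\<Sum>c\<in>C. integral (fd c) (\<lambda>x. \<rho> c (proj c x) * G c x))"

lemma total_refine:
  assumes P: "partition_of_unity M C \<rho>" and P': "partition_of_unity M C' \<rho>'" and G: "cont_density G"
  shows "total C \<rho> G = (\<Sum>c\<in>C. \<Sum>c'\<in>C'. integral (fd c) (\<lambda>x. \<rho> c (proj c x) * (\<rho>' c' (proj c x) * G c x)))"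
  unfolding total_def
proof (rule sum.cong[OF refl])
  fix c assume c: "c \<in> C"
  have ca: "c \<in> atlas M" using pouD(2)[OF P] c by blast
  note F = fund_domD[OF fd[OF ca]]
  have i: "(\<lambda>x. \<rho> c (proj c x) * (\<rho>' c' (proj c x) * G c x)) integrable_on fd c" if "c' \<in> C'" for c'
    by (intro set_lebesgue_integral_eq_integral(1) pou_integrable[OF P c] continuous_on_mult pouD(5)[OF P' that ca]
      cont_densityD[OF G] ca)
  have "integral (fd c) (\<lambda>x. \<rho> c (proj c x) * G c x)
      = integral (fd c) (\<lambda>x. \<Sum>c'\<in>C'. \<rho> c (proj c x) * (\<rho>' c' (proj c x) * G c x))"
  proof (rule integral_cong)
    fix x assume "x \<in> fd c"
    then have "(\<Sum>c'\<in>C'. \<rho>' c' (proj c x)) = 1" using pouD(4)[OF P' ca] F(4) by blast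
    then show "\<rho> c (proj c x) * G c x = (\<Sum>c'\<in>C'. \<rho> c (proj c x) * (\<rho>' c' (proj c x) * G c x))"
      by (simp only: sum_distrib_left[symmetric] sum_distrib_right[symmetric] mult_1)
  qed
  also have "\<dots> = (\<Sum>c'\<in>C'. integral (fd c) (\<lambda>x. \<rho> c (proj c x) * (\<rho>' c' (proj c x) * G c x)))"
    by (rule integral_sum[OF pouD(1)[OF P'] i])
  finally show "integral (fd c) (\<lambda>x. \<rho> c (proj c x) * G c x) = \<dots>" .
qed

text \<open>Each partition is refined by the other, and for each pair of charts the doubly weighted
  density is moved between their domains; the weights make it vanish off the overlap, as
  \<open>density_transfer\<close> demands.\<close>

lemma total_independent:
  assumes P: "partition_of_unity M C \<rho>" and P': "partition_of_unity M C' \<rho>'" and G: "cont_density G"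
  shows "total C \<rho> G = total C' \<rho>' G"
proof -
  have t: "integral (fd c) (\<lambda>x. \<rho> c (proj c x) * (\<rho>' c' (proj c x) * G c x))
      = integral (fd c') (\<lambda>x. \<rho>' c' (proj c' x) * (\<rho> c (proj c' x) * G c' x))" if c: "c \<in> C" "c' \<in> C'" for c c'
  proof -
    have ca: "c \<in> atlas M" "c' \<in> atlas M" using pouD(2)[OF P] pouD(2)[OF P'] c by blast+
    have d: "density (\<lambda>d x. \<rho>' c' (proj d x) * (\<rho> c (proj d x) * G d x))"
      by (intro density_mult cont_densityD(1)[OF G])
    have "integral (fd c) (\<lambda>x. \<rho>' c' (proj c x) * (\<rho> c (proj c x) * G c x))
      = integral (fd c') (\<lambda>x. \<rho>' c' (proj c' x) * (\<rho> c (proj c' x) * G c' x))"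
    proof (rule density_transfer(2)[OF fd[OF ca(1)] fd[OF ca(2)] d])
      show "\<rho>' c' (proj c x) * (\<rho> c (proj c x) * G c x) = 0" if "x \<in> lift c" "proj c x \<notin> image_of c'" for x
        using pouD(6)[OF P' c(2) ca(1) that] by simp
      show "\<rho>' c' (proj c' x) * (\<rho> c (proj c' x) * G c' x) = 0" if "x \<in> lift c'" "proj c' x \<notin> image_of c" for x
        using pouD(6)[OF P c(1) ca(2) that] by simp
      show "(\<lambda>x. \<rho>' c' (proj c' x) * (\<rho> c (proj c' x) * G c' x)) absolutely_integrable_on fd c'"
        by (intro pou_integrable[OF P' c(2)] continuous_on_mult pouD(5)[OF P c(1) ca(2)] cont_densityD[OF G] ca)
    qed
    then show ?thesis by (simp only: mult.left_commute)
  qed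
  have "total C \<rho> G = (\<Sum>c\<in>C. \<Sum>c'\<in>C'. integral (fd c) (\<lambda>x. \<rho> c (proj c x) * (\<rho>' c' (proj c x) * G c x)))"
    by (rule total_refine[OF P P' G])
  also have "\<dots> = (\<Sum>c\<in>C. \<Sum>c'\<in>C'. integral (fd c') (\<lambda>x. \<rho>' c' (proj c' x) * (\<rho> c (proj c' x) * G c' x)))"
    by (intro sum.cong refl t)
  also have "\<dots> = (\<Sum>c'\<in>C'. \<Sum>c\<in>C. integral (fd c') (\<lambda>x. \<rho>' c' (proj c' x) * (\<rho> c (proj c' x) * G c' x)))"
    by (rule sum.swap)
  also have "\<dots> = total C' \<rho>' G" by (rule total_refine[OF P' P G, symmetric])
  finally show ?thesis .
qed

text \<open>The sign of the chart turns the volume coefficient into \<open>vol_dens\<close>, and the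
  division by the group order cancels against the equal contributions of the translates.\<close>

lemma orbifold_integral_chart_sum:
  assumes P: "partition_of_unity M C \<rho>" and \<phi>: "G2_form M \<phi>"
  shows "(\<Sum>c\<in>C. orient M c / real (card (grp c)) *
      (LINT x:lift c|lborel. \<rho> c (proj c x) * vol_form M \<phi> c x std_basis)) = total C \<rho> (vol_dens \<phi>)"
  unfolding total_def
proof (rule sum.cong[OF refl])
  fix c assume c: "c \<in> C"
  have ca: "c \<in> atlas M" using pouD(2)[OF P] c by blast
  note G = cont_density_vol_dens[OF \<phi>] and F = fd[OF ca]
  let ?g = "\<lambda>x. \<rho> c (proj c x) * vol_form M \<phi> c x std_basis" and ?h = "\<lambda>d x. \<rho> c (proj d x) * vol_dens \<phi> d x"
  have "?h c = (\<lambda>x. orient M c * ?g x)"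
    by (rule ext) (simp add: vol_dens_def form_vol_def vol_form_def)
  then have "(LINT x:lift c|lborel. ?h c x) = orient M c * (LINT x:lift c|lborel. ?g x)" by simp
  moreover have "(LINT x:lift c|lborel. ?h c x) = integral (lift c) (?h c)"
    by (rule pou_integrable(2)[OF P c cont_densityD(2)[OF G ca]])
  moreover have "\<dots> = real (card (grp c)) * integral (fd c) (?h c)"
    by (rule integral_fund_dom[OF density_mult[OF cont_densityD(1)[OF G]] F]) (rule pou_integrable(1)[OF P c cont_densityD(2)[OF G ca]])
  moreover have "card (grp c) \<noteq> 0" using grp_finite[OF ca] grp_one[OF ca] by auto
  ultimately show "orient M c / real (card (grp c)) * (LINT x:lift c|lborel. ?g x) = integral (fd c) (?h c)"
    by (simp add: field_simps)
qed

text \<open>All partitions of unity give one value, so the \<open>SOME\<close> in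
  \<open>orbifold_integral\<close> is determined, and any convenient partition computes it.\<close>

lemma hitchin_eq_total:
  assumes P: "partition_of_unity M C \<rho>" and \<phi>: "G2_form M \<phi>"
  shows "hitchin_functional M \<phi> = total C \<rho> (vol_dens \<phi>)"
  unfolding hitchin_functional_def orbifold_integral_def
proof (rule some_equality)
  show "\<exists>C' \<rho>'. partition_of_unity M C' \<rho>' \<and> total C \<rho> (vol_dens \<phi>) =
      (\<Sum>c\<in>C'. orient M c / real (card (grp c)) * (LINT x:lift c|lborel. \<rho>' c (proj c x) * vol_form M \<phi> c x std_basis))"
    by (intro exI[of _ C] exI[of _ \<rho>] conjI P orbifold_integral_chart_sum[OF P \<phi>, symmetric])
next
  fix I
  assume "\<exists>C' \<rho>'. partition_of_unity M C' \<rho>' \<and> I =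
      (\<Sum>c\<in>C'. orient M c / real (card (grp c)) * (LINT x:lift c|lborel. \<rho>' c (proj c x) * vol_form M \<phi> c x std_basis))"
  then obtain C' \<rho>' where P': "partition_of_unity M C' \<rho>'" and I: "I =
      (\<Sum>c\<in>C'. orient M c / real (card (grp c)) * (LINT x:lift c|lborel. \<rho>' c (proj c x) * vol_form M \<phi> c x std_basis))"
    by (elim exE conjE)
  show "I = total C \<rho> (vol_dens \<phi>)"
    unfolding I orbifold_integral_chart_sum[OF P' \<phi>]
    by (rule total_independent[OF P' P cont_density_vol_dens[OF \<phi>]])
qed

lemma total_diff:
  assumes P: "partition_of_unity M C \<rho>" and G: "cont_density G" and H: "cont_density H"
  shows "total C \<rho> G - total C \<rho> H = total C \<rho> (\<lambda>c x. G c x - H c x)"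
  unfolding total_def sum_subtractf[symmetric]
proof (rule sum.cong[OF refl])
  fix c assume c: "c \<in> C"
  have ca: "c \<in> atlas M" using pouD(2)[OF P] c by blast
  have i: "(\<lambda>x. \<rho> c (proj c x) * K c x) integrable_on fd c" if "cont_density K" for K
    by (rule set_lebesgue_integral_eq_integral(1)[OF pou_integrable(3)[OF P c cont_densityD(2)[OF that ca]]])
  show "integral (fd c) (\<lambda>x. \<rho> c (proj c x) * G c x) - integral (fd c) (\<lambda>x. \<rho> c (proj c x) * H c x)
      = integral (fd c) (\<lambda>x. \<rho> c (proj c x) * (G c x - H c x))"
    unfolding right_diff_distrib by (rule integral_diff[OF i[OF G] i[OF H], symmetric])
qed

text \<open>A density supported over one domain can have every weighted piece moved to that domain,
  where the weights add up to 1. The change of volume caused by a perturbation is of this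
  kind.\<close>

lemma total_local:
  assumes P: "partition_of_unity M C \<rho>" and E: "cont_density E" and d: "d \<in> atlas M"
    and K: "compact K" "K \<subseteq> fd d"
    and off: "\<And>c x. c \<in> atlas M \<Longrightarrow> x \<in> lift c \<Longrightarrow> proj c x \<notin> proj d ` K \<Longrightarrow> E c x = 0"
  shows "total C \<rho> E = integral (fd d) (E d)"
proof -
  note F = fund_domD[OF fd[OF d]]
  have KL: "K \<subseteq> lift d" using K(2) F(4) by blast
  have KS: "compact {x \<in> lift d. proj d x \<in> proj d ` K}"
    by (rule compact_lift_preimage[OF d compact proj_compact_closed[OF d K(1) KL]]) (use KL in blast)
  have i: "(\<lambda>x. \<rho> c (proj d x) * E d x) absolutely_integrable_on fd d" if c: "c \<in> C" for c
  proof (rule set_integrable_subset[OF compact_support_integrable(1)[OF _ KS]])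
    show "continuous_on (lift d) (\<lambda>x. \<rho> c (proj d x) * E d x)"
      by (intro continuous_on_mult pouD(5)[OF P c d] cont_densityD(2)[OF E d])
    show "\<rho> c (proj d x) * E d x = 0" if "x \<in> lift d" "x \<notin> {x \<in> lift d. proj d x \<in> proj d ` K}" for x
      using off[OF d that(1)] that by simp
  qed (use F in auto)
  have "total C \<rho> E = (\<Sum>c\<in>C. integral (fd d) (\<lambda>x. \<rho> c (proj d x) * E d x))"
    unfolding total_def
  proof (rule sum.cong[OF refl])
    fix c assume c: "c \<in> C"
    have ca: "c \<in> atlas M" using pouD(2)[OF P] c by blast
    have nK: "proj c x \<notin> proj d ` K" if "proj c x \<notin> image_of d" for x using that KL by blast
    show "integral (fd c) (\<lambda>x. \<rho> c (proj c x) * E c x) = integral (fd d) (\<lambda>x. \<rho> c (proj d x) * E d x)"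
    proof (rule density_transfer(2)[OF fd[OF ca] fd[OF d] density_mult[OF cont_densityD(1)[OF E]]])
      show "\<rho> c (proj c x) * E c x = 0" if "x \<in> lift c" "proj c x \<notin> image_of d" for x
        using off[OF ca that(1) nK[OF that(2)]] by simp
      show "\<rho> c (proj d x) * E d x = 0" if "x \<in> lift d" "proj d x \<notin> image_of c" for x
        using pouD(6)[OF P c d that] by simp
    qed (rule i[OF c])
  qed
  also have "\<dots> = integral (fd d) (\<lambda>x. \<Sum>c\<in>C. \<rho> c (proj d x) * E d x)"
    by (rule integral_sum[OF pouD(1)[OF P], symmetric]) (rule set_lebesgue_integral_eq_integral(1)[OF i])
  also have "\<dots> = integral (fd d) (E d)"
  proof (rule integral_cong)
    fix x assume "x \<in> fd d"
    then have "(\<Sum>c\<in>C. \<rho> c (proj d x)) = 1" using pouD(4)[OF P d] F(4) by blast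
    then show "(\<Sum>c\<in>C. \<rho> c (proj d x) * E d x) = E d x" by (simp only: sum_distrib_right[symmetric] mult_1)
  qed
  finally show ?thesis .
qed

end

section \<open>Decreasing the volume on a small ball\<close>

definition scaled_bump :: "real \<Rightarrow> R7 \<Rightarrow> R7 \<Rightarrow> real" where
  "scaled_bump r x0 x = bump ((1/r) *\<^sub>R (x - x0))"

text \<open>The bump times \<theta>^23 in the coordinates of the frame \<open>L\<close>. The factor
  \<open>r\<close> compensates the 1/r from differentiating the rescaled bump, so the exterior
  derivative has a size governed by \<open>t\<close> alone.\<close>

definition bump_form :: "real \<Rightarrow> real \<Rightarrow> R7 \<Rightarrow> (R7 \<Rightarrow> R7) \<Rightarrow> R7 \<Rightarrow> R7 \<Rightarrow> R7 \<Rightarrow> real" where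
  "bump_form t r x0 L x a b = scaled_bump r x0 x * (t * r * (L a $ 2 * L b $ 3 - L b $ 2 * L a $ 3))"

text \<open>The differential of \<open>t * r * scaled_bump r x0\<close>, with components taken in
  the frame: entry j is its value on \<open>M (axis j 1)\<close>.\<close>

definition bump_eta :: "real \<Rightarrow> real \<Rightarrow> R7 \<Rightarrow> (R7 \<Rightarrow> R7) \<Rightarrow> R7 \<Rightarrow> R7" where
  "bump_eta t r x0 M x = (let y = (1/r) *\<^sub>R (x - x0) in \<chi> j. - 2 * t * flat_fun 2 (1 - y \<bullet> y) * (y \<bullet> M (axis j 1)))"

lemma scaled_bump_smooth: "smooth_on UNIV (scaled_bump r x0)"
proof -
  have "smooth_on UNIV (\<lambda>x. (1/r) *\<^sub>R x + (1/r) *\<^sub>R (- x0))"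
    by (intro smooth_on_add smooth_on_bounded_linear smooth_on_const bounded_linear_scaleR_right)
  then have "smooth_on UNIV (\<lambda>x. (1/r) *\<^sub>R (x - x0))" by (simp add: algebra_simps)
  then show ?thesis unfolding scaled_bump_def by (rule smooth_on_compose[OF _ bump_smooth[of UNIV]]) simp
qed

lemma scaled_bump_zero:
  assumes "r > 0" "x \<notin> cball x0 r" shows "scaled_bump r x0 x = 0"
proof -
  have "norm ((1/r) *\<^sub>R (x - x0)) \<ge> 1"
    using assms by (simp add: dist_norm norm_minus_commute divide_simps)
  then show ?thesis by (simp add: scaled_bump_def bump_eq_0_iff)
qed

lemma bump_form_smooth:
  assumes "linear L"
  shows "smooth_2form (bump_form t r x0 L)"
  unfolding smooth_2form_def
proof (intro conjI allI)
  have a: "L (x + y) $ i = L x $ i + L y $ i" "L (k *\<^sub>R x) $ i = k * L x $ i" for x y k i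
    by (simp_all add: linear_add[OF assms] linear_scale[OF assms])
  show "bilinear (bump_form t r x0 L x)" for x
    unfolding bilinear_def linear_iff bump_form_def a by (simp add: algebra_simps)
  show "bump_form t r x0 L x a a = 0" for x a by (simp add: bump_form_def)
  show "smooth_on UNIV (\<lambda>x. bump_form t r x0 L x a b)" for a b
    unfolding bump_form_def by (intro smooth_on_mult scaled_bump_smooth smooth_on_const)
qed

lemma bump_eta_inner:
  assumes "linear M" "\<forall>v. M (L v) = v"
  shows "bump_eta t r x0 M x \<bullet> L h =
    - 2 * t * flat_fun 2 (1 - ((1/r) *\<^sub>R (x - x0)) \<bullet> ((1/r) *\<^sub>R (x - x0))) * (((1/r) *\<^sub>R (x - x0)) \<bullet> h)"
proof -
  let ?y = "(1/r) *\<^sub>R (x - x0)"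
  have "M (\<Sum>j\<in>UNIV. L h $ j *\<^sub>R axis j 1) = (\<Sum>j\<in>UNIV. L h $ j *\<^sub>R M (axis j 1))"
    by (simp only: linear_sum[OF assms(1)] linear_scale[OF assms(1)])
  then have "h = (\<Sum>j\<in>UNIV. L h $ j *\<^sub>R M (axis j 1))" using assms(2) by (simp only: R7_expand)
  then have "?y \<bullet> h = (\<Sum>j\<in>UNIV. L h $ j * (?y \<bullet> M (axis j 1)))"
    by (metis (no_types, lifting) inner_sum_right inner_scaleR_right sum.cong)
  moreover define q where "q = - 2 * t * flat_fun 2 (1 - ?y \<bullet> ?y)"
  have "bump_eta t r x0 M x \<bullet> L h = (\<Sum>j\<in>UNIV. bump_eta t r x0 M x $ j * L h $ j)" by (simp add: inner_vec_def)
  then have "bump_eta t r x0 M x \<bullet> L h = (\<Sum>j\<in>UNIV. q * (?y \<bullet> M (axis j 1)) * L h $ j)"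
    by (simp only: bump_eta_def Let_def vec_lambda_beta q_def)
  then have "bump_eta t r x0 M x \<bullet> L h = q * (\<Sum>j\<in>UNIV. L h $ j * (?y \<bullet> M (axis j 1)))"
    by (simp only: sum_distrib_left mult.assoc mult.commute[of "_ $ _"])
  ultimately show ?thesis by (simp only: q_def)
qed

lemma dform2_bump_form:
  assumes r: "r > 0" and M: "linear M" "\<forall>v. M (L v) = v"
  shows "dform2 (bump_form t r x0 L) x v = wedge23 (bump_eta t r x0 M x) (L (v 0)) (L (v 1)) (L (v 2))"
proof -
  let ?y = "(1/r) *\<^sub>R (x - x0)"
  have "((\<lambda>x. (1/r) *\<^sub>R (x - x0)) has_derivative (\<lambda>h. (1/r) *\<^sub>R h)) (at x)"
    by (auto intro!: derivative_eq_intros)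
  from has_derivative_compose[OF this bump_has_derivative]
  have sb: "(scaled_bump r x0 has_derivative (\<lambda>h. - 2 * flat_fun 2 (1 - ?y \<bullet> ?y) * (?y \<bullet> ((1/r) *\<^sub>R h)))) (at x)"
    unfolding scaled_bump_def .
  have "((\<lambda>x. bump_form t r x0 L x a b) has_derivative
     (\<lambda>h. - 2 * flat_fun 2 (1 - ?y \<bullet> ?y) * (?y \<bullet> ((1/r) *\<^sub>R h)) * (t * r * (L a $ 2 * L b $ 3 - L b $ 2 * L a $ 3)))) (at x)" for a b
    unfolding bump_form_def by (rule has_derivative_mult_left[OF sb])
  from frechet_derivative_eq[OF this]
  have d: "deriv_2form (bump_form t r x0 L) x h a b = (bump_eta t r x0 M x \<bullet> L h) * (L a $ 2 * L b $ 3 - L b $ 2 * L a $ 3)" for h a b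
    unfolding deriv_2form_def bump_eta_inner[OF M] using r by (simp add: field_simps)
  show ?thesis unfolding dform2_def d wedge23_def by simp
qed

text \<open>With z = 1/u the function is z^2 exp (-z). It is at most 2 because exp z is at least
  z^2/2, and for z between 1 and 2 it is at least exp (-2).\<close>

lemma flat_fun_2_bounds: "0 \<le> flat_fun 2 u" "flat_fun 2 u \<le> 2" "1/2 \<le> u \<Longrightarrow> u \<le> 1 \<Longrightarrow> exp (-2) \<le> flat_fun 2 u"
proof -
  show "0 \<le> flat_fun 2 u" by (simp add: flat_fun_def)
  show "flat_fun 2 u \<le> 2"
  proof (cases "u \<le> 0")
    case False
    define z where "z = inverse u"
    have z: "z > 0" using False by (simp add: z_def)
    have "1 + z + z\<^sup>2 / 2 \<le> exp z" using exp_lower_Taylor_quadratic[of z] z by simp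
    then have "z\<^sup>2 \<le> 2 * exp z" using z by simp
    then have "exp (- z) * z\<^sup>2 \<le> exp (- z) * (2 * exp z)" by (intro mult_left_mono) simp_all
    also have "\<dots> = 2" by (simp add: exp_minus)
    finally show ?thesis using False by (simp add: flat_fun_def z_def)
  qed (simp add: flat_fun_def)
  assume u: "1/2 \<le> u" "u \<le> 1"
  have z: "1 \<le> inverse u" "inverse u \<le> 2" using u by (auto simp: field_simps)
  have "exp (-2) * 1 \<le> exp (- inverse u) * (inverse u)\<^sup>2"
    using z by (intro mult_mono one_le_power) simp_all
  then show "exp (-2) \<le> flat_fun 2 u" using u by (simp add: flat_fun_def)
qed

lemma bump_eta_continuous: "continuous_on S (\<lambda>x. bump_eta t r x0 M x $ j)"
proof -
  have "continuous_on UNIV (flat_fun 2)" using Ck_on_flat_fun[of 0 2] by simp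
  then have "continuous_on S (\<lambda>x. flat_fun 2 (1 - ((1/r) *\<^sub>R (x - x0)) \<bullet> ((1/r) *\<^sub>R (x - x0))))"
    by (rule continuous_on_compose2)
      (intro continuous_on_diff continuous_on_inner continuous_on_scaleR continuous_on_const continuous_on_id, simp)
  then show ?thesis unfolding bump_eta_def Let_def vec_lambda_beta
    by (intro continuous_on_mult continuous_on_diff continuous_on_inner continuous_on_scaleR continuous_on_const continuous_on_id)
qed

text \<open>The quantity subtracted in \<open>model_vol_le\<close>; components 2 and 3 are absent
  because wedging with \<theta>^23 kills them.\<close>

definition transverse_sq :: "R7 \<Rightarrow> real" where
  "transverse_sq \<eta> = (\<eta>$1)\<^sup>2 + (\<eta>$4)\<^sup>2 + (\<eta>$5)\<^sup>2 + (\<eta>$6)\<^sup>2 + (\<eta>$7)\<^sup>2"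

lemma transverse_sq_ge: "j \<in> {1,4,5,6,7} \<Longrightarrow> (\<eta> $ j)\<^sup>2 \<le> transverse_sq \<eta>"
  by (auto simp: transverse_sq_def)

lemma transverse_sq_nonneg: "0 \<le> transverse_sq \<eta>"
  by (simp add: transverse_sq_def)

lemma content_cball_scale:
  assumes "0 \<le> r" "0 \<le> k"
  shows "measure lborel (cball (x::R7) (k * r)) = k ^ 7 * measure lborel (cball (y::R7) r)"
proof -
  have "measure lborel (cball z u) = unit_ball_vol (real DIM(R7)) * u ^ DIM(R7)" if "0 \<le> u" for z :: R7 and u
    unfolding content_cball_conv_ball using that by (rule content_ball)
  from this[of "k * r" x] this[of r y] show ?thesis using assms by (simp add: power_mult_distrib)
qed

lemma integral_cball_const: "integral (cball (x::R7) r) (\<lambda>x. k :: real) = k * measure lborel (cball x r)"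
proof -
  have "measure lebesgue (cball x r) = integral (cball x r) (\<lambda>x. 1 :: real)" by (rule lmeasure_integral) simp
  then have "integral (cball x r) (\<lambda>x. 1 :: real) = measure lborel (cball x r)" by (simp add: measure_completion)
  then show ?thesis using integral_mult_right[of "cball x r" k "\<lambda>x. 1"] by simp
qed

lemma integral_cball_odd:
  fixes f :: "R7 \<Rightarrow> real"
  assumes "continuous_on (cball x0 r) f" "\<And>x. f (2 *\<^sub>R x0 - x) = - f x"
  shows "integral (cball x0 r) f = 0"
proof -
  let ?g = "\<lambda>x. 2 *\<^sub>R x0 - x" and ?B = "cball x0 r"
  have "dist x0 (?g x) = dist x0 x" for x
    by (simp add: dist_norm norm_minus_commute scaleR_2 algebra_simps)
  then have gB: "?g x \<in> ?B \<longleftrightarrow> x \<in> ?B" for x by simp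
  have im: "?g ` ?B = ?B"
  proof (intro equalityI subsetI)
    fix x assume "x \<in> ?B"
    then have "?g x \<in> ?B" by (simp only: gB)
    then show "x \<in> ?g ` ?B" by (rule image_eqI[rotated]) simp
  qed (use gB in blast)
  have ai: "f absolutely_integrable_on ?B"
    by (rule compact_support_integrable(1)[OF assms(1) compact_cball]) auto
  have m: "matrix (\<lambda>v. - v :: R7) = (-1) *\<^sub>R mat 1"
    by (simp add: matrix_def mat_def axis_def vec_eq_iff)
  have d: "\<bar>det (matrix (\<lambda>v. - v :: R7))\<bar> = 1"
    unfolding m det_scaleR_mat by simp
  have "integral (?g ` ?B) f = integral ?B (\<lambda>x. \<bar>det (matrix (\<lambda>v. - v :: R7))\<bar> * f (?g x))"
  proof (rule change_of_variables_real(2))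
    show "(?g has_derivative (\<lambda>v. - v)) (at x within ?B)" for x by (auto intro!: derivative_eq_intros)
    show "inj_on ?g ?B" by (simp add: inj_on_def)
    show "f absolutely_integrable_on ?g ` ?B" unfolding im by (rule ai)
  qed simp
  then show ?thesis unfolding im d assms(2) by simp
qed

text \<open>The linear term is odd about the centre of the ball. The quadratic term is bounded below on a
  ball of an eighth of the radius, placed where the bump function is steep.\<close>

lemma ball_volume_bound:
  assumes r: "r > 0" and M: "linear M" "inj M"
  shows "\<exists>t. (\<forall>x. \<forall>j\<in>{1,4,5,6,7}. \<bar>bump_eta t r x0 M x $ j\<bar> \<le> 1/4) \<and>
    integral (cball x0 r) (\<lambda>x. 1 + bump_eta t r x0 M x $ 1 / 3 - transverse_sq (bump_eta t r x0 M x) / 36)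
      \<le> (1 - (3 * exp (-2) / 64)\<^sup>2 / 36 / 8 ^ 7) * measure lborel (cball x0 r)"
proof -
  let ?J = "{1,4,5,6,7} :: 7 set" and ?B = "cball x0 r"
  let ?n = "\<lambda>j. norm (M (axis j 1))"
  have "Max (?n ` ?J) \<in> ?n ` ?J" by (rule Max_in) simp_all
  \<comment> \<open>The longest frame vector among the relevant directions. Normalising by it makes
    the gain independent of how distorted the frame is.\<close>
  then obtain k where k: "k \<in> ?J" "Max (?n ` ?J) = ?n k" by blast
  have kmax: "?n j \<le> ?n k" if "j \<in> ?J" for j
    unfolding k(2)[symmetric] by (intro Max_ge imageI[OF that]) simp
  have "M (axis k 1) \<noteq> 0" using M linear_injective_0[OF M(1)] by (metis axis_eq_0_iff zero_neq_one)
  then have \<nu>: "?n k > 0" by simp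
  \<comment> \<open>The bump derivative is at most 2 * t * 2 * \<open>?n k\<close>, which this
    choice makes equal to 1/4, the limit under which \<open>model_vol_le\<close> applies.\<close>
  define t where "t = 1 / (16 * ?n k)"
  have t: "t > 0" using \<nu> by (simp add: t_def)
  let ?\<eta> = "bump_eta t r x0 M"
  have bound: "\<bar>?\<eta> x $ j\<bar> \<le> 1/4" if j: "j \<in> ?J" for x j
  proof -
    define y where "y = (1/r) *\<^sub>R (x - x0)"
    have e: "?\<eta> x $ j = - 2 * t * flat_fun 2 (1 - y \<bullet> y) * (y \<bullet> M (axis j 1))" by (simp add: bump_eta_def Let_def y_def)
    show ?thesis
    proof (cases "norm y \<ge> 1")
      case True
      then have "1 \<le> (norm y)\<^sup>2" by simp
      then have "flat_fun 2 (1 - y \<bullet> y) = 0" by (simp add: flat_fun_def power2_norm_eq_inner)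
      then show ?thesis unfolding e by simp
    next
      case False
      have "\<bar>y \<bullet> M (axis j 1)\<bar> \<le> norm y * ?n j" by (rule Cauchy_Schwarz_ineq2)
      also have "\<dots> \<le> 1 * ?n k" using False kmax[OF j] by (intro mult_mono) simp_all
      finally have y: "\<bar>y \<bullet> M (axis j 1)\<bar> \<le> ?n k" by simp
      have "\<bar>?\<eta> x $ j\<bar> = 2 * t * flat_fun 2 (1 - y \<bullet> y) * \<bar>y \<bullet> M (axis j 1)\<bar>"
        unfolding e using t flat_fun_2_bounds(1) by (simp add: abs_mult)
      also have "\<dots> \<le> 2 * t * 2 * ?n k"
        using t y flat_fun_2_bounds by (intro mult_mono mult_nonneg_nonneg) simp_all
      also have "\<dots> = 1/4" using \<nu> by (simp add: t_def)
      finally show ?thesis .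
    qed
  qed
  \<comment> \<open>In rescaled coordinates y this is the ball of radius 1/8 about half the unit
    vector a along \<open>M (axis k 1)\<close>. There |y| is at most 5/8 and y . a at least 3/8, so
    1 - |y|^2 exceeds 1/2 and the steepness bound exp (-2) applies. Since 2 * t *
    \<open>?n k\<close> = 1/8, this gives 3 exp (-2) / 64.\<close>
  define B' where "B' = cball (x0 + (r / (2 * ?n k)) *\<^sub>R M (axis k 1)) (1/8 * r)"
  have B': "3 * exp (-2) / 64 \<le> \<bar>?\<eta> x $ k\<bar> \<and> x \<in> ?B" if x: "x \<in> B'" for x
  proof -
    define a where "a = (1 / ?n k) *\<^sub>R M (axis k 1)"
    define y where "y = (1/r) *\<^sub>R (x - x0)"
    have na: "norm a = 1" using \<nu> by (simp add: a_def)
    have "y - (1/2) *\<^sub>R a = (1/r) *\<^sub>R (x - (x0 + (r / (2 * ?n k)) *\<^sub>R M (axis k 1)))"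
      using r by (simp add: y_def a_def algebra_simps)
    then have "norm (y - (1/2) *\<^sub>R a) = (1/r) * dist (x0 + (r / (2 * ?n k)) *\<^sub>R M (axis k 1)) x"
      using r by (simp add: dist_norm norm_minus_commute)
    also have "\<dots> \<le> (1/r) * (1/8 * r)" using x r unfolding B'_def by (intro mult_left_mono) simp_all
    finally have d: "norm (y - (1/2) *\<^sub>R a) \<le> 1/8" using r by simp
    have ny: "norm y \<le> 5/8" using norm_triangle_ineq[of "y - (1/2) *\<^sub>R a" "(1/2) *\<^sub>R a"] d na by simp
    then have "(norm y)\<^sup>2 \<le> (5/8)\<^sup>2" by (intro power_mono) simp_all
    then have yy: "y \<bullet> y \<le> 25/64" unfolding power2_norm_eq_inner by (simp add: power2_eq_square)
    have "\<bar>(y - (1/2) *\<^sub>R a) \<bullet> a\<bar> \<le> 1/8" using Cauchy_Schwarz_ineq2[of "y - (1/2) *\<^sub>R a" a] d na by simp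
    moreover have "a \<bullet> a = 1" using na by (simp add: norm_eq_1)
    ultimately have "\<bar>y \<bullet> a - 1/2\<bar> \<le> 1/8" by (simp add: inner_diff_left)
    then have ya: "y \<bullet> a \<ge> 3/8" unfolding abs_le_iff by linarith
    have Me: "y \<bullet> M (axis k 1) = ?n k * (y \<bullet> a)" using \<nu> by (simp add: a_def)
    have "\<bar>?\<eta> x $ k\<bar> = 2 * t * flat_fun 2 (1 - y \<bullet> y) * (?n k * (y \<bullet> a))"
      using t flat_fun_2_bounds(1) \<nu> ya by (simp add: bump_eta_def Let_def y_def[symmetric] Me abs_mult)
    also have "\<dots> \<ge> 2 * t * exp (-2) * (?n k * (3/8))"
      using t flat_fun_2_bounds(1) flat_fun_2_bounds(3)[of "1 - y \<bullet> y"] yy ya \<nu>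
      by (intro mult_mono mult_nonneg_nonneg) simp_all
    also have "2 * t * exp (-2) * (?n k * (3/8)) = 3 * exp (-2) / 64" using \<nu> by (simp add: t_def)
    finally have "3 * exp (-2) / 64 \<le> \<bar>?\<eta> x $ k\<bar>" .
    moreover have "norm (x - x0) = r * norm y" using r by (simp add: y_def)
    then have "x \<in> ?B" using ny r mult_left_mono[of "norm y" 1 r] by (simp add: dist_norm norm_minus_commute)
    ultimately show ?thesis ..
  qed
  have ts: "continuous_on S (\<lambda>x. transverse_sq (?\<eta> x))" for S
    unfolding transverse_sq_def by (intro continuous_intros bump_eta_continuous)
  have int: "f integrable_on cball z u" if "continuous_on (cball z u) f" for f :: "R7 \<Rightarrow> real" and z u
    by (rule set_lebesgue_integral_eq_integral(1)[OF compact_support_integrable(1)[OF that compact_cball]]) auto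
  have low: "(3 * exp (-2) / 64)\<^sup>2 * (measure lborel ?B / 8 ^ 7) \<le> integral ?B (\<lambda>x. transverse_sq (?\<eta> x))"
  proof -
    have "measure lborel B' = (1/8) ^ 7 * measure lborel ?B" unfolding B'_def by (rule content_cball_scale) (use r in simp_all)
    then have "(3 * exp (-2) / 64)\<^sup>2 * (measure lborel ?B / 8 ^ 7) = (3 * exp (-2) / 64)\<^sup>2 * measure lborel B'"
      by (simp add: power_one_over)
    also have "\<dots> = integral B' (\<lambda>x. (3 * exp (-2) / 64)\<^sup>2)"
      unfolding B'_def by (rule integral_cball_const[symmetric])
    also have "\<dots> \<le> integral B' (\<lambda>x. transverse_sq (?\<eta> x))"
    proof (rule integral_le)
      show "(\<lambda>x. (3 * exp (-2) / 64)\<^sup>2 :: real) integrable_on B'" unfolding B'_def by (intro int continuous_on_const)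
      show "(\<lambda>x. transverse_sq (?\<eta> x)) integrable_on B'" unfolding B'_def by (intro int ts)
      fix x assume "x \<in> B'"
      then have "(3 * exp (-2) / 64)\<^sup>2 \<le> \<bar>?\<eta> x $ k\<bar>\<^sup>2" using B' by (intro power_mono) simp_all
      also have "\<dots> \<le> transverse_sq (?\<eta> x)" using transverse_sq_ge[OF k(1)] by simp
      finally show "(3 * exp (-2) / 64)\<^sup>2 \<le> transverse_sq (?\<eta> x)" .
    qed
    also have "\<dots> \<le> integral ?B (\<lambda>x. transverse_sq (?\<eta> x))"
    proof (rule integral_subset_le)
      show "B' \<subseteq> ?B" using B' by blast
      show "(\<lambda>x. transverse_sq (?\<eta> x)) integrable_on B'" unfolding B'_def by (intro int ts)
    qed (use int[OF ts] transverse_sq_nonneg in auto)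
    finally show ?thesis .
  qed
  have odd: "integral ?B (\<lambda>x. ?\<eta> x $ 1) = 0"
  proof (rule integral_cball_odd[OF bump_eta_continuous])
    fix x
    have "(1/r) *\<^sub>R (2 *\<^sub>R x0 - x - x0) = - ((1/r) *\<^sub>R (x - x0))" by (simp add: scaleR_2 algebra_simps)
    then show "?\<eta> (2 *\<^sub>R x0 - x) $ 1 = - (?\<eta> x $ 1)" unfolding bump_eta_def Let_def by simp
  qed
  have "integral ?B (\<lambda>x. 1 + ?\<eta> x $ 1 / 3 - transverse_sq (?\<eta> x) / 36)
     = integral ?B (\<lambda>x. 1 + ?\<eta> x $ 1 / 3) - integral ?B (\<lambda>x. transverse_sq (?\<eta> x) / 36)"
    by (intro integral_diff int continuous_intros bump_eta_continuous ts) simp_all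
  also have "integral ?B (\<lambda>x. 1 + ?\<eta> x $ 1 / 3) = integral ?B (\<lambda>x. 1) + integral ?B (\<lambda>x. ?\<eta> x $ 1 / 3)"
    by (intro integral_add int continuous_intros bump_eta_continuous) simp_all
  also have "integral ?B (\<lambda>x. 1 :: real) = measure lborel ?B" by (simp add: integral_cball_const)
  finally have "integral ?B (\<lambda>x. 1 + ?\<eta> x $ 1 / 3 - transverse_sq (?\<eta> x) / 36)
     = measure lborel ?B - integral ?B (\<lambda>x. transverse_sq (?\<eta> x)) / 36" using odd by simp
  also have "\<dots> \<le> measure lborel ?B - (3 * exp (-2) / 64)\<^sup>2 * (measure lborel ?B / 8 ^ 7) / 36" using low by (simp add: mult.commute)
  also have "\<dots> = (1 - (3 * exp (-2) / 64)\<^sup>2 / 36 / 8 ^ 7) * measure lborel ?B" by (simp add: left_diff_distrib)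
  finally show ?thesis using bound by (intro exI[of _ t]) blast
qed

definition decreases :: "real \<Rightarrow> (R7 \<Rightarrow> pform) \<Rightarrow> R7 \<Rightarrow> real \<Rightarrow> real \<Rightarrow> (R7 \<Rightarrow> R7 \<Rightarrow> R7 \<Rightarrow> real) \<Rightarrow> bool" where
  "decreases s \<psi> x0 r \<kappa> B \<longleftrightarrow> smooth_2form B \<and> (\<forall>x a b. x \<notin> cball x0 r \<longrightarrow> B x a b = 0) \<and>
     (\<forall>x\<in>cball x0 r. G2_frames s (\<lambda>v. \<psi> x v + dform2 B x v) \<noteq> {}) \<and>
     integral (cball x0 r) (\<lambda>x. form_vol s (\<lambda>v. \<psi> x v + dform2 B x v))
       \<le> (1 - \<kappa>) * integral (cball x0 r) (\<lambda>x. form_vol s (\<psi> x))"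

lemma wedge23_continuous:
  assumes "\<And>j. continuous_on S (\<lambda>x. \<eta> x $ j)"
  shows "continuous_on S (\<lambda>x. wedge23 (\<eta> x) u v w)"
  unfolding wedge23_def inner_vec_def
  by (intro continuous_on_add continuous_on_diff continuous_on_mult continuous_on_sum continuous_on_const continuous_on_inner assms)

lemma cball_integrable:
  fixes f :: "R7 \<Rightarrow> real"
  assumes "continuous_on (cball x r) f" shows "f integrable_on cball x r"
  by (rule set_lebesgue_integral_eq_integral(1)[OF compact_support_integrable(1)[OF assms compact_cball]]) auto

text \<open>The order of quantifiers matters: \<kappa> precedes the form, while the admissible
  radius may depend on the form and the point. In the frame at the centre the perturbation is
  exactly \<eta> wedge \<theta>^23 on the whole ball, and only the variation of \<psi> has to be
  made small.\<close>

lemma ball_decrease: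
  "\<exists>\<kappa>::real. 0 < \<kappa> \<and> \<kappa> < 1 \<and> (\<forall>s D \<psi> x0. s = 1 \<or> s = -1 \<longrightarrow> open D \<longrightarrow> x0 \<in> D \<longrightarrow>
     (\<forall>x\<in>D. G2_frames s (\<psi> x) \<noteq> {} \<and> alternating_form 3 (\<psi> x)) \<longrightarrow> (\<forall>v. continuous_on D (\<lambda>x. \<psi> x v)) \<longrightarrow>
     (\<exists>r0>0. \<forall>r. 0 < r \<longrightarrow> r \<le> r0 \<longrightarrow> cball x0 r \<subseteq> D \<and> (\<exists>B. decreases s \<psi> x0 r \<kappa> B)))"
proof -
  define \<kappa>0 :: real where "\<kappa>0 = (3 * exp (-2) / 64)\<^sup>2 / 36 / 8 ^ 7"
  have "exp (-2 :: real) \<le> 1" by simp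
  then have "3 * exp (-2) / 64 \<le> (1 :: real)" by linarith
  then have "(3 * exp (-2) / 64 :: real)\<^sup>2 \<le> 1" by (rule power_le_one[rotated]) simp
  then have \<kappa>0: "0 < \<kappa>0" "\<kappa>0 < 1" by (auto simp: \<kappa>0_def)
  \<comment> \<open>A relative error \<tau> in the new volume and in the old one costs at most half
    of the gain: the two sides of \<open>key\<close> differ by 3/8 of the square of
    \<kappa>0.\<close>
  define \<tau> where "\<tau> = \<kappa>0 / 4"
  have \<tau>: "0 < \<tau>" "\<tau> < 1" using \<kappa>0 by (auto simp: \<tau>_def)
  have "(1 - \<kappa>0 / 2) * (1 - \<tau>) - (1 + \<tau>) * (1 - \<kappa>0) = 3 * \<kappa>0 * \<kappa>0 / 8"
    unfolding \<tau>_def by (simp add: algebra_simps) (simp add: field_simps)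
  then have key: "(1 + \<tau>) * (1 - \<kappa>0) \<le> (1 - \<kappa>0 / 2) * (1 - \<tau>)"
    using mult_pos_pos[OF \<kappa>0(1) \<kappa>0(1)] by linarith
  obtain \<delta> where \<delta>: "\<delta> > 0" and near: "\<forall>s L M w0 \<eta> w. L \<in> G2_frames s w0 \<longrightarrow> linear M \<longrightarrow> (\<forall>v. M (L v) = v) \<longrightarrow>
     (\<forall>j\<in>{1,4,5,6,7}. \<bar>\<eta> $ j\<bar> \<le> 1/4) \<longrightarrow> alternating_form 3 w \<longrightarrow>
     (\<forall>i j k. \<bar>w (vec3 (M (axis i 1)) (M (axis j 1)) (M (axis k 1))) - (phi3 (axis i 1) (axis j 1) (axis k 1) + wedge23 \<eta> (axis i 1) (axis j 1) (axis k 1))\<bar> < \<delta>) \<longrightarrow>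
     (\<exists>L'\<in>G2_frames s w. \<bar>\<bar>det (matrix L')\<bar> - model_vol \<eta> * \<bar>det (matrix L)\<bar>\<bar> \<le> \<tau> * model_vol \<eta> * \<bar>det (matrix L)\<bar>)"
    using frame_near[OF \<tau>] by (elim exE conjE)
  have main: "\<exists>r0>0. \<forall>r. 0 < r \<longrightarrow> r \<le> r0 \<longrightarrow> cball x0 r \<subseteq> D \<and> (\<exists>B. decreases s \<psi> x0 r (\<kappa>0 / 2) B)"
    if s: "s = 1 \<or> s = -1" and D: "open D" "x0 \<in> D"
      and fr: "\<forall>x\<in>D. G2_frames s (\<psi> x) \<noteq> {} \<and> alternating_form 3 (\<psi> x)" and cont: "\<forall>v. continuous_on D (\<lambda>x. \<psi> x v)"
    for s D \<psi> x0
  proof -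
    obtain L where L: "L \<in> G2_frames s (\<psi> x0)" using fr D(2) by (auto simp: ex_in_conv[symmetric])
    obtain M where M: "linear M" "\<forall>v. M (L v) = v" "\<forall>v. L (M v) = v" using frame_inverse[OF L] .
    have injM: "inj M" by (rule inj_on_inverseI[where g = L]) (use M(3) in simp)
    have pos: "\<bar>det (matrix L)\<bar> > 0" using L by (auto simp: G2_frames_def)
    let ?e = "\<lambda>i j k. vec3 (M (axis i 1)) (M (axis j 1)) (M (axis k 1))"
    have ctr: "\<psi> x0 (?e i j k) = phi3 (axis i 1) (axis j 1) (axis k 1)" for i j k
      by (rule frame_at_center[OF L M(3)]) (use fr D(2) in blast)
    have "\<forall>\<^sub>F y in nhds x0. \<bar>\<psi> y (?e i j k) - phi3 (axis i 1) (axis j 1) (axis k 1)\<bar> < \<delta>" for i j k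
    proof -
      have "((\<lambda>y. \<psi> y (?e i j k)) \<longlongrightarrow> \<psi> x0 (?e i j k)) (at x0)"
        using continuous_on_eq_continuous_at[THEN iffD1, OF D(1) cont[THEN spec, of "?e i j k"]] D(2)
        by (simp only: isCont_def)
      then have "\<forall>\<^sub>F y in at x0. dist (\<psi> y (?e i j k)) (\<psi> x0 (?e i j k)) < \<delta>" using \<delta> by (rule tendstoD)
      then show ?thesis using \<delta> unfolding eventually_nhds_conv_at ctr dist_real_def by simp
    qed
    then have "\<forall>\<^sub>F y in nhds x0. \<forall>i j k. \<bar>\<psi> y (?e i j k) - phi3 (axis i 1) (axis j 1) (axis k 1)\<bar> < \<delta>"
      by (simp only: eventually_all_finite)
    moreover have "\<forall>\<^sub>F y in nhds x0. y \<in> D" using D by (rule eventually_nhds_in_open)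
    ultimately have "\<forall>\<^sub>F y in nhds x0. y \<in> D \<and> (\<forall>i j k. \<bar>\<psi> y (?e i j k) - phi3 (axis i 1) (axis j 1) (axis k 1)\<bar> < \<delta>)"
      by eventually_elim simp
    then obtain d where d: "d > 0" "\<And>y. dist y x0 < d \<Longrightarrow> y \<in> D \<and> (\<forall>i j k. \<bar>\<psi> y (?e i j k) - phi3 (axis i 1) (axis j 1) (axis k 1)\<bar> < \<delta>)"
      unfolding eventually_nhds_metric by blast
    show ?thesis
    proof (intro exI[of _ "d/2"] conjI allI impI)
      show "d / 2 > 0" using d(1) by simp
      fix r assume r: "0 < r" "r \<le> d / 2"
      let ?B = "cball x0 r"
      have cb: "x \<in> D \<and> (\<forall>i j k. \<bar>\<psi> x (?e i j k) - phi3 (axis i 1) (axis j 1) (axis k 1)\<bar> < \<delta>)" if "x \<in> ?B" for x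
        using d(2)[of x] that r d(1) by (simp add: dist_commute)
      then show BD: "?B \<subseteq> D" by blast
      obtain t where tb: "\<forall>x. \<forall>j\<in>{1,4,5,6,7}. \<bar>bump_eta t r x0 M x $ j\<bar> \<le> 1/4"
        and ti: "integral ?B (\<lambda>x. 1 + bump_eta t r x0 M x $ 1 / 3 - transverse_sq (bump_eta t r x0 M x) / 36) \<le> (1 - \<kappa>0) * measure lborel ?B"
        using ball_volume_bound[OF r(1) M(1) injM] unfolding \<kappa>0_def by blast
      define \<eta> where "\<eta> = bump_eta t r x0 M"
      define B where "B = bump_form t r x0 L"
      define h where "h x = 1 + \<eta> x $ 1 / 3 - transverse_sq (\<eta> x) / 36" for x
      have linL: "linear L" using L by (simp add: G2_frames_def)
      have smB: "smooth_2form B" unfolding B_def by (rule bump_form_smooth[OF linL])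
      have Bz: "B x a b = 0" if "x \<notin> ?B" for x a b
        using scaled_bump_zero[OF r(1) that] by (simp add: B_def bump_form_def)
      have dB: "dform2 B x v = wedge23 (\<eta> x) (L (v 0)) (L (v 1)) (L (v 2))" for x v
        unfolding B_def \<eta>_def by (rule dform2_bump_form[OF r(1) M(1,2)])
      have alt: "alternating_form 3 (\<lambda>v. \<psi> x v + dform2 B x v)" if "x \<in> ?B" for x
        using fr BD that by (intro alternating_form_add alternating_dform2[OF smB]) blast
      have new: "\<exists>L'\<in>G2_frames s (\<lambda>v. \<psi> x v + dform2 B x v). \<bar>\<bar>det (matrix L')\<bar> - model_vol (\<eta> x) * \<bar>det (matrix L)\<bar>\<bar> \<le> \<tau> * model_vol (\<eta> x) * \<bar>det (matrix L)\<bar>"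
        if x: "x \<in> ?B" for x
      proof (rule near[rule_format, OF L M(1)])
        show "\<bar>\<psi> x (?e i j k) + dform2 B x (?e i j k) - (phi3 (axis i 1) (axis j 1) (axis k 1) + wedge23 (\<eta> x) (axis i 1) (axis j 1) (axis k 1))\<bar> < \<delta>" for i j k
          using cb[OF x] M(3) by (simp add: dB)
        show "\<bar>\<eta> x $ j\<bar> \<le> 1/4" if "j \<in> {1,4,5,6,7}" for j using tb that unfolding \<eta>_def by blast
      qed (rule M(2)[rule_format] alt[OF x])+
      have old: "\<exists>L'\<in>G2_frames s (\<psi> x). \<bar>\<bar>det (matrix L')\<bar> - model_vol 0 * \<bar>det (matrix L)\<bar>\<bar> \<le> \<tau> * model_vol 0 * \<bar>det (matrix L)\<bar>"
        if x: "x \<in> ?B" for x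
      proof (rule near[rule_format, OF L M(1)])
        show "\<bar>\<psi> x (?e i j k) - (phi3 (axis i 1) (axis j 1) (axis k 1) + wedge23 0 (axis i 1) (axis j 1) (axis k 1))\<bar> < \<delta>" for i j k
          using cb[OF x] by simp
      qed (use M(2) fr BD x in auto)
      have up: "form_vol s (\<lambda>v. \<psi> x v + dform2 B x v) \<le> (1 + \<tau>) * \<bar>det (matrix L)\<bar> * h x" if x: "x \<in> ?B" for x
      proof -
        obtain L' where L': "L' \<in> G2_frames s (\<lambda>v. \<psi> x v + dform2 B x v)"
          "\<bar>\<bar>det (matrix L')\<bar> - model_vol (\<eta> x) * \<bar>det (matrix L)\<bar>\<bar> \<le> \<tau> * model_vol (\<eta> x) * \<bar>det (matrix L)\<bar>"
          using new[OF x] by blast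
        have "form_vol s (\<lambda>v. \<psi> x v + dform2 B x v) \<le> model_vol (\<eta> x) * \<bar>det (matrix L)\<bar> + \<tau> * model_vol (\<eta> x) * \<bar>det (matrix L)\<bar>"
          using L'(2) unfolding form_vol_frame(1)[OF L'(1) s] abs_le_iff by linarith
        also have "\<dots> = (1 + \<tau>) * \<bar>det (matrix L)\<bar> * model_vol (\<eta> x)" by (simp add: algebra_simps)
        also have "\<dots> \<le> (1 + \<tau>) * \<bar>det (matrix L)\<bar> * h x"
          using model_vol_le[of "\<eta> x"] tb \<tau> unfolding h_def transverse_sq_def \<eta>_def by (intro mult_left_mono) auto
        finally show ?thesis .
      qed
      have low: "(1 - \<tau>) * \<bar>det (matrix L)\<bar> \<le> form_vol s (\<psi> x)" if x: "x \<in> ?B" for x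
      proof -
        obtain L' where L': "L' \<in> G2_frames s (\<psi> x)" "\<bar>\<bar>det (matrix L')\<bar> - \<bar>det (matrix L)\<bar>\<bar> \<le> \<tau> * \<bar>det (matrix L)\<bar>"
          using old[OF x] by auto
        have "\<bar>det (matrix L)\<bar> - \<tau> * \<bar>det (matrix L)\<bar> \<le> form_vol s (\<psi> x)"
          using L'(2) unfolding form_vol_frame(1)[OF L'(1) s] abs_le_iff by linarith
        then show ?thesis by (simp add: left_diff_distrib)
      qed
      have frn: "G2_frames s (\<lambda>v. \<psi> x v + dform2 B x v) \<noteq> {}" if "x \<in> ?B" for x using new[OF that] by blast
      have c\<eta>: "continuous_on S (\<lambda>x. \<eta> x $ j)" for S j unfolding \<eta>_def by (rule bump_eta_continuous)
      have c1: "continuous_on ?B (\<lambda>x. form_vol s (\<lambda>v. \<psi> x v + dform2 B x v))"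
      proof (rule form_vol_continuous[OF s frn alt])
        show "continuous_on ?B (\<lambda>x. \<psi> x v + dform2 B x v)" for v
          unfolding dB using cont BD by (intro continuous_on_add wedge23_continuous c\<eta>) (blast intro: continuous_on_subset)
      qed
      have c2: "continuous_on ?B (\<lambda>x. form_vol s (\<psi> x))"
        by (rule form_vol_continuous[OF s]) (use fr BD cont in \<open>blast intro: continuous_on_subset\<close>)+
      have c3: "continuous_on ?B h"
        unfolding h_def transverse_sq_def by (intro continuous_intros c\<eta>) simp_all
      have "integral ?B (\<lambda>x. form_vol s (\<lambda>v. \<psi> x v + dform2 B x v)) \<le> integral ?B (\<lambda>x. (1 + \<tau>) * \<bar>det (matrix L)\<bar> * h x)"
        by (intro integral_le cball_integrable c1 continuous_on_mult continuous_on_const c3 up)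
      also have "\<dots> = (1 + \<tau>) * \<bar>det (matrix L)\<bar> * integral ?B h" by simp
      also have "\<dots> \<le> (1 + \<tau>) * \<bar>det (matrix L)\<bar> * ((1 - \<kappa>0) * measure lborel ?B)"
        using ti \<tau> unfolding h_def \<eta>_def by (intro mult_left_mono) simp_all
      also have "\<dots> = (1 + \<tau>) * (1 - \<kappa>0) * (\<bar>det (matrix L)\<bar> * measure lborel ?B)" by simp
      also have "\<dots> \<le> (1 - \<kappa>0 / 2) * (1 - \<tau>) * (\<bar>det (matrix L)\<bar> * measure lborel ?B)"
        by (intro mult_right_mono key) simp
      also have "\<dots> = (1 - \<kappa>0 / 2) * integral ?B (\<lambda>x. (1 - \<tau>) * \<bar>det (matrix L)\<bar>)"
        by (simp only: integral_cball_const mult.assoc)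
      also have "\<dots> \<le> (1 - \<kappa>0 / 2) * integral ?B (\<lambda>x. form_vol s (\<psi> x))"
        using \<kappa>0 by (intro mult_left_mono integral_le cball_integrable c2 continuous_on_const low) simp_all
      finally have "decreases s \<psi> x0 r (\<kappa>0 / 2) B"
        unfolding decreases_def using smB Bz frn by blast
      then show "\<exists>B. decreases s \<psi> x0 r (\<kappa>0 / 2) B" by (rule exI[of _ B])
    qed
  qed
  show ?thesis
  proof (rule exI[of _ "\<kappa>0 / 2"], rule conjI[OF _ conjI])
    show "0 < \<kappa>0 / 2" "\<kappa>0 / 2 < 1" using \<kappa>0 by auto
  qed (intro allI impI, rule main; assumption)
qed

lemma smooth_2form_sum:
  assumes "finite F" "\<And>i. i \<in> F \<Longrightarrow> smooth_2form (B i)"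
  shows "smooth_2form (\<lambda>x a b. \<Sum>i\<in>F. B i x a b)"
    "dform2 (\<lambda>x a b. \<Sum>i\<in>F. B i x a b) x v = (\<Sum>i\<in>F. dform2 (B i) x v)"
proof -
  have s: "smooth_on UNIV (\<lambda>x. B i x a b)" if "i \<in> F" for i a b
    using assms(2)[OF that] by (simp add: smooth_2form_def)
  show "smooth_2form (\<lambda>x a b. \<Sum>i\<in>F. B i x a b)"
    unfolding smooth_2form_def
  proof (intro conjI allI)
    fix x
    have bl: "linear (\<lambda>a. B i x a b)" "linear (\<lambda>a. B i x b a)" if "i \<in> F" for i b
      using assms(2)[OF that] by (simp_all add: smooth_2form_def bilinear_def)
    show "bilinear (\<lambda>a b. \<Sum>i\<in>F. B i x a b)"
      unfolding bilinear_def by (intro conjI allI linear_compose_sum ballI bl)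
    show "(\<Sum>i\<in>F. B i x a a) = 0" for a
      using assms(2) by (intro sum.neutral) (simp add: smooth_2form_def)
  next
    show "smooth_on UNIV (\<lambda>x. \<Sum>i\<in>F. B i x a b)" for a b by (intro smooth_on_sum s)
  qed
  have "deriv_2form (\<lambda>x a b. \<Sum>i\<in>F. B i x a b) x h a b = (\<Sum>i\<in>F. deriv_2form (B i) x h a b)" for h a b
  proof -
    have "((\<lambda>x. B i x a b) has_derivative (\<lambda>h. deriv_2form (B i) x h a b)) (at x)" if "i \<in> F" for i
      unfolding deriv_2form_def using smooth_on_differentiable[OF s[OF that], of x] frechet_derivative_works by fastforce
    then have "((\<lambda>x. \<Sum>i\<in>F. B i x a b) has_derivative (\<lambda>h. \<Sum>i\<in>F. deriv_2form (B i) x h a b)) (at x)"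
      by (intro has_derivative_sum)
    from frechet_derivative_eq[OF this] show ?thesis unfolding deriv_2form_def by simp
  qed
  then show "dform2 (\<lambda>x a b. \<Sum>i\<in>F. B i x a b) x v = (\<Sum>i\<in>F. dform2 (B i) x v)"
    unfolding dform2_def by (simp add: sum.distrib sum_subtractf)
qed

section \<open>The infimum\<close>

context compact_oriented_orb
begin

lemma to_patch_id:
  assumes P: "patch d D" and x: "x \<in> D"
  shows "x \<in> preimg d D d" "to_patch d D d x = x" "to_patch' d D d x = (\<lambda>v. v)"
proof -
  have D: "d \<in> atlas M" "open D" "D \<subseteq> lift d" using P unfolding patch_def by simp_all
  show "x \<in> preimg d D d" using x D(3) by (auto simp: preimg_def)
  have e: "to_patch d D d y = y" if "y \<in> D" for y by (rule to_patch_eq[OF P that refl])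
  show "to_patch d D d x = x" by (rule e[OF x])
  have "(to_patch d D d has_derivative (\<lambda>v. v)) (at x)"
    by (rule has_derivative_transform_within_open[OF has_derivative_ident D(2) x]) (simp add: e)
  then show "to_patch' d D d x = (\<lambda>v. v)" unfolding to_patch'_def by (rule frechet_derivative_eq)
qed

text \<open>Over the domain the G2 condition is checked in the chart \<open>d\<close> and carried to
  every other chart by \<open>to_patch\<close>, which respects orientation; off the support nothing
  changes. The volume difference is supported over one domain, so it is a single integral
  there.\<close>

lemma perturbation:
  assumes \<phi>: "G2_form M \<phi>" and d: "d \<in> atlas M" and K: "compact K" "K \<subseteq> fd d"
    and B: "smooth_2form B" "\<forall>x a b. x \<notin> K \<longrightarrow> B x a b = 0"
    and fr: "\<forall>x\<in>K. G2_frames (orient M d) (\<lambda>v. \<phi> d x v + dform2 B x v) \<noteq> {}"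
  defines "\<beta> \<equiv> globform d (fd d) (form2 B)"
  defines "\<phi>' \<equiv> \<lambda>c x v. \<phi> c x v + ext_d 2 \<beta> c x v"
  shows "\<beta> \<in> forms_rel_boundary M 2" "G2_form M \<phi>'"
    "hitchin_functional M \<phi>' = hitchin_functional M \<phi> + integral (fd d) (\<lambda>x. vol_dens \<phi>' d x - vol_dens \<phi> d x)"
    "\<And>x. x \<in> fd d \<Longrightarrow> \<phi>' d x = (\<lambda>v. \<phi> d x v + dform2 B x v)"
proof -
  note F = fund_domD[OF fd[OF d]]
  note P = F(1)
  have Bz: "B x a b = 0" if "x \<notin> K" for x a b using B(2) that by blast
  have gd: "dform2 B x v = 0" if "x \<notin> K" for x v by (rule is_form_globd2(1)[OF P K _ B(1) that]) (rule Bz)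
  have gf: "is_form M 3 (globform d (fd d) (dform2 B))" by (rule is_form_globd2(2)[OF P K _ B(1)]) (rule Bz)
  have \<phi>f: "is_form M 3 \<phi>" by (rule G2_formD(1)[OF \<phi>])
  have val: "\<phi>' c y v = \<phi> c y v + globform d (fd d) (dform2 B) c y v" if "c \<in> atlas M" "y \<in> lift c" for c y v
  proof -
    have "ext_d 2 (globform d (fd d) (form2 B)) c y v = globform d (fd d) (dform2 B) c y v"
      by (rule ext_d_globform[OF P K _ B(1) that]) (rule Bz)
    then show ?thesis by (simp add: \<phi>'_def \<beta>_def)
  qed
  have form: "is_form M 3 \<phi>'"
    by (rule is_form_cong[OF is_form_add[OF \<phi>f gf]]) (rule val)
  show loc: "\<phi>' d x = (\<lambda>v. \<phi> d x v + dform2 B x v)" if "x \<in> fd d" for x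
  proof
    fix v
    have "x \<in> lift d" using that F(4) by blast
    then show "\<phi>' d x v = \<phi> d x v + dform2 B x v"
      unfolding val[OF d \<open>x \<in> lift d\<close>] globform_def using to_patch_id[OF P that] by (simp add: pullback_def)
  qed
  have off: "\<phi>' c y = \<phi> c y" if "c \<in> atlas M" "y \<in> lift c" "proj c y \<notin> proj d ` K" for c y
    using globform_off_support[OF gd that(2,3)] by (intro ext) (simp add: val[OF that(1,2)])
  have frx: "G2_frames (orient M d) (\<lambda>v. \<phi> d x v + dform2 B x v) \<noteq> {}" if "x \<in> fd d" for x
  proof (cases "x \<in> K")
    case False
    have "x \<in> lift d" using that F(4) by blast
    then show ?thesis using G2_formD(2)[OF \<phi> d] gd[OF False] by simp
  qed (rule fr[rule_format])
  have "G2_frames (orient M c) (\<phi>' c y) \<noteq> {}" if c: "c \<in> atlas M" and y: "y \<in> lift c" for c y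
  proof (cases "y \<in> preimg d (fd d) c")
    case True
    let ?x = "to_patch d (fd d) c y" and ?T = "to_patch' d (fd d) c y"
    have "\<phi>' c y = pullback ?T (\<lambda>v. \<phi> d ?x v + dform2 B ?x v)"
      using form_preimg[OF P c True \<phi>f] True
      by (intro ext) (simp add: val[OF c y] globform_def pullback_def)
    moreover obtain L where "L \<in> G2_frames (orient M d) (\<lambda>v. \<phi> d ?x v + dform2 B ?x v)"
      using frx[OF to_patch_in(1)[OF True]] by (auto simp: ex_in_conv[symmetric])
    moreover have "linear ?T"
      by (rule has_derivative_linear[OF to_patch_has_derivative[OF P c True]])
    ultimately have "L \<circ> ?T \<in> G2_frames (orient M c) (\<phi>' c y)"
      using G2_frames_compose[OF _ _ to_patch_orient[OF P c True]] by simp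
    then show ?thesis by blast
  next
    case False
    then have "\<phi>' c y = \<phi> c y" by (intro ext) (simp add: val[OF c y] globform_def)
    then show ?thesis using G2_formD(2)[OF \<phi> c y] by simp
  qed
  then show G: "G2_form M \<phi>'" unfolding G2_form_def using form by blast
  have "is_form M 2 \<beta>" unfolding \<beta>_def by (rule is_form_glob2[OF P K _ B(1)]) (rule Bz)
  moreover have "\<beta> c x = (\<lambda>v. 0)" if "c \<in> atlas M" "proj c x \<in> orb_boundary M" for c x
    using preimg_boundary[OF P that(1)] that(2) by (intro ext) (auto simp: \<beta>_def globform_def)
  ultimately show "\<beta> \<in> forms_rel_boundary M 2" unfolding forms_rel_boundary_def by simp
  obtain C \<rho> where C: "partition_of_unity M C \<rho>" using partition_of_unity_exists[OF compact] by blast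
  note cd = cont_density_vol_dens[OF G] cont_density_vol_dens[OF \<phi>]
  have "total C \<rho> (\<lambda>c x. vol_dens \<phi>' c x - vol_dens \<phi> c x) = integral (fd d) (\<lambda>x. vol_dens \<phi>' d x - vol_dens \<phi> d x)"
    by (rule total_local[OF C cont_density_diff[OF cd] d K]) (simp add: vol_dens_def off)
  then show "hitchin_functional M \<phi>' = hitchin_functional M \<phi> + integral (fd d) (\<lambda>x. vol_dens \<phi>' d x - vol_dens \<phi> d x)"
    using total_diff[OF C cd] unfolding hitchin_eq_total[OF C G] hitchin_eq_total[OF C \<phi>] by simp
qed

lemma pou_part_nonneg:
  assumes C: "partition_of_unity M C \<rho>" and \<phi>: "G2_form M \<phi>" and c: "c \<in> C"
  shows "0 \<le> integral (fd c) (\<lambda>x. \<rho> c (proj c x) * vol_dens \<phi> c x)"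
proof (rule integral_nonneg)
  have ca: "c \<in> atlas M" using pouD(2)[OF C] c by blast
  show "(\<lambda>x. \<rho> c (proj c x) * vol_dens \<phi> c x) integrable_on fd c"
    by (rule set_lebesgue_integral_eq_integral(1)[OF pou_integrable(3)[OF C c vol_dens_continuous[OF \<phi> ca]]])
  fix x assume "x \<in> fd c"
  then have "x \<in> lift c" using fund_domD(4)[OF fd[OF ca]] by blast
  then show "0 \<le> \<rho> c (proj c x) * vol_dens \<phi> c x"
    using pouD(3)[OF C c ca] vol_dens_pos[OF \<phi> ca] by (intro mult_nonneg_nonneg) (auto intro: less_imp_le)
qed

lemma hitchin_nonneg: "G2_form M \<phi> \<Longrightarrow> 0 \<le> hitchin_functional M \<phi>"
  using partition_of_unity_exists[OF compact] hitchin_eq_total pou_part_nonneg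
  by (auto simp: total_def intro!: sum_nonneg)

text \<open>Vitali gives countably many disjoint balls that fill \<open>D\<close> up to a null set.
  A finite subfamily is needed, as a finite sum of perturbations is smooth with compact support; by
  continuity of the integral along increasing unions it can catch half of the total.\<close>

lemma finite_ball_cover:
  fixes f :: "R7 \<Rightarrow> real"
  assumes D: "open D" and f: "f absolutely_integrable_on D" "\<And>x. x \<in> D \<Longrightarrow> 0 \<le> f x"
    and r0: "\<And>x. x \<in> D \<Longrightarrow> 0 < r0 x" and sub: "\<And>x r. x \<in> D \<Longrightarrow> 0 < r \<Longrightarrow> r \<le> r0 x \<Longrightarrow> cball x r \<subseteq> D"
  shows "\<exists>F. finite F \<and> (\<forall>i\<in>F. fst i \<in> D \<and> 0 < snd i \<and> snd i \<le> r0 (fst i)) \<and>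
    pairwise (\<lambda>i j. disjnt (cball (fst i) (snd i)) (cball (fst j) (snd j))) F \<and>
    integral D f / 2 \<le> integral (\<Union>i\<in>F. cball (fst i) (snd i)) f"
proof -
  let ?b = "\<lambda>i :: R7 \<times> real. cball (fst i) (snd i)"
  define I where "I = {i :: R7 \<times> real. fst i \<in> D \<and> 0 < snd i \<and> snd i \<le> r0 (fst i)}"
  have ex: "\<exists>i. i \<in> I \<and> x \<in> ?b i \<and> snd i < e" if "x \<in> D" "0 < e" for x e
    using r0[OF that(1)] that by (intro exI[of _ "(x, min (r0 x) (e/2))"]) (auto simp: I_def)
  obtain C where C: "countable C" "C \<subseteq> I" "pairwise (\<lambda>i j. disjnt (?b i) (?b j)) C" "negligible (D - (\<Union>i\<in>C. ?b i))"
    by (rule Vitali_covering_theorem_cballs[of I snd D fst, OF _ ex]) (auto simp: I_def)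
  define F where "F n = {i \<in> C. to_nat_on C i < n}" for n
  define A where "A n = (\<Union>i\<in>F n. ?b i)" for n
  have FC: "F n \<subseteq> C" for n by (auto simp: F_def)
  have fin: "finite (F n)" for n
  proof (rule finite_imageD)
    show "finite (to_nat_on C ` F n)" by (rule finite_subset[of _ "{..<n}"]) (auto simp: F_def)
    show "inj_on (to_nat_on C) (F n)" by (rule inj_on_subset[OF inj_on_to_nat_on[OF C(1)] FC])
  qed
  have AD: "A n \<subseteq> D" for n using FC C(2) sub unfolding A_def I_def by blast
  have AU: "(\<Union>n. A n) = (\<Union>i\<in>C. ?b i)"
  proof (intro equalityI subsetI)
    fix x assume "x \<in> (\<Union>i\<in>C. ?b i)"
    then obtain i where i: "i \<in> C" "x \<in> ?b i" by blast
    then have "i \<in> F (Suc (to_nat_on C i))" by (simp add: F_def)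
    then have "x \<in> A (Suc (to_nat_on C i))" unfolding A_def using i(2) by blast
    then show "x \<in> (\<Union>n. A n)" by blast
  qed (use FC in \<open>auto simp: A_def\<close>)
  have Am: "A n \<in> sets lebesgue" for n
    unfolding A_def using fin by (intro sets.finite_UN) simp_all
  have UD: "(\<Union>n. A n) \<subseteq> D" using AD by blast
  have fU: "set_integrable lebesgue (\<Union>n. A n) f"
    by (rule set_integrable_subset[OF f(1) sets.countable_UN UD]) (use Am in auto)
  have "(\<lambda>n. LINT x:A n|lebesgue. f x) \<longlonglongrightarrow> (LINT x:(\<Union>n. A n)|lebesgue. f x)"
    by (rule set_integral_cont_up[OF Am _ fU]) (auto simp: incseq_def A_def F_def)
  moreover have "(LINT x:A n|lebesgue. f x) = integral (A n) f" for n
    by (rule set_lebesgue_integral_eq_integral(2)[OF set_integrable_subset[OF f(1) Am AD]])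
  moreover have "(LINT x:(\<Union>n. A n)|lebesgue. f x) = integral D f"
    unfolding set_lebesgue_integral_eq_integral(2)[OF fU]
    by (rule integral_subset_negligible[OF UD]) (unfold AU, rule C(4))
  ultimately have lim: "(\<lambda>n. integral (A n) f) \<longlonglongrightarrow> integral D f" by simp
  have "\<exists>n. integral D f / 2 \<le> integral (A n) f"
  \<comment> \<open>Convergence gives a strict inequality only for a positive limit; otherwise the
    empty family does.\<close>
  proof (cases "integral D f > 0")
    case True
    then have "\<forall>\<^sub>F n in sequentially. integral D f / 2 < integral (A n) f"
      by (intro order_tendstoD(1)[OF lim]) simp
    then show ?thesis by (auto simp: eventually_sequentially intro: less_imp_le)
  next
    case False
    have "integral D f / 2 \<le> integral (A 0) f" using False by (simp add: A_def F_def)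
    then show ?thesis ..
  qed
  then obtain n where n: "integral D f / 2 \<le> integral (A n) f" ..
  show ?thesis
  proof (intro exI[of _ "F n"] conjI)
    show "\<forall>i\<in>F n. fst i \<in> D \<and> 0 < snd i \<and> snd i \<le> r0 (fst i)" using FC C(2) by (auto simp: I_def)
    show "pairwise (\<lambda>i j. disjnt (?b i) (?b j)) (F n)" by (rule pairwise_subset[OF C(3) FC])
    show "integral D f / 2 \<le> integral (\<Union>i\<in>F n. ?b i) f" using n by (simp add: A_def)
  qed (rule fin)
qed

text \<open>The partition is fixed before the form, so its number of members may enter the rate; the
  further 2 comes from catching half of an integral. The balls are selected by the density weighted
  with \<rho>, which is integrable over the whole domain, whereas the decrease concerns the
  unweighted density; as the weight is at most 1, the decrease is at least \<kappa> times the
  weighted integral.\<close>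

lemma hitchin_decrease:
  "\<exists>\<kappa>>0. \<forall>\<phi>. G2_form M \<phi> \<longrightarrow> (\<exists>\<beta>\<in>forms_rel_boundary M 2. G2_form M (\<lambda>c x v. \<phi> c x v + ext_d 2 \<beta> c x v) \<and>
     hitchin_functional M (\<lambda>c x v. \<phi> c x v + ext_d 2 \<beta> c x v) \<le> (1 - \<kappa>) * hitchin_functional M \<phi>)"
proof -
  obtain \<kappa> :: real where \<kappa>: "0 < \<kappa>" and dec: "\<forall>s D \<psi> x0. s = 1 \<or> s = -1 \<longrightarrow> open D \<longrightarrow> x0 \<in> D \<longrightarrow>
     (\<forall>x\<in>D. G2_frames s (\<psi> x) \<noteq> {} \<and> alternating_form 3 (\<psi> x)) \<longrightarrow> (\<forall>v. continuous_on D (\<lambda>x. \<psi> x v)) \<longrightarrow>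
     (\<exists>r0>0. \<forall>r. 0 < r \<longrightarrow> r \<le> r0 \<longrightarrow> cball x0 r \<subseteq> D \<and> (\<exists>B. decreases s \<psi> x0 r \<kappa> B))"
    using ball_decrease by (elim exE conjE)
  obtain C \<rho> where C: "partition_of_unity M C \<rho>" using partition_of_unity_exists[OF compact] by blast
  note fin = pouD(1)[OF C]
  have "C \<noteq> {}"
  proof
    assume "C = {}"
    obtain p where "p \<in> topspace (space_of M)" using orbD(1) by blast
    then show False using C \<open>C = {}\<close> unfolding partition_of_unity_def by auto
  qed
  then have n0: "real (card C) > 0" using fin by (simp add: card_gt_0_iff)
  have "\<exists>\<beta>\<in>forms_rel_boundary M 2. G2_form M (\<lambda>c x v. \<phi> c x v + ext_d 2 \<beta> c x v) \<and>
     hitchin_functional M (\<lambda>c x v. \<phi> c x v + ext_d 2 \<beta> c x v) \<le> (1 - \<kappa> / (2 * real (card C))) * hitchin_functional M \<phi>"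
    if \<phi>: "G2_form M \<phi>" for \<phi>
  proof -
    let ?H = "hitchin_functional M \<phi>"
    define J where "J c = integral (fd c) (\<lambda>x. \<rho> c (proj c x) * vol_dens \<phi> c x)" for c
    have HJ: "?H = (\<Sum>c\<in>C. J c)" unfolding hitchin_eq_total[OF C \<phi>] total_def J_def ..
    \<comment> \<open>Pigeonhole: some member carries at least the average.\<close>
    have "\<exists>d\<in>C. ?H / real (card C) \<le> J d"
    proof (rule ccontr)
      assume "\<not> ?thesis"
      then have "(\<Sum>c\<in>C. J c) < (\<Sum>c\<in>C. ?H / real (card C))"
        using fin \<open>C \<noteq> {}\<close> by (intro sum_strict_mono) auto
      then show False using n0 HJ by simp
    qed
    then obtain d where d: "d \<in> C" "?H / real (card C) \<le> J d" ..
    have da: "d \<in> atlas M" using pouD(2)[OF C] d(1) by blast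
    define D where "D = fd d"
    have D: "patch d D" "open D" "D \<subseteq> lift d" unfolding D_def using fund_domD[OF fd[OF da]] by simp_all
    let ?s = "orient M d" and ?q = "vol_dens \<phi> d" and ?f = "\<lambda>x. \<rho> d (proj d x) * vol_dens \<phi> d x"
    have alt: "\<forall>x\<in>D. G2_frames ?s (\<phi> d x) \<noteq> {} \<and> alternating_form 3 (\<phi> d x)"
      using G2_formD(2)[OF \<phi> da] is_formD(1)[OF G2_formD(1)[OF \<phi>] da] D(3) by blast
    have cont: "\<forall>v. continuous_on D (\<lambda>x. \<phi> d x v)"
      using smooth_on_imp_continuous_on[OF is_formD(2)[OF G2_formD(1)[OF \<phi>] da]] D(3)
      by (intro allI continuous_on_subset[OF _ D(3)])
    have "\<forall>x\<in>D. \<exists>r0>0. \<forall>r. 0 < r \<longrightarrow> r \<le> r0 \<longrightarrow> cball x r \<subseteq> D \<and> (\<exists>B. decreases ?s (\<phi> d) x r \<kappa> B)"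
    proof
      fix x assume x: "x \<in> D"
      show "\<exists>r0>0. \<forall>r. 0 < r \<longrightarrow> r \<le> r0 \<longrightarrow> cball x r \<subseteq> D \<and> (\<exists>B. decreases ?s (\<phi> d) x r \<kappa> B)"
        using dec[THEN spec, THEN spec, THEN spec, THEN spec, THEN mp, OF orient_cases[OF da], THEN mp, OF D(2), THEN mp, OF x, THEN mp, OF alt, THEN mp, OF cont] .
    qed
    from bchoice[OF this] obtain r0 where r0: "\<forall>x\<in>D. r0 x > 0 \<and> (\<forall>r. 0 < r \<longrightarrow> r \<le> r0 x \<longrightarrow> cball x r \<subseteq> D \<and> (\<exists>B. decreases ?s (\<phi> d) x r \<kappa> B))" ..
    have fint: "?f absolutely_integrable_on D"
      unfolding D_def by (rule pou_integrable(3)[OF C d(1) vol_dens_continuous[OF \<phi> da]])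
    have \<rho>: "0 \<le> \<rho> d (proj d x)" "\<rho> d (proj d x) \<le> 1" if "x \<in> D" for x
    proof -
      have xl: "x \<in> lift d" using that D(3) by blast
      show "0 \<le> \<rho> d (proj d x)" by (rule pouD(3)[OF C d(1) da xl])
      have "\<rho> d (proj d x) \<le> (\<Sum>c\<in>C. \<rho> c (proj d x))"
        using pouD(3)[OF C _ da xl] by (intro member_le_sum d(1) fin) auto
      then show "\<rho> d (proj d x) \<le> 1" using pouD(4)[OF C da xl] by simp
    qed
    have q: "0 < ?q x" if "x \<in> D" for x using vol_dens_pos[OF \<phi> da] D(3) that by blast
    let ?b = "\<lambda>i :: R7 \<times> real. cball (fst i) (snd i)"
    have "\<exists>F. finite F \<and> (\<forall>i\<in>F. fst i \<in> D \<and> 0 < snd i \<and> snd i \<le> r0 (fst i)) \<and>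
      pairwise (\<lambda>i j. disjnt (?b i) (?b j)) F \<and> integral D ?f / 2 \<le> integral (\<Union>i\<in>F. ?b i) ?f"
    proof (rule finite_ball_cover[OF D(2) fint])
      show "0 \<le> ?f x" if "x \<in> D" for x using \<rho>(1)[OF that] q[OF that] by simp
    qed (use r0 in auto)
    then obtain F where F: "finite F" "\<forall>i\<in>F. fst i \<in> D \<and> 0 < snd i \<and> snd i \<le> r0 (fst i)"
      "pairwise (\<lambda>i j. disjnt (?b i) (?b j)) F" "integral D ?f / 2 \<le> integral (\<Union>i\<in>F. ?b i) ?f"
      by (elim exE conjE)
    have bD: "?b i \<subseteq> D" and "\<exists>B. decreases ?s (\<phi> d) (fst i) (snd i) \<kappa> B" if "i \<in> F" for i
      using r0 F(2) that by blast+
    then have "\<forall>i\<in>F. \<exists>B. decreases ?s (\<phi> d) (fst i) (snd i) \<kappa> B" by blast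
    from bchoice[OF this] obtain B where B: "\<forall>i\<in>F. decreases ?s (\<phi> d) (fst i) (snd i) \<kappa> (B i)" ..
    have smB: "smooth_2form (B i)" and Bz: "x \<notin> ?b i \<Longrightarrow> B i x a b = 0"
      and Bf: "x \<in> ?b i \<Longrightarrow> G2_frames ?s (\<lambda>v. \<phi> d x v + dform2 (B i) x v) \<noteq> {}"
      and Bi: "integral (?b i) (\<lambda>x. form_vol ?s (\<lambda>v. \<phi> d x v + dform2 (B i) x v)) \<le> (1 - \<kappa>) * integral (?b i) ?q"
      if "i \<in> F" for i x a b
      using B[rule_format, OF that] unfolding decreases_def vol_dens_def by blast+
    define S where "S x a b = (\<Sum>i\<in>F. B i x a b)" for x a b
    define K where "K = (\<Union>i\<in>F. ?b i)"
    have K: "compact K" "K \<subseteq> D" unfolding K_def using F(1) bD by (auto intro!: compact_UN)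
    have S: "smooth_2form S" "dform2 S x v = (\<Sum>i\<in>F. dform2 (B i) x v)" for x v
      unfolding S_def[abs_def] by (rule smooth_2form_sum[OF F(1) smB]; assumption)+
    have Sz: "S x a b = 0" if "x \<notin> K" for x a b
      unfolding S_def using that Bz by (intro sum.neutral) (auto simp: K_def)
    \<comment> \<open>The closed balls are disjoint, so at a point of one ball the exterior
      derivatives of all other summands vanish.\<close>
    have dS: "dform2 S x v = dform2 (B i) x v" if i: "i \<in> F" "x \<in> ?b i" for i x v
    proof -
      have "dform2 (B j) x v = 0" if j: "j \<in> F" "j \<noteq> i" for j
      proof -
        have nx: "x \<notin> ?b j" using F(3) i j unfolding pairwise_def disjnt_def by blast
        show ?thesis
          by (rule is_form_globd2(1)[OF D(1) compact_cball bD[OF j(1)] _ smB[OF j(1)] nx]) (rule Bz[OF j(1)])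
      qed
      then have "(\<Sum>j\<in>F. dform2 (B j) x v) = (\<Sum>j\<in>{i}. dform2 (B j) x v)"
        using F(1) i(1) by (intro sum.mono_neutral_right) auto
      then show ?thesis unfolding S(2) by simp
    qed
    have fr: "G2_frames ?s (\<lambda>v. \<phi> d x v + dform2 S x v) \<noteq> {}" if "x \<in> K" for x
    proof -
      obtain i where i: "i \<in> F" "x \<in> ?b i" using \<open>x \<in> K\<close> by (auto simp: K_def)
      then show ?thesis using Bf[OF i] dS[OF i] by simp
    qed
    define \<beta> where "\<beta> = globform d (fd d) (form2 S)"
    define \<phi>' where "\<phi>' = (\<lambda>c x v. \<phi> c x v + ext_d 2 \<beta> c x v)"
    have Sz': "\<forall>x a b. x \<notin> K \<longrightarrow> S x a b = 0" using Sz by blast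
    have fr': "\<forall>x\<in>K. G2_frames ?s (\<lambda>v. \<phi> d x v + dform2 S x v) \<noteq> {}" using fr by blast
    note pt = perturbation[OF \<phi> da K[unfolded D_def] S(1) Sz' fr', folded \<beta>_def, folded \<phi>'_def D_def]
    have loc: "\<phi>' d x = (\<lambda>v. \<phi> d x v + dform2 S x v)" if "x \<in> D" for x
      using pt(4)[OF that] by (simp add: \<phi>'_def)
    let ?q' = "vol_dens \<phi>' d" let ?g = "\<lambda>x. ?q' x - ?q x"
    note q'c = continuous_on_subset[OF vol_dens_continuous[OF pt(2) da] D(3)] continuous_on_subset[OF vol_dens_continuous[OF \<phi> da] D(3)]
    have q'i: "?q' integrable_on ?b i" "?q integrable_on ?b i" if "i \<in> F" for i
      by (intro cball_integrable continuous_on_subset[OF q'c(1) bD[OF that]] continuous_on_subset[OF q'c(2) bD[OF that]])+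
    have gb: "integral (?b i) ?g \<le> - \<kappa> * integral (?b i) ?f" if i: "i \<in> F" for i
    proof -
      have "integral (?b i) ?q' = integral (?b i) (\<lambda>x. form_vol ?s (\<lambda>v. \<phi> d x v + dform2 (B i) x v))"
      proof (rule integral_cong)
        fix x assume x: "x \<in> ?b i"
        then have "x \<in> D" using bD[OF i] by blast
        then show "?q' x = form_vol ?s (\<lambda>v. \<phi> d x v + dform2 (B i) x v)"
          unfolding vol_dens_def loc[OF \<open>x \<in> D\<close>] dS[OF i x] by simp
      qed
      then have "integral (?b i) ?g \<le> - \<kappa> * integral (?b i) ?q"
        using Bi[OF i] integral_diff[OF q'i[OF i]] by (simp add: algebra_simps)
      moreover have "integral (?b i) ?f \<le> integral (?b i) ?q"
      proof (rule integral_le[OF _ q'i(2)[OF i]])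
        show "?f integrable_on ?b i"
          by (rule set_lebesgue_integral_eq_integral(1)[OF set_integrable_subset[OF fint _ bD[OF i]]]) simp
        show "?f x \<le> ?q x" if "x \<in> ?b i" for x
        proof -
          have "x \<in> D" using bD[OF i] that by blast
          then show ?thesis using \<rho>(2) q mult_right_mono[of "\<rho> d (proj d x)" 1 "?q x"] by (simp add: less_imp_le)
        qed
      qed
      then have "- \<kappa> * integral (?b i) ?q \<le> - \<kappa> * integral (?b i) ?f" using \<kappa> by simp
      ultimately show ?thesis by (rule order_trans)
    qed
    have un: "integral K h = (\<Sum>i\<in>F. integral (?b i) h)" if "\<And>i. i \<in> F \<Longrightarrow> h integrable_on ?b i" for h :: "R7 \<Rightarrow> real"
    proof -
      have "(h has_integral (\<Sum>i\<in>F. integral (?b i) h)) (\<Union>i\<in>F. ?b i)"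
      proof (rule has_integral_UN[OF F(1)])
        show "(h has_integral integral (?b i) h) (?b i)" if "i \<in> F" for i
          using \<open>\<And>i. i \<in> F \<Longrightarrow> h integrable_on ?b i\<close>[OF that] by (rule integrable_integral)
        show "pairwise (\<lambda>i j. negligible (?b i \<inter> ?b j)) F"
          by (rule pairwise_mono[OF F(3)]) (auto simp: disjnt_def)
      qed
      then show ?thesis unfolding K_def by (rule integral_unique)
    qed
    have "integral D ?g = integral K ?g"
    proof (rule integral_spike_set)
      have "?g x = 0" if "x \<in> D" "x \<notin> K" for x
      proof -
        have "dform2 S x v = 0" for v
          by (rule is_form_globd2(1)[OF D(1) K _ S(1) that(2)]) (rule Sz)
        then show ?thesis using loc[OF that(1)] by (simp add: vol_dens_def)
      qed
      then have e: "{x \<in> D - K. ?g x \<noteq> 0} = {}" by blast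
      show "negligible {x \<in> D - K. ?g x \<noteq> 0}" unfolding e by simp
      have e: "{x \<in> K - D. ?g x \<noteq> 0} = {}" using K(2) by blast
      show "negligible {x \<in> K - D. ?g x \<noteq> 0}" unfolding e by simp
    qed
    also have "\<dots> = (\<Sum>i\<in>F. integral (?b i) ?g)" by (rule un) (intro integrable_diff q'i)
    also have "\<dots> \<le> (\<Sum>i\<in>F. - \<kappa> * integral (?b i) ?f)" by (intro sum_mono gb)
    also have "\<dots> = - \<kappa> * (\<Sum>i\<in>F. integral (?b i) ?f)" by (rule sum_distrib_left[symmetric])
    also have "(\<Sum>i\<in>F. integral (?b i) ?f) = integral K ?f"
    proof (rule un[symmetric])
      show "?f integrable_on ?b i" if "i \<in> F" for i
        by (rule set_lebesgue_integral_eq_integral(1)[OF set_integrable_subset[OF fint _ bD[OF that]]]) simp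
    qed
    finally have 1: "integral D ?g \<le> - \<kappa> * integral K ?f" .
    have "?H / real (card C) / 2 \<le> J d / 2" using d(2) by (rule divide_right_mono) simp
    also have "\<dots> \<le> integral K ?f" using F(4) unfolding K_def J_def D_def[symmetric] .
    finally have "?H / real (card C) / 2 \<le> integral K ?f" .
    then have "\<kappa> * (?H / real (card C) / 2) \<le> \<kappa> * integral K ?f" using \<kappa> by (intro mult_left_mono) simp_all
    moreover have "\<kappa> * (?H / real (card C) / 2) = \<kappa> / (2 * real (card C)) * ?H" by simp
    ultimately have "hitchin_functional M \<phi>' \<le> ?H - \<kappa> / (2 * real (card C)) * ?H"
      unfolding pt(3) using 1 by linarith
    then have "hitchin_functional M \<phi>' \<le> (1 - \<kappa> / (2 * real (card C))) * ?H" by (simp only: left_diff_distrib mult_1)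
    then show ?thesis using pt(1,2) unfolding \<phi>'_def by blast
  qed
  then show ?thesis using \<kappa> n0 by (intro exI[of _ "\<kappa> / (2 * real (card C))"]) simp
qed

text \<open>A perturbation of a member of the class stays in the class, since the potentials add and
  both vanish at the boundary. With one rate for all members, a positive infimum would be undercut
  by perturbing a near-minimiser. The full class contains the relative one and has nonnegative
  values, so its infimum is 0 as well.\<close>

lemma Inf_hitchin:
  assumes \<phi>: "G2_form M \<phi>"
  shows "(INF \<phi>'\<in>G2_class_rel_boundary M \<phi>. hitchin_functional M \<phi>') = 0"
    and "(INF \<phi>'\<in>G2_class M \<phi>. hitchin_functional M \<phi>') = 0"
proof -
  let ?Y = "G2_class_rel_boundary M \<phi>" and ?Z = "G2_class M \<phi>" and ?H = "hitchin_functional M"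
  obtain \<kappa> where \<kappa>: "\<kappa> > 0" and dec: "\<And>\<phi>. G2_form M \<phi> \<Longrightarrow> \<exists>\<beta>\<in>forms_rel_boundary M 2. G2_form M (\<lambda>c x v. \<phi> c x v + ext_d 2 \<beta> c x v) \<and>
     ?H (\<lambda>c x v. \<phi> c x v + ext_d 2 \<beta> c x v) \<le> (1 - \<kappa>) * ?H \<phi>"
    using hitchin_decrease by blast
  have YZ: "?Y \<subseteq> ?Z" unfolding G2_class_rel_boundary_def G2_class_def forms_rel_boundary_def by blast
  have Z0: "0 \<le> ?H \<psi>" if "\<psi> \<in> ?Z" for \<psi> using that hitchin_nonneg by (simp add: G2_class_def)
  have bddZ: "bdd_below (?H ` ?Z)" by (rule bdd_belowI2[OF Z0])
  have bddY: "bdd_below (?H ` ?Y)" by (rule bdd_below_mono[OF bddZ image_mono[OF YZ]])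
  have ne: "?Y \<noteq> {}"
  proof -
    obtain \<beta> where "\<beta> \<in> forms_rel_boundary M 2" "G2_form M (\<lambda>c x v. \<phi> c x v + ext_d 2 \<beta> c x v)"
      using dec[OF \<phi>] by blast
    then have "(\<lambda>c x v. \<phi> c x v + ext_d 2 \<beta> c x v) \<in> ?Y" unfolding G2_class_rel_boundary_def form_eq_def by blast
    then show ?thesis by blast
  qed
  have step: "\<exists>\<psi>'\<in>?Y. ?H \<psi>' \<le> (1 - \<kappa>) * ?H \<psi>" if \<psi>: "\<psi> \<in> ?Y" for \<psi>
  proof -
    obtain \<alpha> where \<alpha>: "G2_form M \<psi>" "\<alpha> \<in> forms_rel_boundary M 2" "form_eq M \<psi> (\<lambda>c x v. \<phi> c x v + ext_d 2 \<alpha> c x v)"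
      using \<psi> unfolding G2_class_rel_boundary_def by blast
    obtain \<beta> where \<beta>: "\<beta> \<in> forms_rel_boundary M 2" "G2_form M (\<lambda>c x v. \<psi> c x v + ext_d 2 \<beta> c x v)"
      "?H (\<lambda>c x v. \<psi> c x v + ext_d 2 \<beta> c x v) \<le> (1 - \<kappa>) * ?H \<psi>" using dec[OF \<alpha>(1)] by blast
    have f: "is_form M 2 \<alpha>" "is_form M 2 \<beta>" using \<alpha>(2) \<beta>(1) by (simp_all add: forms_rel_boundary_def)
    have "(\<lambda>c x v. \<alpha> c x v + \<beta> c x v) \<in> forms_rel_boundary M 2"
      using \<alpha>(2) \<beta>(1) is_form_add[OF f] by (simp add: forms_rel_boundary_def)
    moreover have "form_eq M (\<lambda>c x v. \<psi> c x v + ext_d 2 \<beta> c x v) (\<lambda>c x v. \<phi> c x v + ext_d 2 (\<lambda>c x v. \<alpha> c x v + \<beta> c x v) c x v)"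
      unfolding form_eq_def
    proof (intro ballI ext)
      fix c x v assume c: "c \<in> atlas M" "x \<in> lift c"
      have "\<psi> c x v = \<phi> c x v + ext_d 2 \<alpha> c x v" using \<alpha>(3) c by (simp add: form_eq_def)
      then show "\<psi> c x v + ext_d 2 \<beta> c x v = \<phi> c x v + ext_d 2 (\<lambda>c x v. \<alpha> c x v + \<beta> c x v) c x v"
        using ext_d_add[OF f c] by simp
    qed
    ultimately have "(\<lambda>c x v. \<psi> c x v + ext_d 2 \<beta> c x v) \<in> ?Y"
      unfolding G2_class_rel_boundary_def using \<beta>(2) by blast
    then show ?thesis using \<beta>(3) by blast
  qed
  let ?m = "INF \<phi>'\<in>?Y. ?H \<phi>'"
  have m0: "0 \<le> ?m" using ne YZ Z0 by (intro cINF_greatest) auto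
  have lower: "?m \<le> ?H \<psi>" if "\<psi> \<in> ?Y" for \<psi> by (rule cINF_lower[OF bddY that])
  show Y: "?m = 0"
  proof (rule ccontr)
    assume "?m \<noteq> 0"
    then have m: "0 < ?m" using m0 by simp
    \<comment> \<open>Were \<kappa> at least 1, one step would produce a value at most 0, below the
      positive infimum; so division by 1 - \<kappa> is legitimate.\<close>
    have \<kappa>1: "\<kappa> < 1"
    proof -
      obtain \<psi> where "\<psi> \<in> ?Y" using ne by blast
      then obtain \<psi>' where "\<psi>' \<in> ?Y" "?H \<psi>' \<le> (1 - \<kappa>) * ?H \<psi>" using step by blast
      then have "0 < (1 - \<kappa>) * ?H \<psi>" using lower m by fastforce
      moreover have "0 < ?H \<psi>" using lower[OF \<open>\<psi> \<in> ?Y\<close>] m by simp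
      ultimately show ?thesis by (simp add: zero_less_mult_iff)
    qed
    have "?m < ?m / (1 - \<kappa>)" using m \<kappa> \<kappa>1 by (simp add: field_simps)
    then obtain \<psi> where \<psi>: "\<psi> \<in> ?Y" "?H \<psi> < ?m / (1 - \<kappa>)" using cINF_less_iff[OF ne bddY] by blast
    obtain \<psi>' where \<psi>': "\<psi>' \<in> ?Y" "?H \<psi>' \<le> (1 - \<kappa>) * ?H \<psi>" using step[OF \<psi>(1)] by blast
    have "(1 - \<kappa>) * ?H \<psi> < (1 - \<kappa>) * (?m / (1 - \<kappa>))" using \<psi>(2) \<kappa>1 by (intro mult_strict_left_mono) simp_all
    then have "?H \<psi>' < ?m" using \<psi>'(2) \<kappa>1 by simp
    then show False using lower[OF \<psi>'(1)] by simp
  qed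
  have "(INF \<phi>'\<in>?Z. ?H \<phi>') \<le> 0"
    unfolding Y[symmetric] by (rule cINF_superset_mono[OF ne bddZ YZ]) simp
  moreover have "0 \<le> (INF \<phi>'\<in>?Z. ?H \<phi>')" using ne YZ Z0 by (intro cINF_greatest) auto
  ultimately show "(INF \<phi>'\<in>?Z. ?H \<phi>') = 0" by simp
qed

end

theorem theorem1p2:
  fixes M :: "'a oriented_orbifold" and \<phi> :: "'a dform"
  assumes "oriented_orbifold7 M"
    and "compact_space (space_of M)"
    and "G2_form M \<phi>"
    and "closed_form M 3 \<phi>"
  shows "(INF \<phi>'\<in>G2_class_rel_boundary M \<phi>. hitchin_functional M \<phi>') = 0 \<and>
    (orb_boundary M = {} \<longrightarrow> (INF \<phi>'\<in>G2_class M \<phi>. hitchin_functional M \<phi>') = 0)"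
proof -
  interpret compact_oriented_orb M by unfold_locales (rule assms)+
  show ?thesis using Inf_hitchin[OF assms(3)] by simp
qed

end
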